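(* Let $Q=2$ and let $\pi=\pi_\Xi$ be the corresponding chromatic Temperley–Lieb unitary representation of Thompson's groups $F$ and $T$, with vacuum vector $\xi$. Put $$\overrightarrow F=\{g\in F:\langle\pi(g)\xi,\xi\rangle=2\},\qquad \overrightarrow T=\{g\in T:\langle\pi(g)\xi,\xi\rangle=2\}.$$ Then $\overrightarrow F$ and $\overrightarrow T$ are subgroups of $F$ and $T$ respectively, and the unitary representations $\pi_\Xi$ of $F$ and $T$ are (unitarily equivalent to) the permutation representations on $\ell^2(F/\overrightarrow F)$ and $\ell^2(T/\overrightarrow T)$ respectively.
   Context: $T$ is Thompson's group of orientation-preserving piecewise linear homeomorphisms of $S^1=\mathbb R/\mathbb Z$ with finitely many breakpoints, all dyadic, slopes in $2^{\mathbb Z}$, mapping dyadic rationals to dyadic rationals; $F$ is the subgroup fixing $0$, i.e. the corresponding group of homeomorphisms of $[0,1]$. A standard dyadic interval is $[p/2^n,(p+1)/2^n]\subseteq[0,1]$ with $n,p$ non-negative integers. $\mathscr D$ is the set of finite partitions of $[0,1]$ into standard dyadic intervals, directed by refinement $\mathcal I\lesssim\mathcal J$. $\mathcal J\in\mathscr D$ is good for $g\in T$ if $g$ is affine on each $J\in\mathcal J$ and $g(\mathcal J)=\{g(J)\}\in\mathscr D$. Chromatic Temperley–Lieb representation with parameter $Q$ (here $Q=2$): for $\mathcal I\in\mathscr D$ let $S(\mathcal I)\subset S^1$ consist of all endpoints and midpoints of intervals of $\mathcal I$ ($2|\mathcal I|$ points, $0=1$). $K(\mathcal I)$ is the vector space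 with basis the isotopy classes of non-crossing pairings of $S(\mathcal I)$ by strings in the closed disc. The regions of such a diagram are shaded in checkerboard fashion so that the boundary arcs from the left endpoint of an interval of $\mathcal I$ to its midpoint are shaded. The sesquilinear form is given on basis elements by $\langle x,y\rangle=Q^{c}$, where $c$ is the number of connected components of the shaded region of the sphere obtained by gluing the disc of $x$ to the reflected disc of $y$ along the circle. If $\mathcal J$ is obtained from $\mathcal I$ by halving $[a,b]$ at its midpoint $c$, the map $K(\mathcal I)\to K(\mathcal J)$ is $x\mapsto (Q-1)^{-1/2}(x_A-x_B)$: in $x_A$ the string of $x$ ending at $c$ is extended to end at the midpoint of $[a,c]$ and a new small string joins $c$ to the midpoint of $[c,b]$; in $x_B$ it is extended to end at the midpoint of $[c,b]$ and a new small string joins the midpoint of $[a,c]$ to $c$; the rest is unchanged. These maps preserve the form; composing them gives the connecting maps for all $\mathcal I\lesssim\mathcal J$. For $Q=2$ the form is positive semidefinite and the Hilbert space of $\pi_\Xi$ is the completion of the direct limit of the $K(\mathcal I)$ modulo null vectors. For $g\in T$ and $v\in K(\mathcal I)$, $\pi_\Xi(g)v$ is obtained by mapping $v$ into $K(\mathcal J)$ for some refinement $\mathcal J$ of $\mathcal I$ good for $g$, and moving the boundary points by $g$ to get an element of $K(g(\mathcal J))$. The representation of $F$ is the restriction of this one to $F$ (equivalently, the one built from rectangular Temperley–Lieb diagrams with one boundary point on top). The vector $\xi\in K(\{[0,1]\})$ is the single string joining $0$ and $1/2$; $\langle\xi,\xi\rangle=Q=2$. *)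

theory Defs
  imports
    "HOL-Analysis.Analysis"
    "HOL-Library.Disjoint_Sets"
    "HOL-Algebra.Bij"
    "HOL-Algebra.Left_Coset"
begin

section \<open>Thompson's groups\<close>

text \<open>The circle \<open>\<real>/\<int>\<close> is represented by its fundamental domain \<open>{0..<1}\<close>, and its homeomorphisms
  by extensional bijections of \<open>{0..<1}\<close>, so that groups of homeomorphisms live in
  \<^const>\<open>BijGroup\<close>. The orientation-preserving homeomorphisms of the circle are exactly the maps
  that have a continuous strictly increasing lift commuting with translation by 1.\<close>

abbreviation circle :: "real set" where
  "circle \<equiv> {0..<1}"

definition dyadic :: "real set" where
  "dyadic = {of_int m / 2 ^ n | (m::int) (n::nat). True}"

text \<open>The finite set \<open>B\<close> contains the breakpoints in \<open>[0,1]\<close>.\<close>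

definition thompson_lift :: "(real \<Rightarrow> real) \<Rightarrow> bool" where
  "thompson_lift G \<longleftrightarrow>
     continuous_on UNIV G \<and> strict_mono G \<and> (\<forall>t. G (t + 1) = G t + 1) \<and>
     (\<exists>B. finite B \<and> B \<subseteq> dyadic \<and>
        (\<forall>a b. 0 \<le> a \<and> a < b \<and> b \<le> 1 \<and> {a<..<b} \<inter> B = {} \<longrightarrow>
           (\<exists>(k::int) c. \<forall>t\<in>{a..b}. G t = 2 powi k * t + c))) \<and>
     G ` dyadic \<subseteq> dyadic"

definition thompson_T :: "(real \<Rightarrow> real) monoid" where
  "thompson_T = (BijGroup circle)
     \<lparr>carrier := {g \<in> Bij circle. \<exists>G. thompson_lift G \<and> (\<forall>t\<in>circle. g t = frac (G t))}\<rparr>"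

definition thompson_F :: "(real \<Rightarrow> real) monoid" where
  "thompson_F = thompson_T\<lparr>carrier := {g \<in> carrier thompson_T. g 0 = 0}\<rparr>"


section \<open>Standard dyadic partitions\<close>

text \<open>A standard dyadic interval \<open>[a,b]\<close> is encoded as the half-open interval \<open>{a..<b}\<close>, so that a
  partition of \<open>[0,1]\<close> into standard dyadic intervals is a set-theoretic partition of \<open>{0..<1}\<close>,
  and the image of an interval under a circle homeomorphism is the image of the set, even
  if the right endpoint is mapped to \<open>0 = 1\<close>. The endpoints of \<open>J\<close> are \<open>Inf J\<close> and \<open>Sup J\<close>.\<close>

definition standard_dyadic :: "real set \<Rightarrow> bool" where
  "standard_dyadic J \<longleftrightarrow> (\<exists>n p::nat. p < 2 ^ n \<and> J = {real p / 2 ^ n ..< (real p + 1) / 2 ^ n})"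

definition dyadic_partitions :: "real set set set" where
  "dyadic_partitions = {I. finite I \<and> partition_on circle I \<and> (\<forall>J\<in>I. standard_dyadic J)}"

definition middle :: "real set \<Rightarrow> real" where
  "middle J = (Inf J + Sup J) / 2"

definition lower_half :: "real set \<Rightarrow> real set" where
  "lower_half J = {Inf J ..< middle J}"

definition upper_half :: "real set \<Rightarrow> real set" where
  "upper_half J = {middle J ..< Sup J}"

definition halve :: "real set set \<Rightarrow> real set \<Rightarrow> real set set" where
  "halve I J = (I - {J}) \<union> {lower_half J, upper_half J}"

definition good_for :: "(real \<Rightarrow> real) \<Rightarrow> real set set \<Rightarrow> bool" where
  "good_for g I \<longleftrightarrow> I \<in> dyadic_partitions \<and>
     (\<forall>J\<in>I. \<exists>\<alpha> \<beta>. \<forall>t\<in>J. g t = \<alpha> * t + \<beta>) \<and> image g ` I \<in> dyadic_partitions"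


section \<open>Diagrams and the shaded region\<close>

text \<open>\<^const>\<open>frac\<close> identifies the endpoint 1 with 0.\<close>

definition bdry_points :: "real set set \<Rightarrow> real set" where
  "bdry_points I = (\<Union>J\<in>I. {Inf J, middle J, frac (Sup J)})"

text \<open>An isotopy class of systems of disjoint strings in the disc is determined by the pairing of
  the boundary points; a pairing occurs if and only if no two of its pairs interlace.\<close>

definition pairings :: "real set set \<Rightarrow> real set set set" where
  "pairings I = {x. partition_on (bdry_points I) x \<and> (\<forall>s\<in>x. card s = 2) \<and>
     \<not> (\<exists>p r q s. p < r \<and> r < q \<and> q < s \<and> {p, q} \<in> x \<and> {r, s} \<in> x)}"

definition circle_point :: "real \<Rightarrow> complex" where
  "circle_point t = cis (2 * pi * t)"

text \<open>Every isotopy class is drawn with straight strings in the closed unit disc.\<close>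

definition strings :: "real set set \<Rightarrow> complex set" where
  "strings x = (\<Union>s\<in>x. convex hull (circle_point ` s))"

text \<open>The shaded regions are those which contain one of the open boundary arcs from the left
  endpoint of an interval to its midpoint.\<close>

definition shaded_disc :: "real set set \<Rightarrow> real set set \<Rightarrow> complex set" where
  "shaded_disc I x = {z. \<exists>J\<in>I. \<exists>t\<in>{Inf J<..<middle J}.
     connected_component (cball 0 1 - strings x) (circle_point t) z}"

text \<open>The disc of \<open>x\<close> is placed on the upper and the disc of \<open>y\<close> on the lower hemisphere of the
  unit sphere of \<open>\<complex> \<times> \<real>\<close> by vertical projection; this glues the first disc to the
  reflection of the second along the equator.\<close>

definition shaded_sphere ::
  "real set set \<Rightarrow> real set set \<Rightarrow> real set set \<Rightarrow> (complex \<times> real) set" where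
  "shaded_sphere I x y = {(z, h). (z, h) \<in> sphere 0 1 \<and>
     (0 \<le> h \<and> z \<in> shaded_disc I x \<or> h \<le> 0 \<and> z \<in> shaded_disc I y)}"


section \<open>The spaces \<open>K(I)\<close> and the maps between them\<close>

type_synonym tl_vector = "real set set \<Rightarrow> complex"

definition tl_space :: "real set set \<Rightarrow> tl_vector set" where
  "tl_space I = {v. \<forall>x. x \<notin> pairings I \<longrightarrow> v x = 0}"

definition tl_basis :: "real set set \<Rightarrow> tl_vector" where
  "tl_basis x = (\<lambda>y. of_bool (y = x))"

definition tl_extend :: "real set set \<Rightarrow> (real set set \<Rightarrow> tl_vector) \<Rightarrow> tl_vector \<Rightarrow> tl_vector" where
  "tl_extend I f v = (\<lambda>y. \<Sum>x\<in>pairings I. v x * f x y)"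

definition chrom_form :: "real \<Rightarrow> real set set \<Rightarrow> tl_vector \<Rightarrow> tl_vector \<Rightarrow> complex" where
  "chrom_form Q I v w = (\<Sum>x\<in>pairings I. \<Sum>y\<in>pairings I.
     v x * cnj (w y) * complex_of_real Q ^ card (components (shaded_sphere I x y)))"

definition move_end :: "real \<Rightarrow> real \<Rightarrow> real set set \<Rightarrow> real set set" where
  "move_end c d x = image (id(c := d)) ` x"

definition halve_map :: "real \<Rightarrow> real set set \<Rightarrow> real set \<Rightarrow> tl_vector \<Rightarrow> tl_vector" where
  "halve_map Q I J =
     (let c = middle J; l = middle (lower_half J); r = middle (upper_half J) in
      tl_extend I (\<lambda>x y. complex_of_real (1 / sqrt (Q - 1)) *
        (tl_basis (insert {c, r} (move_end c l x)) y - tl_basis (insert {l, c} (move_end c r x)) y)))"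

definition move_by :: "(real \<Rightarrow> real) \<Rightarrow> real set set \<Rightarrow> tl_vector \<Rightarrow> tl_vector" where
  "move_by g I = tl_extend I (\<lambda>x. tl_basis (image g ` x))"


section \<open>Spaces with an inner product\<close>

record 'a ip_space =
  vecs :: "'a set"
  vadd :: "'a \<Rightarrow> 'a \<Rightarrow> 'a"
  vscale :: "complex \<Rightarrow> 'a \<Rightarrow> 'a"
  vinner :: "'a \<Rightarrow> 'a \<Rightarrow> complex"

definition vdist :: "'a ip_space \<Rightarrow> 'a \<Rightarrow> 'a \<Rightarrow> real" where
  "vdist V u v = (let d = vadd V u (vscale V (-1) v) in sqrt (Re (vinner V d d)))"

text \<open>The completion of \<open>V\<close> modulo its null vectors, as Cauchy sequences modulo sequences of
  seminorm tending to 0; in particular vectors differing by a null vector become equal.\<close>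

definition cauchy_seqs :: "'a ip_space \<Rightarrow> (nat \<Rightarrow> 'a) set" where
  "cauchy_seqs V = {s. range s \<subseteq> vecs V \<and>
     (\<forall>e>0. \<exists>N. \<forall>m\<ge>N. \<forall>n\<ge>N. vdist V (s m) (s n) < e)}"

definition cauchy_rel :: "'a ip_space \<Rightarrow> ((nat \<Rightarrow> 'a) \<times> (nat \<Rightarrow> 'a)) set" where
  "cauchy_rel V = {(s, t). s \<in> cauchy_seqs V \<and> t \<in> cauchy_seqs V \<and>
     (\<lambda>n. vdist V (s n) (t n)) \<longlonglongrightarrow> 0}"

definition completion :: "'a ip_space \<Rightarrow> (nat \<Rightarrow> 'a) set ip_space" where
  "completion V =
     \<lparr>vecs = cauchy_seqs V // cauchy_rel V,
      vadd = (\<lambda>A B. cauchy_rel V `` {(\<lambda>n. vadd V (s n) (t n)) | s t. s \<in> A \<and> t \<in> B}),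
      vscale = (\<lambda>c A. cauchy_rel V `` {(\<lambda>n. vscale V c (s n)) | s. s \<in> A}),
      vinner = (\<lambda>A B. the_elem {lim (\<lambda>n. vinner V (s n) (t n)) | s t. s \<in> A \<and> t \<in> B})\<rparr>"

definition completion_embed :: "'a ip_space \<Rightarrow> 'a \<Rightarrow> (nat \<Rightarrow> 'a) set" where
  "completion_embed V u = cauchy_rel V `` {\<lambda>n. u}"

definition completion_map :: "'a ip_space \<Rightarrow> ('a \<Rightarrow> 'a) \<Rightarrow> (nat \<Rightarrow> 'a) set \<Rightarrow> (nat \<Rightarrow> 'a) set" where
  "completion_map V f A = cauchy_rel V `` {(\<lambda>n. f (s n)) | s. s \<in> A}"

definition ell2 :: "'x set \<Rightarrow> ('x \<Rightarrow> complex) ip_space" where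
  "ell2 X =
     \<lparr>vecs = {f. (\<forall>x. x \<notin> X \<longrightarrow> f x = 0) \<and> (\<lambda>x. (cmod (f x))\<^sup>2) summable_on X},
      vadd = (\<lambda>f h x. f x + h x),
      vscale = (\<lambda>c f x. c * f x),
      vinner = (\<lambda>f h. \<Sum>\<^sub>\<infinity>x\<in>X. f x * cnj (h x))\<rparr>"

text \<open>The left translation action of \<open>G\<close> on functions on \<open>G/H\<close>.\<close>

definition perm_rep ::
  "('g, 'm) monoid_scheme \<Rightarrow> 'g set \<Rightarrow> 'g \<Rightarrow> ('g set \<Rightarrow> complex) \<Rightarrow> 'g set \<Rightarrow> complex" where
  "perm_rep G H g f = (\<lambda>C. if C \<in> lcosets\<^bsub>G\<^esub> H then f ((inv\<^bsub>G\<^esub> g) <#\<^bsub>G\<^esub> C) else 0)"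

definition unitarily_equivalent ::
  "('g, 'm) monoid_scheme \<Rightarrow> 'a ip_space \<Rightarrow> ('g \<Rightarrow> 'a \<Rightarrow> 'a) \<Rightarrow>
   'b ip_space \<Rightarrow> ('g \<Rightarrow> 'b \<Rightarrow> 'b) \<Rightarrow> bool" where
  "unitarily_equivalent G V \<pi> W \<rho> \<longleftrightarrow>
     (\<forall>g\<in>carrier G. \<pi> g \<in> vecs V \<rightarrow> vecs V \<and> \<rho> g \<in> vecs W \<rightarrow> vecs W) \<and>
     (\<exists>U. bij_betw U (vecs V) (vecs W) \<and>
        (\<forall>u\<in>vecs V. \<forall>v\<in>vecs V. vadd V u v \<in> vecs V \<and> U (vadd V u v) = vadd W (U u) (U v)) \<and>
        (\<forall>c. \<forall>u\<in>vecs V. vscale V c u \<in> vecs V \<and> U (vscale V c u) = vscale W c (U u)) \<and>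
        (\<forall>u\<in>vecs V. \<forall>v\<in>vecs V. vinner W (U u) (U v) = vinner V u v) \<and>
        (\<forall>g\<in>carrier G. \<forall>u\<in>vecs V. U (\<pi> g u) = \<rho> g (U u)))"


section \<open>The chromatic representation\<close>

text \<open>Each refinement of standard dyadic partitions is a sequence of halvings, so the connecting
  maps are the compositions of halving maps: the pair \<open>((I, v), (J, w))\<close> lies in
  \<open>(halve_step Q)\<^sup>*\<close> iff \<open>J\<close> refines \<open>I\<close> and the connecting map sends \<open>v\<close> to \<open>w\<close>. Elements of
  the direct limit are classes of pairs \<open>(I, v)\<close> with \<open>v\<close> in \<open>K(I)\<close>, two pairs being equivalent
  if they are mapped to the same vector for some common refinement.\<close>

definition halve_step :: "real \<Rightarrow> ((real set set \<times> tl_vector) \<times> (real set set \<times> tl_vector)) set" where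
  "halve_step Q = {((I, v), (halve I J, halve_map Q I J v)) | I J v.
     I \<in> dyadic_partitions \<and> J \<in> I \<and> v \<in> tl_space I}"

definition limit_rel :: "real \<Rightarrow> ((real set set \<times> tl_vector) \<times> (real set set \<times> tl_vector)) set" where
  "limit_rel Q = {(a, b). a \<in> Sigma dyadic_partitions tl_space \<and> b \<in> Sigma dyadic_partitions tl_space \<and>
     (\<exists>d. (a, d) \<in> (halve_step Q)\<^sup>* \<and> (b, d) \<in> (halve_step Q)\<^sup>*)}"

definition limit_space :: "real \<Rightarrow> (real set set \<times> tl_vector) set ip_space" where
  "limit_space Q =
     \<lparr>vecs = Sigma dyadic_partitions tl_space // limit_rel Q,
      vadd = (\<lambda>A B. limit_rel Q `` {(I, \<lambda>x. v x + w x) | I v w. (I, v) \<in> A \<and> (I, w) \<in> B}),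
      vscale = (\<lambda>c A. limit_rel Q `` {(I, \<lambda>x. c * v x) | I v. (I, v) \<in> A}),
      vinner = (\<lambda>A B. the_elem {chrom_form Q I v w | I v w. (I, v) \<in> A \<and> (I, w) \<in> B})\<rparr>"

text \<open>A class \<open>A\<close> contains, with each representative, all its images in the finer \<open>K(J)\<close>.\<close>

definition limit_rep ::
  "real \<Rightarrow> (real \<Rightarrow> real) \<Rightarrow> (real set set \<times> tl_vector) set \<Rightarrow> (real set set \<times> tl_vector) set" where
  "limit_rep Q g A =
     limit_rel Q `` {(image g ` J, move_by g J v) | J v. (J, v) \<in> A \<and> good_for g J}"

definition chrom_space :: "real \<Rightarrow> (nat \<Rightarrow> (real set set \<times> tl_vector) set) set ip_space" where
  "chrom_space Q = completion (limit_space Q)"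

definition chrom_rep ::
  "real \<Rightarrow> (real \<Rightarrow> real) \<Rightarrow> (nat \<Rightarrow> (real set set \<times> tl_vector) set) set \<Rightarrow>
   (nat \<Rightarrow> (real set set \<times> tl_vector) set) set" where
  "chrom_rep Q g = completion_map (limit_space Q) (limit_rep Q g)"

definition vacuum :: "real \<Rightarrow> (nat \<Rightarrow> (real set set \<times> tl_vector) set) set" where
  "vacuum Q = completion_embed (limit_space Q) (limit_rel Q `` {({circle}, tl_basis {{0, 1/2}})})"

end

theory Submission
  imports Defs
begin

text \<open>At \<open>Q = 2\<close> the number \<open>2 ^ c\<close> counts the colourings of the \<open>c\<close> shaded components of a sphere with two
colours. A diagram \<open>x\<close> on a partition \<open>I\<close> thus becomes a function of spin configurations
\<open>s : I \<rightarrow> bool\<close>, with value 1 if \<open>s\<close> is constant on every shaded region of \<open>x\<close> and 0 otherwise, and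
the form becomes the inner product of such functions (\<open>chrom_form_eq_spin_sum\<close>). This is the only
topological step: strings are chords, so the regions of a disc are convex cells cut out by the sides
of the chords, and the cells of two discs are glued exactly along the shaded boundary arcs
(\<open>card_components_shaded_sphere\<close>).

Halving an interval subtracts from a diagram in which the new shaded region is isolated the diagram in
which it is joined to the old one. The difference lives on the configurations that give the two halves
opposite spins (\<open>spin_coeff_halve\<close>), so the connecting map sends the point mass of a configuration to
the point mass of the configuration in which each halved spin \<open>s\<close> is replaced by \<open>s\<close>, \<open>\<not> s\<close>. In the
limit there remains an orthonormal basis indexed by limit configurations up to a global flip. As the
left half keeps both the left endpoint and the spin, a limit configuration is a function on the dyadic
points of the circle; below some partition it agrees on each interval, up to sign, with the parity of
the number of binary digits 1 of the position in the interval. These functions, normalised at 0, form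
the set \<open>spins\<close>. Thompson's group \<open>T\<close> permutes them by moving the points (\<open>act\<close>), and the vacuum is
\<open>sqrt 2\<close> times the point mass of the parity function itself, normalised (\<open>vacuum_spin\<close>). Therefore the
representation is the permutation representation of \<open>T\<close> on \<open>spins\<close>
(\<open>unitarily_equivalent_spin_rep\<close>), and the matrix coefficient of the vacuum is 2 on the stabilizer of
\<open>vacuum_spin\<close> and 0 elsewhere (\<open>vacuum_coeff\<close>).

It remains that already \<open>F\<close> acts transitively (\<open>spins_transitive\<close>). A piecewise linear map identifies any
two partitions of equal size, hence only the word of spins matters. Halving replaces a letter \<open>+\<close> by
\<open>+-\<close>, and halving twice replaces it by \<open>+-+\<close>; read backwards, \<open>+-\<close> may be replaced by \<open>+\<close>, and so may
\<open>++\<close>, which is halved to \<open>+-+\<close>. Every word therefore shrinks to its first letter, the word of the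
vacuum. The orbit-stabilizer bijection (\<open>perm_rep_equivalent\<close>) turns the action on \<open>spins\<close> into the one
on cosets.\<close>

section \<open>Dyadic partitions and their boundary points\<close>

lemma standard_dyadicD:
  assumes "standard_dyadic J"
  shows "J = {Inf J..<Sup J}" "0 \<le> Inf J" "Inf J < Sup J" "Sup J \<le> 1"
proof -
  obtain n p :: nat where p: "p < 2 ^ n" and J: "J = {real p / 2 ^ n ..< (real p + 1) / 2 ^ n}"
    using assms by (auto simp: standard_dyadic_def)
  have lt: "real p / 2 ^ n < (real p + 1) / 2 ^ n" by (simp add: divide_strict_right_mono)
  have "real (p + 1) \<le> real (2 ^ n)" using p by (intro of_nat_mono) simp
  then have le: "(real p + 1) / 2 ^ n \<le> 1" by (simp add: divide_le_eq)
  have I: "Inf J = real p / 2 ^ n" "Sup J = (real p + 1) / 2 ^ n"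
    using lt by (simp_all add: J)
  show "J = {Inf J..<Sup J}" using I J by simp
  show "0 \<le> Inf J" "Inf J < Sup J" "Sup J \<le> 1" using I lt le by simp_all
qed

lemma standard_dyadic_mem: "standard_dyadic J \<Longrightarrow> t \<in> J \<longleftrightarrow> Inf J \<le> t \<and> t < Sup J"
  using standard_dyadicD(1)[of J] by (metis atLeastLessThan_iff)

lemma middle_between:
  assumes "standard_dyadic J"
  shows "Inf J < middle J" "middle J < Sup J"
  using standard_dyadicD[OF assms] by (auto simp: middle_def)

lemma dyadic_partitionsD:
  assumes "I \<in> dyadic_partitions"
  shows "finite I" "partition_on circle I" "J \<in> I \<Longrightarrow> standard_dyadic J"
  using assms by (auto simp: dyadic_partitions_def)

lemma circle_in_interval:
  assumes "I \<in> dyadic_partitions" "t \<in> circle"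
  obtains J where "J \<in> I" "Inf J \<le> t" "t < Sup J"
proof -
  have "t \<in> \<Union>I" using assms dyadic_partitionsD(2) partition_onD1 by blast
  then show thesis using that dyadic_partitionsD(3)[OF assms(1)] standard_dyadic_mem by (meson UnionE)
qed

lemma intervals_apart:
  assumes "I \<in> dyadic_partitions" "J \<in> I" "K \<in> I" "J \<noteq> K"
  shows "Sup J \<le> Inf K \<or> Sup K \<le> Inf J"
proof (rule ccontr)
  assume *: "\<not> ?thesis"
  have sd: "standard_dyadic J" "standard_dyadic K"
    using dyadic_partitionsD(3)[OF assms(1) assms(2)] dyadic_partitionsD(3)[OF assms(1) assms(3)] .
  let ?t = "max (Inf J) (Inf K)"
  have "?t \<in> J" "?t \<in> K"
    using * standard_dyadicD(3)[OF sd(1)] standard_dyadicD(3)[OF sd(2)]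
    by (auto simp: standard_dyadic_mem[OF sd(1)] standard_dyadic_mem[OF sd(2)])
  moreover have "J \<inter> K = {}"
    using assms dyadic_partitionsD(2) by (metis disjointD partition_onD2)
  ultimately show False by auto
qed

lemma Inf_inj_on: "I \<in> dyadic_partitions \<Longrightarrow> inj_on Inf I"
proof (rule inj_onI)
  fix J K assume *: "I \<in> dyadic_partitions" "J \<in> I" "K \<in> I" "Inf J = Inf K"
  have "Inf J < Sup J" "Inf K < Sup K"
    using dyadic_partitionsD(3)[OF *(1) *(2)] dyadic_partitionsD(3)[OF *(1) *(3)]
    by (simp_all add: standard_dyadicD(3))
  then show "J = K" using intervals_apart[OF *(1-3)] *(4) by fastforce
qed

lemma interval_unique:
  assumes "I \<in> dyadic_partitions" "J \<in> I" "K \<in> I" "Inf J \<le> t" "t < Sup J" "Inf K \<le> t" "t < Sup K"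
  shows "J = K"
  using intervals_apart[OF assms(1-3)] assms(4-) by force

lemma zero_left_end:
  assumes "I \<in> dyadic_partitions"
  obtains J where "J \<in> I" "Inf J = 0"
proof -
  obtain J where J: "J \<in> I" "Inf J \<le> 0" "0 < Sup J"
    using circle_in_interval[OF assms, of 0] by auto
  then show thesis using that standard_dyadicD(2)[of J] dyadic_partitionsD(3)[OF assms] by force
qed

lemma bdry_points_eq:
  assumes I: "I \<in> dyadic_partitions"
  shows "bdry_points I = (\<Union>J\<in>I. {Inf J, middle J})"
proof -
  have "\<exists>K\<in>I. frac (Sup J) = Inf K" if J: "J \<in> I" for J
  proof -
    have sd: "standard_dyadic J" using I J by (rule dyadic_partitionsD(3))
    show ?thesis
    proof (cases "Sup J = 1")
      case True
      then show ?thesis using zero_left_end[OF I] by force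
    next
      case False
      then have c: "Sup J \<in> circle" using standard_dyadicD[OF sd] by auto
      then obtain K where K: "K \<in> I" "Inf K \<le> Sup J" "Sup J < Sup K"
        using circle_in_interval[OF I] by blast
      have "K \<noteq> J" using K by auto
      then have "Sup J \<le> Inf K" using intervals_apart[OF I J K(1)] K standard_dyadicD(3)[OF sd] by force
      moreover have "frac (Sup J) = Sup J" using c by (simp add: frac_eq)
      ultimately show ?thesis using K by force
    qed
  qed
  then show ?thesis unfolding bdry_points_def by fastforce
qed

lemma finite_bdry_points: "I \<in> dyadic_partitions \<Longrightarrow> finite (bdry_points I)"
  by (simp add: bdry_points_eq dyadic_partitionsD(1))

lemma bdry_points_subset:
  assumes I: "I \<in> dyadic_partitions"
  shows "bdry_points I \<subseteq> circle"
proof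
  fix u assume "u \<in> bdry_points I"
  then obtain K where K: "K \<in> I" "u = Inf K \<or> u = middle K" by (auto simp: bdry_points_eq[OF I])
  have sd: "standard_dyadic K" using I K(1) by (rule dyadic_partitionsD(3))
  show "u \<in> circle" using K(2) middle_between[OF sd] standard_dyadicD(2-4)[OF sd] by auto
qed

lemma bdry_point_in_interval:
  assumes I: "I \<in> dyadic_partitions" and "J \<in> I" "u \<in> bdry_points I" "Inf J \<le> u" "u < Sup J"
  shows "u = Inf J \<or> u = middle J"
proof -
  obtain K where K: "K \<in> I" "u = Inf K \<or> u = middle K" using assms(3) by (auto simp: bdry_points_eq[OF I])
  have sd: "standard_dyadic K" using I K(1) by (rule dyadic_partitionsD(3))
  have "Inf K \<le> u" "u < Sup K"
    using K(2) middle_between[OF sd] standard_dyadicD(2-4)[OF sd] by auto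
  then have "K = J" using interval_unique[OF I K(1) assms(2)] assms by auto
  then show ?thesis using K by auto
qed

lemma bdry_mem [intro]:
  "I \<in> dyadic_partitions \<Longrightarrow> J \<in> I \<Longrightarrow> Inf J \<in> bdry_points I"
  "I \<in> dyadic_partitions \<Longrightarrow> J \<in> I \<Longrightarrow> middle J \<in> bdry_points I"
  by (auto simp: bdry_points_eq)

lemma finite_pairings: "I \<in> dyadic_partitions \<Longrightarrow> finite (pairings I)"
proof -
  assume I: "I \<in> dyadic_partitions"
  have "pairings I \<subseteq> Pow (Pow (bdry_points I))" by (auto simp: pairings_def partition_on_def)
  then show ?thesis using finite_bdry_points[OF I] by (meson finite_Pow_iff finite_subset)
qed

lemma pairing_pairE:
  assumes "x \<in> pairings I" "u \<in> bdry_points I"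
  obtains v where "v \<in> bdry_points I" "v \<noteq> u" "{u, v} \<in> x"
proof -
  have "u \<in> \<Union>x" using assms by (auto simp: pairings_def dest: partition_onD1)
  then obtain s where s: "s \<in> x" "u \<in> s" by auto
  then have "card s = 2" using assms by (auto simp: pairings_def)
  then obtain v where "s = {u, v}" "u \<noteq> v" using s(2) by (auto simp: card_2_iff doubleton_eq_iff)
  moreover have "s \<subseteq> bdry_points I" using s assms by (auto simp: pairings_def dest: partition_onD1)
  ultimately show thesis using that s by auto
qed

lemma pairing_pair:
  assumes "x \<in> pairings I" "{p, q} \<in> x"
  shows "p \<in> bdry_points I" "q \<in> bdry_points I" "p \<noteq> q"
proof -
  have "card {p, q} = 2" using assms by (auto simp: pairings_def)
  then show "p \<noteq> q" by auto
  have "{p, q} \<subseteq> bdry_points I" using assms by (auto simp: pairings_def dest: partition_onD1)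
  then show "p \<in> bdry_points I" "q \<in> bdry_points I" by auto
qed

lemma pairing_set:
  assumes "x \<in> pairings I" "s \<in> x"
  obtains p q where "s = {p, q}" "p < q" "p \<in> bdry_points I" "q \<in> bdry_points I"
proof -
  have "card s = 2" using assms by (auto simp: pairings_def)
  then obtain p q where "s = {p, q}" "p \<noteq> q" by (auto simp: card_2_iff)
  then have "s = {min p q, max p q}" "min p q < max p q" by (auto simp: min_def max_def)
  then show thesis using that assms pairing_pair by metis
qed

section \<open>Chords and cells of the disc\<close>

text \<open>The signed distance of a point from the line through the boundary points with parameters \<open>p\<close> and
\<open>q\<close>; its unit normal points to the midpoint of the arc from \<open>p\<close> to \<open>q\<close>.\<close>

definition chord_side :: "real \<Rightarrow> real \<Rightarrow> complex \<Rightarrow> real" where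
  "chord_side p q z = inner (cis (pi * (p + q))) z - cos (pi * (q - p))"

lemma chord_side_circle_point:
  "chord_side p q (circle_point t) = - 2 * sin (pi * (t - p)) * sin (pi * (t - q))"
proof -
  have "chord_side p q (circle_point t) = cos (pi * (p + q) - 2 * pi * t) - cos (pi * (q - p))"
    by (simp add: chord_side_def circle_point_def inner_complex_def cos_diff)
  also have "\<dots> = 2 * sin (pi * (q - t)) * sin (pi * (t - p))"
  proof -
    have "(pi * (p + q) - 2 * pi * t + pi * (q - p)) / 2 = pi * (q - t)"
      "(pi * (q - p) - (pi * (p + q) - 2 * pi * t)) / 2 = pi * (t - p)"
      by (simp_all add: field_simps)
    then show ?thesis by (simp add: cos_diff_cos)
  qed
  also have "pi * (q - t) = - (pi * (t - q))" by (simp add: field_simps)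
  finally show ?thesis by (simp del: mult_minus_left)
qed

lemma sgn_sin_pi:
  assumes "\<bar>u\<bar> < 1"
  shows "sgn (sin (pi * u)) = sgn u"
proof -
  have *: "0 < sin (pi * r)" if "0 < r" "r < 1" for r :: real
    using that pi_gt_zero by (intro sin_gt_zero) (auto simp: mult_less_cancel_left2 simp del: pi_gt_zero)
  consider "u = 0" | "0 < u" | "u < 0" by linarith
  then show ?thesis
  proof cases
    case 2
    then show ?thesis using *[of u] assms by simp
  next
    case 3
    then have "0 < sin (pi * - u)" using *[of "- u"] assms by simp
    then have "sin (pi * u) < 0" by simp
    then show ?thesis using 3 by simp
  qed simp
qed

lemma sgn_chord_side_circle_point:
  assumes "p \<in> circle" "q \<in> circle" "t \<in> circle"
  shows "sgn (chord_side p q (circle_point t)) = - sgn (t - p) * sgn (t - q)"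
proof -
  have "\<bar>t - p\<bar> < 1" "\<bar>t - q\<bar> < 1" using assms by auto
  then show ?thesis by (simp add: chord_side_circle_point sgn_mult sgn_sin_pi)
qed

lemma chord_side_circle_point_iff:
  assumes "p \<in> circle" "q \<in> circle" "t \<in> circle" "p < q"
  shows "0 < chord_side p q (circle_point t) \<longleftrightarrow> p < t \<and> t < q"
    and "chord_side p q (circle_point t) < 0 \<longleftrightarrow> t < p \<or> q < t"
    and "chord_side p q (circle_point t) = 0 \<longleftrightarrow> t = p \<or> t = q"
  using sgn_chord_side_circle_point[OF assms(1-3)] assms(4)
  by (auto simp: sgn_if split: if_splits)

lemma cmod_circle_point [simp]: "cmod (circle_point t) = 1"
  by (simp add: circle_point_def)

lemma circle_point_exists:
  assumes "cmod z = 1"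
  obtains t where "t \<in> circle" "z = circle_point t"
proof -
  let ?s = "Arg z / (2 * pi)"
  have "circle_point (frac ?s) = cis (2 * pi * ?s - 2 * pi * of_int \<lfloor>?s\<rfloor>)"
    by (simp add: circle_point_def frac_def right_diff_distrib)
  also have "\<dots> = cis (2 * pi * ?s) / cis (2 * pi * of_int \<lfloor>?s\<rfloor>)"
    by (simp only: cis_divide)
  also have "\<dots> = cis (Arg z)" by (simp add: cis_multiple_2pi)
  also have "\<dots> = z" using assms rcis_cmod_Arg[of z] by (simp add: rcis_def)
  finally show thesis using that[of "frac ?s"] by (auto simp: frac_lt_1)
qed

text \<open>Undoing the rotation by \<open>cis (pi * (p + q))\<close> makes the chord vertical, with real part \<open>cos d\<close> and
imaginary parts between \<open>- sin d\<close> and \<open>sin d\<close>, where \<open>d\<close> is half the angle that it subtends.\<close>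

lemma chord_eq_zero_set:
  assumes "p \<in> circle" "q \<in> circle" "p < q"
  shows "convex hull (circle_point ` {p, q}) = {z \<in> cball 0 1. chord_side p q z = 0}"
proof (intro equalityI subsetI)
  fix z assume "z \<in> convex hull (circle_point ` {p, q})"
  then obtain u where u: "0 \<le> u" "u \<le> 1" "z = (1 - u) *\<^sub>R circle_point p + u *\<^sub>R circle_point q"
    by (auto simp: segment_convex_hull[symmetric] in_segment)
  have zero: "chord_side p q (circle_point p) = 0" "chord_side p q (circle_point q) = 0"
    using assms chord_side_circle_point_iff(3)[of p q] by auto
  have "chord_side p q z = (1 - u) * chord_side p q (circle_point p) + u * chord_side p q (circle_point q)"
    by (simp add: u(3) chord_side_def inner_add_right algebra_simps)
  moreover have "z \<in> cball 0 1" unfolding u(3)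
    by (intro convexD) (use u in auto)
  ultimately show "z \<in> {z \<in> cball 0 1. chord_side p q z = 0}" by (simp add: zero)
next
  fix z assume "z \<in> {z \<in> cball 0 1. chord_side p q z = 0}"
  then have z: "cmod z \<le> 1" "chord_side p q z = 0" by auto
  define u where "u = cis (pi * (p + q))"
  define d where "d = pi * (q - p)"
  define w where "w = z * cnj u"
  have uu: "cnj u * u = 1" by (simp add: u_def cis_cnj cis_mult)
  have zw: "z = w * u" by (simp add: w_def mult.assoc uu)
  have Re: "Re w = cos d"
    using z(2) by (simp add: chord_side_def w_def u_def d_def inner_complex_def mult.commute)
  have "0 < d" "d < pi" using assms pi_gt_zero by (auto simp: d_def mult_less_cancel_left2 simp del: pi_gt_zero)
  then have sd: "0 < sin d" by (rule sin_gt_zero)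
  have "cmod w \<le> 1" using z(1) by (simp add: w_def u_def norm_mult)
  then have "(cmod w)\<^sup>2 \<le> 1" by (simp add: abs_square_le_1)
  then have "(Im w)\<^sup>2 \<le> (sin d)\<^sup>2" by (simp add: cmod_power2 Re sin_squared_eq)
  then have Im: "\<bar>Im w\<bar> \<le> sin d" using sd by (simp add: abs_le_square_iff[symmetric])
  define s where "s = (Im w + sin d) / (2 * sin d)"
  have s: "0 \<le> s" "s \<le> 1" using Im sd by (auto simp: s_def field_simps)
  have "w = (1 - s) *\<^sub>R cis (- d) + s *\<^sub>R cis d"
    using sd by (simp add: complex_eq_iff Re s_def field_simps)
  moreover have "cis (- d) * u = circle_point p" "cis d * u = circle_point q"
    by (simp_all add: d_def u_def circle_point_def cis_mult algebra_simps)
  ultimately have "z = (1 - s) *\<^sub>R circle_point p + s *\<^sub>R circle_point q"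
    by (simp add: zw distrib_right)
  then show "z \<in> convex hull (circle_point ` {p, q})"
    using s by (auto simp: segment_convex_hull[symmetric] in_segment)
qed

text \<open>No string separates the boundary positions \<open>a\<close> and \<open>b\<close>. Intervals are half-open because the
shaded arc of an interval starts at its left endpoint, which stands for the whole arc.\<close>

definition linked :: "real set set \<Rightarrow> real \<Rightarrow> real \<Rightarrow> bool" where
  "linked x a b \<longleftrightarrow> (\<forall>p q. p < q \<and> {p, q} \<in> x \<longrightarrow> (p \<le> a \<and> a < q \<longleftrightarrow> p \<le> b \<and> b < q))"

text \<open>The region of the disc that meets the shaded arc starting at \<open>a\<close>: it lies on the same side of every
string as this arc.\<close>

definition cell :: "real set set \<Rightarrow> real \<Rightarrow> complex set" where
  "cell x a = {z \<in> cball 0 1. \<forall>p q. p < q \<and> {p, q} \<in> x \<longrightarrow>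
     (if p \<le> a \<and> a < q then 0 < chord_side p q z else chord_side p q z < 0)}"

lemma linked_sym: "linked x a b \<Longrightarrow> linked x b a"
  by (auto simp: linked_def)

lemma linked_trans: "linked x a b \<Longrightarrow> linked x b c \<Longrightarrow> linked x a c"
  by (auto simp: linked_def)

lemma cell_linked: "linked x a b \<Longrightarrow> cell x a = cell x b"
  unfolding linked_def cell_def by (intro Collect_cong conj_cong refl all_cong) simp

lemma cell_disjoint:
  assumes "z \<in> cell x a" "z \<in> cell x b"
  shows "linked x a b"
  unfolding linked_def
proof (intro allI impI)
  fix p q assume *: "p < q \<and> {p, q} \<in> x"
  have "if p \<le> a \<and> a < q then 0 < chord_side p q z else chord_side p q z < 0"
    "if p \<le> b \<and> b < q then 0 < chord_side p q z else chord_side p q z < 0"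
    using assms * by (auto simp: cell_def)
  then show "p \<le> a \<and> a < q \<longleftrightarrow> p \<le> b \<and> b < q" by (auto split: if_splits)
qed

text \<open>Convexity is what makes straight strings convenient: a cell is connected without any argument
about planar curves.\<close>

lemma convex_cell: "convex (cell x a)"
proof -
  have "cell x a = cball 0 1 \<inter> (\<Inter>(p, q)\<in>{(p, q). p < q \<and> {p, q} \<in> x}.
      if p \<le> a \<and> a < q then {z. inner (cis (pi * (p + q))) z > cos (pi * (q - p))}
      else {z. inner (cis (pi * (p + q))) z < cos (pi * (q - p))})"
    by (auto simp: cell_def chord_side_def split: if_splits)
  moreover have "convex \<dots>"
    by (intro convex_Int convex_INT convex_cball)
      (auto simp: convex_halfspace_gt convex_halfspace_lt)
  ultimately show ?thesis by simp
qed

lemma circle_point_in_cell_iff: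
  assumes I: "I \<in> dyadic_partitions" and x: "x \<in> pairings I" and t: "t \<in> circle" "t \<notin> bdry_points I"
  shows "circle_point t \<in> cell x a \<longleftrightarrow> linked x a t"
proof -
  have "(if p \<le> a \<and> a < q then 0 < chord_side p q (circle_point t) else chord_side p q (circle_point t) < 0)
      \<longleftrightarrow> (p \<le> a \<and> a < q \<longleftrightarrow> p \<le> t \<and> t < q)" if "p < q" "{p, q} \<in> x" for p q
  proof -
    have pq: "p \<in> bdry_points I" "q \<in> bdry_points I" using pairing_pair[OF x that(2)] by auto
    then have c: "p \<in> circle" "q \<in> circle" using bdry_points_subset[OF I] by auto
    have "t \<noteq> p" "t \<noteq> q" using pq t by auto
    then show ?thesis using chord_side_circle_point_iff[OF c t(1) that(1)] that(1) by auto
  qed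
  then show ?thesis by (auto simp: cell_def linked_def)
qed

lemma cell_side_nonzero:
  assumes "z \<in> cell x a" "p < q" "{p, q} \<in> x"
  shows "chord_side p q z \<noteq> 0"
proof -
  have "if p \<le> a \<and> a < q then 0 < chord_side p q z else chord_side p q z < 0"
    using assms by (simp add: cell_def)
  then show ?thesis by (auto split: if_splits)
qed

lemma circle_point_bdry_not_in_cell:
  assumes I: "I \<in> dyadic_partitions" and x: "x \<in> pairings I" and t: "t \<in> bdry_points I"
  shows "circle_point t \<notin> cell x a"
proof
  assume *: "circle_point t \<in> cell x a"
  obtain v where v: "v \<in> bdry_points I" "v \<noteq> t" "{t, v} \<in> x" using pairing_pairE[OF x t] by metis
  define p q where "p = min t v" and "q = max t v"
  have pq: "{p, q} \<in> x" "p < q" using v by (auto simp: p_def q_def min_def max_def insert_commute)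
  have "t \<in> circle" "v \<in> circle" using v t bdry_points_subset[OF I] by auto
  then have "p \<in> circle" "q \<in> circle" "t \<in> circle" by (auto simp: p_def q_def min_def max_def)
  moreover have "t = p \<or> t = q" by (auto simp: p_def q_def)
  ultimately have "chord_side p q (circle_point t) = 0" using chord_side_circle_point_iff(3) pq(2) by blast
  then show False using cell_side_nonzero[OF * pq(2,1)] by simp
qed

lemma open_arc_not_bdry:
  assumes I: "I \<in> dyadic_partitions" and J: "J \<in> I" and t: "Inf J < t" "t < Sup J" "t \<noteq> middle J"
  shows "t \<notin> bdry_points I" "t \<in> circle"
proof -
  have "standard_dyadic J" using I J by (rule dyadic_partitionsD(3))
  then show "t \<in> circle" using t standard_dyadicD(2,4)[of J] by auto
  show "t \<notin> bdry_points I" using bdry_point_in_interval[OF I J, of t] t by auto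
qed

lemma linked_in_lower_half:
  assumes I: "I \<in> dyadic_partitions" and J: "J \<in> I" and x: "x \<in> pairings I"
    and t: "Inf J \<le> t" "t < middle J"
  shows "linked x (Inf J) t"
  unfolding linked_def
proof (intro allI impI)
  fix p q assume "p < q \<and> {p, q} \<in> x"
  then have "p \<in> bdry_points I" "q \<in> bdry_points I" using pairing_pair[OF x] by auto
  moreover have "middle J < Sup J" using middle_between(2) dyadic_partitionsD(3)[OF I J] .
  moreover have "u = Inf J" if "u \<in> bdry_points I" "Inf J \<le> u" "u \<le> t" for u
    using bdry_point_in_interval[OF I J that(1,2)] that t calculation by linarith
  ultimately show "p \<le> Inf J \<and> Inf J < q \<longleftrightarrow> p \<le> t \<and> t < q"
    using t by (smt (verit))
qed

lemma cell_subset: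
  assumes I: "I \<in> dyadic_partitions" and x: "x \<in> pairings I"
  shows "cell x a \<subseteq> cball 0 1 - strings x"
proof
  fix z assume z: "z \<in> cell x a"
  have "z \<notin> convex hull (circle_point ` s)" if s: "s \<in> x" for s
  proof -
    obtain p q where pq: "s = {p, q}" "p < q" "p \<in> bdry_points I" "q \<in> bdry_points I"
      using pairing_set[OF x s] .
    have c: "p \<in> circle" "q \<in> circle" using pq bdry_points_subset[OF I] by auto
    have "chord_side p q z \<noteq> 0" using cell_side_nonzero[OF z pq(2)] s pq(1) by simp
    then show ?thesis using chord_eq_zero_set[OF c pq(2)] pq(1) by auto
  qed
  then show "z \<in> cball 0 1 - strings x" using z by (auto simp: cell_def strings_def)
qed

text \<open>A connected set that avoids a chord stays on one side of it, since the signed distance would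
otherwise vanish somewhere on the set; conversely the cell is connected.\<close>

lemma connected_component_eq_cell:
  assumes I: "I \<in> dyadic_partitions" and J: "J \<in> I" and x: "x \<in> pairings I"
    and t: "t \<in> {Inf J<..<middle J}"
  shows "connected_component (cball 0 1 - strings x) (circle_point t) z \<longleftrightarrow> z \<in> cell x (Inf J)"
proof -
  have "middle J < Sup J" using middle_between(2) dyadic_partitionsD(3)[OF I J] .
  then have t': "t \<in> circle" "t \<notin> bdry_points I" using open_arc_not_bdry[OF I J, of t] t by auto
  have tc: "circle_point t \<in> cell x (Inf J)"
    using circle_point_in_cell_iff[OF I x t'] linked_in_lower_half[OF I J x, of t] t by simp
  show ?thesis
  proof
    assume "z \<in> cell x (Inf J)"
    then show "connected_component (cball 0 1 - strings x) (circle_point t) z"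
      using convex_connected[OF convex_cell] cell_subset[OF I x] tc
      unfolding connected_component_def by blast
  next
    assume "connected_component (cball 0 1 - strings x) (circle_point t) z"
    then obtain C where C: "connected C" "C \<subseteq> cball 0 1 - strings x" "circle_point t \<in> C" "z \<in> C"
      unfolding connected_component_def by blast
    have "if p \<le> Inf J \<and> Inf J < q then 0 < chord_side p q z else chord_side p q z < 0"
      if pq: "p < q" "{p, q} \<in> x" for p q
    proof -
      have c: "p \<in> circle" "q \<in> circle" using pairing_pair[OF x pq(2)] bdry_points_subset[OF I] by auto
      have nz: "chord_side p q w \<noteq> 0" if "w \<in> C" for w
      proof -
        have "w \<in> cball 0 1" "w \<notin> convex hull (circle_point ` {p, q})"
          using that C(2) pq(2) unfolding strings_def by blast+
        then show ?thesis using chord_eq_zero_set[OF c pq(1)] by blast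
      qed
      let ?s = "if p \<le> Inf J \<and> Inf J < q then 0 < chord_side p q (circle_point t) else chord_side p q (circle_point t) < 0"
      have "?s" using tc pq by (auto simp: cell_def)
      moreover have "0 < chord_side p q (circle_point t) \<longleftrightarrow> 0 < chord_side p q z"
      proof (rule ccontr)
        assume neg: "\<not> ?thesis"
        have "\<exists>w\<in>C. inner (cis (pi * (p + q))) w = cos (pi * (q - p))"
          using connected_ivt_hyperplane[OF C(1) C(3) C(4), of "cis (pi * (p + q))" "cos (pi * (q - p))"]
            connected_ivt_hyperplane[OF C(1) C(4) C(3), of "cis (pi * (p + q))" "cos (pi * (q - p))"] neg
          unfolding chord_side_def by linarith
        then show False using nz by (auto simp: chord_side_def)
      qed
      ultimately show ?thesis using nz[OF C(4)] nz[OF C(3)] by (auto split: if_splits)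
    qed
    then show "z \<in> cell x (Inf J)" using C by (auto simp: cell_def)
  qed
qed

lemma shaded_disc_eq:
  assumes I: "I \<in> dyadic_partitions" and x: "x \<in> pairings I"
  shows "shaded_disc I x = (\<Union>J\<in>I. cell x (Inf J))"
proof -
  have "(\<exists>t\<in>{Inf J<..<middle J}. connected_component (cball 0 1 - strings x) (circle_point t) z)
      \<longleftrightarrow> z \<in> cell x (Inf J)" if J: "J \<in> I" for J z
  proof -
    obtain t where "t \<in> {Inf J<..<middle J}"
      using middle_between(1)[OF dyadic_partitionsD(3)[OF I J]] dense by force
    then show ?thesis using connected_component_eq_cell[OF I J x] by blast
  qed
  then show ?thesis by (auto simp: shaded_disc_def)
qed

lemma even_card_sym_diff:
  assumes "finite A" "finite B"
  shows "even (card ((A - B) \<union> (B - A))) \<longleftrightarrow> (even (card A) \<longleftrightarrow> even (card B))"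
proof -
  have "card ((A - B) \<union> (B - A)) = card (A - B) + card (B - A)"
    using assms by (intro card_Un_disjoint) auto
  moreover have "card A = card (A - B) + card (A \<inter> B)" "card B = card (B - A) + card (A \<inter> B)"
    using card_Int_Diff[OF assms(1), of B] card_Int_Diff[OF assms(2), of A] by (simp_all add: Int_commute)
  ultimately show ?thesis by auto
qed

lemma even_card_bdry_points:
  assumes I: "I \<in> dyadic_partitions" and S: "S \<subseteq> I"
  shows "even (card (\<Union>L\<in>S. {Inf L, middle L}))"
proof (rule dvd_partition)
  have mb: "Inf L < middle L \<and> middle L < Sup L" if "L \<in> S" for L
    using middle_between dyadic_partitionsD(3)[OF I] that S by blast
  show "finite (\<Union>L\<in>S. {Inf L, middle L})"
    using finite_subset[OF S] dyadic_partitionsD(1)[OF I] by auto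
  show "\<forall>c\<in>(\<lambda>L. {Inf L, middle L}) ` S. 2 dvd card c" using mb by force
  show "\<forall>c1\<in>(\<lambda>L. {Inf L, middle L}) ` S. \<forall>c2\<in>(\<lambda>L. {Inf L, middle L}) ` S. c1 \<noteq> c2 \<longrightarrow> c1 \<inter> c2 = {}"
  proof (intro ballI impI)
    fix c1 c2 assume *: "c1 \<in> (\<lambda>L. {Inf L, middle L}) ` S" "c2 \<in> (\<lambda>L. {Inf L, middle L}) ` S" "c1 \<noteq> c2"
    then obtain L M where LM: "L \<in> S" "M \<in> S" "L \<noteq> M" "c1 = {Inf L, middle L}" "c2 = {Inf M, middle M}"
      by auto
    then have "Sup L \<le> Inf M \<or> Sup M \<le> Inf L" using intervals_apart[OF I] S by blast
    then show "c1 \<inter> c2 = {}" using LM mb[of L] mb[of M] by auto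
  qed
qed

text \<open>The checkerboard shading is consistent: between a point of an unshaded arc and the beginning of a
shaded arc there is an odd number of boundary points, so some string has exactly one end among
them and separates the two.\<close>

lemma unshaded_arc:
  assumes I: "I \<in> dyadic_partitions" and J: "J \<in> I" and K: "K \<in> I" and x: "x \<in> pairings I"
    and t: "middle K < t" "t < Sup K"
  shows "\<not> linked x (Inf J) t"
proof
  assume link: "linked x (Inf J) t"
  let ?a = "Inf J"
  have sd: "L \<in> I \<Longrightarrow> Inf L < middle L \<and> middle L < Sup L" for L
    using middle_between dyadic_partitionsD(3)[OF I] by blast
  \<comment> \<open>Up to \<open>t\<close> the boundary points come in pairs from whole intervals; up to the start of a shaded arc one is left over.\<close>
  define P where "P u = bdry_points I \<inter> {..u}" for u
  have fin: "finite (P u)" for u using finite_bdry_points[OF I] by (simp add: P_def)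
  have "P t = (\<Union>L\<in>{L\<in>I. Inf L \<le> t}. {Inf L, middle L})"
  proof -
    have "middle L \<le> t" if "L \<in> I" "Inf L \<le> t" for L
      using intervals_apart[OF I that(1) K] that sd[OF that(1)] t sd[OF K] by fastforce
    then show ?thesis using sd by (fastforce simp: P_def bdry_points_eq[OF I])
  qed
  then have evt: "even (card (P t))" using even_card_bdry_points[OF I, of "{L\<in>I. Inf L \<le> t}"] by simp
  have Pa: "P ?a = insert ?a (\<Union>L\<in>{L\<in>I. Inf L < ?a}. {Inf L, middle L})" (is "_ = insert _ ?U")
  proof -
    have "middle L \<le> ?a" if "L \<in> I" "Inf L < ?a" for L
      using intervals_apart[OF I that(1) J] that sd[OF that(1)] sd[OF J] by fastforce
    moreover have "Inf L < ?a" if "L \<in> I" "middle L \<le> ?a" for L using sd that by fastforce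
    ultimately show ?thesis using J by (fastforce simp: P_def bdry_points_eq[OF I])
  qed
  have "?a \<notin> ?U"
  proof
    assume "?a \<in> ?U"
    then obtain L where L: "L \<in> I" "Inf L < ?a" "?a = middle L" by auto
    then show False using interval_unique[OF I L(1) J, of ?a] sd[OF L(1)] sd[OF J] by auto
  qed
  moreover have "finite ?U" using dyadic_partitionsD(1)[OF I] by simp
  ultimately have "card (P ?a) = Suc (card ?U)" unfolding Pa by (rule card_insert_disjoint[rotated])
  then have oda: "odd (card (P ?a))" using even_card_bdry_points[OF I, of "{L\<in>I. Inf L < ?a}"] by simp
  define D where "D = (P ?a - P t) \<union> (P t - P ?a)"
  have "odd (card D)" using even_card_sym_diff[OF fin fin] evt oda unfolding D_def by blast
  moreover have "even (card D)"
  proof -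
    have memD: "u \<in> D \<longleftrightarrow> (u \<le> ?a) \<noteq> (u \<le> t)" if "u \<in> bdry_points I" for u
      using that by (auto simp: D_def P_def)
    \<comment> \<open>A string with just one end in \<open>D\<close> would separate the two positions.\<close>
    have sat: "s \<subseteq> D" if s: "s \<in> x" "s \<inter> D \<noteq> {}" for s
    proof -
      obtain p q where pq: "s = {p, q}" "p < q" "p \<in> bdry_points I" "q \<in> bdry_points I"
        using pairing_set[OF x s(1)] .
      then have "p \<le> ?a \<and> ?a < q \<longleftrightarrow> p \<le> t \<and> t < q" using link s(1) by (auto simp: linked_def)
      then have "p \<in> D \<longleftrightarrow> q \<in> D" using memD pq by auto
      then show ?thesis using s pq by auto
    qed
    have part: "partition_on (bdry_points I) x" using x by (simp add: pairings_def)
    have Deq: "D = \<Union>{s\<in>x. s \<subseteq> D}"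
    proof
      show "D \<subseteq> \<Union>{s\<in>x. s \<subseteq> D}"
      proof
        fix u assume u: "u \<in> D"
        then have "u \<in> \<Union>x" using partition_onD1[OF part] by (auto simp: D_def P_def)
        then show "u \<in> \<Union>{s\<in>x. s \<subseteq> D}" using u sat by blast
      qed
    qed auto
    have "even (card (\<Union>{s\<in>x. s \<subseteq> D}))"
    proof (rule dvd_partition)
      show "finite (\<Union>{s\<in>x. s \<subseteq> D})" using Deq fin unfolding D_def by (metis finite_Diff finite_Un)
      show "\<forall>c\<in>{s\<in>x. s \<subseteq> D}. 2 dvd card c" using x by (auto simp: pairings_def)
      show "\<forall>c1\<in>{s\<in>x. s \<subseteq> D}. \<forall>c2\<in>{s\<in>x. s \<subseteq> D}. c1 \<noteq> c2 \<longrightarrow> c1 \<inter> c2 = {}"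
        using partition_onD2[OF part] by (auto simp: disjoint_def)
    qed
    then show ?thesis using Deq by simp
  qed
  ultimately show False by simp
qed


section \<open>Components of the shaded sphere\<close>

text \<open>A cell lifted to the upper (\<open>e = 1\<close>) or lower (\<open>e = - 1\<close>) hemisphere, including its part on the
equator.\<close>

definition cap :: "real \<Rightarrow> real set set \<Rightarrow> real \<Rightarrow> (complex \<times> real) set" where
  "cap e x a = {(z, h). (z, h) \<in> sphere 0 1 \<and> 0 \<le> e * h \<and> z \<in> cell x a}"

lemma connected_cap:
  assumes "\<bar>e\<bar> = 1"
  shows "connected (cap e x a)"
proof -
  have "cap e x a = (\<lambda>z. (z, e * sqrt (1 - (cmod z)\<^sup>2))) ` cell x a"
  proof (intro equalityI subsetI)
    fix w assume "w \<in> cap e x a"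
    then obtain z h where w: "w = (z, h)" "norm (z, h) = 1" "0 \<le> e * h" "z \<in> cell x a"
      by (auto simp: cap_def)
    have "(cmod z)\<^sup>2 + h\<^sup>2 = 1" using w(2) by (simp add: norm_Pair real_sqrt_eq_1_iff)
    then have "sqrt (1 - (cmod z)\<^sup>2) = \<bar>h\<bar>" by (simp add: algebra_simps flip: real_sqrt_abs)
    then have "h = e * sqrt (1 - (cmod z)\<^sup>2)" using assms w(3) by (auto simp: abs_if split: if_splits)
    then show "w \<in> (\<lambda>z. (z, e * sqrt (1 - (cmod z)\<^sup>2))) ` cell x a" using w by blast
  next
    fix w assume "w \<in> (\<lambda>z. (z, e * sqrt (1 - (cmod z)\<^sup>2))) ` cell x a"
    then obtain z where z: "w = (z, e * sqrt (1 - (cmod z)\<^sup>2))" "z \<in> cell x a" by auto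
    have le: "(cmod z)\<^sup>2 \<le> 1" using z(2) by (simp add: cell_def abs_square_le_1)
    have "e * e = 1" using assms by (metis abs_mult_self mult_1)
    then have "0 \<le> e * (e * sqrt (1 - (cmod z)\<^sup>2))" using le by (simp flip: mult.assoc)
    moreover have "norm (z, e * sqrt (1 - (cmod z)\<^sup>2)) = 1"
      using le assms by (simp add: norm_Pair power_mult_distrib power2_eq_1_iff abs_if split: if_splits)
    ultimately show "w \<in> cap e x a" using z by (simp add: cap_def)
  qed
  moreover have "connected \<dots>"
    by (intro connected_continuous_image convex_connected convex_cell continuous_intros)
  ultimately show ?thesis by simp
qed

lemma shaded_sphere_eq:
  assumes "I \<in> dyadic_partitions" "x \<in> pairings I" "y \<in> pairings I"
  shows "shaded_sphere I x y = (\<Union>J\<in>I. cap 1 x (Inf J) \<union> cap (- 1) y (Inf J))"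
  using assms by (auto simp: shaded_sphere_def shaded_disc_eq cap_def)

text \<open>The closed counterpart of a cap. On the shaded sphere the two agree, which shows that caps are
relatively closed.\<close>

definition closed_cap :: "real \<Rightarrow> real set set \<Rightarrow> real \<Rightarrow> (complex \<times> real) set" where
  "closed_cap e x a = {w. 0 \<le> e * snd w \<and> (\<forall>p q. p < q \<and> {p, q} \<in> x \<longrightarrow>
     (if p \<le> a \<and> a < q then 0 \<le> chord_side p q (fst w) else chord_side p q (fst w) \<le> 0))}"

lemma closed_closed_cap: "closed (closed_cap e x a)"
proof -
  have "closed {w. p < q \<and> {p, q} \<in> x \<longrightarrow>
      (if p \<le> a \<and> a < q then 0 \<le> chord_side p q (fst w) else chord_side p q (fst w) \<le> 0)}" for p q
    unfolding chord_side_def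
    by (cases "p < q \<and> {p, q} \<in> x"; cases "p \<le> a \<and> a < q")
      (auto intro!: closed_Collect_le continuous_intros)
  moreover have "closed {w. 0 \<le> e * snd w}"
    by (intro closed_Collect_le continuous_intros)
  ultimately show ?thesis
    unfolding closed_cap_def by (intro closed_Collect_conj closed_Collect_all)
qed

lemma shaded_sphere_equator:
  assumes I: "I \<in> dyadic_partitions" and xy: "x \<in> pairings I" "y \<in> pairings I"
    and z: "cmod z = 1" "z \<in> cell x a \<or> z \<in> cell y b"
  obtains t where "t \<in> circle" "t \<notin> bdry_points I" "z = circle_point t"
proof -
  obtain t where t: "t \<in> circle" "z = circle_point t" using circle_point_exists[OF z(1)] .
  then show thesis using that circle_point_bdry_not_in_cell[OF I] xy z(2) by blast
qed

text \<open>Passing to weak inequalities only adds points on strings. In the open hemisphere these are not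
shaded, and on the equator they are boundary points, which lie on strings of both discs.\<close>

lemma cap_closed_in_shaded_sphere:
  assumes I: "I \<in> dyadic_partitions" and xy: "x \<in> pairings I" "y \<in> pairings I" and J: "J \<in> I"
    and ex: "e = 1 \<and> u = x \<or> e = - 1 \<and> u = y"
  shows "cap e u (Inf J) = shaded_sphere I x y \<inter> closed_cap e u (Inf J)"
proof (intro equalityI subsetI)
  fix w assume w: "w \<in> cap e u (Inf J)"
  then have "w \<in> shaded_sphere I x y" using shaded_sphere_eq[OF I xy] J ex by auto
  moreover have "w \<in> closed_cap e u (Inf J)"
  proof -
    obtain z h where zh: "w = (z, h)" "0 \<le> e * h" "z \<in> cell u (Inf J)" using w by (auto simp: cap_def)
    have "if p \<le> Inf J \<and> Inf J < q then 0 \<le> chord_side p q z else chord_side p q z \<le> 0"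
      if "p < q" "{p, q} \<in> u" for p q
    proof -
      have "if p \<le> Inf J \<and> Inf J < q then 0 < chord_side p q z else chord_side p q z < 0"
        using zh(3) that by (simp add: cell_def)
      then show ?thesis by (auto split: if_splits)
    qed
    then show ?thesis using zh by (simp add: closed_cap_def)
  qed
  ultimately show "w \<in> shaded_sphere I x y \<inter> closed_cap e u (Inf J)" by simp
next
  fix w assume w: "w \<in> shaded_sphere I x y \<inter> closed_cap e u (Inf J)"
  obtain z h where zh: "w = (z, h)" by (cases w)
  have eh: "0 \<le> e * h" using w by (auto simp: closed_cap_def zh)
  obtain K where K: "K \<in> I" "(z, h) \<in> cap 1 x (Inf K) \<or> (z, h) \<in> cap (- 1) y (Inf K)"
    using w shaded_sphere_eq[OF I xy] zh by auto
  have sph: "(z, h) \<in> sphere 0 1" using K by (auto simp: cap_def)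
  have nz: "chord_side p q z \<noteq> 0" if pq: "p < q" "{p, q} \<in> u" for p q
  proof (cases "h = 0")
    case False
    then have "z \<in> cell u (Inf K)" using K(2) eh ex by (auto simp: cap_def)
    then show ?thesis using cell_side_nonzero pq by blast
  next
    case True
    then have "cmod z = 1" using sph by (simp add: norm_Pair)
    moreover have "z \<in> cell x (Inf K) \<or> z \<in> cell y (Inf K)" using K by (auto simp: cap_def)
    ultimately obtain t where t: "t \<in> circle" "t \<notin> bdry_points I" "z = circle_point t"
      using shaded_sphere_equator[OF I xy] by blast
    have u: "u \<in> pairings I" using ex xy by auto
    have b: "p \<in> bdry_points I" "q \<in> bdry_points I" using pairing_pair[OF u pq(2)] by auto
    then have "p \<in> circle" "q \<in> circle" using bdry_points_subset[OF I] by auto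
    then show ?thesis using chord_side_circle_point_iff(3)[of p q t] t pq(1) b by auto
  qed
  have "if p \<le> Inf J \<and> Inf J < q then 0 < chord_side p q z else chord_side p q z < 0"
    if pq: "p < q" "{p, q} \<in> u" for p q
  proof -
    have "if p \<le> Inf J \<and> Inf J < q then 0 \<le> chord_side p q z else chord_side p q z \<le> 0"
      using w pq unfolding closed_cap_def zh
      by (simp only: Int_iff mem_Collect_eq fst_conv) blast
    then show ?thesis using nz[OF pq] by (auto split: if_splits)
  qed
  moreover have "z \<in> cball 0 1" using K by (auto simp: cap_def cell_def)
  ultimately have "z \<in> cell u (Inf J)" by (auto simp: cell_def)
  then show "w \<in> cap e u (Inf J)" using sph eh by (simp add: cap_def zh)
qed

text \<open>The configuration \<open>s\<close> is constant on each shaded region of \<open>x\<close>; only its values on the set \<open>A\<close> of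
left endpoints matter.\<close>

definition spin_compat :: "real set \<Rightarrow> real set set \<Rightarrow> (real \<Rightarrow> bool) \<Rightarrow> bool" where
  "spin_compat A x s \<longleftrightarrow> (\<forall>a\<in>A. \<forall>b\<in>A. linked x a b \<longrightarrow> s a = s b)"

text \<open>Caps of different hemispheres meet on the equator only, in a point that belongs to a shaded arc by
\<open>unshaded_arc\<close>; this arc is linked to both caps.\<close>

lemma caps_meet:
  assumes I: "I \<in> dyadic_partitions" and xy: "x \<in> pairings I" "y \<in> pairings I"
    and comp: "spin_compat (Inf ` I) x s" "spin_compat (Inf ` I) y s" and JK: "J \<in> I" "K \<in> I"
    and w: "w \<in> cap 1 x (Inf J) \<union> cap (- 1) y (Inf J)" "w \<in> cap 1 x (Inf K) \<union> cap (- 1) y (Inf K)"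
  shows "s (Inf J) = s (Inf K)"
proof -
  have mixed: "s (Inf J) = s (Inf K)"
    if JK: "J \<in> I" "K \<in> I" and w: "w \<in> cap 1 x (Inf J)" "w \<in> cap (- 1) y (Inf K)" for J K
  proof -
    obtain z h where zh: "w = (z, h)" by (cases w)
    have z: "z \<in> cell x (Inf J)" "z \<in> cell y (Inf K)" and h: "h = 0" "norm (z, h) = 1"
      using w by (auto simp: zh cap_def)
    have "cmod z = 1" using h by (simp add: norm_Pair)
    then obtain t where t: "t \<in> circle" "t \<notin> bdry_points I" "z = circle_point t"
      using shaded_sphere_equator[OF I xy] z by blast
    have link: "linked x (Inf J) t" "linked y (Inf K) t"
      using z circle_point_in_cell_iff[OF I _ t(1,2)] xy by (auto simp: t(3))
    obtain L where L: "L \<in> I" "Inf L \<le> t" "t < Sup L" using circle_in_interval[OF I t(1)] .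
    have "t \<noteq> middle L" using t(2) L(1) bdry_mem(2)[OF I] by auto
    then have "t < middle L" using unshaded_arc[OF I JK(1) L(1) xy(1) _ L(3)] link(1) by force
    then have "linked x (Inf L) t" "linked y (Inf L) t"
      using linked_in_lower_half[OF I L(1) _ L(2)] xy by auto
    then have "linked x (Inf J) (Inf L)" "linked y (Inf K) (Inf L)"
      using link linked_sym linked_trans by blast+
    then show ?thesis using comp JK L(1) by (auto simp: spin_compat_def)
  qed
  have same: "s (Inf J) = s (Inf K)" if "w \<in> cap e u (Inf J)" "w \<in> cap e u (Inf K)" "spin_compat (Inf ` I) u s" for e u
  proof -
    have "linked u (Inf J) (Inf K)" using cell_disjoint that(1,2) by (auto simp: cap_def)
    then show ?thesis using that(3) JK unfolding spin_compat_def by blast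
  qed
  show ?thesis using w same comp mixed[OF JK] mixed[OF JK(2,1)] by blast
qed

lemma card_fibre_colourings:
  fixes f :: "'a \<Rightarrow> 'b"
  assumes "finite A"
  shows "card {s \<in> A \<rightarrow>\<^sub>E (UNIV :: bool set). \<forall>a\<in>A. \<forall>b\<in>A. f a = f b \<longrightarrow> s a = s b} = 2 ^ card (f ` A)"
proof -
  let ?C = "{s \<in> A \<rightarrow>\<^sub>E (UNIV :: bool set). \<forall>a\<in>A. \<forall>b\<in>A. f a = f b \<longrightarrow> s a = s b}"
  have "bij_betw (\<lambda>r. restrict (r \<circ> f) A) (f ` A \<rightarrow>\<^sub>E (UNIV :: bool set)) ?C"
  proof (rule bij_betw_byWitness[where f' = "\<lambda>s. restrict (s \<circ> inv_into A f) (f ` A)"])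
    show "\<forall>r\<in>f ` A \<rightarrow>\<^sub>E (UNIV :: bool set). restrict (restrict (r \<circ> f) A \<circ> inv_into A f) (f ` A) = r"
    proof
      fix r assume r: "r \<in> f ` A \<rightarrow>\<^sub>E (UNIV :: bool set)"
      show "restrict (restrict (r \<circ> f) A \<circ> inv_into A f) (f ` A) = r"
      proof
        fix b
        show "restrict (restrict (r \<circ> f) A \<circ> inv_into A f) (f ` A) b = r b"
        proof (cases "b \<in> f ` A")
          case True
          then have "inv_into A f b \<in> A" "f (inv_into A f b) = b" by (rule inv_into_into, rule f_inv_into_f)
          then show ?thesis using True by simp
        next
          case False
          then show ?thesis using PiE_arb[OF r False] by simp
        qed
      qed
    qed
    show "\<forall>s\<in>?C. restrict (restrict (s \<circ> inv_into A f) (f ` A) \<circ> f) A = s"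
    proof
      fix s assume s: "s \<in> ?C"
      show "restrict (restrict (s \<circ> inv_into A f) (f ` A) \<circ> f) A = s"
      proof
        fix a
        show "restrict (restrict (s \<circ> inv_into A f) (f ` A) \<circ> f) A a = s a"
        proof (cases "a \<in> A")
          case True
          then have i: "inv_into A f (f a) \<in> A" "f (inv_into A f (f a)) = f a"
            by (simp_all add: inv_into_into f_inv_into_f)
          have "\<forall>a\<in>A. \<forall>b\<in>A. f a = f b \<longrightarrow> s a = s b"
            using s unfolding mem_Collect_eq by (rule conjunct2)
          then have "s (inv_into A f (f a)) = s a" using i True by blast
          then show ?thesis using True by simp
        next
          case False
          have "s \<in> A \<rightarrow>\<^sub>E UNIV" using s unfolding mem_Collect_eq by (rule conjunct1)
          then have "s a = undefined" using False by (rule PiE_arb)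
          then show ?thesis using False by simp
        qed
      qed
    qed
    show "(\<lambda>r. restrict (r \<circ> f) A) ` (f ` A \<rightarrow>\<^sub>E (UNIV :: bool set)) \<subseteq> ?C"
    proof (rule image_subsetI, unfold mem_Collect_eq, intro conjI ballI impI)
      fix r :: "'b \<Rightarrow> bool" and a b assume "a \<in> A" "b \<in> A" "f a = f b"
      then show "restrict (r \<circ> f) A a = restrict (r \<circ> f) A b" by simp
    qed simp
    show "(\<lambda>s. restrict (s \<circ> inv_into A f) (f ` A)) ` ?C \<subseteq> f ` A \<rightarrow>\<^sub>E (UNIV :: bool set)"
      by (rule image_subsetI) (simp add: PiE_def)
  qed
  then have "card ?C = card (f ` A \<rightarrow>\<^sub>E (UNIV :: bool set))" by (simp add: bij_betw_same_card)
  then show ?thesis using assms by (simp add: card_PiE)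
qed

text \<open>Colourings of the components are the same as colourings of the shaded arcs that are compatible with
both diagrams. The caps of linked arcs coincide, and the upper and the lower cap of an arc meet, so
a colouring of components is compatible on arcs. Conversely a compatible colouring divides the sphere
into two disjoint closed sets, so that it is constant on components.\<close>

lemma card_components_shaded_sphere:
  assumes I: "I \<in> dyadic_partitions" and xy: "x \<in> pairings I" "y \<in> pairings I"
  shows "2 ^ card (components (shaded_sphere I x y)) =
    card {s \<in> Inf ` I \<rightarrow>\<^sub>E UNIV. spin_compat (Inf ` I) x s \<and> spin_compat (Inf ` I) y s}"
proof -
  let ?S = "shaded_sphere I x y"
  define piece where "piece J = cap 1 x (Inf J) \<union> cap (- 1) y (Inf J)" for J
  have Seq: "?S = (\<Union>J\<in>I. piece J)" using shaded_sphere_eq[OF I xy] by (simp add: piece_def)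
  \<comment> \<open>A point on the shaded arc that starts at \<open>a\<close>.\<close>
  define base where "base a = (circle_point ((a + middle (the_inv_into I Inf a)) / 2), 0 :: real)" for a
  have base: "base (Inf J) \<in> cap 1 x (Inf J)" "base (Inf J) \<in> cap (- 1) y (Inf J)" if J: "J \<in> I" for J
  proof -
    let ?t = "(Inf J + middle J) / 2"
    have sd: "Inf J < middle J" "middle J < Sup J" using middle_between dyadic_partitionsD(3)[OF I J] by auto
    then have t: "?t \<in> circle" "?t \<notin> bdry_points I" "Inf J \<le> ?t" "?t < middle J"
      using open_arc_not_bdry[OF I J, of ?t] by auto
    have "base (Inf J) = (circle_point ?t, 0)"
      using the_inv_into_f_f[OF Inf_inj_on[OF I] J] by (simp add: base_def)
    moreover have "circle_point ?t \<in> cell u (Inf J)" if "u \<in> pairings I" for u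
      using circle_point_in_cell_iff[OF I that t(1,2)] linked_in_lower_half[OF I J that t(3,4)] by blast
    ultimately show "base (Inf J) \<in> cap 1 x (Inf J)" "base (Inf J) \<in> cap (- 1) y (Inf J)"
      using xy by (auto simp: cap_def norm_Pair)
  qed
  define comp where "comp a = connected_component_set ?S (base a)" for a
  have piece_conn: "connected (piece J)" if "J \<in> I" for J
    unfolding piece_def using base[OF that] by (intro connected_Un connected_cap) auto
  have base_piece: "base (Inf J) \<in> piece J" if "J \<in> I" for J using base[OF that] by (auto simp: piece_def)
  have pieceS: "piece J \<subseteq> ?S" if "J \<in> I" for J using that Seq by auto
  have comps: "components ?S = comp ` Inf ` I"
  proof
    show "comp ` Inf ` I \<subseteq> components ?S"
      unfolding comp_def using base_piece pieceS by (auto simp: components_def)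
    show "components ?S \<subseteq> comp ` Inf ` I"
    proof
      fix C assume "C \<in> components ?S"
      then obtain w where w: "w \<in> ?S" "C = connected_component_set ?S w" by (auto simp: components_def)
      then obtain J where J: "J \<in> I" "w \<in> piece J" using Seq by auto
      have "connected_component ?S w (base (Inf J))"
        using piece_conn[OF J(1)] pieceS[OF J(1)] J(2) base_piece[OF J(1)]
        unfolding connected_component_def by blast
      then have "C = comp (Inf J)" unfolding w(2) comp_def by (metis connected_component_eq mem_Collect_eq)
      then show "C \<in> comp ` Inf ` I" using J by blast
    qed
  qed
  have linked_comp: "comp (Inf J) = comp (Inf K)"
    if JK: "J \<in> I" "K \<in> I" and u: "u = x \<and> e = 1 \<or> u = y \<and> e = - 1" and link: "linked u (Inf J) (Inf K)" for J K u and e :: real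
  proof -
    have "cap e u (Inf J) = cap e u (Inf K)" using cell_linked[OF link] by (simp add: cap_def)
    then have "base (Inf J) \<in> cap e u (Inf J)" "base (Inf K) \<in> cap e u (Inf J)" "cap e u (Inf J) \<subseteq> ?S"
      "connected (cap e u (Inf J))"
      using base[OF JK(1)] base[OF JK(2)] u pieceS[OF JK(1)] connected_cap[of e u "Inf J"]
      by (auto simp: piece_def)
    then have "connected_component ?S (base (Inf J)) (base (Inf K))"
      unfolding connected_component_def by blast
    then show ?thesis unfolding comp_def by (metis connected_component_eq mem_Collect_eq)
  qed
  have comp_colour: "s (Inf J) = s (Inf K)"
    if s: "spin_compat (Inf ` I) x s" "spin_compat (Inf ` I) y s" and JK: "J \<in> I" "K \<in> I" "comp (Inf J) = comp (Inf K)" for s J K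
  proof (rule ccontr)
    assume neq: "s (Inf J) \<noteq> s (Inf K)"
    \<comment> \<open>On the sphere these closed sets cut out the parts of colour \<open>b\<close>.\<close>
    define W where "W b = (\<Union>L\<in>{L\<in>I. s (Inf L) = b}. closed_cap 1 x (Inf L) \<union> closed_cap (- 1) y (Inf L))" for b
    have cl: "closed (W b)" for b
      unfolding W_def using dyadic_partitionsD(1)[OF I]
      by (intro closed_UN closed_Un closed_closed_cap ballI) auto
    have SW: "?S \<inter> W b = (\<Union>L\<in>{L\<in>I. s (Inf L) = b}. piece L)" for b
    proof -
      have "piece L = ?S \<inter> (closed_cap 1 x (Inf L) \<union> closed_cap (- 1) y (Inf L))" if "L \<in> I" for L
        using cap_closed_in_shaded_sphere[OF I xy that] unfolding piece_def by (simp add: Int_Un_distrib)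
      then show ?thesis unfolding W_def by auto
    qed
    have "base (Inf K) \<in> comp (Inf K)"
      unfolding comp_def using base_piece[OF JK(2)] pieceS[OF JK(2)] by auto
    then have "base (Inf K) \<in> comp (Inf J)" unfolding JK(3) .
    then have "connected_component ?S (base (Inf J)) (base (Inf K))" by (simp add: comp_def)
    then obtain C where C: "connected C" "C \<subseteq> ?S" "base (Inf J) \<in> C" "base (Inf K) \<in> C"
      unfolding connected_component_def by blast
    have "base (Inf L) \<in> W (s (Inf L))" if "L \<in> I" for L using base_piece[OF that] SW that by blast
    then have ne: "W True \<inter> C \<noteq> {}" "W False \<inter> C \<noteq> {}" using C neq JK by (metis (full_types) IntI empty_iff)+
    have cover: "C \<subseteq> W True \<union> W False"
    proof
      fix w assume "w \<in> C"
      then obtain L where "L \<in> I" "w \<in> piece L" using C(2) Seq by auto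
      then show "w \<in> W True \<union> W False" using SW[of "s (Inf L)"] by (cases "s (Inf L)") auto
    qed
    have disj: "W True \<inter> W False \<inter> C = {}"
    proof (rule ccontr)
      assume "W True \<inter> W False \<inter> C \<noteq> {}"
      then obtain w where "w \<in> ?S \<inter> W True" "w \<in> ?S \<inter> W False" using C(2) by auto
      then obtain L M where "L \<in> I" "s (Inf L)" "w \<in> piece L" "M \<in> I" "\<not> s (Inf M)" "w \<in> piece M"
        unfolding SW by auto
      then show False using caps_meet[OF I xy s, of L M w] unfolding piece_def by auto
    qed
    show False using connected_closedD[OF C(1) disj cover cl cl] ne by blast
  qed
  have "(spin_compat (Inf ` I) x s \<and> spin_compat (Inf ` I) y s) \<longleftrightarrow>
      (\<forall>a\<in>Inf ` I. \<forall>b\<in>Inf ` I. comp a = comp b \<longrightarrow> s a = s b)" for s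
  proof
    assume "spin_compat (Inf ` I) x s \<and> spin_compat (Inf ` I) y s"
    then show "\<forall>a\<in>Inf ` I. \<forall>b\<in>Inf ` I. comp a = comp b \<longrightarrow> s a = s b" using comp_colour by blast
  next
    assume *: "\<forall>a\<in>Inf ` I. \<forall>b\<in>Inf ` I. comp a = comp b \<longrightarrow> s a = s b"
    show "spin_compat (Inf ` I) x s \<and> spin_compat (Inf ` I) y s"
      unfolding spin_compat_def
    proof (intro conjI ballI impI; elim imageE)
      fix a b J K assume J: "linked x a b" "a = Inf J" "b = Inf K" "J \<in> I" "K \<in> I"
      then have "comp a = comp b" using linked_comp[of J K x 1] by simp
      then show "s a = s b" using * J(2-5) by blast
    next
      fix a b J K assume J: "linked y a b" "a = Inf J" "b = Inf K" "J \<in> I" "K \<in> I"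
      then have "comp a = comp b" using linked_comp[of J K y "- 1"] by simp
      then show "s a = s b" using * J(2-5) by blast
    qed
  qed
  then have colourings: "{s \<in> Inf ` I \<rightarrow>\<^sub>E UNIV. spin_compat (Inf ` I) x s \<and> spin_compat (Inf ` I) y s} =
      {s \<in> Inf ` I \<rightarrow>\<^sub>E UNIV. \<forall>a\<in>Inf ` I. \<forall>b\<in>Inf ` I. comp a = comp b \<longrightarrow> s a = s b}"
    by (simp only:)
  have "finite (Inf ` I)" using dyadic_partitionsD(1)[OF I] by (rule finite_imageI)
  from card_fibre_colourings[OF this, of comp] show ?thesis
    unfolding comps colourings by (rule sym)
qed

section \<open>The form as a sum over spin configurations\<close>

text \<open>The value at \<open>s\<close> of the function of spin configurations that represents \<open>v\<close>.\<close>

definition spin_coeff :: "real set set \<Rightarrow> tl_vector \<Rightarrow> (real \<Rightarrow> bool) \<Rightarrow> complex" where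
  "spin_coeff I v s = (\<Sum>x\<in>pairings I. v x * of_bool (spin_compat (Inf ` I) x s))"

lemma cnj_of_bool: "cnj (of_bool b) = of_bool b"
  by (cases b) simp_all

lemma chrom_form_eq_spin_sum:
  assumes I: "I \<in> dyadic_partitions"
  shows "chrom_form 2 I v w =
    (\<Sum>s\<in>Inf ` I \<rightarrow>\<^sub>E UNIV. spin_coeff I v s * cnj (spin_coeff I w s))"
proof -
  let ?E = "Inf ` I \<rightarrow>\<^sub>E (UNIV :: bool set)"
  have finE: "finite ?E" using dyadic_partitionsD(1)[OF I] by (intro finite_PiE) auto
  have "complex_of_real 2 ^ card (components (shaded_sphere I x y)) =
      (\<Sum>s\<in>?E. of_bool (spin_compat (Inf ` I) x s) * of_bool (spin_compat (Inf ` I) y s))"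
    if "x \<in> pairings I" "y \<in> pairings I" for x y
  proof -
    have "complex_of_real 2 ^ card (components (shaded_sphere I x y)) =
        of_nat (2 ^ card (components (shaded_sphere I x y)))" by simp
    also have "\<dots> = of_nat (card {s \<in> ?E. spin_compat (Inf ` I) x s \<and> spin_compat (Inf ` I) y s})"
      using card_components_shaded_sphere[OF I that] by simp
    also have "\<dots> = (\<Sum>s\<in>?E. of_bool (spin_compat (Inf ` I) x s \<and> spin_compat (Inf ` I) y s))"
      using finE by (simp add: of_bool_def sum.If_cases Int_def)
    finally show ?thesis by (simp add: of_bool_conj)
  qed
  then have "chrom_form 2 I v w = (\<Sum>x\<in>pairings I. \<Sum>y\<in>pairings I. \<Sum>s\<in>?E.
      (v x * of_bool (spin_compat (Inf ` I) x s)) * (cnj (w y) * of_bool (spin_compat (Inf ` I) y s)))"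
    unfolding chrom_form_def by (intro sum.cong refl) (simp add: sum_distrib_left mult_ac)
  also have "\<dots> = (\<Sum>s\<in>?E. \<Sum>x\<in>pairings I. \<Sum>y\<in>pairings I.
      (v x * of_bool (spin_compat (Inf ` I) x s)) * (cnj (w y) * of_bool (spin_compat (Inf ` I) y s)))"
    by (simp only: sum.swap[of _ ?E])
  also have "\<dots> = (\<Sum>s\<in>?E. spin_coeff I v s * cnj (spin_coeff I w s))"
    by (simp add: spin_coeff_def sum_product cnj_of_bool)
  finally show ?thesis .
qed

section \<open>Square-summable functions\<close>

abbreviation ell2_vecs :: "'x set \<Rightarrow> ('x \<Rightarrow> complex) set" where
  "ell2_vecs X \<equiv> vecs (ell2 X)"

definition ell2_norm :: "'x set \<Rightarrow> ('x \<Rightarrow> complex) \<Rightarrow> real" where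
  "ell2_norm X f = sqrt (\<Sum>\<^sub>\<infinity>x\<in>X. (cmod (f x))\<^sup>2)"

lemma ell2_vecs_iff:
  "f \<in> ell2_vecs X \<longleftrightarrow> (\<forall>x. x \<notin> X \<longrightarrow> f x = 0) \<and> (\<lambda>x. (cmod (f x))\<^sup>2) summable_on X"
  by (simp add: ell2_def)

lemma ell2_norm_nonneg [simp]: "0 \<le> ell2_norm X f"
  by (simp add: ell2_norm_def infsum_nonneg)

lemma L2_set_le_ell2_norm:
  assumes "f \<in> ell2_vecs X" "finite F" "F \<subseteq> X"
  shows "L2_set (\<lambda>x. cmod (f x)) F \<le> ell2_norm X f"
  using assms by (auto simp: L2_set_def ell2_norm_def ell2_vecs_iff intro!: finite_sum_le_infsum)

text \<open>Square-summability and a norm bound follow together from a uniform bound on finite subsets; the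
inequalities below are all reduced to finite sums in this way.\<close>

lemma ell2_vecsI:
  assumes "\<And>x. x \<notin> X \<Longrightarrow> f x = 0"
    and bd: "\<And>F. finite F \<Longrightarrow> F \<subseteq> X \<Longrightarrow> L2_set (\<lambda>x. cmod (f x)) F \<le> c"
  shows "f \<in> ell2_vecs X" "ell2_norm X f \<le> c"
proof -
  have c: "0 \<le> c" using bd[of "{}"] by simp
  have sq: "(\<Sum>x\<in>F. (cmod (f x))\<^sup>2) \<le> c\<^sup>2" if "finite F" "F \<subseteq> X" for F
    using bd[OF that] by (simp add: L2_set_def real_le_lsqrt sqrt_le_D)
  then have sm: "(\<lambda>x. (cmod (f x))\<^sup>2) summable_on X"
    by (intro nonneg_bdd_above_summable_on bdd_aboveI2[where M = "c\<^sup>2"]) auto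
  then show "f \<in> ell2_vecs X" using assms(1) by (simp add: ell2_vecs_iff)
  have "(\<Sum>\<^sub>\<infinity>x\<in>X. (cmod (f x))\<^sup>2) \<le> c\<^sup>2" using sm sq by (intro infsum_le_finite_sums) auto
  then show "ell2_norm X f \<le> c" unfolding ell2_norm_def using c by (intro real_le_lsqrt) auto
qed

lemma
  assumes f: "f \<in> ell2_vecs X" and g: "g \<in> ell2_vecs X"
  shows ell2_add: "(\<lambda>x. f x + g x) \<in> ell2_vecs X"
    and ell2_norm_triangle: "ell2_norm X (\<lambda>x. f x + g x) \<le> ell2_norm X f + ell2_norm X g"
proof -
  have z: "f x + g x = 0" if "x \<notin> X" for x using f g that by (simp add: ell2_vecs_iff)
  have "L2_set (\<lambda>x. cmod (f x + g x)) F \<le> ell2_norm X f + ell2_norm X g" if F: "finite F" "F \<subseteq> X" for F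
  proof -
    have "L2_set (\<lambda>x. cmod (f x + g x)) F \<le> L2_set (\<lambda>x. cmod (f x) + cmod (g x)) F"
      by (intro L2_set_mono norm_triangle_ineq) auto
    also have "\<dots> \<le> L2_set (\<lambda>x. cmod (f x)) F + L2_set (\<lambda>x. cmod (g x)) F"
      by (rule L2_set_triangle_ineq)
    finally show ?thesis using L2_set_le_ell2_norm[OF f F] L2_set_le_ell2_norm[OF g F] by linarith
  qed
  then show "(\<lambda>x. f x + g x) \<in> ell2_vecs X" "ell2_norm X (\<lambda>x. f x + g x) \<le> ell2_norm X f + ell2_norm X g"
    using ell2_vecsI[of X "\<lambda>x. f x + g x"] z by blast+
qed

lemma
  assumes f: "f \<in> ell2_vecs X"
  shows ell2_scale: "(\<lambda>x. c * f x) \<in> ell2_vecs X"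
    and ell2_norm_scale: "ell2_norm X (\<lambda>x. c * f x) \<le> cmod c * ell2_norm X f"
proof -
  have z: "c * f x = 0" if "x \<notin> X" for x using f that by (simp add: ell2_vecs_iff)
  have "L2_set (\<lambda>x. cmod (c * f x)) F \<le> cmod c * ell2_norm X f" if F: "finite F" "F \<subseteq> X" for F
    using L2_set_le_ell2_norm[OF f F]
    by (simp add: norm_mult mult_left_mono flip: L2_set_right_distrib)
  then show "(\<lambda>x. c * f x) \<in> ell2_vecs X" "ell2_norm X (\<lambda>x. c * f x) \<le> cmod c * ell2_norm X f"
    using ell2_vecsI[of X "\<lambda>x. c * f x"] z by blast+
qed

lemma ell2_diff: "f \<in> ell2_vecs X \<Longrightarrow> g \<in> ell2_vecs X \<Longrightarrow> (\<lambda>x. f x - g x) \<in> ell2_vecs X"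
  using ell2_add[OF _ ell2_scale[of g X "-1"]] by simp

lemma ell2_norm_minus: "ell2_norm X (\<lambda>x. f x - g x) = ell2_norm X (\<lambda>x. g x - f x)"
  by (simp add: ell2_norm_def norm_minus_commute)

lemma ell2_norm_triangle_diff:
  assumes "f \<in> ell2_vecs X" "g \<in> ell2_vecs X" "h \<in> ell2_vecs X"
  shows "ell2_norm X (\<lambda>x. f x - h x) \<le> ell2_norm X (\<lambda>x. f x - g x) + ell2_norm X (\<lambda>x. g x - h x)"
  using ell2_norm_triangle[OF ell2_diff[OF assms(1,2)] ell2_diff[OF assms(2,3)]] by simp

lemma cmod_le_ell2_norm:
  assumes "f \<in> ell2_vecs X" "x \<in> X"
  shows "cmod (f x) \<le> ell2_norm X f"
  using L2_set_le_ell2_norm[OF assms(1), of "{x}"] assms(2) by simp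

lemma ell2_norm_eq_0D:
  assumes "f \<in> ell2_vecs X" "g \<in> ell2_vecs X" "ell2_norm X (\<lambda>x. f x - g x) = 0"
  shows "f = g"
proof
  fix x
  show "f x = g x"
    using cmod_le_ell2_norm[OF ell2_diff[OF assms(1,2)], of x] assms
    by (cases "x \<in> X") (auto simp: ell2_vecs_iff)
qed

lemma
  assumes f: "f \<in> ell2_vecs X" and g: "g \<in> ell2_vecs X"
  shows ell2_inner_summable: "(\<lambda>x. f x * cnj (g x)) summable_on X"
    and ell2_Cauchy_Schwarz: "cmod (\<Sum>\<^sub>\<infinity>x\<in>X. f x * cnj (g x)) \<le> ell2_norm X f * ell2_norm X g"
proof -
  have bd: "(\<Sum>x\<in>F. cmod (f x * cnj (g x))) \<le> ell2_norm X f * ell2_norm X g" if F: "finite F" "F \<subseteq> X" for F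
  proof -
    have "(\<Sum>x\<in>F. cmod (f x * cnj (g x))) \<le> L2_set (\<lambda>x. cmod (f x)) F * L2_set (\<lambda>x. cmod (g x)) F"
      using L2_set_mult_ineq[of "\<lambda>x. cmod (f x)" "\<lambda>x. cmod (g x)" F] by (simp add: norm_mult)
    also have "\<dots> \<le> ell2_norm X f * ell2_norm X g"
      using L2_set_le_ell2_norm[OF f F] L2_set_le_ell2_norm[OF g F] by (intro mult_mono) auto
    finally show ?thesis .
  qed
  have ab: "(\<lambda>x. cmod (f x * cnj (g x))) summable_on X"
    using bd by (intro nonneg_bdd_above_summable_on bdd_aboveI2[where M = "ell2_norm X f * ell2_norm X g"]) auto
  then show "(\<lambda>x. f x * cnj (g x)) summable_on X" by (rule abs_summable_summable)
  have "cmod (\<Sum>\<^sub>\<infinity>x\<in>X. f x * cnj (g x)) \<le> (\<Sum>\<^sub>\<infinity>x\<in>X. cmod (f x * cnj (g x)))"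
    using ab by (rule norm_infsum_bound)
  also have "\<dots> \<le> ell2_norm X f * ell2_norm X g" using ab bd by (intro infsum_le_finite_sums) auto
  finally show "cmod (\<Sum>\<^sub>\<infinity>x\<in>X. f x * cnj (g x)) \<le> ell2_norm X f * ell2_norm X g" .
qed

lemma ell2_norm_inner:
  assumes "f \<in> ell2_vecs X"
  shows "sqrt (Re (vinner (ell2 X) f f)) = ell2_norm X f"
proof -
  have eq: "f x * cnj (f x) = complex_of_real ((cmod (f x))\<^sup>2)" for x by (rule complex_norm_square[symmetric])
  have "((\<lambda>x. (cmod (f x))\<^sup>2) has_sum (\<Sum>\<^sub>\<infinity>x\<in>X. (cmod (f x))\<^sup>2)) X"
    using assms by (intro has_sum_infsum) (simp add: ell2_vecs_iff)
  then have "((\<lambda>x. complex_of_real ((cmod (f x))\<^sup>2)) has_sum complex_of_real (\<Sum>\<^sub>\<infinity>x\<in>X. (cmod (f x))\<^sup>2)) X"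
    by (simp only: has_sum_of_real_iff)
  then have "vinner (ell2 X) f f = complex_of_real (\<Sum>\<^sub>\<infinity>x\<in>X. (cmod (f x))\<^sup>2)"
    by (simp only: ell2_def ip_space.simps eq infsumI)
  then show ?thesis by (simp add: ell2_norm_def)
qed

lemma tendsto_zero_le:
  fixes f :: "nat \<Rightarrow> 'a :: real_normed_vector"
  assumes "g \<longlonglongrightarrow> 0" "\<And>n. norm (f n) \<le> g n"
  shows "f \<longlonglongrightarrow> 0"
  by (rule Lim_null_comparison[OF always_eventually assms(1)]) (use assms(2) in blast)

definition ell2_tendsto :: "'x set \<Rightarrow> (nat \<Rightarrow> 'x \<Rightarrow> complex) \<Rightarrow> ('x \<Rightarrow> complex) \<Rightarrow> bool" where
  "ell2_tendsto X F f \<longleftrightarrow> range F \<subseteq> ell2_vecs X \<and> f \<in> ell2_vecs X \<and>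
     (\<lambda>n. ell2_norm X (\<lambda>x. F n x - f x)) \<longlonglongrightarrow> 0"

lemma ell2_tendsto_transfer:
  assumes "ell2_tendsto X F f" "range G \<subseteq> ell2_vecs X" "g \<in> ell2_vecs X"
    and "\<And>n. ell2_norm X (\<lambda>x. G n x - g x) \<le> c * ell2_norm X (\<lambda>x. F n x - f x)"
  shows "ell2_tendsto X G g"
  unfolding ell2_tendsto_def
proof (intro conjI assms)
  have "(\<lambda>n. c * ell2_norm X (\<lambda>x. F n x - f x)) \<longlonglongrightarrow> 0"
    using assms(1) unfolding ell2_tendsto_def by (intro tendsto_mult_right_zero) auto
  then show "(\<lambda>n. ell2_norm X (\<lambda>x. G n x - g x)) \<longlonglongrightarrow> 0"
    by (rule tendsto_zero_le) (use assms(4) in simp)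
qed

lemma ell2_tendsto_add:
  assumes F: "ell2_tendsto X F f" and G: "ell2_tendsto X G g"
  shows "ell2_tendsto X (\<lambda>n x. F n x + G n x) (\<lambda>x. f x + g x)"
  unfolding ell2_tendsto_def
proof (intro conjI)
  have mem: "F n \<in> ell2_vecs X" "G n \<in> ell2_vecs X" "f \<in> ell2_vecs X" "g \<in> ell2_vecs X" for n
    using assms by (auto simp: ell2_tendsto_def)
  then show "range (\<lambda>n x. F n x + G n x) \<subseteq> ell2_vecs X" "(\<lambda>x. f x + g x) \<in> ell2_vecs X"
    using ell2_add by blast+
  have "ell2_norm X (\<lambda>x. F n x + G n x - (f x + g x)) \<le>
      ell2_norm X (\<lambda>x. F n x - f x) + ell2_norm X (\<lambda>x. G n x - g x)" for n
    using ell2_norm_triangle[OF ell2_diff[OF mem(1,3)] ell2_diff[OF mem(2,4)], of n n]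
    by (simp add: algebra_simps)
  moreover have "(\<lambda>n. ell2_norm X (\<lambda>x. F n x - f x) + ell2_norm X (\<lambda>x. G n x - g x)) \<longlonglongrightarrow> 0"
    using assms unfolding ell2_tendsto_def by (intro tendsto_add_zero) auto
  ultimately show "(\<lambda>n. ell2_norm X (\<lambda>x. F n x + G n x - (f x + g x))) \<longlonglongrightarrow> 0"
    by - (rule tendsto_zero_le, assumption, simp)
qed

lemma ell2_tendsto_scale:
  assumes "ell2_tendsto X F f"
  shows "ell2_tendsto X (\<lambda>n x. c * F n x) (\<lambda>x. c * f x)"
proof (rule ell2_tendsto_transfer[OF assms])
  have mem: "F n \<in> ell2_vecs X" "f \<in> ell2_vecs X" for n using assms by (auto simp: ell2_tendsto_def)
  then show "range (\<lambda>n x. c * F n x) \<subseteq> ell2_vecs X" "(\<lambda>x. c * f x) \<in> ell2_vecs X"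
    using ell2_scale by blast+
  show "ell2_norm X (\<lambda>x. c * F n x - c * f x) \<le> cmod c * ell2_norm X (\<lambda>x. F n x - f x)" for n
    using ell2_norm_scale[OF ell2_diff[OF mem], of c n] by (simp add: algebra_simps)
qed

lemma ell2_tendsto_unique:
  assumes F: "ell2_tendsto X F f" and G: "ell2_tendsto X G g"
  shows "(\<lambda>n. ell2_norm X (\<lambda>x. F n x - G n x)) \<longlonglongrightarrow> 0 \<longleftrightarrow> f = g"
proof -
  have mem: "F n \<in> ell2_vecs X" "G n \<in> ell2_vecs X" "f \<in> ell2_vecs X" "g \<in> ell2_vecs X" for n
    using assms by (auto simp: ell2_tendsto_def)
  have "ell2_tendsto X (\<lambda>n x. F n x + - 1 * G n x) (\<lambda>x. f x + - 1 * g x)"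
    by (intro ell2_tendsto_add F ell2_tendsto_scale G)
  then have lim: "(\<lambda>n. ell2_norm X (\<lambda>x. (F n x - G n x) - (f x - g x))) \<longlonglongrightarrow> 0"
    by (simp add: ell2_tendsto_def)
  have m: "(\<lambda>x. F n x - G n x) \<in> ell2_vecs X" "(\<lambda>x. f x - g x) \<in> ell2_vecs X" for n
    using mem ell2_diff by blast+
  have zero: "(\<lambda>x. 0) \<in> ell2_vecs X" by (simp add: ell2_vecs_iff)
  show ?thesis
  proof
    assume "(\<lambda>n. ell2_norm X (\<lambda>x. F n x - G n x)) \<longlonglongrightarrow> 0"
    then have "(\<lambda>n. ell2_norm X (\<lambda>x. (F n x - G n x) - (f x - g x)) + ell2_norm X (\<lambda>x. F n x - G n x)) \<longlonglongrightarrow> 0"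
      using lim by (intro tendsto_add_zero)
    moreover have "ell2_norm X (\<lambda>x. f x - g x) \<le>
        ell2_norm X (\<lambda>x. (F n x - G n x) - (f x - g x)) + ell2_norm X (\<lambda>x. F n x - G n x)" for n
      using ell2_norm_triangle_diff[OF m(2) m(1) zero, of n]
        ell2_norm_minus[of X "\<lambda>x. f x - g x" "\<lambda>x. F n x - G n x"] by simp
    ultimately have "ell2_norm X (\<lambda>x. f x - g x) \<le> 0" by (intro LIMSEQ_le_const) auto
    then show "f = g" using ell2_norm_eq_0D[OF mem(3,4)] by (metis ell2_norm_nonneg antisym)
  next
    assume "f = g"
    then show "(\<lambda>n. ell2_norm X (\<lambda>x. F n x - G n x)) \<longlonglongrightarrow> 0" using lim by simp
  qed
qed

lemma ell2_tendsto_inner: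
  assumes F: "ell2_tendsto X F f" and G: "ell2_tendsto X G g"
  shows "(\<lambda>n. vinner (ell2 X) (F n) (G n)) \<longlonglongrightarrow> vinner (ell2 X) f g"
proof -
  let ?N = "ell2_norm X"
  have mem: "F n \<in> ell2_vecs X" "G n \<in> ell2_vecs X" "f \<in> ell2_vecs X" "g \<in> ell2_vecs X" for n
    using assms by (auto simp: ell2_tendsto_def)
  have dF: "(\<lambda>n. ?N (\<lambda>x. F n x - f x)) \<longlonglongrightarrow> 0" and dG: "(\<lambda>n. ?N (\<lambda>x. G n x - g x)) \<longlonglongrightarrow> 0"
    using assms by (auto simp: ell2_tendsto_def)
  have "cmod (vinner (ell2 X) (F n) (G n) - vinner (ell2 X) f g) \<le>
      ?N (\<lambda>x. F n x - f x) * (?N (\<lambda>x. G n x - g x) + ?N g) + ?N f * ?N (\<lambda>x. G n x - g x)" for n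
  proof -
    have a: "(\<lambda>x. F n x - f x) \<in> ell2_vecs X" "(\<lambda>x. G n x - g x) \<in> ell2_vecs X" using mem ell2_diff by blast+
    have s: "(\<lambda>x. f x * cnj (g x)) summable_on X" "(\<lambda>x. (F n x - f x) * cnj (G n x)) summable_on X"
      "(\<lambda>x. f x * cnj (G n x - g x)) summable_on X"
      using ell2_inner_summable[OF mem(3,4)] ell2_inner_summable[OF a(1) mem(2)[of n]]
        ell2_inner_summable[OF mem(3) a(2)] by simp_all
    have "vinner (ell2 X) (F n) (G n) =
        (\<Sum>\<^sub>\<infinity>x\<in>X. f x * cnj (g x) + ((F n x - f x) * cnj (G n x) + f x * cnj (G n x - g x)))"
      unfolding ell2_def ip_space.simps by (intro infsum_cong) (simp add: algebra_simps)
    also have "\<dots> = vinner (ell2 X) f g +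
        (\<Sum>\<^sub>\<infinity>x\<in>X. (F n x - f x) * cnj (G n x) + f x * cnj (G n x - g x))"
      unfolding ell2_def ip_space.simps by (intro infsum_add s summable_on_add)
    also have "(\<Sum>\<^sub>\<infinity>x\<in>X. (F n x - f x) * cnj (G n x) + f x * cnj (G n x - g x)) =
        (\<Sum>\<^sub>\<infinity>x\<in>X. (F n x - f x) * cnj (G n x)) + (\<Sum>\<^sub>\<infinity>x\<in>X. f x * cnj (G n x - g x))"
      by (intro infsum_add s)
    finally have "vinner (ell2 X) (F n) (G n) - vinner (ell2 X) f g =
        (\<Sum>\<^sub>\<infinity>x\<in>X. (F n x - f x) * cnj (G n x)) + (\<Sum>\<^sub>\<infinity>x\<in>X. f x * cnj (G n x - g x))" by simp
    then have "cmod (vinner (ell2 X) (F n) (G n) - vinner (ell2 X) f g) \<le>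
        ?N (\<lambda>x. F n x - f x) * ?N (G n) + ?N f * ?N (\<lambda>x. G n x - g x)"
      using ell2_Cauchy_Schwarz[OF a(1) mem(2)[of n]] ell2_Cauchy_Schwarz[OF mem(3) a(2)]
      by (auto intro: norm_triangle_le)
    moreover have "?N (G n) \<le> ?N (\<lambda>x. G n x - g x) + ?N g"
      using ell2_norm_triangle[OF a(2) mem(4)] by simp
    ultimately show ?thesis
      by (smt (verit) ell2_norm_nonneg mult_left_mono)
  qed
  moreover have "(\<lambda>n. ?N (\<lambda>x. F n x - f x) * (?N (\<lambda>x. G n x - g x) + ?N g) + ?N f * ?N (\<lambda>x. G n x - g x)) \<longlonglongrightarrow> 0"
    by (rule tendsto_eq_intros dF dG refl | simp)+
  ultimately have "(\<lambda>n. vinner (ell2 X) (F n) (G n) - vinner (ell2 X) f g) \<longlonglongrightarrow> 0"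
    by - (rule tendsto_zero_le, assumption, simp)
  then show ?thesis by (simp add: LIM_zero_iff)
qed

text \<open>The limit is taken pointwise. A bound on the norm of differences passes to the limit on every finite
set, and hence on the whole index set.\<close>

theorem ell2_complete:
  assumes mem: "range F \<subseteq> ell2_vecs X"
    and cauchy: "\<And>e. e > 0 \<Longrightarrow> \<exists>M. \<forall>m\<ge>M. \<forall>n\<ge>M. ell2_norm X (\<lambda>x. F m x - F n x) < e"
  obtains f where "ell2_tendsto X F f"
proof -
  have memF: "F n \<in> ell2_vecs X" for n using mem by auto
  have "\<exists>l. (\<lambda>n. F n x) \<longlonglongrightarrow> l" for x
  proof (cases "x \<in> X")
    case True
    have "Cauchy (\<lambda>n. F n x)"
    proof (rule CauchyI)
      fix e :: real assume "0 < e"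
      then obtain M where M: "\<And>m n. m \<ge> M \<Longrightarrow> n \<ge> M \<Longrightarrow> ell2_norm X (\<lambda>x. F m x - F n x) < e"
        using cauchy by blast
      have "cmod (F m x - F n x) < e" if "m \<ge> M" "n \<ge> M" for m n
        using M[OF that] cmod_le_ell2_norm[OF ell2_diff[OF memF memF] True, of m n] by linarith
      then show "\<exists>M. \<forall>m\<ge>M. \<forall>n\<ge>M. cmod (F m x - F n x) < e" by blast
    qed
    then show ?thesis using Cauchy_convergent convergent_def by blast
  next
    case False
    then have "(\<lambda>n. F n x) = (\<lambda>n. 0)" using memF by (simp add: ell2_vecs_iff)
    then show ?thesis by auto
  qed
  then obtain f where f: "\<And>x. (\<lambda>n. F n x) \<longlonglongrightarrow> f x" by metis
  have f0: "f x = 0" if "x \<notin> X" for x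
  proof -
    have "(\<lambda>n. F n x) = (\<lambda>n. 0)" using memF that by (simp add: ell2_vecs_iff)
    then show ?thesis using f[of x] LIMSEQ_unique tendsto_const by metis
  qed
  have close: "(\<lambda>x. F m x - f x) \<in> ell2_vecs X \<and> ell2_norm X (\<lambda>x. F m x - f x) \<le> e"
    if M: "\<And>n. n \<ge> M \<Longrightarrow> ell2_norm X (\<lambda>x. F m x - F n x) < e" for m M e
  proof -
    have "L2_set (\<lambda>x. cmod (F m x - f x)) A \<le> e" if A: "finite A" "A \<subseteq> X" for A
    proof (rule LIMSEQ_le_const2)
      show "(\<lambda>n. L2_set (\<lambda>x. cmod (F m x - F n x)) A) \<longlonglongrightarrow> L2_set (\<lambda>x. cmod (F m x - f x)) A"
        unfolding L2_set_def by (intro tendsto_intros f)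
      have "L2_set (\<lambda>x. cmod (F m x - F n x)) A \<le> e" if "n \<ge> M" for n
        using L2_set_le_ell2_norm[OF ell2_diff[OF memF memF] A, of m n] M[OF that] by linarith
      then show "\<exists>M. \<forall>n\<ge>M. L2_set (\<lambda>x. cmod (F m x - F n x)) A \<le> e" by blast
    qed
    moreover have "F m x - f x = 0" if "x \<notin> X" for x
      using f0[OF that] memF[of m] that by (simp add: ell2_vecs_iff)
    ultimately show ?thesis using ell2_vecsI[of X "\<lambda>x. F m x - f x" e] by blast
  qed
  have fmem: "f \<in> ell2_vecs X"
  proof -
    obtain M where M: "\<And>m n. m \<ge> M \<Longrightarrow> n \<ge> M \<Longrightarrow> ell2_norm X (\<lambda>x. F m x - F n x) < 1"
      using cauchy[of 1] by auto
    have "(\<lambda>x. F M x - f x) \<in> ell2_vecs X" using close[of M M 1] M by blast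
    from ell2_diff[OF memF[of M] this] show ?thesis by simp
  qed
  have "(\<lambda>n. ell2_norm X (\<lambda>x. F n x - f x)) \<longlonglongrightarrow> 0"
  proof (rule LIMSEQ_I)
    fix r :: real assume "0 < r"
    then obtain M where M: "\<And>m n. m \<ge> M \<Longrightarrow> n \<ge> M \<Longrightarrow> ell2_norm X (\<lambda>x. F m x - F n x) < r / 2"
      using cauchy[of "r / 2"] by auto
    have "norm (ell2_norm X (\<lambda>x. F n x - f x) - 0) < r" if "n \<ge> M" for n
    proof -
      have "ell2_norm X (\<lambda>x. F n x - f x) \<le> r / 2" using close[of M n "r / 2"] M[OF that] by blast
      moreover have "0 \<le> ell2_norm X (\<lambda>x. F n x - f x)" by simp
      ultimately show ?thesis using \<open>0 < r\<close> unfolding real_norm_def diff_0_right by linarith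
    qed
    then show "\<exists>no. \<forall>n\<ge>no. norm (ell2_norm X (\<lambda>x. F n x - f x) - 0) < r" by blast
  qed
  then show thesis using that memF fmem by (auto simp: ell2_tendsto_def)
qed

lemma ell2_truncation:
  assumes f: "f \<in> ell2_vecs X" and e: "e > 0"
  obtains F where "finite F" "F \<subseteq> X" "ell2_norm X (\<lambda>x. (if x \<in> F then f x else 0) - f x) \<le> e"
proof -
  let ?s = "\<lambda>x. (cmod (f x))\<^sup>2"
  have sm: "?s summable_on X" using f by (simp add: ell2_vecs_iff)
  obtain F where F: "finite F" "F \<subseteq> X" "dist (sum ?s F) (infsum ?s X) \<le> e\<^sup>2"
    using infsum_finite_approximation[OF sm, of "e\<^sup>2"] e by auto
  have "L2_set (\<lambda>x. cmod ((if x \<in> F then f x else 0) - f x)) A \<le> e" if A: "finite A" "A \<subseteq> X" for A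
  proof -
    have "sum ?s (A - F) + sum ?s F = sum ?s (A \<union> F)"
      using A F by (subst sum.union_disjoint[symmetric]) (auto simp: Un_commute)
    also have "\<dots> \<le> infsum ?s X" using A F by (intro finite_sum_le_infsum sm) auto
    also have "\<dots> \<le> sum ?s F + e\<^sup>2" using F(3) by (simp add: dist_real_def abs_le_iff)
    finally have "sum ?s (A - F) \<le> e\<^sup>2" by simp
    moreover have "(\<Sum>x\<in>A. (cmod ((if x \<in> F then f x else 0) - f x))\<^sup>2) = sum ?s (A - F)"
      using A by (intro sum.mono_neutral_cong_right) auto
    ultimately show ?thesis unfolding L2_set_def using e by (intro real_le_lsqrt) (auto intro: sum_nonneg)
  qed
  then have "ell2_norm X (\<lambda>x. (if x \<in> F then f x else 0) - f x) \<le> e"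
    using f by (intro ell2_vecsI(2)) (auto simp: ell2_vecs_iff)
  then show thesis using that F by blast
qed

section \<open>Completions with square-summable coordinates\<close>

text \<open>A space that carries isometric linear coordinates in a space of square-summable functions whose
range contains all point masses. The coordinates may have a kernel, consisting of null vectors. The
completion of such a space is the whole space of square-summable functions: Cauchy sequences have
limits in coordinates, and two of them are identified if and only if their limits agree.\<close>

locale ell2_model =
  fixes V :: "'a ip_space" and X :: "'x set" and coord :: "'a \<Rightarrow> 'x \<Rightarrow> complex"
  assumes coord_mem: "u \<in> vecs V \<Longrightarrow> coord u \<in> ell2_vecs X"
    and add_mem: "u \<in> vecs V \<Longrightarrow> v \<in> vecs V \<Longrightarrow> vadd V u v \<in> vecs V"
    and coord_add: "u \<in> vecs V \<Longrightarrow> v \<in> vecs V \<Longrightarrow> coord (vadd V u v) = (\<lambda>x. coord u x + coord v x)"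
    and scale_mem: "u \<in> vecs V \<Longrightarrow> vscale V c u \<in> vecs V"
    and coord_scale: "u \<in> vecs V \<Longrightarrow> coord (vscale V c u) = (\<lambda>x. c * coord u x)"
    and inner_coord: "u \<in> vecs V \<Longrightarrow> v \<in> vecs V \<Longrightarrow> vinner V u v = vinner (ell2 X) (coord u) (coord v)"
    and delta: "x \<in> X \<Longrightarrow> \<exists>u\<in>vecs V. coord u = (\<lambda>y. of_bool (y = x))"
    and nonempty: "vecs V \<noteq> {}"
begin

lemma vdist_eq:
  assumes "u \<in> vecs V" "v \<in> vecs V"
  shows "vdist V u v = ell2_norm X (\<lambda>x. coord u x - coord v x)"
proof -
  let ?d = "vadd V u (vscale V (-1) v)"
  have d: "?d \<in> vecs V" "coord ?d = (\<lambda>x. coord u x - coord v x)"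
    using assms by (simp_all add: add_mem scale_mem coord_add coord_scale)
  then have "vinner V ?d ?d = vinner (ell2 X) (coord ?d) (coord ?d)" by (intro inner_coord)
  then show ?thesis
    unfolding vdist_def Let_def using ell2_norm_inner[OF coord_mem[OF d(1)]] d(2) by simp
qed

definition seq_limit :: "(nat \<Rightarrow> 'a) \<Rightarrow> ('x \<Rightarrow> complex) \<Rightarrow> bool" where
  "seq_limit s f \<longleftrightarrow> range s \<subseteq> vecs V \<and> ell2_tendsto X (\<lambda>n. coord (s n)) f"

lemma seq_limit_mem: "seq_limit s f \<Longrightarrow> f \<in> ell2_vecs X" "seq_limit s f \<Longrightarrow> s n \<in> vecs V"
  by (auto simp: seq_limit_def ell2_tendsto_def)

lemma vdist_tendsto_zero_iff:
  assumes "seq_limit s f" "seq_limit t g"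
  shows "(\<lambda>n. vdist V (s n) (t n)) \<longlonglongrightarrow> 0 \<longleftrightarrow> f = g"
proof -
  have "vdist V (s n) (t n) = ell2_norm X (\<lambda>x. coord (s n) x - coord (t n) x)" for n
    using assms by (intro vdist_eq) (simp_all add: seq_limit_mem)
  then show ?thesis
    using ell2_tendsto_unique[of X "\<lambda>n. coord (s n)" f "\<lambda>n. coord (t n)" g] assms
    unfolding seq_limit_def by simp
qed

lemma seq_limit_unique: "seq_limit s f \<Longrightarrow> seq_limit s g \<Longrightarrow> f = g"
  using vdist_tendsto_zero_iff[of s f s f] vdist_tendsto_zero_iff[of s f s g] by simp

lemma cauchy_seqs_iff: "s \<in> cauchy_seqs V \<longleftrightarrow> (\<exists>f. seq_limit s f)"
proof
  assume s: "s \<in> cauchy_seqs V"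
  then have mem: "s n \<in> vecs V" for n by (auto simp: cauchy_seqs_def)
  obtain f where "ell2_tendsto X (\<lambda>n. coord (s n)) f"
  proof (rule ell2_complete)
    show "range (\<lambda>n. coord (s n)) \<subseteq> ell2_vecs X" using mem coord_mem by blast
    show "\<exists>M. \<forall>m\<ge>M. \<forall>n\<ge>M. ell2_norm X (\<lambda>x. coord (s m) x - coord (s n) x) < e" if "e > 0" for e
      using s that unfolding cauchy_seqs_def by (simp add: vdist_eq[OF mem mem])
  qed
  then show "\<exists>f. seq_limit s f" using mem by (auto simp: seq_limit_def)
next
  assume "\<exists>f. seq_limit s f"
  then obtain f where f: "seq_limit s f" by blast
  have mem: "s n \<in> vecs V" "coord (s n) \<in> ell2_vecs X" "f \<in> ell2_vecs X" for n
    using f seq_limit_mem coord_mem by auto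
  have "\<exists>N. \<forall>m\<ge>N. \<forall>n\<ge>N. vdist V (s m) (s n) < e" if e: "e > 0" for e
  proof -
    have "(\<lambda>n. ell2_norm X (\<lambda>x. coord (s n) x - f x)) \<longlonglongrightarrow> 0"
      using f by (simp add: seq_limit_def ell2_tendsto_def)
    then obtain N where "\<And>n. n \<ge> N \<Longrightarrow> norm (ell2_norm X (\<lambda>x. coord (s n) x - f x) - 0) < e / 2"
      using LIMSEQ_D[of "\<lambda>n. ell2_norm X (\<lambda>x. coord (s n) x - f x)" 0 "e / 2"] e by auto
    then have N: "\<And>n. n \<ge> N \<Longrightarrow> ell2_norm X (\<lambda>x. coord (s n) x - f x) < e / 2" by simp
    have "vdist V (s m) (s n) < e" if "m \<ge> N" "n \<ge> N" for m n
      using ell2_norm_triangle_diff[OF mem(2,3,2), of m n] N[OF that(1)] N[OF that(2)]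
        ell2_norm_minus[of X f "coord (s n)"] by (simp add: vdist_eq[OF mem(1) mem(1)])
    then show ?thesis by blast
  qed
  then show "s \<in> cauchy_seqs V" using mem by (auto simp: cauchy_seqs_def)
qed

lemma cauchy_rel_iff: "(s, t) \<in> cauchy_rel V \<longleftrightarrow> (\<exists>f. seq_limit s f \<and> seq_limit t f)"
proof -
  have "(s, t) \<in> cauchy_rel V \<longleftrightarrow> (\<exists>f g. seq_limit s f \<and> seq_limit t g \<and> (\<lambda>n. vdist V (s n) (t n)) \<longlonglongrightarrow> 0)"
    by (auto simp: cauchy_rel_def cauchy_seqs_iff)
  then show ?thesis using vdist_tendsto_zero_iff by blast
qed

definition limit_class :: "('x \<Rightarrow> complex) \<Rightarrow> (nat \<Rightarrow> 'a) set" where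
  "limit_class f = {s. seq_limit s f}"

lemma cauchy_rel_image:
  assumes "S \<noteq> {}" "\<And>s. s \<in> S \<Longrightarrow> seq_limit s f"
  shows "cauchy_rel V `` S = limit_class f"
proof (intro equalityI subsetI)
  fix t assume "t \<in> cauchy_rel V `` S"
  then obtain s g where "s \<in> S" "seq_limit s g" "seq_limit t g" by (auto simp: cauchy_rel_iff)
  then show "t \<in> limit_class f"
    using assms(2) seq_limit_unique[of s f g] by (simp add: limit_class_def)
next
  fix t assume t: "t \<in> limit_class f"
  obtain s where "s \<in> S" using assms(1) by blast
  then have "(s, t) \<in> cauchy_rel V" using assms(2) t by (auto simp: cauchy_rel_iff limit_class_def)
  then show "t \<in> cauchy_rel V `` S" using \<open>s \<in> S\<close> by blast
qed

lemma finite_support_coord: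
  assumes "finite F" "F \<subseteq> X"
  shows "\<exists>u\<in>vecs V. coord u = (\<lambda>x. if x \<in> F then f x else 0)"
  using assms
proof (induction F rule: finite_induct)
  case empty
  obtain u where "u \<in> vecs V" using nonempty by blast
  then show ?case using scale_mem[of u 0] coord_scale[of u 0] by auto
next
  case (insert a F)
  obtain u where u: "u \<in> vecs V" "coord u = (\<lambda>x. if x \<in> F then f x else 0)" using insert by auto
  obtain d where d: "d \<in> vecs V" "coord d = (\<lambda>y. of_bool (y = a))" using delta[of a] insert by auto
  have "vadd V u (vscale V (f a) d) \<in> vecs V" using u d add_mem scale_mem by blast
  moreover have "coord (vadd V u (vscale V (f a) d)) = (\<lambda>x. if x \<in> insert a F then f x else 0)"
    using insert.hyps(2) u d by (auto simp: coord_add scale_mem coord_scale)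
  ultimately show ?case by blast
qed

lemma seq_limit_exists:
  assumes "f \<in> ell2_vecs X"
  shows "\<exists>s. seq_limit s f"
proof -
  have "\<exists>u\<in>vecs V. ell2_norm X (\<lambda>x. coord u x - f x) \<le> inverse (real (Suc n))" for n
  proof -
    obtain F where "finite F" "F \<subseteq> X" "ell2_norm X (\<lambda>x. (if x \<in> F then f x else 0) - f x) \<le> inverse (real (Suc n))"
      using ell2_truncation[OF assms, of "inverse (real (Suc n))"] by auto
    then show ?thesis using finite_support_coord[of F f] by force
  qed
  then obtain s where s: "\<And>n. s n \<in> vecs V" "\<And>n. ell2_norm X (\<lambda>x. coord (s n) x - f x) \<le> inverse (real (Suc n))"
    by metis
  have "(\<lambda>n. ell2_norm X (\<lambda>x. coord (s n) x - f x)) \<longlonglongrightarrow> 0"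
    by (rule tendsto_zero_le[OF LIMSEQ_inverse_real_of_nat]) (use s(2) in simp)
  then have "seq_limit s f" using s(1) coord_mem assms by (auto simp: seq_limit_def ell2_tendsto_def)
  then show ?thesis by blast
qed

lemma vecs_completion: "vecs (completion V) = limit_class ` ell2_vecs X"
proof
  show "vecs (completion V) \<subseteq> limit_class ` ell2_vecs X"
  proof
    fix A assume "A \<in> vecs (completion V)"
    then obtain s where s: "s \<in> cauchy_seqs V" "A = cauchy_rel V `` {s}"
      by (auto simp: completion_def elim: quotientE)
    then obtain f where "seq_limit s f" by (auto simp: cauchy_seqs_iff)
    then show "A \<in> limit_class ` ell2_vecs X"
      using cauchy_rel_image[of "{s}" f] seq_limit_mem(1) s(2) by auto
  qed
  show "limit_class ` ell2_vecs X \<subseteq> vecs (completion V)"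
  proof
    fix A assume "A \<in> limit_class ` ell2_vecs X"
    then obtain f s where f: "A = limit_class f" "seq_limit s f" using seq_limit_exists by blast
    then have "A = cauchy_rel V `` {s}" using cauchy_rel_image[of "{s}" f] by auto
    then show "A \<in> vecs (completion V)"
      using f(2) quotientI[of s "cauchy_seqs V" "cauchy_rel V"] by (auto simp: completion_def cauchy_seqs_iff)
  qed
qed

text \<open>The unitary map from the completion, inverse to \<open>limit_class\<close>.\<close>

definition coords :: "(nat \<Rightarrow> 'a) set \<Rightarrow> 'x \<Rightarrow> complex" where
  "coords = the_inv_into (ell2_vecs X) limit_class"

lemma limit_class_inj: "inj_on limit_class (ell2_vecs X)"
proof (rule inj_onI)
  fix f g assume "f \<in> ell2_vecs X" "g \<in> ell2_vecs X" "limit_class f = limit_class g"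
  then show "f = g" using seq_limit_exists[of f] seq_limit_unique by (auto simp: limit_class_def)
qed

lemma coords_limit_class [simp]: "f \<in> ell2_vecs X \<Longrightarrow> coords (limit_class f) = f"
  unfolding coords_def by (rule the_inv_into_f_f[OF limit_class_inj])

lemma bij_coords: "bij_betw coords (vecs (completion V)) (ell2_vecs X)"
  unfolding vecs_completion coords_def
  by (rule bij_betw_the_inv_into[OF inj_on_imp_bij_betw[OF limit_class_inj]])

lemma completion_add:
  assumes "f \<in> ell2_vecs X" "g \<in> ell2_vecs X"
  shows "vadd (completion V) (limit_class f) (limit_class g) = limit_class (\<lambda>x. f x + g x)"
proof -
  have "seq_limit (\<lambda>n. vadd V (s n) (t n)) (\<lambda>x. f x + g x)" if st: "seq_limit s f" "seq_limit t g" for s t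
  proof -
    have mem: "s n \<in> vecs V" "t n \<in> vecs V" for n using st seq_limit_mem(2) by blast+
    have "ell2_tendsto X (\<lambda>n x. coord (s n) x + coord (t n) x) (\<lambda>x. f x + g x)"
      using st unfolding seq_limit_def by (intro ell2_tendsto_add) simp_all
    then show ?thesis using add_mem[OF mem] unfolding seq_limit_def coord_add[OF mem] by blast
  qed
  moreover obtain s t where "seq_limit s f" "seq_limit t g" using seq_limit_exists assms by blast
  ultimately show ?thesis
    unfolding completion_def ip_space.simps
    by (intro cauchy_rel_image) (auto simp: limit_class_def)
qed

lemma completion_scale:
  assumes "f \<in> ell2_vecs X"
  shows "vscale (completion V) c (limit_class f) = limit_class (\<lambda>x. c * f x)"
proof -
  have "seq_limit (\<lambda>n. vscale V c (s n)) (\<lambda>x. c * f x)" if s: "seq_limit s f" for s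
  proof -
    have mem: "s n \<in> vecs V" for n using s seq_limit_mem(2) by blast
    have "ell2_tendsto X (\<lambda>n x. c * coord (s n) x) (\<lambda>x. c * f x)"
      using s unfolding seq_limit_def by (intro ell2_tendsto_scale) simp
    then show ?thesis using scale_mem[OF mem] unfolding seq_limit_def coord_scale[OF mem] by blast
  qed
  moreover obtain s where "seq_limit s f" using seq_limit_exists assms by blast
  ultimately show ?thesis
    unfolding completion_def ip_space.simps
    by (intro cauchy_rel_image) (auto simp: limit_class_def)
qed

lemma completion_inner:
  assumes "f \<in> ell2_vecs X" "g \<in> ell2_vecs X"
  shows "vinner (completion V) (limit_class f) (limit_class g) = vinner (ell2 X) f g"
proof -
  have "lim (\<lambda>n. vinner V (s n) (t n)) = vinner (ell2 X) f g" if "seq_limit s f" "seq_limit t g" for s t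
  proof -
    have "vinner V (s n) (t n) = vinner (ell2 X) (coord (s n)) (coord (t n))" for n
      using that by (intro inner_coord) (simp_all add: seq_limit_mem)
    then have "(\<lambda>n. vinner V (s n) (t n)) \<longlonglongrightarrow> vinner (ell2 X) f g"
      using ell2_tendsto_inner[of X "\<lambda>n. coord (s n)" f "\<lambda>n. coord (t n)" g] that
      unfolding seq_limit_def by simp
    then show ?thesis by (rule limI)
  qed
  moreover obtain s t where "seq_limit s f" "seq_limit t g" using seq_limit_exists assms by blast
  ultimately have "{lim (\<lambda>n. vinner V (s n) (t n)) | s t. s \<in> limit_class f \<and> t \<in> limit_class g} =
      {vinner (ell2 X) f g}" by (auto simp: limit_class_def) metis
  then show ?thesis unfolding completion_def ip_space.simps by simp
qed

lemma completion_embed_eq: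
  assumes "u \<in> vecs V"
  shows "completion_embed V u = limit_class (coord u)"
proof -
  have "seq_limit (\<lambda>n. u) (coord u)"
    using assms coord_mem by (auto simp: seq_limit_def ell2_tendsto_def ell2_norm_def)
  then show ?thesis unfolding completion_embed_def by (intro cauchy_rel_image) auto
qed

text \<open>A map that does not increase distances in coordinates extends to the completion by continuity.\<close>

lemma completion_map_eq:
  assumes T: "\<And>u. u \<in> vecs V \<Longrightarrow> T u \<in> vecs V" "\<And>u. u \<in> vecs V \<Longrightarrow> coord (T u) = P (coord u)"
    and P: "\<And>f. f \<in> ell2_vecs X \<Longrightarrow> P f \<in> ell2_vecs X"
      "\<And>f g. f \<in> ell2_vecs X \<Longrightarrow> g \<in> ell2_vecs X \<Longrightarrow>
         ell2_norm X (\<lambda>x. P f x - P g x) \<le> ell2_norm X (\<lambda>x. f x - g x)"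
    and f: "f \<in> ell2_vecs X"
  shows "completion_map V T (limit_class f) = limit_class (P f)"
proof -
  have "seq_limit (\<lambda>n. T (s n)) (P f)" if s: "seq_limit s f" for s
  proof -
    have mem: "s n \<in> vecs V" "coord (s n) \<in> ell2_vecs X" for n using s seq_limit_mem(2) coord_mem by auto
    have "ell2_tendsto X (\<lambda>n. coord (T (s n))) (P f)"
    proof (rule ell2_tendsto_transfer[where c = 1])
      show "ell2_tendsto X (\<lambda>n. coord (s n)) f" using s by (simp add: seq_limit_def)
    qed (use mem T P f in auto)
    then show ?thesis using mem T by (auto simp: seq_limit_def)
  qed
  moreover obtain s where "seq_limit s f" using seq_limit_exists f by blast
  ultimately show ?thesis
    unfolding completion_map_def
    by (intro cauchy_rel_image) (auto simp: limit_class_def)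
qed

end

section \<open>Diagrams on a halved interval\<close>

lemma half_simps:
  assumes "standard_dyadic J"
  shows "Inf (lower_half J) = Inf J" "Sup (lower_half J) = middle J"
    "Inf (upper_half J) = middle J" "Sup (upper_half J) = Sup J"
  using middle_between[OF assms] by (simp_all add: lower_half_def upper_half_def)

lemma standard_dyadic_half:
  assumes "standard_dyadic J"
  shows "standard_dyadic (lower_half J)" "standard_dyadic (upper_half J)"
proof -
  obtain n p :: nat where p: "p < 2 ^ n" and J: "J = {real p / 2 ^ n ..< (real p + 1) / 2 ^ n}"
    using assms by (auto simp: standard_dyadic_def)
  have "real p / 2 ^ n < (real p + 1) / 2 ^ n" by (simp add: divide_strict_right_mono)
  then have I: "Inf J = real p / 2 ^ n" "Sup J = (real p + 1) / 2 ^ n" by (simp_all add: J)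
  have "real (2 * p) / 2 ^ Suc n = Inf J" "(real (2 * p) + 1) / 2 ^ Suc n = middle J"
    "real (2 * p + 1) / 2 ^ Suc n = middle J" "(real (2 * p + 1) + 1) / 2 ^ Suc n = Sup J"
    by (simp_all add: middle_def I field_simps)
  then have "lower_half J = {real (2 * p) / 2 ^ Suc n ..< (real (2 * p) + 1) / 2 ^ Suc n}"
    "upper_half J = {real (2 * p + 1) / 2 ^ Suc n ..< (real (2 * p + 1) + 1) / 2 ^ Suc n}"
    by (simp_all only: lower_half_def upper_half_def)
  moreover have "2 * p < 2 ^ Suc n" "2 * p + 1 < 2 ^ Suc n" using p by auto
  ultimately show "standard_dyadic (lower_half J)" "standard_dyadic (upper_half J)"
    unfolding standard_dyadic_def by blast+
qed

lemma halves:
  assumes "standard_dyadic J"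
  shows "lower_half J \<union> upper_half J = J" "lower_half J \<inter> upper_half J = {}"
    "lower_half J \<noteq> {}" "upper_half J \<noteq> {}"
proof -
  have "J = {Inf J..<Sup J}" using standard_dyadicD(1)[OF assms] .
  then show "lower_half J \<union> upper_half J = J"
    unfolding lower_half_def upper_half_def
    using middle_between[OF assms] by (metis ivl_disj_un_two(3) less_imp_le)
  show "lower_half J \<inter> upper_half J = {}" "lower_half J \<noteq> {}" "upper_half J \<noteq> {}"
    unfolding lower_half_def upper_half_def using middle_between[OF assms] by auto
qed

lemma halve_in_dyadic_partitions:
  assumes I: "I \<in> dyadic_partitions" and J: "J \<in> I"
  shows "halve I J \<in> dyadic_partitions"
proof -
  note sd = dyadic_partitionsD(3)[OF I J]
  have part: "partition_on circle I" using dyadic_partitionsD(2)[OF I] .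
  have disj: "A \<inter> B = {}" if "A \<in> I" "B \<in> I" "A \<noteq> B" for A B
    using partition_onD2[OF part] that by (auto simp: disjoint_def)
  have sub: "lower_half J \<subseteq> J" "upper_half J \<subseteq> J" using halves(1)[OF sd] by auto
  have "partition_on circle (halve I J)"
  proof (rule partition_onI)
    have "\<Union>(halve I J) = \<Union>(I - {J}) \<union> J" using halves(1)[OF sd] by (auto simp: halve_def)
    also have "\<dots> = circle" using partition_onD1[OF part] J by auto
    finally show "\<Union>(halve I J) = circle" .
    show "{} \<notin> halve I J" using halves(3,4)[OF sd] partition_onD3[OF part] by (auto simp: halve_def)
    fix A B assume "A \<in> halve I J" "B \<in> halve I J" "A \<noteq> B"
    then show "disjnt A B"
    proof -
      have "disjnt C D" if "C \<in> I - {J}" "D \<in> {lower_half J, upper_half J}" for C D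
        using disj[of C J] that J sub unfolding disjnt_def by blast
      moreover have "disjnt C D" if "C \<in> I - {J}" "D \<in> I - {J}" "C \<noteq> D" for C D
        using disj[of C D] that unfolding disjnt_def by blast
      moreover have "disjnt (lower_half J) (upper_half J)" using halves(2)[OF sd] by (simp add: disjnt_def)
      ultimately show ?thesis
        using \<open>A \<in> halve I J\<close> \<open>B \<in> halve I J\<close> \<open>A \<noteq> B\<close>
        unfolding halve_def by (metis UnE insertE singletonD disjnt_sym)
    qed
  qed
  then show ?thesis
    using standard_dyadic_half[OF sd] dyadic_partitionsD(1,3)[OF I]
    by (auto simp: dyadic_partitions_def halve_def)
qed

lemma Inf_halve:
  assumes I: "I \<in> dyadic_partitions" and J: "J \<in> I"
  shows "Inf ` halve I J = insert (middle J) (Inf ` I)"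
proof -
  note sd = dyadic_partitionsD(3)[OF I J]
  have "Inf ` halve I J = Inf ` (I - {J}) \<union> {Inf J, middle J}" by (simp add: halve_def half_simps[OF sd])
  also have "\<dots> = insert (middle J) (Inf ` I)" using J by auto
  finally show ?thesis .
qed

lemma quarter_points:
  assumes "standard_dyadic J"
  shows "Inf J < middle (lower_half J)" "middle (lower_half J) < middle J"
    "middle J < middle (upper_half J)" "middle (upper_half J) < Sup J"
  using middle_between[OF standard_dyadic_half(1)[OF assms]] middle_between[OF standard_dyadic_half(2)[OF assms]]
  by (simp_all add: half_simps[OF assms])

lemma bdry_points_halve:
  assumes I: "I \<in> dyadic_partitions" and J: "J \<in> I"
  shows "bdry_points (halve I J) = bdry_points I \<union> {middle (lower_half J), middle (upper_half J)}"
proof -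
  note sd = dyadic_partitionsD(3)[OF I J]
  have "bdry_points (halve I J) = (\<Union>K\<in>I - {J}. {Inf K, middle K}) \<union>
      {Inf J, middle (lower_half J), middle J, middle (upper_half J)}"
    unfolding bdry_points_eq[OF halve_in_dyadic_partitions[OF I J]]
    by (auto simp: halve_def half_simps[OF sd])
  then show ?thesis unfolding bdry_points_eq[OF I] using J by auto
qed

text \<open>Both diagrams in the image of a halving arise in the same way: one end is moved without passing
another boundary point, and a new string is inserted that encloses no boundary point. Neither can create
a crossing.\<close>

lemma pairing_after_move:
  assumes x: "x \<in> pairings I"
    and mono: "strict_mono_on (bdry_points I) (id(c := d))"
    and b': "bdry_points I' = insert u (insert w (id(c := d) ` bdry_points I))"
    and uw: "u < w" "u \<notin> id(c := d) ` bdry_points I" "w \<notin> id(c := d) ` bdry_points I"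
    and gap: "\<And>p. p \<in> id(c := d) ` bdry_points I \<Longrightarrow> \<not> (u < p \<and> p < w)"
  shows "insert {u, w} (move_end c d x) \<in> pairings I'"
proof -
  let ?f = "id(c := d)" and ?P = "bdry_points I"
  have inj: "inj_on ?f ?P" using strict_mono_on_imp_inj_on[OF mono] .
  have part: "partition_on ?P x" using x by (simp add: pairings_def)
  have c2: "card s = 2" if "s \<in> x" for s using x that by (simp add: pairings_def)
  have sub: "s \<subseteq> ?P" if "s \<in> x" for s using partition_onD1[OF part] that by auto
  have "partition_on (bdry_points I') (insert {u, w} (move_end c d x))"
  proof (rule partition_onI)
    show "\<Union>(insert {u, w} (move_end c d x)) = bdry_points I'"
      unfolding b' move_end_def using partition_onD1[OF part] by (auto simp del: fun_upd_apply)
    show "{} \<notin> insert {u, w} (move_end c d x)"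
      using partition_onD3[OF part] unfolding move_end_def by (metis image_iff image_is_empty insertE insert_not_empty)
    fix p q assume pq: "p \<in> insert {u, w} (move_end c d x)" "q \<in> insert {u, w} (move_end c d x)" "p \<noteq> q"
    have mv: "s \<subseteq> ?f ` ?P" if "s \<in> move_end c d x" for s
      using that sub unfolding move_end_def by blast
    have disj: "disjnt (?f ` s) (?f ` t)" if st: "s \<in> x" "t \<in> x" "?f ` s \<noteq> ?f ` t" for s t
    proof -
      have "s \<inter> t = {}" using partition_onD2[OF part] st by (auto simp: disjoint_def)
      then show ?thesis
        using inj_on_image_Int[OF inj sub[OF st(1)] sub[OF st(2)]] by (simp add: disjnt_def)
    qed
    consider "p = {u, w}" "q \<in> move_end c d x" | "q = {u, w}" "p \<in> move_end c d x"
      | "p \<in> move_end c d x" "q \<in> move_end c d x" using pq by auto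
    then show "disjnt p q"
    proof cases
      case 1
      then show ?thesis using mv[OF 1(2)] uw unfolding disjnt_def by auto
    next
      case 2
      then show ?thesis using mv[OF 2(2)] uw unfolding disjnt_def by auto
    next
      case 3
      then show ?thesis using disj pq(3) unfolding move_end_def by blast
    qed
  qed
  moreover have "\<forall>s\<in>insert {u, w} (move_end c d x). card s = 2"
  proof
    fix s assume "s \<in> insert {u, w} (move_end c d x)"
    then consider "s = {u, w}" | t where "t \<in> x" "s = ?f ` t" by (auto simp: move_end_def simp del: fun_upd_apply)
    then show "card s = 2"
    proof cases
      case 2
      then show ?thesis using c2[OF 2(1)] card_image[OF inj_on_subset[OF inj sub[OF 2(1)]]] by simp
    qed (use uw in auto)
  qed
  moreover have "\<not> (\<exists>p r q s. p < r \<and> r < q \<and> q < s \<and> {p, q} \<in> insert {u, w} (move_end c d x) \<and>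
      {r, s} \<in> insert {u, w} (move_end c d x))"
  proof
    assume "\<exists>p r q s. p < r \<and> r < q \<and> q < s \<and> {p, q} \<in> insert {u, w} (move_end c d x) \<and>
      {r, s} \<in> insert {u, w} (move_end c d x)"
    then obtain p r q s where ord: "p < r" "r < q" "q < s"
      and pq: "{p, q} \<in> insert {u, w} (move_end c d x)" and rs: "{r, s} \<in> insert {u, w} (move_end c d x)"
      by blast
    have pull: "\<exists>a\<in>?P. \<exists>b\<in>?P. {a, b} \<in> x \<and> y = ?f a \<and> z = ?f b"
      if yz: "{y, z} \<in> move_end c d x" "y < z" for y z
    proof -
      obtain e where e: "e \<in> x" "{y, z} = ?f ` e" using yz(1) unfolding move_end_def by blast
      obtain a b where ab: "a \<in> e" "b \<in> e" "y = ?f a" "z = ?f b" using e(2) by (metis imageE insertCI)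
      have "a \<noteq> b" using ab yz(2) by auto
      then have "e = {a, b}" using ab c2[OF e(1)] by (auto simp: card_2_iff)
      then show ?thesis using ab e(1) sub[OF e(1)] by blast
    qed
    have lt: "a < b" if "a \<in> ?P" "b \<in> ?P" "?f a < ?f b" for a b
      using mono that by (metis linorder_neqE_linordered_idom not_less_iff_gr_or_eq strict_mono_onD)
    consider "{p, q} = {u, w}" | "{r, s} = {u, w}" "{p, q} \<noteq> {u, w}"
      | "{p, q} \<in> move_end c d x" "{r, s} \<in> move_end c d x" using pq rs by auto
    then show False
    proof cases
      case 1
      then have u: "p = u" "q = w" using ord uw(1) by (auto simp: doubleton_eq_iff)
      then have "{r, s} \<in> move_end c d x" using rs ord by (auto simp: doubleton_eq_iff)
      then obtain a where "a \<in> ?P" "r = ?f a" using pull[of r s] ord by fastforce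
      then have "r \<in> ?f ` ?P" by (metis imageI)
      then show False using gap u ord by blast
    next
      case 2
      then have u: "r = u" "s = w" using ord uw(1) by (auto simp: doubleton_eq_iff)
      have "{p, q} \<in> move_end c d x" using pq 2(2) by auto
      then obtain b where "b \<in> ?P" "q = ?f b" using pull[of p q] ord by fastforce
      then have "q \<in> ?f ` ?P" by (metis imageI)
      then show False using gap u ord by blast
    next
      case 3
      obtain a b where ab: "a \<in> ?P" "b \<in> ?P" "{a, b} \<in> x" "p = ?f a" "q = ?f b"
        using pull[OF 3(1)] ord by (meson order.strict_trans)
      obtain a' b' where ab': "a' \<in> ?P" "b' \<in> ?P" "{a', b'} \<in> x" "r = ?f a'" "s = ?f b'"
        using pull[OF 3(2)] ord by (meson order.strict_trans)
      have "a < a'" "a' < b" "b < b'" using lt ab ab' ord by metis+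
      then show False using ab(3) ab'(3) x unfolding pairings_def by blast
    qed
  qed
  ultimately show ?thesis unfolding pairings_def mem_Collect_eq by (intro conjI)
qed

text \<open>Moving an end past no left endpoint, and inserting a string around none, does not change
which left endpoints are separated.\<close>

lemma linked_after_move:
  assumes x: "x \<in> pairings I" and mono: "strict_mono_on (bdry_points I) (id(c := d))"
    and cut: "\<And>p t. p \<in> bdry_points I \<Longrightarrow> t \<in> {a, b} \<Longrightarrow> (id(c := d)) p \<le> t \<longleftrightarrow> p \<le> t"
    and uw: "u < w" "\<And>t. t \<in> {a, b} \<Longrightarrow> \<not> (u \<le> t \<and> t < w)"
  shows "linked (insert {u, w} (move_end c d x)) a b \<longleftrightarrow> linked x a b"
proof
  let ?f = "id(c := d)"
  assume L: "linked (insert {u, w} (move_end c d x)) a b"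
  show "linked x a b" unfolding linked_def
  proof (intro allI impI)
    fix p q assume pq: "p < q \<and> {p, q} \<in> x"
    have P: "p \<in> bdry_points I" "q \<in> bdry_points I" using pairing_pair[OF x, of p q] pq by auto
    have "?f p < ?f q" using mono P pq by (meson strict_mono_onD)
    moreover have "{?f p, ?f q} \<in> move_end c d x"
      using pq unfolding move_end_def by (metis image_eqI image_empty image_insert)
    ultimately have "?f p \<le> a \<and> a < ?f q \<longleftrightarrow> ?f p \<le> b \<and> b < ?f q" using L unfolding linked_def by blast
    then show "p \<le> a \<and> a < q \<longleftrightarrow> p \<le> b \<and> b < q"
      using cut[OF P(1)] cut[OF P(2)] by (simp add: not_le[symmetric] del: fun_upd_apply)
  qed
next
  let ?f = "id(c := d)"
  assume L: "linked x a b"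
  show "linked (insert {u, w} (move_end c d x)) a b" unfolding linked_def
  proof (intro allI impI)
    fix y z assume yz: "y < z \<and> {y, z} \<in> insert {u, w} (move_end c d x)"
    show "y \<le> a \<and> a < z \<longleftrightarrow> y \<le> b \<and> b < z"
    proof (cases "{y, z} = {u, w}")
      case True
      then have "y = u" "z = w" using yz uw(1) by (auto simp: doubleton_eq_iff)
      then show ?thesis using uw(2) by blast
    next
      case False
      then obtain e where e: "e \<in> x" "{y, z} = ?f ` e" using yz unfolding move_end_def by blast
      obtain p q where pq: "e = {p, q}" "p < q" "p \<in> bdry_points I" "q \<in> bdry_points I"
        using pairing_set[OF x e(1)] .
      have "?f p < ?f q" using mono pq by (meson strict_mono_onD)
      moreover have "{y, z} = {?f p, ?f q}" using e(2) unfolding pq(1) by simp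
      ultimately have "y = ?f p" "z = ?f q" using yz by (auto simp: doubleton_eq_iff simp del: fun_upd_apply)
      moreover have "p \<le> a \<and> a < q \<longleftrightarrow> p \<le> b \<and> b < q" using L pq e(1) unfolding linked_def by blast
      ultimately show ?thesis
        using cut[OF pq(3)] cut[OF pq(4)] by (simp add: not_le[symmetric] del: fun_upd_apply)
    qed
  qed
qed

text \<open>The two diagrams on the halved partition. In \<open>split_left\<close> the new shaded arc is cut off by a small
string around it; in \<open>split_right\<close> the small string cuts off the unshaded arc before it, which joins it to
the arc of the lower half.\<close>

definition split_left :: "real set \<Rightarrow> real set set \<Rightarrow> real set set" where
  "split_left J x = insert {middle J, middle (upper_half J)} (move_end (middle J) (middle (lower_half J)) x)"

definition split_right :: "real set \<Rightarrow> real set set \<Rightarrow> real set set" where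
  "split_right J x = insert {middle (lower_half J), middle J} (move_end (middle J) (middle (upper_half J)) x)"

lemma halve_map_eq:
  "halve_map Q I J = tl_extend I (\<lambda>x y. complex_of_real (1 / sqrt (Q - 1)) *
     (tl_basis (split_left J x) y - tl_basis (split_right J x) y))"
  by (simp add: halve_map_def Let_def split_left_def split_right_def)

context
  fixes I J x
  assumes I: "I \<in> dyadic_partitions" and J: "J \<in> I" and x: "x \<in> pairings I"
begin

private lemma sd: "standard_dyadic J"
  using dyadic_partitionsD(3)[OF I J] .

private lemma P_cases: "p \<in> bdry_points I \<Longrightarrow> p \<le> Inf J \<or> p = middle J \<or> Sup J \<le> p"
  using bdry_point_in_interval[OF I J, of p] by force

private lemma A_cases: "a \<in> Inf ` I \<Longrightarrow> a \<le> Inf J \<or> Sup J \<le> a"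
  using intervals_apart[OF I J] standard_dyadicD(3) dyadic_partitionsD(3)[OF I] by fastforce

private lemmas q = quarter_points[OF sd]

private lemma mono_left: "strict_mono_on (bdry_points I) (id(middle J := middle (lower_half J)))"
proof (rule strict_mono_onI)
  fix r s assume "r \<in> bdry_points I" "s \<in> bdry_points I" "r < s"
  then show "(id(middle J := middle (lower_half J))) r < (id(middle J := middle (lower_half J))) s"
    using P_cases[of r] P_cases[of s] q by auto
qed

private lemma mono_right: "strict_mono_on (bdry_points I) (id(middle J := middle (upper_half J)))"
proof (rule strict_mono_onI)
  fix r s assume "r \<in> bdry_points I" "s \<in> bdry_points I" "r < s"
  then show "(id(middle J := middle (upper_half J))) r < (id(middle J := middle (upper_half J))) s"
    using P_cases[of r] P_cases[of s] q by auto
qed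

private lemma image_move: "id(middle J := d) ` bdry_points I = insert d (bdry_points I - {middle J})"
  using bdry_mem(2)[OF I J] by (auto simp: image_iff)

private lemma quarter_not_bdry:
  "middle (lower_half J) \<notin> bdry_points I" "middle (upper_half J) \<notin> bdry_points I"
  using P_cases[of "middle (lower_half J)"] P_cases[of "middle (upper_half J)"] q by auto

lemma split_left_in_pairings: "split_left J x \<in> pairings (halve I J)"
  unfolding split_left_def
proof (rule pairing_after_move[OF x mono_left])
  show "bdry_points (halve I J) = insert (middle J) (insert (middle (upper_half J))
      (id(middle J := middle (lower_half J)) ` bdry_points I))"
    unfolding image_move bdry_points_halve[OF I J] using bdry_mem(2)[OF I J] by auto
next
  fix p assume "p \<in> id(middle J := middle (lower_half J)) ` bdry_points I"
  then show "\<not> (middle J < p \<and> p < middle (upper_half J))"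
    unfolding image_move using q P_cases[of p] by auto
qed (unfold image_move, use q quarter_not_bdry in auto)

lemma split_right_in_pairings: "split_right J x \<in> pairings (halve I J)"
  unfolding split_right_def
proof (rule pairing_after_move[OF x mono_right])
  show "bdry_points (halve I J) = insert (middle (lower_half J)) (insert (middle J)
      (id(middle J := middle (upper_half J)) ` bdry_points I))"
    unfolding image_move bdry_points_halve[OF I J] using bdry_mem(2)[OF I J] by auto
next
  fix p assume "p \<in> id(middle J := middle (upper_half J)) ` bdry_points I"
  then show "\<not> (middle (lower_half J) < p \<and> p < middle J)"
    unfolding image_move using q P_cases[of p] by auto
qed (unfold image_move, use q quarter_not_bdry in auto)

private lemma linked_left:
  assumes "a \<in> Inf ` I" "b \<in> Inf ` I"
  shows "linked (split_left J x) a b \<longleftrightarrow> linked x a b"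
  unfolding split_left_def
proof (rule linked_after_move[OF x mono_left])
  fix p t assume "p \<in> bdry_points I" "t \<in> {a, b}"
  then show "(id(middle J := middle (lower_half J))) p \<le> t \<longleftrightarrow> p \<le> t"
    using A_cases[of t] q assms by auto
next
  fix t assume "t \<in> {a, b}"
  then show "\<not> (middle J \<le> t \<and> t < middle (upper_half J))" using A_cases[of t] q assms by auto
qed (use q in simp)

private lemma linked_right:
  assumes "a \<in> Inf ` I" "b \<in> Inf ` I"
  shows "linked (split_right J x) a b \<longleftrightarrow> linked x a b"
  unfolding split_right_def
proof (rule linked_after_move[OF x mono_right])
  fix p t assume "p \<in> bdry_points I" "t \<in> {a, b}"
  then show "(id(middle J := middle (upper_half J))) p \<le> t \<longleftrightarrow> p \<le> t"
    using A_cases[of t] q assms by auto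
next
  fix t assume "t \<in> {a, b}"
  then show "\<not> (middle (lower_half J) \<le> t \<and> t < middle J)" using A_cases[of t] q assms by auto
qed (use q in simp)

private lemma not_linked_left: "a \<in> Inf ` I \<Longrightarrow> \<not> linked (split_left J x) a (middle J)"
proof
  assume a: "a \<in> Inf ` I" "linked (split_left J x) a (middle J)"
  have "{middle J, middle (upper_half J)} \<in> split_left J x" by (simp add: split_left_def)
  then have "middle J \<le> a \<and> a < middle (upper_half J)" using a(2) q unfolding linked_def by blast
  then show False using A_cases[OF a(1)] q by linarith
qed

private lemma linked_right_middle: "linked (split_right J x) (Inf J) (middle J)"
  unfolding linked_def
proof (intro allI impI)
  fix y z assume yz: "y < z \<and> {y, z} \<in> split_right J x"
  then have "y \<in> bdry_points (halve I J)" "z \<in> bdry_points (halve I J)"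
    using pairing_pair[OF split_right_in_pairings, of y z] by auto
  then have cases: "t \<le> Inf J \<or> t = middle (lower_half J) \<or> t = middle J \<or> t = middle (upper_half J) \<or> Sup J \<le> t"
    if "t \<in> {y, z}" for t
    using that P_cases unfolding bdry_points_halve[OF I J] by blast
  have "disjnt {y, z} {middle (lower_half J), middle J} \<or> {y, z} = {middle (lower_half J), middle J}"
  proof -
    have "partition_on (bdry_points (halve I J)) (split_right J x)"
      using split_right_in_pairings by (simp add: pairings_def)
    moreover have "{middle (lower_half J), middle J} \<in> split_right J x" by (simp add: split_right_def)
    ultimately show ?thesis
      using yz disjointD[OF partition_onD2] unfolding disjnt_def by meson
  qed
  then show "y \<le> Inf J \<and> Inf J < z \<longleftrightarrow> y \<le> middle J \<and> middle J < z"
  proof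
    assume "disjnt {y, z} {middle (lower_half J), middle J}"
    then have "t \<le> Inf J \<or> t = middle (upper_half J) \<or> Sup J \<le> t" if "t \<in> {y, z}" for t
      using cases[OF that] that by (auto simp: disjnt_def)
    then have "y \<le> Inf J \<or> y = middle (upper_half J) \<or> Sup J \<le> y" "z \<le> Inf J \<or> z = middle (upper_half J) \<or> Sup J \<le> z"
      by blast+
    then show ?thesis using q by linarith
  next
    assume "{y, z} = {middle (lower_half J), middle J}"
    then have "y = middle (lower_half J)" "z = middle J" using yz q by (auto simp: doubleton_eq_iff)
    then show ?thesis using q by auto
  qed
qed

lemma spin_compat_split_left:
  "spin_compat (Inf ` halve I J) (split_left J x) s \<longleftrightarrow> spin_compat (Inf ` I) x s"
proof -
  have "linked (split_left J x) (middle J) a \<Longrightarrow> a \<notin> Inf ` I" for a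
    using not_linked_left linked_sym by blast
  then show ?thesis
    unfolding Inf_halve[OF I J] spin_compat_def using linked_left not_linked_left by blast
qed

lemma spin_compat_split_right:
  "spin_compat (Inf ` halve I J) (split_right J x) s \<longleftrightarrow>
     spin_compat (Inf ` I) x s \<and> s (Inf J) = s (middle J)"
proof
  assume *: "spin_compat (Inf ` halve I J) (split_right J x) s"
  then show "spin_compat (Inf ` I) x s \<and> s (Inf J) = s (middle J)"
    unfolding Inf_halve[OF I J] spin_compat_def using linked_right linked_right_middle J by blast
next
  assume *: "spin_compat (Inf ` I) x s \<and> s (Inf J) = s (middle J)"
  \<comment> \<open>The new left endpoint can be traded for the one to which it is linked.\<close>
  define h where "h a = (if a = middle J then Inf J else a)" for a
  have h: "h a \<in> Inf ` I" "linked (split_right J x) a (h a)" "s (h a) = s a" if "a \<in> insert (middle J) (Inf ` I)" for a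
    using that J * linked_right_middle linked_sym unfolding h_def by (auto simp: linked_def)
  show "spin_compat (Inf ` halve I J) (split_right J x) s"
    unfolding Inf_halve[OF I J] spin_compat_def
  proof (intro ballI impI)
    fix a b assume ab: "a \<in> insert (middle J) (Inf ` I)" "b \<in> insert (middle J) (Inf ` I)"
      "linked (split_right J x) a b"
    then have "linked (split_right J x) (h a) (h b)" using h(2) linked_sym linked_trans by meson
    then have "linked x (h a) (h b)" using linked_right[OF h(1)[OF ab(1)] h(1)[OF ab(2)]] by blast
    then have "s (h a) = s (h b)" using * h(1)[OF ab(1)] h(1)[OF ab(2)] unfolding spin_compat_def by blast
    then show "s a = s b" using h(3)[OF ab(1)] h(3)[OF ab(2)] by simp
  qed
qed

end

section \<open>Linear extension of maps on diagrams\<close>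

lemma tl_extend_add: "tl_extend I f (\<lambda>x. v x + w x) = (\<lambda>y. tl_extend I f v y + tl_extend I f w y)"
  by (simp add: tl_extend_def fun_eq_iff distrib_right sum.distrib)

lemma tl_extend_scale: "tl_extend I f (\<lambda>x. c * v x) = (\<lambda>y. c * tl_extend I f v y)"
  by (simp add: tl_extend_def fun_eq_iff sum_distrib_left mult.assoc)

lemma tl_extend_basis:
  assumes "finite (pairings I)" "x \<in> pairings I"
  shows "tl_extend I f (tl_basis x) = f x"
  using assms by (simp add: tl_extend_def tl_basis_def fun_eq_iff if_distrib[of "\<lambda>u. u * _"] of_bool_def
      cong: if_cong)

lemma tl_extend_extend:
  "tl_extend I' g (tl_extend I f v) = tl_extend I (\<lambda>x. tl_extend I' g (f x)) v"
  unfolding tl_extend_def fun_eq_iff sum_distrib_left sum_distrib_right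
  by (subst sum.swap) (simp add: mult.assoc)

lemma tl_extend_cong: "(\<And>x. x \<in> pairings I \<Longrightarrow> f x = g x) \<Longrightarrow> tl_extend I f v = tl_extend I g v"
  by (simp add: tl_extend_def)

lemma tl_basis_in_tl_space: "x \<in> pairings I \<Longrightarrow> tl_basis x \<in> tl_space I"
  by (auto simp: tl_space_def tl_basis_def)

lemma tl_extend_in_tl_space:
  "(\<And>x. x \<in> pairings I \<Longrightarrow> f x \<in> tl_space I') \<Longrightarrow> tl_extend I f v \<in> tl_space I'"
  by (simp add: tl_space_def tl_extend_def)

lemma tl_space_add: "v \<in> tl_space I \<Longrightarrow> w \<in> tl_space I \<Longrightarrow> (\<lambda>x. v x + w x) \<in> tl_space I"
  and tl_space_scale: "v \<in> tl_space I \<Longrightarrow> (\<lambda>x. c * v x) \<in> tl_space I"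
  by (simp_all add: tl_space_def)

lemma halve_map_in_tl_space:
  assumes "I \<in> dyadic_partitions" "J \<in> I"
  shows "halve_map Q I J v \<in> tl_space (halve I J)"
  unfolding halve_map_eq
  using split_left_in_pairings[OF assms] split_right_in_pairings[OF assms]
  by (intro tl_extend_in_tl_space) (auto simp: tl_space_def tl_basis_def)

lemma halve_map_add: "halve_map Q I J (\<lambda>x. v x + w x) = (\<lambda>y. halve_map Q I J v y + halve_map Q I J w y)"
  by (simp add: halve_map_eq tl_extend_add)

lemma halve_map_scale: "halve_map Q I J (\<lambda>x. c * v x) = (\<lambda>y. c * halve_map Q I J v y)"
  by (simp add: halve_map_eq tl_extend_scale)

lemma spin_coeff_extend:
  "spin_coeff I' (tl_extend I f v) s = (\<Sum>x\<in>pairings I. v x * spin_coeff I' (f x) s)"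
  unfolding spin_coeff_def tl_extend_def sum_distrib_left sum_distrib_right
  by (subst sum.swap) (simp add: mult.assoc)

lemma spin_coeff_basis:
  assumes "finite (pairings I)" "x \<in> pairings I"
  shows "spin_coeff I (tl_basis x) s = of_bool (spin_compat (Inf ` I) x s)"
  using assms by (simp add: spin_coeff_def tl_basis_def if_distrib[of "\<lambda>u. u * _"] of_bool_def
      cong: if_cong)

lemma spin_coeff_diff: "spin_coeff I (\<lambda>y. v y - w y) s = spin_coeff I v s - spin_coeff I w s"
  by (simp add: spin_coeff_def left_diff_distrib sum_subtractf)

text \<open>The isolated new arc admits both spins and the joined one only the old spin; the difference of the
two diagrams keeps exactly the configurations with opposite spins.\<close>

lemma spin_coeff_halve:
  assumes I: "I \<in> dyadic_partitions" and J: "J \<in> I"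
  shows "spin_coeff (halve I J) (halve_map 2 I J v) s =
    (if s (Inf J) \<noteq> s (middle J) then spin_coeff I v s else 0)"
proof -
  have fin: "finite (pairings (halve I J))" using finite_pairings[OF halve_in_dyadic_partitions[OF I J]] .
  have "spin_coeff (halve I J) (\<lambda>y. tl_basis (split_left J x) y - tl_basis (split_right J x) y) s =
      of_bool (spin_compat (Inf ` I) x s) * of_bool (s (Inf J) \<noteq> s (middle J))" if x: "x \<in> pairings I" for x
    using spin_compat_split_left[OF I J x] spin_compat_split_right[OF I J x]
    by (simp add: spin_coeff_diff spin_coeff_basis[OF fin] split_left_in_pairings[OF I J x]
        split_right_in_pairings[OF I J x])
  then have "spin_coeff (halve I J) (halve_map 2 I J v) s =
      (\<Sum>x\<in>pairings I. v x * (of_bool (spin_compat (Inf ` I) x s) * of_bool (s (Inf J) \<noteq> s (middle J))))"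
    unfolding halve_map_eq spin_coeff_extend by (intro sum.cong refl) simp
  then show ?thesis by (simp add: spin_coeff_def)
qed

lemma insert_move_end_commute:
  assumes "c1 \<noteq> c2" "d1 \<noteq> c2" "d2 \<noteq> c1" "c2 \<notin> {a1, b1}" "c1 \<notin> {a2, b2}"
  shows "insert {a2, b2} (move_end c2 d2 (insert {a1, b1} (move_end c1 d1 x))) =
    insert {a1, b1} (move_end c1 d1 (insert {a2, b2} (move_end c2 d2 x)))"
proof -
  have "id(c2 := d2) \<circ> id(c1 := d1) = id(c1 := d1) \<circ> id(c2 := d2)" using assms by (auto simp: fun_eq_iff)
  then have "(\<lambda>s. id(c2 := d2) ` id(c1 := d1) ` s) = (\<lambda>s. id(c1 := d1) ` id(c2 := d2) ` s)"
    by (simp only: image_comp)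
  then have "move_end c2 d2 (move_end c1 d1 x) = move_end c1 d1 (move_end c2 d2 x)"
    unfolding move_end_def image_image by metis
  moreover have "id(c2 := d2) ` {a1, b1} = {a1, b1}" "id(c1 := d1) ` {a2, b2} = {a2, b2}"
    using assms by auto
  ultimately show ?thesis by (auto simp: move_end_def image_image simp del: fun_upd_apply)
qed

text \<open>The points that are moved or joined for two different intervals are all distinct.\<close>

lemma halve_commute:
  assumes I: "I \<in> dyadic_partitions" and JK: "J \<in> I" "K \<in> I" "J \<noteq> K"
  shows "K \<in> halve I J" "halve (halve I J) K = halve (halve I K) J"
    "halve_map Q (halve I J) K (halve_map Q I J v) = halve_map Q (halve I K) J (halve_map Q I K v)"
proof -
  have sdJ: "standard_dyadic J" and sdK: "standard_dyadic K" using dyadic_partitionsD(3)[OF I] JK by auto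
  show KJ: "K \<in> halve I J" using JK by (auto simp: halve_def)
  have JK': "J \<in> halve I K" using JK by (auto simp: halve_def)
  have apart: "Sup J \<le> Inf K \<or> Sup K \<le> Inf J" using intervals_apart[OF I JK] .
  have ne: "lower_half L \<noteq> M \<and> upper_half L \<noteq> M"
    if "L = J \<and> M = K \<or> L = K \<and> M = J" for L M
  proof -
    have "Inf (lower_half L) \<noteq> Inf M" "Inf (upper_half L) \<noteq> Inf M"
      using that apart standard_dyadicD(3)[OF sdJ] standard_dyadicD(3)[OF sdK]
        middle_between[OF sdJ] middle_between[OF sdK]
      by (auto simp: half_simps[OF sdJ] half_simps[OF sdK])
    then show ?thesis by auto
  qed
  show "halve (halve I J) K = halve (halve I K) J"
    unfolding halve_def using JK ne[of J K] ne[of K J] by auto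
  note dJ = halve_in_dyadic_partitions[OF I JK(1)] and dK = halve_in_dyadic_partitions[OF I JK(2)]
  note qJ = quarter_points[OF sdJ] and qK = quarter_points[OF sdK]
  have comm: "split_left K (split_left J x) = split_left J (split_left K x)"
    "split_right K (split_right J x) = split_right J (split_right K x)"
    "split_left K (split_right J x) = split_right J (split_left K x)"
    "split_right K (split_left J x) = split_left J (split_right K x)" for x
    unfolding split_left_def split_right_def
    by (rule insert_move_end_commute; use apart qJ qK in auto)+
  have expand: "halve_map Q (halve I L) M (halve_map Q I L v) = tl_extend I (\<lambda>x y. complex_of_real (1 / sqrt (Q - 1)) *
      (complex_of_real (1 / sqrt (Q - 1)) * (tl_basis (split_left M (split_left L x)) y - tl_basis (split_right M (split_left L x)) y)
     - complex_of_real (1 / sqrt (Q - 1)) * (tl_basis (split_left M (split_right L x)) y - tl_basis (split_right M (split_right L x)) y))) v"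
    if L: "L \<in> I" for L M
  proof -
    note fin = finite_pairings[OF halve_in_dyadic_partitions[OF I L]]
    define k where "k = complex_of_real (1 / sqrt (Q - 1))"
    let ?g = "\<lambda>x y. k * (tl_basis (split_left M x) y - tl_basis (split_right M x) y)"
    have "tl_extend (halve I L) ?g (\<lambda>y. k * (tl_basis (split_left L x) y - tl_basis (split_right L x) y)) =
        (\<lambda>y. k * (?g (split_left L x) y - ?g (split_right L x) y))" if x: "x \<in> pairings I" for x
    proof -
      have "(\<lambda>y. k * (tl_basis (split_left L x) y - tl_basis (split_right L x) y)) =
          (\<lambda>y. k * (tl_basis (split_left L x) y + - 1 * tl_basis (split_right L x) y))" by simp
      then show ?thesis
        by (simp only: tl_extend_scale tl_extend_add tl_extend_basis[OF fin split_left_in_pairings[OF I L x]]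
            tl_extend_basis[OF fin split_right_in_pairings[OF I L x]])
          (simp add: fun_eq_iff algebra_simps)
    qed
    then show ?thesis unfolding halve_map_eq tl_extend_extend k_def[symmetric] by (rule tl_extend_cong)
  qed
  show "halve_map Q (halve I J) K (halve_map Q I J v) = halve_map Q (halve I K) J (halve_map Q I K v)"
    unfolding expand[OF JK(1)] expand[OF JK(2)] comm
    by (rule arg_cong[where f = "\<lambda>f. tl_extend I f v"]) (simp add: fun_eq_iff algebra_simps)
qed

section \<open>Paths of halvings\<close>

lemma halve_stepI: "I \<in> dyadic_partitions \<Longrightarrow> J \<in> I \<Longrightarrow> v \<in> tl_space I \<Longrightarrow>
    ((I, v), (halve I J, halve_map Q I J v)) \<in> halve_step Q"
  by (auto simp: halve_step_def)

lemma halve_stepE: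
  assumes "((I, v), b) \<in> halve_step Q"
  obtains J where "I \<in> dyadic_partitions" "J \<in> I" "v \<in> tl_space I" "b = (halve I J, halve_map Q I J v)"
  using assms by (auto simp: halve_step_def)

lemma halve_step_closed:
  assumes "(a, b) \<in> (halve_step Q)\<^sup>*" "a \<in> Sigma dyadic_partitions tl_space"
  shows "b \<in> Sigma dyadic_partitions tl_space"
  using assms by (induction rule: rtrancl_induct)
    (auto simp: halve_step_def halve_in_dyadic_partitions halve_map_in_tl_space)

lemma halved_interval_gone:
  assumes "((I, v), (K, w)) \<in> (halve_step Q)\<^sup>*" "I \<in> dyadic_partitions"
    "J \<in> dyadic_partitions" "A \<in> J" "I = halve J A"
  shows "A \<notin> K"
proof -
  note sd = dyadic_partitionsD(3)[OF assms(3,4)]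
  have "\<forall>B\<in>K. (\<exists>C\<in>I. B \<subseteq> C) \<and> B \<noteq> {}"
    using assms(1)
  proof (induction "(K, w)" arbitrary: K w rule: rtrancl_induct)
    case base
    show ?case using partition_onD3[OF dyadic_partitionsD(2)[OF assms(2)]] by auto
  next
    case (step y)
    obtain L z where y: "y = (L, z)" by (cases y)
    obtain M where M: "L \<in> dyadic_partitions" "M \<in> L" "K = halve L M"
      using step(2) unfolding y by (auto elim: halve_stepE)
    have "lower_half M \<subseteq> M" "upper_half M \<subseteq> M" "lower_half M \<noteq> {}" "upper_half M \<noteq> {}"
      using halves[OF dyadic_partitionsD(3)[OF M(1,2)]] by auto
    note half = this
    have L: "(\<exists>C\<in>I. B \<subseteq> C) \<and> B \<noteq> {}" if "B \<in> L" for B using step(3)[OF y] that by (rule bspec)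
    then obtain C where C: "C \<in> I" "M \<subseteq> C" using M(2) by blast
    show ?case
    proof
      fix B assume "B \<in> K"
      then consider "B \<in> L" | "B = lower_half M" | "B = upper_half M" unfolding M(3) halve_def by blast
      then show "(\<exists>C\<in>I. B \<subseteq> C) \<and> B \<noteq> {}"
      proof cases
        case 1
        then show ?thesis by (rule L)
      next
        case 2
        have "B \<subseteq> C" "B \<noteq> {}" unfolding 2 using half(1,3) C(2) by auto
        then show ?thesis using C(1) by blast
      next
        case 3
        have "B \<subseteq> C" "B \<noteq> {}" unfolding 3 using half(2,4) C(2) by auto
        then show ?thesis using C(1) by blast
      qed
    qed
  qed
  moreover have "\<not> A \<subseteq> C" if "C \<in> I" for C
  proof (cases "C \<in> J - {A}")
    case True
    then have "A \<inter> C = {}"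
      using partition_onD2[OF dyadic_partitionsD(2)[OF assms(3)]] assms(4) by (auto simp: disjoint_def)
    moreover have "A \<noteq> {}" using partition_onD3[OF dyadic_partitionsD(2)[OF assms(3)]] assms(4) by auto
    ultimately show ?thesis by blast
  next
    case False
    then have "C = lower_half A \<or> C = upper_half A" using that unfolding assms(5) halve_def by blast
    then show ?thesis using halves[OF sd] by blast
  qed
  ultimately show ?thesis by blast
qed

text \<open>An interval that has to be halved at some time can be halved first, because halvings of different
intervals commute.\<close>

lemma halve_early:
  assumes "((I, v), (K, w)) \<in> (halve_step Q)\<^sup>*" "J \<in> I" "J \<notin> K" "I \<in> dyadic_partitions" "v \<in> tl_space I"
  shows "((halve I J, halve_map Q I J v), (K, w)) \<in> (halve_step Q)\<^sup>*"
  using assms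
proof (induction "(I, v)" arbitrary: I v rule: converse_rtrancl_induct)
  case base
  then show ?case by blast
next
  case (step z)
  obtain L where L: "L \<in> I" "z = (halve I L, halve_map Q I L v)" using step(1) by (auto elim: halve_stepE)
  show ?case
  proof (cases "L = J")
    case True
    then show ?thesis using step(2) L(2) by simp
  next
    case False
    note comm = halve_commute[OF step(6) L(1) step(4) False]
    have "((halve (halve I L) J, halve_map Q (halve I L) J (halve_map Q I L v)), (K, w)) \<in> (halve_step Q)\<^sup>*"
      using step(3)[OF L(2) comm(1) step(5)] halve_in_dyadic_partitions[OF step(6) L(1)]
        halve_map_in_tl_space[OF step(6) L(1)] by blast
    moreover have "((halve I J, halve_map Q I J v), (halve (halve I J) L, halve_map Q (halve I J) L (halve_map Q I J v)))
        \<in> halve_step Q"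
      using halve_commute(1)[OF step(6) step(4) L(1)] False halve_in_dyadic_partitions[OF step(6,4)]
        halve_map_in_tl_space[OF step(6,4)] by (intro halve_stepI) auto
    ultimately show ?thesis unfolding comm(2,3) by (rule converse_rtrancl_into_rtrancl[rotated])
  qed
qed

lemma card_halve:
  assumes "I \<in> dyadic_partitions" "J \<in> I"
  shows "card (halve I J) = Suc (card I)"
proof -
  note h = halve_in_dyadic_partitions[OF assms] and sd = dyadic_partitionsD(3)[OF assms]
  have "middle J \<notin> Inf ` I"
  proof
    assume "middle J \<in> Inf ` I"
    then obtain K where K: "K \<in> I" "middle J = Inf K" by auto
    have "K = J"
      using interval_unique[OF assms(1) K(1) assms(2), of "middle J"] K
        middle_between[OF sd] standard_dyadicD(3)[OF dyadic_partitionsD(3)[OF assms(1) K(1)]] by auto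
    then show False using K(2) middle_between[OF sd] by simp
  qed
  then have "card (Inf ` halve I J) = Suc (card (Inf ` I))"
    using Inf_halve[OF assms] dyadic_partitionsD(1)[OF assms(1)] by simp
  then show ?thesis using card_image[OF Inf_inj_on[OF h]] card_image[OF Inf_inj_on[OF assms(1)]] by simp
qed

lemma card_path:
  assumes "(a, b) \<in> (halve_step Q)\<^sup>*"
  shows "card (fst a) \<le> card (fst b)"
  using assms by (induction rule: rtrancl_induct) (auto simp: halve_step_def card_halve)

text \<open>The connecting map does not depend on the order of the halvings: the first halving of one sequence
can be moved to the front of the other one.\<close>

lemma path_unique:
  assumes "((I, v), (K, w)) \<in> (halve_step Q)\<^sup>*" "((I, v), (K, w')) \<in> (halve_step Q)\<^sup>*"
    "I \<in> dyadic_partitions" "v \<in> tl_space I"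
  shows "w = w'"
  using assms
proof (induction "(I, v)" arbitrary: I v rule: converse_rtrancl_induct)
  case base
  from base(1) show ?case
  proof (cases rule: converse_rtranclE)
    case (step z)
    obtain J where J: "K \<in> dyadic_partitions" "J \<in> K" "z = (halve K J, halve_map Q K J w)"
      using step(1) by (auto elim: halve_stepE)
    \<comment> \<open>Halving increases the number of intervals, so there is no way back to \<open>K\<close>.\<close>
    then show ?thesis using card_path[OF step(2)] card_halve[OF J(1,2)] by simp
  qed simp
next
  case (step z)
  obtain J where J: "J \<in> I" "z = (halve I J, halve_map Q I J v)" using step(1) by (auto elim: halve_stepE)
  note h = halve_in_dyadic_partitions[OF step(5) J(1)] and m = halve_map_in_tl_space[OF step(5) J(1)]
  have "J \<notin> K" using halved_interval_gone[OF step(2)[unfolded J(2)] h step(5) J(1)] by simp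
  then have "((halve I J, halve_map Q I J v), (K, w')) \<in> (halve_step Q)\<^sup>*"
    using halve_early[OF step(4) J(1)] step(5,6) by blast
  then show ?case using step(3)[OF J(2)] h m by blast
qed

text \<open>By uniqueness of connecting maps this says that they are linear.\<close>

lemma path_linear:
  assumes "((I, v), (K, v')) \<in> (halve_step Q)\<^sup>*" "I \<in> dyadic_partitions" "v \<in> tl_space I" "w \<in> tl_space I"
  shows "\<exists>w'. ((I, w), (K, w')) \<in> (halve_step Q)\<^sup>* \<and>
    ((I, \<lambda>x. v x + w x), (K, \<lambda>x. v' x + w' x)) \<in> (halve_step Q)\<^sup>* \<and>
    ((I, \<lambda>x. c * v x), (K, \<lambda>x. c * v' x)) \<in> (halve_step Q)\<^sup>*"
  using assms
proof (induction "(I, v)" arbitrary: I v w rule: converse_rtrancl_induct)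
  case base
  show ?case by (intro exI[of _ w] conjI rtrancl_refl)
next
  case (step z)
  obtain J where J: "J \<in> I" "z = (halve I J, halve_map Q I J v)" using step(1) by (auto elim: halve_stepE)
  note h = halve_in_dyadic_partitions[OF step(4) J(1)] and m = halve_map_in_tl_space[OF step(4) J(1)]
  obtain w' where w': "((halve I J, halve_map Q I J w), (K, w')) \<in> (halve_step Q)\<^sup>*"
    "((halve I J, \<lambda>x. halve_map Q I J v x + halve_map Q I J w x), (K, \<lambda>x. v' x + w' x)) \<in> (halve_step Q)\<^sup>*"
    "((halve I J, \<lambda>x. c * halve_map Q I J v x), (K, \<lambda>x. c * v' x)) \<in> (halve_step Q)\<^sup>*"
    using step(3)[OF J(2) h m m] by blast
  have first: "((I, u), (K, u')) \<in> (halve_step Q)\<^sup>*"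
    if "((halve I J, halve_map Q I J u), (K, u')) \<in> (halve_step Q)\<^sup>*" "u \<in> tl_space I" for u u'
    using halve_stepI[OF step(4) J(1) that(2)] that(1) by (rule converse_rtrancl_into_rtrancl)
  show ?case
    using first[OF w'(1) step(6)] first[OF w'(2)[folded halve_map_add] tl_space_add[OF step(5,6)]]
      first[OF w'(3)[folded halve_map_scale] tl_space_scale[OF step(5)]] by blast
qed

section \<open>Uniform partitions\<close>

definition dyadic_interval :: "nat \<Rightarrow> nat \<Rightarrow> real set" where
  "dyadic_interval n p = {real p / 2 ^ n ..< (real p + 1) / 2 ^ n}"

lemma Inf_Sup_dyadic_interval [simp]:
  "Inf (dyadic_interval n p) = real p / 2 ^ n" "Sup (dyadic_interval n p) = (real p + 1) / 2 ^ n"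
  by (simp_all add: dyadic_interval_def divide_strict_right_mono)

lemma standard_dyadic_iff: "standard_dyadic J \<longleftrightarrow> (\<exists>n p. p < 2 ^ n \<and> J = dyadic_interval n p)"
  by (simp add: standard_dyadic_def dyadic_interval_def)

definition uniform :: "nat \<Rightarrow> real set set" where
  "uniform n = dyadic_interval n ` {..<2 ^ n}"

lemma uniform_in_dyadic_partitions: "uniform n \<in> dyadic_partitions"
proof -
  have "partition_on circle (uniform n)"
  proof (rule partition_onI)
    show "\<Union>(uniform n) = circle"
    proof (intro equalityI subsetI)
      fix t assume "t \<in> \<Union>(uniform n)"
      then obtain p where p: "p < 2 ^ n" "t \<in> dyadic_interval n p" by (auto simp: uniform_def)
      have sd: "standard_dyadic (dyadic_interval n p)" using p by (auto simp: standard_dyadic_iff)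
      have "Inf (dyadic_interval n p) \<le> t" "t < Sup (dyadic_interval n p)"
        using p(2) standard_dyadic_mem[OF sd] by blast+
      then show "t \<in> circle"
        using standard_dyadicD(2,4)[OF sd] by (meson atLeastLessThan_iff order_trans order_less_le_trans)
    next
      fix t :: real assume t: "t \<in> circle"
      define p where "p = nat \<lfloor>t * 2 ^ n\<rfloor>"
      have "0 \<le> t * 2 ^ n" "t * 2 ^ n < 2 ^ n" using t by auto
      then have p: "real p \<le> t * 2 ^ n" "t * 2 ^ n < real p + 1" "p < 2 ^ n"
        unfolding p_def by (auto simp: floor_less_iff nat_less_iff of_nat_nat)
      then have "t \<in> dyadic_interval n p" by (simp add: dyadic_interval_def field_simps)
      then show "t \<in> \<Union>(uniform n)" using p(3) by (auto simp: uniform_def)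
    qed
    show "{} \<notin> uniform n" by (auto simp: uniform_def dyadic_interval_def divide_strict_right_mono not_le)
    fix A B assume AB: "A \<in> uniform n" "B \<in> uniform n" "A \<noteq> B"
    then obtain p q where pq: "A = dyadic_interval n p" "B = dyadic_interval n q" "p \<noteq> q" by (auto simp: uniform_def)
    show "disjnt A B"
    proof (rule ccontr)
      assume "\<not> disjnt A B"
      then obtain t where "t \<in> A" "t \<in> B" by (auto simp: disjnt_def)
      then have "real p \<le> t * 2 ^ n" "t * 2 ^ n < real p + 1" "real q \<le> t * 2 ^ n" "t * 2 ^ n < real q + 1"
        by (auto simp: pq dyadic_interval_def field_simps)
      then show False using pq(3) by linarith
    qed
  qed
  then show ?thesis by (auto simp: dyadic_partitions_def uniform_def standard_dyadic_iff)
qed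

text \<open>The partition is refined by the uniform partition of level \<open>N\<close>.\<close>

definition level_le :: "nat \<Rightarrow> real set set \<Rightarrow> bool" where
  "level_le N I \<longleftrightarrow> I \<in> dyadic_partitions \<and> (\<forall>J\<in>I. \<exists>n\<le>N. \<exists>p<2 ^ n. J = dyadic_interval n p)"

lemma level_le_exists:
  assumes "I \<in> dyadic_partitions"
  obtains N where "\<And>M. M \<ge> N \<Longrightarrow> level_le M I"
proof -
  have *: "\<exists>N. \<forall>J\<in>S. \<exists>n\<le>N. \<exists>p<2 ^ n. J = dyadic_interval n p" if "finite S" "\<forall>J\<in>S. standard_dyadic J" for S
    using that
  proof (induction S rule: finite_induct)
    case (insert J S)
    then obtain N where N: "\<forall>J\<in>S. \<exists>n\<le>N. \<exists>p<2 ^ n. J = dyadic_interval n p" by auto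
    obtain n p where "p < 2 ^ n" "J = dyadic_interval n p" using insert.prems by (auto simp: standard_dyadic_iff)
    then show ?case using N by (intro exI[of _ "max n N"]) (metis insert_iff le_max_iff_disj order_refl)
  qed auto
  obtain N where "\<forall>J\<in>I. \<exists>n\<le>N. \<exists>p<2 ^ n. J = dyadic_interval n p"
    using *[of I] dyadic_partitionsD(1,3)[OF assms] by blast
  then have "level_le M I" if "M \<ge> N" for M
    using that assms unfolding level_le_def by (meson order_trans)
  then show thesis using that by blast
qed

text \<open>Uniform partitions serve as common refinements: an interval of a partition that is not yet of
level \<open>N\<close> can be halved, and each halving uses up one of the finitely many points of the grid.\<close>

lemma path_to_uniform:
  assumes "level_le N I" "v \<in> tl_space I"
  shows "\<exists>w. ((I, v), (uniform N, w)) \<in> (halve_step Q)\<^sup>*"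
  using assms
proof (induction "card (Inf ` uniform N - Inf ` I)" arbitrary: I v rule: less_induct)
  case less
  have I: "I \<in> dyadic_partitions" using less.prems by (simp add: level_le_def)
  show ?case
  proof (cases "I \<subseteq> uniform N")
    case True
    have "uniform N \<subseteq> I"
    proof
      fix K assume K: "K \<in> uniform N"
      have "Inf K \<in> circle"
        using bdry_points_subset[OF uniform_in_dyadic_partitions] bdry_mem(1)[OF uniform_in_dyadic_partitions K] by blast
      then obtain J where J: "J \<in> I" "Inf J \<le> Inf K" "Inf K < Sup J" using circle_in_interval[OF I] by blast
      have "J = K"
        using interval_unique[OF uniform_in_dyadic_partitions, of J N K "Inf K"] True J K
          standard_dyadicD(3)[OF dyadic_partitionsD(3)[OF uniform_in_dyadic_partitions K]] by auto
      then show "K \<in> I" using J by simp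
    qed
    then show ?thesis using True by auto
  next
    case False
    then obtain J where J: "J \<in> I" "J \<notin> uniform N" by auto
    then obtain n p where np: "n \<le> N" "p < 2 ^ n" "J = dyadic_interval n p"
      using less.prems by (auto simp: level_le_def)
    have nN: "Suc n \<le> N" using np J(2) by (cases "n = N") (auto simp: uniform_def)
    have mid: "middle J = real (2 * p + 1) / 2 ^ Suc n"
      by (simp add: middle_def np(3) field_simps)
    have "real (2 * p) / 2 ^ Suc n = Inf J" "(real (2 * p) + 1) / 2 ^ Suc n = middle J"
      "real (2 * p + 1) / 2 ^ Suc n = middle J" "(real (2 * p + 1) + 1) / 2 ^ Suc n = Sup J"
      by (simp_all add: middle_def np(3) field_simps)
    then have halves: "lower_half J = dyadic_interval (Suc n) (2 * p)" "upper_half J = dyadic_interval (Suc n) (2 * p + 1)"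
      unfolding lower_half_def upper_half_def dyadic_interval_def by simp_all
    note h = halve_in_dyadic_partitions[OF I J(1)]
    have lev: "level_le N (halve I J)"
      unfolding level_le_def
    proof (intro conjI ballI h)
      fix K assume "K \<in> halve I J"
      then consider "K \<in> I" | "K = dyadic_interval (Suc n) (2 * p)" | "K = dyadic_interval (Suc n) (2 * p + 1)"
        unfolding halve_def halves by auto
      then show "\<exists>n\<le>N. \<exists>p<2 ^ n. K = dyadic_interval n p"
      proof cases
        case 1
        then show ?thesis using less.prems by (auto simp: level_le_def)
      next
        case 2
        have "2 * p < 2 ^ Suc n" using np(2) by simp
        then show ?thesis using nN 2 by blast
      next
        case 3
        have "2 * p + 1 < 2 ^ Suc n" using np(2) by simp
        then show ?thesis using nN 3 by blast
      qed
    qed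
    have "middle J \<in> Inf ` uniform N - Inf ` I"
    proof
      have "2 * p + 1 < 2 ^ Suc n" using np(2) by simp
      then have "(2 * p + 1) * 2 ^ (N - Suc n) < 2 ^ Suc n * 2 ^ (N - Suc n)" by (intro mult_strict_right_mono) auto
      also have "\<dots> = 2 ^ N" using nN by (metis le_add_diff_inverse power_add)
      finally have lt: "(2 * p + 1) * 2 ^ (N - Suc n) < 2 ^ N" .
      have "(2 :: real) ^ N = 2 ^ Suc n * 2 ^ (N - Suc n)" using nN by (metis le_add_diff_inverse power_add)
      then have "middle J = Inf (dyadic_interval N ((2 * p + 1) * 2 ^ (N - Suc n)))"
        unfolding mid Inf_Sup_dyadic_interval by (simp add: field_simps)
      then show "middle J \<in> Inf ` uniform N" using lt unfolding uniform_def by blast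
      show "middle J \<notin> Inf ` I"
        using card_halve[OF I J(1)] card_image[OF Inf_inj_on[OF h]] card_image[OF Inf_inj_on[OF I]]
        unfolding Inf_halve[OF I J(1)] by (metis insert_absorb n_not_Suc_n)
    qed
    moreover have "Inf ` uniform N - Inf ` halve I J = (Inf ` uniform N - Inf ` I) - {middle J}"
      unfolding Inf_halve[OF I J(1)] by auto
    moreover have "finite (Inf ` uniform N - Inf ` I)" by (simp add: uniform_def)
    ultimately have "card (Inf ` uniform N - Inf ` halve I J) < card (Inf ` uniform N - Inf ` I)"
      by (metis card_Diff1_less)
    from less.hyps[OF this lev halve_map_in_tl_space[OF I J(1)]]
    obtain w where "((halve I J, halve_map Q I J v), (uniform N, w)) \<in> (halve_step Q)\<^sup>*" by blast
    then show ?thesis using halve_stepI[OF I J(1) less.prems(2)] by (meson converse_rtrancl_into_rtrancl)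
  qed
qed

section \<open>Dyadic numbers and cyclic order\<close>

lemma dyadic_iff: "x \<in> dyadic \<longleftrightarrow> (\<exists>n. x * 2 ^ n \<in> \<int>)"
proof
  assume "x \<in> dyadic"
  then obtain m :: int and n where "x = of_int m / 2 ^ n" by (auto simp: dyadic_def)
  then show "\<exists>n. x * 2 ^ n \<in> \<int>" by (intro exI[of _ n]) simp
next
  assume "\<exists>n. x * 2 ^ n \<in> \<int>"
  then obtain n and m :: int where "x * 2 ^ n = of_int m" by (auto elim: Ints_cases)
  then have "x = of_int m / 2 ^ n" by (simp add: field_simps)
  then show "x \<in> dyadic" by (auto simp: dyadic_def)
qed

lemma dyadic_scaled_Ints:
  assumes "x * 2 ^ n \<in> \<int>" "n \<le> m"
  shows "(x :: real) * 2 ^ m \<in> \<int>"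
proof -
  have "(2 :: real) ^ m = 2 ^ n * 2 ^ (m - n)" using assms(2) by (metis le_add_diff_inverse power_add)
  then have "x * 2 ^ m = (x * 2 ^ n) * 2 ^ (m - n)" by (simp only: mult.assoc)
  also have "\<dots> \<in> \<int>" by (rule Ints_mult[OF assms(1)]) simp
  finally show ?thesis .
qed

lemma dyadic_add [intro]: "x \<in> dyadic \<Longrightarrow> y \<in> dyadic \<Longrightarrow> x + y \<in> dyadic"
proof -
  assume "x \<in> dyadic" "y \<in> dyadic"
  then obtain m n where "x * 2 ^ m \<in> \<int>" "y * 2 ^ n \<in> \<int>" by (auto simp: dyadic_iff)
  then have "x * 2 ^ max m n \<in> \<int>" "y * 2 ^ max m n \<in> \<int>" using dyadic_scaled_Ints by auto
  then have "(x + y) * 2 ^ max m n \<in> \<int>" by (simp add: distrib_right)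
  then show "x + y \<in> dyadic" by (auto simp: dyadic_iff)
qed

lemma dyadic_Ints [intro]: "x \<in> \<int> \<Longrightarrow> x \<in> dyadic"
  unfolding dyadic_iff by (rule exI[of _ 0]) simp

lemma dyadic_power_int [intro]: "x \<in> dyadic \<Longrightarrow> 2 powi k * x \<in> dyadic"
proof -
  assume "x \<in> dyadic"
  then obtain n where n: "x * 2 ^ n \<in> \<int>" by (auto simp: dyadic_iff)
  have "2 powi k * x * 2 ^ (n + nat (- k)) = (2 powi k * 2 ^ nat (- k)) * (x * 2 ^ n)"
    by (simp add: power_add mult_ac)
  also have "2 powi k * (2 :: real) ^ nat (- k) = 2 ^ nat k"
    by (cases "k \<ge> 0") (simp_all add: power_int_def field_simps)
  also have "2 ^ nat k * (x * 2 ^ n) \<in> \<int>" by (rule Ints_mult[OF _ n]) simp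
  finally have "2 powi k * x * 2 ^ (n + nat (- k)) \<in> \<int>" .
  then show "2 powi k * x \<in> dyadic" unfolding dyadic_iff by blast
qed

lemma dyadic_uminus [intro]: "x \<in> dyadic \<Longrightarrow> - x \<in> dyadic"
  by (auto simp: dyadic_iff)

lemma dyadic_diff [intro]: "x \<in> dyadic \<Longrightarrow> y \<in> dyadic \<Longrightarrow> x - y \<in> dyadic"
  using dyadic_add[of x "- y"] by auto

lemma dyadic_frac [intro]: "x \<in> dyadic \<Longrightarrow> frac x \<in> dyadic"
  unfolding frac_def by (erule dyadic_diff) (rule dyadic_Ints, simp)

lemma standard_dyadic_length:
  assumes "standard_dyadic J"
  obtains n :: nat where "Sup J - Inf J = 2 powi - int n"
proof -
  obtain n p where "J = dyadic_interval n p" using assms by (auto simp: standard_dyadic_iff)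
  then have "Sup J - Inf J = 2 powi - int n"
    by (simp add: add_divide_distrib power_int_minus inverse_eq_divide)
  then show thesis using that by blast
qed

lemma standard_dyadic_Inf_dyadic: "standard_dyadic J \<Longrightarrow> Inf J \<in> dyadic"
  unfolding standard_dyadic_iff dyadic_iff by (auto intro: exI[of _ 0])
    (metis Ints_of_nat nonzero_eq_divide_eq power_not_zero zero_neq_numeral)

text \<open>The points \<open>a\<close>, \<open>b\<close>, \<open>c\<close> of the circle occur in this cyclic order.\<close>

definition cyc :: "real \<Rightarrow> real \<Rightarrow> real \<Rightarrow> bool" where
  "cyc a b c \<longleftrightarrow> a < b \<and> b < c \<or> b < c \<and> c < a \<or> c < a \<and> a < b"

definition cyclic_mono :: "(real \<Rightarrow> real) \<Rightarrow> bool" where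
  "cyclic_mono g \<longleftrightarrow> (\<forall>a\<in>circle. \<forall>b\<in>circle. \<forall>c\<in>circle. cyc a b c \<longrightarrow> cyc (g a) (g b) (g c))"

lemma cyc_iff:
  assumes "cyclic_mono g" "a \<in> circle" "b \<in> circle" "c \<in> circle"
  shows "cyc (g a) (g b) (g c) \<longleftrightarrow> cyc a b c"
proof
  assume *: "cyc (g a) (g b) (g c)"
  then have "a \<noteq> b" "b \<noteq> c" "a \<noteq> c" by (auto simp: cyc_def)
  moreover have "\<not> cyc a c b"
  proof
    assume "cyc a c b"
    then have "cyc (g a) (g c) (g b)" using assms unfolding cyclic_mono_def by blast
    then show False using * by (auto simp: cyc_def)
  qed
  ultimately show "cyc a b c" by (auto simp: cyc_def)
next
  assume "cyc a b c"
  then show "cyc (g a) (g b) (g c)" using assms unfolding cyclic_mono_def by blast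
qed

lemma BijD:
  assumes "g \<in> Bij S"
  shows "inj_on g S" "g ` S = S"
  using assms by (auto simp: Bij_def bij_betw_def)

section \<open>Good partitions\<close>

lemma affine_interval_image:
  fixes k :: real
  assumes "0 < k"
  shows "(\<lambda>t. c + (t - a) * k) ` {p..<q} = {c + (p - a) * k..<c + (q - a) * k}"
proof (intro equalityI subsetI)
  fix y assume "y \<in> {c + (p - a) * k..<c + (q - a) * k}"
  then have y: "(p - a) * k \<le> y - c" "y - c < (q - a) * k" by auto
  let ?t = "a + (y - c) / k"
  have "p - a \<le> (y - c) / k" "(y - c) / k < q - a"
    using y assms by (simp_all add: pos_le_divide_eq pos_divide_less_eq)
  then have "p \<le> ?t" "?t < q" by linarith+
  moreover have "y = c + (?t - a) * k" using assms by simp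
  ultimately show "y \<in> (\<lambda>t. c + (t - a) * k) ` {p..<q}" by (intro image_eqI[of _ _ ?t]) auto
qed (use assms in \<open>auto simp: mult_right_mono mult_strict_right_mono\<close>)

text \<open>The slope is positive because a half-open interval contains its lower but not its upper end.\<close>

lemma affine_onto_interval:
  fixes g :: "real \<Rightarrow> real"
  assumes g: "\<And>t. t \<in> {a..<b} \<Longrightarrow> g t = \<alpha> * t + \<beta>" and ab: "a < b"
    and im: "g ` {a..<b} = {c..<d}" and cd: "c < d"
  shows "\<alpha> = (d - c) / (b - a)" "c = \<alpha> * a + \<beta>"
proof -
  have im': "(\<lambda>t. \<alpha> * t + \<beta>) ` {a..<b} = {c..<d}" using im g by (metis (no_types, lifting) image_cong)
  have ga: "\<alpha> * a + \<beta> \<in> {c..<d}" using im' ab by force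
  have pos: "0 < \<alpha>"
  proof (rule ccontr)
    assume "\<not> 0 < \<alpha>"
    then have le: "\<alpha> * t + \<beta> \<le> \<alpha> * a + \<beta>" if "t \<in> {a..<b}" for t
      using that by (simp add: mult_left_mono_neg)
    \<comment> \<open>A value above the one at \<open>a\<close>, which would be the greatest.\<close>
    have "(\<alpha> * a + \<beta> + d) / 2 \<in> {c..<d}" using ga by auto
    then obtain t where "t \<in> {a..<b}" "\<alpha> * t + \<beta> = (\<alpha> * a + \<beta> + d) / 2" using im' by (metis (no_types, lifting) imageE)
    then show False using le[of t] ga by auto
  qed
  have "(\<lambda>t. \<alpha> * t + \<beta>) ` {a..<b} = (\<lambda>t. (\<alpha> * a + \<beta>) + (t - a) * \<alpha>) ` {a..<b}"
    by (intro image_cong refl) (simp add: algebra_simps)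
  also have "\<dots> = {\<alpha> * a + \<beta>..<(\<alpha> * a + \<beta>) + (b - a) * \<alpha>}"
    using affine_interval_image[OF pos, of "\<alpha> * a + \<beta>" a a b] by simp
  finally have eq: "{\<alpha> * a + \<beta>..<(\<alpha> * a + \<beta>) + (b - a) * \<alpha>} = {c..<d}" using im' by simp
  have "\<alpha> * a + \<beta> < (\<alpha> * a + \<beta>) + (b - a) * \<alpha>" using pos ab by simp
  then have "\<alpha> * a + \<beta> = c" "(\<alpha> * a + \<beta>) + (b - a) * \<alpha> = d"
    using eq cd by (metis cInf_atLeastLessThan, metis cSup_atLeastLessThan)
  then show "c = \<alpha> * a + \<beta>" "\<alpha> = (d - c) / (b - a)" using ab by (auto simp: field_simps)
qed

lemma good_for_interval:
  assumes gd: "good_for g I" and J: "J \<in> I"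
  obtains k where "0 < k" "\<And>t. t \<in> J \<Longrightarrow> g t = Inf (g ` J) + (t - Inf J) * k"
    "Sup (g ` J) - Inf (g ` J) = (Sup J - Inf J) * k" "standard_dyadic J" "standard_dyadic (g ` J)"
    "\<exists>i. k = 2 powi i"
proof -
  have I: "I \<in> dyadic_partitions" and gI: "image g ` I \<in> dyadic_partitions" using gd by (auto simp: good_for_def)
  have sd: "standard_dyadic J" using I J by (rule dyadic_partitionsD(3))
  have sd': "standard_dyadic (g ` J)" using J by (intro dyadic_partitionsD(3)[OF gI]) auto
  obtain \<alpha> \<beta> where ab: "\<And>t. t \<in> J \<Longrightarrow> g t = \<alpha> * t + \<beta>" using gd J unfolding good_for_def by blast
  note Je = standard_dyadicD(1)[OF sd] and ge = standard_dyadicD(1)[OF sd']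
  have k: "\<alpha> = (Sup (g ` J) - Inf (g ` J)) / (Sup J - Inf J)" "Inf (g ` J) = \<alpha> * Inf J + \<beta>"
    using affine_onto_interval[of "Inf J" "Sup J" g \<alpha> \<beta> "Inf (g ` J)" "Sup (g ` J)"]
      ab standard_dyadicD(3)[OF sd] standard_dyadicD(3)[OF sd'] Je ge by metis+
  have "0 < \<alpha>" using k(1) standard_dyadicD(3)[OF sd] standard_dyadicD(3)[OF sd'] by simp
  moreover have "g t = Inf (g ` J) + (t - Inf J) * \<alpha>" if "t \<in> J" for t
    using ab[OF that] k(2) by (simp add: algebra_simps)
  moreover have "Sup (g ` J) - Inf (g ` J) = (Sup J - Inf J) * \<alpha>"
    using k(1) standard_dyadicD(3)[OF sd] by simp
  moreover have "\<exists>i. \<alpha> = 2 powi i"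
  proof -
    obtain m n :: nat where "Sup J - Inf J = 2 powi - int m" "Sup (g ` J) - Inf (g ` J) = 2 powi - int n"
      using standard_dyadic_length[OF sd] standard_dyadic_length[OF sd'] by metis
    then have "\<alpha> = 2 powi (- int n - - int m)" using k(1) by (subst power_int_diff) simp_all
    then show ?thesis by blast
  qed
  ultimately show thesis using that sd sd' by blast
qed

lemma good_for_subinterval:
  assumes gd: "good_for g I" and J: "J \<in> I" and p: "Inf J \<le> p" "p < q" "q \<le> Sup J"
  obtains k where "0 < k" "g ` {p..<q} = {Inf (g ` J) + (p - Inf J) * k..<Inf (g ` J) + (q - Inf J) * k}"
    "\<And>t. t \<in> J \<Longrightarrow> g t = Inf (g ` J) + (t - Inf J) * k"
    "Sup (g ` J) - Inf (g ` J) = (Sup J - Inf J) * k"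
proof -
  obtain k where k: "0 < k" "\<And>t. t \<in> J \<Longrightarrow> g t = Inf (g ` J) + (t - Inf J) * k"
    "Sup (g ` J) - Inf (g ` J) = (Sup J - Inf J) * k" "standard_dyadic J"
    using good_for_interval[OF gd J] by metis
  have "t \<in> J" if "t \<in> {p..<q}" for t using that p by (simp add: standard_dyadic_mem[OF k(4)])
  then have "g ` {p..<q} = (\<lambda>t. Inf (g ` J) + (t - Inf J) * k) ` {p..<q}"
    using k(2) by (intro image_cong refl) blast
  then show thesis using that k(1-3) affine_interval_image[OF k(1)] by simp
qed

lemma good_for_points:
  assumes gd: "good_for g I" and J: "J \<in> I"
  shows "g (Inf J) = Inf (g ` J)" "g (middle J) = middle (g ` J)"
    "g ` lower_half J = lower_half (g ` J)" "g ` upper_half J = upper_half (g ` J)"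
proof -
  obtain k where k: "0 < k" "\<And>t. t \<in> J \<Longrightarrow> g t = Inf (g ` J) + (t - Inf J) * k"
    "Sup (g ` J) - Inf (g ` J) = (Sup J - Inf J) * k" "standard_dyadic J"
    using good_for_interval[OF gd J] by metis
  note mb = middle_between[OF k(4)] and lt = standard_dyadicD(3)[OF k(4)]
  have "Inf J \<in> J" "middle J \<in> J" using mb lt by (auto simp: standard_dyadic_mem[OF k(4)])
  then show "g (Inf J) = Inf (g ` J)" using k(2) by simp
  have mid: "Inf (g ` J) + (middle J - Inf J) * k = middle (g ` J)"
    using k(3) by (simp add: middle_def field_simps)
  then show "g (middle J) = middle (g ` J)" using k(2) \<open>middle J \<in> J\<close> by simp
  obtain k1 where k1: "g ` {Inf J..<middle J} = {Inf (g ` J) + (Inf J - Inf J) * k1..<Inf (g ` J) + (middle J - Inf J) * k1}"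
    "\<And>t. t \<in> J \<Longrightarrow> g t = Inf (g ` J) + (t - Inf J) * k1"
    using good_for_subinterval[OF gd J, of "Inf J" "middle J"] mb by (metis less_eq_real_def)
  have "k1 = k" using k(2)[OF \<open>middle J \<in> J\<close>] k1(2)[OF \<open>middle J \<in> J\<close>] mb by simp
  then show "g ` lower_half J = lower_half (g ` J)" using k1(1) mid by (simp add: lower_half_def)
  obtain k2 where k2: "g ` {middle J..<Sup J} = {Inf (g ` J) + (middle J - Inf J) * k2..<Inf (g ` J) + (Sup J - Inf J) * k2}"
    "\<And>t. t \<in> J \<Longrightarrow> g t = Inf (g ` J) + (t - Inf J) * k2"
    using good_for_subinterval[OF gd J, of "middle J" "Sup J"] mb by (metis less_eq_real_def)
  have "k2 = k" using k(2)[OF \<open>middle J \<in> J\<close>] k2(2)[OF \<open>middle J \<in> J\<close>] mb by simp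
  moreover have "Inf (g ` J) + (Sup J - Inf J) * k = Sup (g ` J)" using k(3) by simp
  ultimately show "g ` upper_half J = upper_half (g ` J)" using k2(1) mid by (simp add: upper_half_def)
qed

lemma interval_subset_circle: "I \<in> dyadic_partitions \<Longrightarrow> J \<in> I \<Longrightarrow> J \<subseteq> circle"
  using partition_onD1[OF dyadic_partitionsD(2)] by blast

lemma partition_image:
  assumes g: "g \<in> Bij circle" and I: "I \<in> dyadic_partitions"
  shows "partition_on circle (image g ` I)" "inj_on (image g) I"
proof -
  have sub: "A \<subseteq> circle" if "A \<in> I" for A using interval_subset_circle[OF I that] .
  have "partition_on (g ` circle) (image g ` I - {{}})"
    using partition_on_inj_image[OF dyadic_partitionsD(2)[OF I] BijD(1)[OF g]] .
  moreover have "{} \<notin> image g ` I" using partition_onD3[OF dyadic_partitionsD(2)[OF I]] by auto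
  ultimately show "partition_on circle (image g ` I)" using BijD(2)[OF g] by simp
  show "inj_on (image g) I"
    using sub BijD(1)[OF g] by (meson inj_onI inj_on_image_eq_iff)
qed

lemma good_forI:
  assumes g: "g \<in> Bij circle" and I: "I \<in> dyadic_partitions"
    and J: "\<And>J. J \<in> I \<Longrightarrow> \<exists>\<alpha> \<beta>. \<forall>t\<in>J. g t = \<alpha> * t + \<beta>" "\<And>J. J \<in> I \<Longrightarrow> standard_dyadic (g ` J)"
  shows "good_for g I"
  unfolding good_for_def dyadic_partitions_def
  using I J partition_image(1)[OF g I] dyadic_partitionsD[OF I] by auto

lemma halve_image:
  assumes g: "g \<in> Bij circle" and gd: "good_for g I" and J: "J \<in> I"
  shows "image g ` halve I J = halve (image g ` I) (g ` J)" "good_for g (halve I J)"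
proof -
  have I: "I \<in> dyadic_partitions" and gI: "image g ` I \<in> dyadic_partitions" using gd by (auto simp: good_for_def)
  have "image g ` (I - {J}) = image g ` I - {g ` J}"
    using inj_on_image_set_diff[OF partition_image(2)[OF g I], of I "{J}"] J by simp
  then show eq: "image g ` halve I J = halve (image g ` I) (g ` J)"
    by (simp add: halve_def image_Un good_for_points[OF gd J])
  note h = halve_in_dyadic_partitions[OF I J] and sd = dyadic_partitionsD(3)[OF I J]
  have gh: "image g ` halve I J \<in> dyadic_partitions"
    unfolding eq using J by (intro halve_in_dyadic_partitions gI) auto
  show "good_for g (halve I J)"
  proof (rule good_forI[OF g h])
    fix K assume K: "K \<in> halve I J"
    show "standard_dyadic (g ` K)" using K by (intro dyadic_partitionsD(3)[OF gh]) auto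
    have "\<exists>L\<in>I. K \<subseteq> L" using K J halves(1)[OF sd] unfolding halve_def by blast
    then show "\<exists>\<alpha> \<beta>. \<forall>t\<in>K. g t = \<alpha> * t + \<beta>" using gd unfolding good_for_def by (meson subsetD)
  qed
qed

text \<open>A good map carries halvings of an interval to halvings of its image, so refinements of the image
partition can be pulled back.\<close>

lemma good_for_pullback:
  assumes g: "g \<in> Bij circle" and "((image g ` I, v), (K, w)) \<in> (halve_step Q)\<^sup>*" "good_for g I"
  shows "\<exists>I'. good_for g I' \<and> image g ` I' = K"
  using assms(2,3)
proof (induction "(image g ` I, v)" arbitrary: I v rule: converse_rtrancl_induct)
  case base
  then show ?case by blast
next
  case (step z)
  obtain J' where J': "J' \<in> image g ` I" "z = (halve (image g ` I) J', halve_map Q (image g ` I) J' v)"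
    using step(1) by (blast elim: halve_stepE)
  then obtain J where J: "J \<in> I" "J' = g ` J" by auto
  note h = halve_image[OF g step(4) J(1)]
  show ?case using step(3)[of "halve I J"] h J'(2) J(2) by auto
qed

section \<open>Lifts and good partitions\<close>

lemma Sup_end:
  assumes I: "I \<in> dyadic_partitions" and J: "J \<in> I"
  shows "Sup J = 1 \<or> Sup J \<in> Inf ` I"
proof (cases "Sup J = 1")
  case False
  note sd = dyadic_partitionsD(3)[OF I J]
  have "Sup J \<in> circle" using False standard_dyadicD[OF sd] by auto
  then obtain K where K: "K \<in> I" "Inf K \<le> Sup J" "Sup J < Sup K"
    using circle_in_interval[OF I] by blast
  then have "K \<noteq> J" by auto
  then have "Sup J \<le> Inf K" using intervals_apart[OF I J K(1)] K standard_dyadicD(3)[OF sd] by force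
  then show ?thesis using K by force
qed simp

lemma affine_closed_interval:
  fixes G :: "real \<Rightarrow> real"
  assumes "continuous_on UNIV G" "u < v" "\<And>t. t \<in> {u..<v} \<Longrightarrow> G t = k * t + c"
  shows "\<And>t. t \<in> {u..v} \<Longrightarrow> G t = k * t + c"
proof -
  have "closed {t. G t = k * t + c}" by (intro closed_Collect_eq assms(1) continuous_intros)
  then have "closure {u..<v} \<subseteq> {t. G t = k * t + c}" by (intro closure_minimal) (use assms(3) in auto)
  then show "\<And>t. t \<in> {u..v} \<Longrightarrow> G t = k * t + c" using closure_atLeastLessThan[OF assms(2)] by auto
qed

lemma frac_cyc:
  assumes "x < y" "y < z" "z < x + 1"
  shows "cyc (frac x) (frac y) (frac z)"
proof -
  have fl: "\<lfloor>y\<rfloor> = \<lfloor>x\<rfloor> \<or> \<lfloor>y\<rfloor> = \<lfloor>x\<rfloor> + 1" "\<lfloor>z\<rfloor> = \<lfloor>x\<rfloor> \<or> \<lfloor>z\<rfloor> = \<lfloor>x\<rfloor> + 1" "\<lfloor>y\<rfloor> \<le> \<lfloor>z\<rfloor>"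
    using assms by linarith+
  then show ?thesis using assms unfolding cyc_def frac_def by (elim disjE) auto
qed

lemma lift_cyclic_mono:
  assumes G: "thompson_lift G" and g: "\<And>t. t \<in> circle \<Longrightarrow> g t = frac (G t)"
  shows "cyclic_mono g"
proof -
  have mono: "strict_mono G" and per: "\<And>t. G (t + 1) = G t + 1" using G by (auto simp: thompson_lift_def)
  have inc: "cyc (g a) (g b) (g c)" if abc: "a \<in> circle" "b \<in> circle" "c \<in> circle" "a < b" "b < c" for a b c
  proof -
    have "G a < G b" "G b < G c" "G c < G (a + 1)" using mono abc by (auto simp: strict_mono_def)
    then show ?thesis using frac_cyc per g abc by simp
  qed
  show ?thesis
    unfolding cyclic_mono_def
  proof (intro ballI impI)
    fix a b c assume c: "a \<in> circle" "b \<in> circle" "c \<in> circle" and "cyc a b c"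
    then consider "a < b" "b < c" | "b < c" "c < a" | "c < a" "a < b" by (auto simp: cyc_def)
    then show "cyc (g a) (g b) (g c)"
    proof cases
      case 1
      then show ?thesis using inc c by blast
    next
      case 2
      then have "cyc (g b) (g c) (g a)" using inc c by blast
      then show ?thesis by (auto simp: cyc_def)
    next
      case 3
      then have "cyc (g c) (g a) (g b)" using inc c by blast
      then show ?thesis by (auto simp: cyc_def)
    qed
  qed
qed

lemma finite_dyadic_common:
  assumes "finite B" "B \<subseteq> dyadic"
  shows "\<exists>n. \<forall>b\<in>B. b * 2 ^ n \<in> \<int>"
  using assms
proof (induction B rule: finite_induct)
  case (insert b B)
  then obtain n where n: "\<forall>b\<in>B. b * 2 ^ n \<in> \<int>" by auto
  obtain m where "b * 2 ^ m \<in> \<int>" using insert.prems by (auto simp: dyadic_iff)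
  then have "\<forall>b\<in>insert b B. b * 2 ^ max n m \<in> \<int>" using n dyadic_scaled_Ints by auto
  then show ?case by blast
qed simp

lemma affine_on_fine_dyadic_interval:
  fixes z :: int and m :: nat
  assumes gt: "\<And>t. t \<in> dyadic_interval M q \<Longrightarrow> g t = frac ((of_int z + (t * 2 ^ M - real q)) / 2 ^ m)"
  shows "\<exists>\<alpha> \<beta>. \<forall>t\<in>dyadic_interval M q. g t = \<alpha> * t + \<beta>" "standard_dyadic (g ` dyadic_interval M q)"
proof -
  define e where "e = z div 2 ^ m"
  define r where "r = nat (z mod 2 ^ m)"
  have r: "r < 2 ^ m" by (simp add: r_def nat_less_iff)
  have "z = e * 2 ^ m + int r" 
    using div_mult_mod_eq[of z "2 ^ m"] by (simp add: e_def r_def)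
  then have z: "of_int z = of_int e * 2 ^ m + real r" by (metis of_int_add of_int_mult of_int_numeral of_int_of_nat_eq of_int_power)
  have g': "g t = real r / 2 ^ m + (t - real q / 2 ^ M) * (2 ^ M / 2 ^ m)" if t: "t \<in> dyadic_interval M q" for t
  proof -
    let ?s = "t * 2 ^ M - real q"
    have s: "0 \<le> ?s" "?s < 1" using t by (auto simp: dyadic_interval_def field_simps)
    have "(of_int z + ?s) / 2 ^ m = of_int e + (real r + ?s) / 2 ^ m"
      by (simp add: z add_divide_distrib)
    moreover have "0 \<le> (real r + ?s) / 2 ^ m" "(real r + ?s) / 2 ^ m < 1"
    proof -
      have "real r + 1 \<le> 2 ^ m" using r by (metis Suc_leI of_nat_Suc of_nat_le_iff of_nat_numeral of_nat_power add.commute)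
      then show "(real r + ?s) / 2 ^ m < 1" using s by simp
    qed (use s in simp)
    ultimately have "frac ((of_int z + ?s) / 2 ^ m) = (real r + ?s) / 2 ^ m"
      by (simp add: frac_unique_iff)
    then have "g t = (real r + ?s) / 2 ^ m" using gt[OF t] by (simp only:)
    also have "\<dots> = real r / 2 ^ m + (t - real q / 2 ^ M) * (2 ^ M / 2 ^ m)" by (simp add: field_simps)
    finally show ?thesis .
  qed
  show "\<exists>\<alpha> \<beta>. \<forall>t\<in>dyadic_interval M q. g t = \<alpha> * t + \<beta>"
  proof (intro exI ballI)
    fix t assume "t \<in> dyadic_interval M q"
    from g'[OF this] show "g t = (2 ^ M / 2 ^ m) * t + (real r / 2 ^ m - real q / 2 ^ M * (2 ^ M / 2 ^ m))"
      by (simp only: left_diff_distrib) simp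
  qed
  have "g ` dyadic_interval M q = (\<lambda>t. real r / 2 ^ m + (t - real q / 2 ^ M) * (2 ^ M / 2 ^ m)) ` dyadic_interval M q"
    using g' by (intro image_cong refl) blast
  also have "\<dots> = dyadic_interval m r"
    unfolding dyadic_interval_def
    by (subst affine_interval_image) (simp_all add: diff_divide_distrib[symmetric] add_divide_distrib)
  finally show "standard_dyadic (g ` dyadic_interval M q)" using r by (auto simp: standard_dyadic_iff)
qed

text \<open>On a fine grid interval the lift is affine with slope \<open>2 powi k\<close> and dyadic constant \<open>c\<close>, where only
finitely many pairs \<open>(k, c)\<close> occur. Once the grid is fine enough, the images of its
points are multiples of the length of the image intervals, which are then standard.\<close>

lemma lift_good_for_uniform:
  assumes G: "thompson_lift G" and g: "\<And>t. t \<in> circle \<Longrightarrow> g t = frac (G t)" and bij: "g \<in> Bij circle"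
  shows "\<exists>N. \<forall>M\<ge>N. good_for g (uniform M)"
proof -
  obtain B where B': "finite B" "B \<subseteq> dyadic"
    "\<forall>a b. 0 \<le> a \<and> a < b \<and> b \<le> 1 \<and> {a<..<b} \<inter> B = {} \<longrightarrow> (\<exists>(k::int) c. \<forall>t\<in>{a..b}. G t = 2 powi k * t + c)"
    and Gd: "G ` dyadic \<subseteq> dyadic"
    using G unfolding thompson_lift_def by (elim conjE exE) (rule that)
  have B: "\<exists>(k::int) c. \<forall>t\<in>{a..b}. G t = 2 powi k * t + c"
    if "0 \<le> a" "a < b" "b \<le> 1" "{a<..<b} \<inter> B = {}" for a b
    using B'(3) that by (elim allE[of _ a] allE[of _ b]) (rule mp, simp_all)
  obtain n where n: "\<forall>b\<in>B. b * 2 ^ n \<in> \<int>" using finite_dyadic_common[OF B'(1,2)] by blast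
  have "\<exists>(k::int) c. \<forall>t\<in>{real p / 2 ^ n..(real p + 1) / 2 ^ n}. G t = 2 powi k * t + c" if p: "p < 2 ^ n" for p
  proof (rule B)
    have sd: "standard_dyadic (dyadic_interval n p)" using p by (auto simp: standard_dyadic_iff)
    show "0 \<le> real p / 2 ^ n" "real p / 2 ^ n < (real p + 1) / 2 ^ n" "(real p + 1) / 2 ^ n \<le> 1"
      using standard_dyadicD(2-4)[OF sd] by simp_all
    show "{real p / 2 ^ n<..<(real p + 1) / 2 ^ n} \<inter> B = {}"
    proof (rule ccontr)
      assume "\<not> ?thesis"
      then obtain b where b: "b \<in> B" "real p / 2 ^ n < b" "b < (real p + 1) / 2 ^ n" by auto
      obtain i :: int where i: "b * 2 ^ n = of_int i" using n b(1) by (auto elim: Ints_cases)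
      have "real p < b * 2 ^ n" "b * 2 ^ n < real p + 1" using b by (auto simp: field_simps)
      then have "(of_int (int p) :: real) < of_int i" "(of_int i :: real) < of_int (int p + 1)"
        unfolding i by simp_all
      then show False by (simp only: of_int_less_iff)
    qed
  qed
  then obtain k :: "nat \<Rightarrow> int" and c where kc:
    "\<And>p t. p < 2 ^ n \<Longrightarrow> t \<in> {real p / 2 ^ n..(real p + 1) / 2 ^ n} \<Longrightarrow> G t = 2 powi k p * t + c p"
    by metis
  have "c p \<in> dyadic" if p: "p < 2 ^ n" for p
  proof -
    have pd: "real p / 2 ^ n \<in> dyadic" unfolding dyadic_iff by (rule exI[of _ n]) simp
    then have "G (real p / 2 ^ n) \<in> dyadic" using Gd by auto
    moreover have "c p = G (real p / 2 ^ n) - 2 powi k p * (real p / 2 ^ n)"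
      using kc[OF p, of "real p / 2 ^ n"] by (simp add: divide_right_mono)
    ultimately show ?thesis using pd by (simp only:) (intro dyadic_diff dyadic_power_int)
  qed
  then obtain m where m: "\<forall>b\<in>c ` {..<2 ^ n}. b * 2 ^ m \<in> \<int>"
    using finite_dyadic_common[of "c ` {..<2 ^ n}"] by auto
  \<comment> \<open>The grid has to resolve the breakpoints (level \<open>n\<close>), and the image of a grid interval needs level at least \<open>m\<close>.\<close>
  define N where "N = n + m + nat (Max (k ` {..<2 ^ n}))"
  have Nk: "k p \<le> int N - int m" if "p < 2 ^ n" for p
  proof -
    have "k p \<le> Max (k ` {..<2 ^ n})" using that by (intro Max_ge) auto
    then show ?thesis unfolding N_def by linarith
  qed
  have "good_for g (uniform M)" if M: "M \<ge> N" for M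
  proof (rule good_forI[OF bij uniform_in_dyadic_partitions])
    fix J assume JU: "J \<in> uniform M"
    then obtain q where q: "q < 2 ^ M" "J = dyadic_interval M q" by (auto simp: uniform_def)
    have nM: "n \<le> M" using M N_def by simp
    define p where "p = q div 2 ^ (M - n)"
    have MM: "(2 :: nat) ^ M = 2 ^ n * 2 ^ (M - n)" using nM by (metis le_add_diff_inverse power_add)
    have p: "p < 2 ^ n" using q(1) unfolding p_def MM by (simp add: div_less_iff_less_mult mult.commute)
    have pq: "p * 2 ^ (M - n) \<le> q" "q + 1 \<le> (p + 1) * 2 ^ (M - n)"
    proof -
      show "p * 2 ^ (M - n) \<le> q" unfolding p_def by (rule div_times_less_eq_dividend)
      have "q = p * 2 ^ (M - n) + q mod 2 ^ (M - n)" "q mod 2 ^ (M - n) < 2 ^ (M - n)"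
        using div_mult_mod_eq[of q "2 ^ (M - n)"] unfolding p_def by simp_all
      then have "q < p * 2 ^ (M - n) + 2 ^ (M - n)" by linarith
      then show "q + 1 \<le> (p + 1) * 2 ^ (M - n)" by simp
    qed
    have MMr: "(2 :: real) ^ M = 2 ^ n * 2 ^ (M - n)" using nM by (metis le_add_diff_inverse power_add)
    have sub: "t \<in> {real p / 2 ^ n..(real p + 1) / 2 ^ n}" if "t \<in> dyadic_interval M q" for t
    proof -
      have t: "real q / 2 ^ M \<le> t" "t < (real q + 1) / 2 ^ M" using that by (auto simp: dyadic_interval_def)
      have "real (p * 2 ^ (M - n)) \<le> real q" "real (q + 1) \<le> real ((p + 1) * 2 ^ (M - n))"
        using pq by (simp_all only: of_nat_le_iff)
      then have "real p * 2 ^ (M - n) \<le> real q" "real q + 1 \<le> (real p + 1) * 2 ^ (M - n)"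
        by (simp_all add: algebra_simps)
      then have "real p * 2 ^ (M - n) / 2 ^ M \<le> real q / 2 ^ M"
        "(real q + 1) / 2 ^ M \<le> (real p + 1) * 2 ^ (M - n) / 2 ^ M"
        by - (rule divide_right_mono, assumption, simp)+
      moreover have "r * 2 ^ (M - n) / 2 ^ M = r / 2 ^ n" for r :: real unfolding MMr by simp
      ultimately have "real p / 2 ^ n \<le> real q / 2 ^ M" "(real q + 1) / 2 ^ M \<le> (real p + 1) / 2 ^ n"
        by simp_all
      then show ?thesis using t by auto
    qed
    define l where "l = nat (int M - k p)"
    have l: "int l = int M - k p" "m \<le> l" using Nk[OF p] M unfolding l_def by linarith+
    have "c p * 2 ^ l \<in> \<int>" using m p by (intro dyadic_scaled_Ints[OF _ l(2)]) blast
    then obtain z' :: int where z': "c p * 2 ^ l = of_int z'" by (auto elim: Ints_cases)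
    have two: "2 powi k p * 2 ^ l = (2 :: real) ^ M"
    proof -
      have "2 powi k p * (2 :: real) ^ l = 2 powi (k p + int l)" by (simp add: power_int_add)
      then show ?thesis using l(1) by simp
    qed
    have "g t = frac ((of_int (z' + int q) + (t * 2 ^ M - real q)) / 2 ^ l)" if t: "t \<in> dyadic_interval M q" for t
    proof -
      have "t \<in> circle" using interval_subset_circle[OF uniform_in_dyadic_partitions JU] t unfolding q(2) by blast
      moreover have "G t = (of_int (z' + int q) + (t * 2 ^ M - real q)) / 2 ^ l"
      proof -
        have "G t * 2 ^ l = t * (2 powi k p * 2 ^ l) + c p * 2 ^ l"
          using kc[OF p sub[OF t]] by (simp add: algebra_simps)
        then have "G t * 2 ^ l = t * 2 ^ M + of_int z'" unfolding two z' .
        then show ?thesis by (simp add: field_simps)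
      qed
      ultimately show ?thesis using g by simp
    qed
    from affine_on_fine_dyadic_interval[of M q g "z' + int q" l, OF this]
    show "\<exists>\<alpha> \<beta>. \<forall>t\<in>J. g t = \<alpha> * t + \<beta>" "standard_dyadic (g ` J)" unfolding q(2) by blast+
  qed
  then show ?thesis by blast
qed

context
  fixes g I
  assumes bij: "g \<in> Bij circle" and cm: "cyclic_mono g" and gd: "good_for g I"
begin

text \<open>The circle is cut open at 0, so that the values increase from \<open>g 0\<close> to \<open>g 0 + 1\<close>.\<close>

private definition unrolled :: "real \<Rightarrow> real" where
  "unrolled s = (if g 0 \<le> g s then g s else g s + 1)"

definition lift_of :: "real \<Rightarrow> real" where
  "lift_of t = unrolled (frac t) + of_int \<lfloor>t\<rfloor>"

private lemma g_circle: "t \<in> circle \<Longrightarrow> g t \<in> circle"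
  using BijD(2)[OF bij] by blast

private lemma I: "I \<in> dyadic_partitions"
  using gd by (simp add: good_for_def)

private lemma zero: "0 \<in> circle" by simp

private lemma frac_circle: "frac t \<in> circle"
  by (simp add: frac_lt_1)

private lemma unrolled_range: "s \<in> circle \<Longrightarrow> g 0 \<le> unrolled s \<and> unrolled s < g 0 + 1"
  using g_circle[of s] g_circle[OF zero] by (auto simp: unrolled_def)

private lemma unrolled_mono:
  assumes st: "s \<in> circle" "t \<in> circle" "s < t"
  shows "unrolled s < unrolled t"
proof (cases "s = 0")
  case True
  have "g t \<noteq> g 0" using st True BijD(1)[OF bij] by (metis inj_onD less_irrefl)
  then show ?thesis using True g_circle[OF st(2)] g_circle[OF zero] by (auto simp: unrolled_def)
next
  case False
  then have "cyc 0 s t" using st by (auto simp: cyc_def)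
  then have "cyc (g 0) (g s) (g t)" using cm st zero unfolding cyclic_mono_def by blast
  then show ?thesis using g_circle[OF st(1)] g_circle[OF st(2)] by (auto simp: unrolled_def cyc_def)
qed

private lemma lift_of_mono: "strict_mono lift_of"
proof (rule strict_monoI)
  fix t u :: real assume tu: "t < u"
  show "lift_of t < lift_of u"
  proof (cases "\<lfloor>t\<rfloor> = \<lfloor>u\<rfloor>")
    case True
    then have "frac t < frac u" using tu by (simp add: frac_def)
    then show ?thesis using unrolled_mono[OF frac_circle frac_circle] True by (simp add: lift_of_def)
  next
    case False
    then have "\<lfloor>t\<rfloor> + 1 \<le> \<lfloor>u\<rfloor>" using tu by linarith
    then have "(of_int \<lfloor>t\<rfloor> :: real) + 1 \<le> of_int \<lfloor>u\<rfloor>" by linarith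
    then show ?thesis
      using unrolled_range[OF frac_circle[of t]] unrolled_range[OF frac_circle[of u]] by (simp add: lift_of_def)
  qed
qed

private lemma lift_of_shift: "lift_of (t + of_int i) = lift_of t + of_int i"
  by (simp add: lift_of_def frac_def)

private lemma lift_of_on_circle: "t \<in> circle \<Longrightarrow> lift_of t = unrolled t"
proof -
  assume "t \<in> circle"
  then have "frac t = t" "\<lfloor>t\<rfloor> = 0" by (auto simp: frac_eq floor_eq_iff)
  then show ?thesis by (simp add: lift_of_def)
qed

lemma frac_lift_of: "t \<in> circle \<Longrightarrow> g t = frac (lift_of t)"
proof -
  assume t: "t \<in> circle"
  have "frac (g t) = g t" using g_circle[OF t] by (simp add: frac_eq)
  then show ?thesis by (simp add: lift_of_on_circle[OF t] unrolled_def frac_1_eq)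
qed

private lemma lift_of_surj: "range lift_of = UNIV"
proof (intro equalityI subsetI UNIV_I)
  fix y :: real
  define n where "n = \<lfloor>y - g 0\<rfloor>"
  define y' where "y' = y - of_int n"
  have y': "g 0 \<le> y'" "y' < g 0 + 1" unfolding y'_def n_def by linarith+
  have "\<exists>s\<in>circle. unrolled s = y'"
  proof (cases "y' < 1")
    case True
    then have "y' \<in> circle" using y' g_circle[OF zero] by auto
    then obtain s where "s \<in> circle" "g s = y'" using BijD(2)[OF bij] by (metis imageE)
    then show ?thesis using y' by (auto simp: unrolled_def)
  next
    case False
    then have "y' - 1 \<in> circle" using y' g_circle[OF zero] by auto
    then obtain s where "s \<in> circle" "g s = y' - 1" using BijD(2)[OF bij] by (metis imageE)
    then show ?thesis using y' by (intro bexI[of _ s]) (auto simp: unrolled_def)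
  qed
  then obtain s where s: "s \<in> circle" "unrolled s = y'" by blast
  have "lift_of (s + of_int n) = y" unfolding lift_of_shift lift_of_on_circle[OF s(1)] s(2) y'_def by simp
  then show "y \<in> range lift_of" by (metis rangeI)
qed

private lemma lift_of_continuous: "continuous_on UNIV lift_of"
  using lift_of_mono lift_of_surj by (intro continuous_onI_mono) (auto simp: strict_mono_less_eq)

private lemma lift_of_piece:
  assumes J: "J \<in> I"
  shows "\<exists>(k::int) c. c \<in> dyadic \<and> (\<forall>t\<in>J. lift_of t = 2 powi k * t + c)"
proof -
  obtain \<kappa> k where k: "0 < \<kappa>" "\<And>t. t \<in> J \<Longrightarrow> g t = Inf (g ` J) + (t - Inf J) * \<kappa>" "\<kappa> = 2 powi k"
    "standard_dyadic J" "standard_dyadic (g ` J)"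
    using good_for_interval[OF gd J] by metis
  have JC: "J \<subseteq> circle" using interval_subset_circle[OF I J] .
  \<comment> \<open>The value \<open>g 0\<close> does not lie in the interior of the image of \<open>J\<close>, so the image is not cut.\<close>
  have "(\<forall>t\<in>J. g 0 \<le> g t) \<or> (\<forall>t\<in>J. \<not> g 0 \<le> g t)"
  proof (cases "0 \<in> J")
    case True
    then have "Inf J = 0" using standard_dyadicD(2)[OF k(4)] standard_dyadic_mem[OF k(4)] by force
    then have "g 0 \<le> g t" if "t \<in> J" for t
      using k(1) k(2)[OF that] k(2)[OF True] JC that by auto
    then show ?thesis by blast
  next
    case False
    have "g 0 \<notin> g ` J" using False JC BijD(1)[OF bij] zero by (meson inj_on_image_mem_iff)
    then have "\<not> (Inf (g ` J) \<le> g 0 \<and> g 0 < Sup (g ` J))" using standard_dyadic_mem[OF k(5)] by blast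
    moreover have "Inf (g ` J) \<le> g t \<and> g t < Sup (g ` J)" if "t \<in> J" for t
      using standard_dyadic_mem[OF k(5)] that by blast
    ultimately show ?thesis by fastforce
  qed
  then obtain e where e: "\<forall>t\<in>J. lift_of t = g t + e" "e = 0 \<or> e = 1"
    using lift_of_on_circle JC unfolding unrolled_def by (metis (no_types, lifting) add_0_right subsetD)
  let ?c = "Inf (g ` J) - 2 powi k * Inf J + e"
  have "lift_of t = 2 powi k * t + ?c" if "t \<in> J" for t
    using e(1) k(2)[OF that] that k(3) by (simp add: algebra_simps)
  moreover have "?c \<in> dyadic"
  proof -
    have "e \<in> dyadic" using e(2) by (intro dyadic_Ints) auto
    then show ?thesis
      using standard_dyadic_Inf_dyadic[OF k(4)] standard_dyadic_Inf_dyadic[OF k(5)]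
      by (intro dyadic_add dyadic_diff dyadic_power_int)
  qed
  ultimately show ?thesis by blast
qed

lemma thompson_lift_lift_of: "thompson_lift lift_of"
  unfolding thompson_lift_def
proof (intro conjI allI)
  show "continuous_on UNIV lift_of" "strict_mono lift_of" by (rule lift_of_continuous, rule lift_of_mono)
  show "lift_of (t + 1) = lift_of t + 1" for t using lift_of_shift[of t 1] by simp
  show "lift_of ` dyadic \<subseteq> dyadic"
  proof
    fix y assume "y \<in> lift_of ` dyadic"
    then obtain t where t: "t \<in> dyadic" "y = lift_of t" by auto
    obtain J where J: "J \<in> I" "frac t \<in> J"
      using partition_onD1[OF dyadic_partitionsD(2)[OF I]] frac_circle[of t] by blast
    obtain k :: int and c where kc: "c \<in> dyadic" "\<forall>t\<in>J. lift_of t = 2 powi k * t + c" using lift_of_piece[OF J(1)] by blast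
    have "lift_of t = lift_of (frac t) + of_int \<lfloor>t\<rfloor>" using lift_of_shift[of "frac t" "\<lfloor>t\<rfloor>"] by (simp add: frac_def)
    also have "\<dots> = 2 powi k * frac t + c + of_int \<lfloor>t\<rfloor>" using kc(2) J(2) by simp
    also have "\<dots> \<in> dyadic"
      by (rule dyadic_add[OF dyadic_add[OF dyadic_power_int[OF dyadic_frac[OF t(1)]] kc(1)] dyadic_Ints[OF Ints_of_int]])
    finally show "y \<in> dyadic" using t(2) by simp
  qed
  let ?B = "insert 1 (Inf ` I)"
  show "\<exists>B. finite B \<and> B \<subseteq> dyadic \<and> (\<forall>a b. 0 \<le> a \<and> a < b \<and> b \<le> 1 \<and> {a<..<b} \<inter> B = {} \<longrightarrow>
      (\<exists>(k::int) c. \<forall>t\<in>{a..b}. lift_of t = 2 powi k * t + c))"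
  proof (intro exI[of _ ?B] conjI allI impI)
    show "finite ?B" using dyadic_partitionsD(1)[OF I] by simp
    show "?B \<subseteq> dyadic" using standard_dyadic_Inf_dyadic dyadic_partitionsD(3)[OF I] by auto
    fix a b :: real assume ab: "0 \<le> a \<and> a < b \<and> b \<le> 1 \<and> {a<..<b} \<inter> ?B = {}"
    then obtain J where J: "J \<in> I" "Inf J \<le> a" "a < Sup J" using circle_in_interval[OF I, of a] by auto
    have "b \<le> Sup J"
    proof (rule ccontr)
      assume "\<not> b \<le> Sup J"
      then have "Sup J \<in> {a<..<b}" using J by simp
      then show False using Sup_end[OF I J(1)] ab by auto
    qed
    moreover obtain k :: int and c where kc: "\<forall>t\<in>J. lift_of t = 2 powi k * t + c" using lift_of_piece[OF J(1)] by blast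
    moreover have "lift_of t = 2 powi k * t + c" if "t \<in> {Inf J..Sup J}" for t
      using affine_closed_interval[OF lift_of_continuous, of "Inf J" "Sup J" "2 powi k" c] that kc
        standard_dyadicD(3)[OF dyadic_partitionsD(3)[OF I J(1)]]
        standard_dyadic_mem[OF dyadic_partitionsD(3)[OF I J(1)]] by auto
    ultimately show "\<exists>(k::int) c. \<forall>t\<in>{a..b}. lift_of t = 2 powi k * t + c"
      using J by (intro exI[of _ k] exI[of _ c]) auto
  qed
qed

end

text \<open>In this form closure under composition and inverses is a statement about finite partitions, without
mention of lifts.\<close>

theorem thompson_T_iff:
  "g \<in> carrier thompson_T \<longleftrightarrow> g \<in> Bij circle \<and> cyclic_mono g \<and> (\<exists>I. good_for g I)"
proof
  assume "g \<in> carrier thompson_T"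
  then obtain G where "g \<in> Bij circle" "thompson_lift G" "\<And>t. t \<in> circle \<Longrightarrow> g t = frac (G t)"
    by (auto simp: thompson_T_def)
  then show "g \<in> Bij circle \<and> cyclic_mono g \<and> (\<exists>I. good_for g I)"
    using lift_cyclic_mono lift_good_for_uniform by blast
next
  assume "g \<in> Bij circle \<and> cyclic_mono g \<and> (\<exists>I. good_for g I)"
  then obtain I where g: "g \<in> Bij circle" "cyclic_mono g" "good_for g I" by blast
  then show "g \<in> carrier thompson_T"
    using thompson_lift_lift_of[OF g] frac_lift_of[OF g] unfolding thompson_T_def by auto
qed

lemma thompson_T_good_uniform:
  assumes "g \<in> carrier thompson_T"
  obtains N where "\<And>M. M \<ge> N \<Longrightarrow> good_for g (uniform M)"
proof -
  obtain G where "g \<in> Bij circle" "thompson_lift G" "\<And>t. t \<in> circle \<Longrightarrow> g t = frac (G t)"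
    using assms by (auto simp: thompson_T_def)
  then show thesis using lift_good_for_uniform that by blast
qed

section \<open>The group structure\<close>

lemma mult_thompson_T: "f \<in> Bij circle \<Longrightarrow> g \<in> Bij circle \<Longrightarrow> mult thompson_T g f = compose circle g f"
  by (simp add: thompson_T_def BijGroup_def)

lemma carrier_T_Bij: "g \<in> carrier thompson_T \<Longrightarrow> g \<in> Bij circle"
  by (simp add: thompson_T_iff)

text \<open>The image partition of the first map is refined until it is good for the second map, and the
refinement is pulled back.\<close>

lemma compose_in_thompson_T:
  assumes f: "f \<in> carrier thompson_T" and g: "g \<in> carrier thompson_T"
  shows "compose circle g f \<in> carrier thompson_T"
proof -
  have fB: "f \<in> Bij circle" and gB: "g \<in> Bij circle" using f g carrier_T_Bij by auto
  obtain I where I: "good_for f I" using f thompson_T_iff by blast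
  have fI: "image f ` I \<in> dyadic_partitions" using I by (simp add: good_for_def)
  obtain N1 where N1: "\<And>M. M \<ge> N1 \<Longrightarrow> good_for g (uniform M)" using thompson_T_good_uniform[OF g] by blast
  obtain N2 where N2: "\<And>M. M \<ge> N2 \<Longrightarrow> level_le M (image f ` I)" using level_le_exists[OF fI] by blast
  define N where "N = max N1 N2"
  have gN: "good_for g (uniform N)" and "level_le N (image f ` I)" using N1 N2 by (simp_all add: N_def)
  \<comment> \<open>Only the chain of halvings matters here, so the zero vector will do.\<close>
  moreover have "(\<lambda>_. 0) \<in> tl_space (image f ` I)" by (simp add: tl_space_def)
  ultimately obtain w where pw: "((image f ` I, \<lambda>_. 0), (uniform N, w)) \<in> (halve_step 2)\<^sup>*"
    using path_to_uniform by blast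
  then obtain I' where I': "good_for f I'" "image f ` I' = uniform N" using good_for_pullback[OF fB pw I] by blast
  have I'p: "I' \<in> dyadic_partitions" using I' by (simp add: good_for_def)
  have cB: "compose circle g f \<in> Bij circle" using compose_Bij gB fB .
  have on: "compose circle g f t = g (f t)" if "J \<in> I'" "t \<in> J" for J t
    using interval_subset_circle[OF I'p that(1)] that(2) by (auto simp: compose_def)
  have "good_for (compose circle g f) I'"
  proof (rule good_forI[OF cB I'p])
    fix J assume J: "J \<in> I'"
    have fJ: "f ` J \<in> uniform N" using I'(2) J by blast
    obtain a b where ab: "\<forall>t\<in>J. f t = a * t + b" using I'(1) J unfolding good_for_def by blast
    obtain c d where cd: "\<forall>t\<in>f ` J. g t = c * t + d" using gN fJ unfolding good_for_def by blast
    have "compose circle g f t = (c * a) * t + (c * b + d)" if "t \<in> J" for t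
    proof -
      have 1: "compose circle g f t = c * f t + d" using cd that on[OF J that] by simp
      have 2: "f t = a * t + b" using ab that by blast
      show ?thesis unfolding 1 2 by (simp add: algebra_simps)
    qed
    then show "\<exists>\<alpha> \<beta>. \<forall>t\<in>J. compose circle g f t = \<alpha> * t + \<beta>" by blast
    have "compose circle g f ` J = g ` f ` J" using on[OF J] unfolding image_image by (intro image_cong refl)
    moreover have "image g ` uniform N \<in> dyadic_partitions" using gN by (simp add: good_for_def)
    ultimately show "standard_dyadic (compose circle g f ` J)" using fJ dyadic_partitionsD(3) by blast
  qed
  moreover have "cyclic_mono (compose circle g f)"
    unfolding cyclic_mono_def
  proof (intro ballI impI)
    fix a b c assume abc: "a \<in> circle" "b \<in> circle" "c \<in> circle" "cyc a b c"
    have fc: "f t \<in> circle" if "t \<in> circle" for t using BijD(2)[OF fB] that by blast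
    have "cyc (f a) (f b) (f c)" using f abc unfolding thompson_T_iff cyclic_mono_def by blast
    then have "cyc (g (f a)) (g (f b)) (g (f c))" using g fc abc unfolding thompson_T_iff cyclic_mono_def by blast
    then show "cyc (compose circle g f a) (compose circle g f b) (compose circle g f c)"
      using abc by (simp add: compose_def)
  qed
  ultimately show ?thesis using cB thompson_T_iff by blast
qed

lemma restrict_inv_into:
  assumes "g \<in> Bij S" "t \<in> S"
  shows "restrict (inv_into S g) S (g t) = t" "g (restrict (inv_into S g) S t) = t"
    "restrict (inv_into S g) S t \<in> S"
proof -
  have "g t \<in> S" using BijD(2)[OF assms(1)] assms(2) by blast
  then show "restrict (inv_into S g) S (g t) = t" using BijD(1)[OF assms(1)] assms(2) by simp
  have "t \<in> g ` S" using BijD(2)[OF assms(1)] assms(2) by simp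
  then show "g (restrict (inv_into S g) S t) = t" "restrict (inv_into S g) S t \<in> S"
    using assms(2) f_inv_into_f[of t g S] inv_into_into[of t g S] by auto
qed

lemma good_for_inverse:
  assumes g: "g \<in> Bij circle" and gd: "good_for g I"
  shows "good_for (restrict (inv_into circle g) circle) (image g ` I)"
    "image (restrict (inv_into circle g) circle) ` image g ` I = I"
proof -
  let ?h = "restrict (inv_into circle g) circle"
  have I: "I \<in> dyadic_partitions" and gI: "image g ` I \<in> dyadic_partitions" using gd by (auto simp: good_for_def)
  have hg: "?h (g t) = t" if "J \<in> I" "t \<in> J" for J t
    using restrict_inv_into(1)[OF g] interval_subset_circle[OF I that(1)] that(2) by blast
  have hgJ: "?h ` g ` J = J" if J: "J \<in> I" for J
  proof -
    have "?h ` g ` J = (\<lambda>t. t) ` J" unfolding image_image using hg[OF J] by (intro image_cong refl)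
    then show ?thesis by simp
  qed
  show "image ?h ` image g ` I = I"
  proof -
    have "image ?h ` image g ` I = (\<lambda>J. J) ` I"
      unfolding image_image[of "image ?h"] using hgJ by (intro image_cong refl)
    then show ?thesis by simp
  qed
  show "good_for ?h (image g ` I)"
  proof (rule good_forI[OF restrict_inv_into_Bij[OF g] gI])
    fix K assume "K \<in> image g ` I"
    then obtain J where J: "J \<in> I" "K = g ` J" by auto
    obtain k where k: "0 < k" "\<And>t. t \<in> J \<Longrightarrow> g t = Inf (g ` J) + (t - Inf J) * k"
      using good_for_interval[OF gd J(1)] by metis
    have "?h y = (1 / k) * y + (Inf J - Inf (g ` J) / k)" if y: "y \<in> K" for y
    proof -
      obtain t where t: "t \<in> J" "y = g t" using y J(2) by auto
      have "t = (1 / k) * y + (Inf J - Inf (g ` J) / k)" using k(2)[OF t(1)] k(1) t(2) by (simp add: field_simps)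
      then show ?thesis using hg[OF J(1) t(1)] t(2) by simp
    qed
    then show "\<exists>\<alpha> \<beta>. \<forall>t\<in>K. ?h t = \<alpha> * t + \<beta>" by blast
    show "standard_dyadic (?h ` K)" unfolding J(2) hgJ[OF J(1)] using I J(1) by (rule dyadic_partitionsD(3))
  qed
qed

lemma inverse_in_thompson_T:
  assumes g: "g \<in> carrier thompson_T"
  shows "restrict (inv_into circle g) circle \<in> carrier thompson_T"
proof -
  let ?h = "restrict (inv_into circle g) circle"
  have gB: "g \<in> Bij circle" using carrier_T_Bij[OF g] .
  obtain I where I: "good_for g I" using g thompson_T_iff by blast
  have "cyclic_mono ?h"
    unfolding cyclic_mono_def
  proof (intro ballI impI)
    fix a b c assume abc: "a \<in> circle" "b \<in> circle" "c \<in> circle" "cyc a b c"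
    have "cyc (g (?h a)) (g (?h b)) (g (?h c))" using abc restrict_inv_into(2)[OF gB] by simp
    moreover have "cyclic_mono g" using g thompson_T_iff by blast
    ultimately show "cyc (?h a) (?h b) (?h c)" using cyc_iff restrict_inv_into(3)[OF gB] abc by blast
  qed
  then show ?thesis
    unfolding thompson_T_iff using restrict_inv_into_Bij[OF gB] good_for_inverse(1)[OF gB I] by blast
qed

lemma id_in_thompson_T: "(\<lambda>t\<in>circle. t) \<in> carrier thompson_T"
proof -
  have "good_for (\<lambda>t\<in>circle. t) (uniform 0)"
  proof (rule good_forI[OF id_Bij uniform_in_dyadic_partitions])
    fix J assume J: "J \<in> uniform 0"
    note sub = interval_subset_circle[OF uniform_in_dyadic_partitions J]
    have "\<forall>t\<in>J. (\<lambda>t\<in>circle. t) t = 1 * t + 0" using sub by auto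
    then show "\<exists>\<alpha> \<beta>. \<forall>t\<in>J. (\<lambda>t\<in>circle. t) t = \<alpha> * t + \<beta>" by blast
    have "(\<lambda>t\<in>circle. t) ` J = J" using sub by (auto simp: image_iff)
    then show "standard_dyadic ((\<lambda>t\<in>circle. t) ` J)"
      using dyadic_partitionsD(3)[OF uniform_in_dyadic_partitions J] by simp
  qed
  moreover have "cyclic_mono (\<lambda>t\<in>circle. t)" by (simp add: cyclic_mono_def)
  ultimately show ?thesis using id_Bij thompson_T_iff by blast
qed

lemma inv_BijGroup_circle: "g \<in> Bij circle \<Longrightarrow> m_inv (BijGroup circle) g = restrict (inv_into circle g) circle"
  using inv_BijGroup[of g circle] by simp

lemma thompson_T_subgroup: "subgroup (carrier thompson_T) (BijGroup circle)"
proof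
  show "carrier thompson_T \<subseteq> carrier (BijGroup circle)" by (auto simp: BijGroup_def carrier_T_Bij)
  show "\<one>\<^bsub>BijGroup circle\<^esub> \<in> carrier thompson_T" using id_in_thompson_T by (simp add: BijGroup_def)
  fix g assume g: "g \<in> carrier thompson_T"
  show "inv\<^bsub>BijGroup circle\<^esub> g \<in> carrier thompson_T"
    using inverse_in_thompson_T[OF g] by (simp only: inv_BijGroup_circle[OF carrier_T_Bij[OF g]])
  fix f assume f: "f \<in> carrier thompson_T"
  show "g \<otimes>\<^bsub>BijGroup circle\<^esub> f \<in> carrier thompson_T"
    using compose_in_thompson_T[OF f g] carrier_T_Bij[OF f] carrier_T_Bij[OF g] by (simp add: BijGroup_def)
qed

lemma thompson_T_eq: "thompson_T = (BijGroup circle)\<lparr>carrier := carrier thompson_T\<rparr>"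
  by (simp add: thompson_T_def)

lemma group_thompson_T: "group thompson_T"
  by (subst thompson_T_eq) (rule subgroup.subgroup_is_group[OF thompson_T_subgroup group_BijGroup])

lemma inv_thompson_T:
  assumes "g \<in> carrier thompson_T"
  shows "m_inv thompson_T g = restrict (inv_into circle g) circle"
proof -
  have "m_inv thompson_T g = m_inv ((BijGroup circle)\<lparr>carrier := carrier thompson_T\<rparr>) g"
    by (rule arg_cong[OF thompson_T_eq])
  also have "\<dots> = m_inv (BijGroup circle) g"
    by (rule group.m_inv_consistent[OF group_BijGroup thompson_T_subgroup assms])
  finally show ?thesis using inv_BijGroup_circle[OF carrier_T_Bij[OF assms]] by simp
qed

lemma one_thompson_T: "one thompson_T = (\<lambda>t\<in>circle. t)"
  by (simp add: thompson_T_def BijGroup_def)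

lemma thompson_F_subgroup: "subgroup (carrier thompson_F) thompson_T"
proof -
  interpret group thompson_T by (rule group_thompson_T)
  have z: "(0 :: real) \<in> circle" by simp
  show ?thesis
  proof (rule subgroupI)
    show "carrier thompson_F \<subseteq> carrier thompson_T" by (auto simp: thompson_F_def)
    have "\<one>\<^bsub>thompson_T\<^esub> \<in> carrier thompson_F" by (simp add: thompson_F_def one_thompson_T id_in_thompson_T)
    then show "carrier thompson_F \<noteq> {}" by blast
    fix g assume "g \<in> carrier thompson_F"
    then have g: "g \<in> carrier thompson_T" "g 0 = 0" by (auto simp: thompson_F_def)
    have "restrict (inv_into circle g) circle 0 = 0"
      using restrict_inv_into(1)[OF carrier_T_Bij[OF g(1)] z] g(2) by simp
    then show "inv\<^bsub>thompson_T\<^esub> g \<in> carrier thompson_F"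
      using inv_closed[OF g(1)] inv_thompson_T[OF g(1)] by (simp add: thompson_F_def)
    fix f assume "f \<in> carrier thompson_F"
    then have f: "f \<in> carrier thompson_T" "f 0 = 0" by (auto simp: thompson_F_def)
    have "(g \<otimes>\<^bsub>thompson_T\<^esub> f) 0 = 0"
      using mult_thompson_T[OF carrier_T_Bij[OF f(1)] carrier_T_Bij[OF g(1)]] f(2) g(2) by (simp add: compose_def)
    then show "g \<otimes>\<^bsub>thompson_T\<^esub> f \<in> carrier thompson_F"
      using m_closed[OF g(1) f(1)] by (simp add: thompson_F_def)
  qed
qed

lemma thompson_F_eq: "thompson_F = thompson_T\<lparr>carrier := carrier thompson_F\<rparr>"
  by (simp add: thompson_F_def)

lemma group_thompson_F: "group thompson_F"
  by (subst thompson_F_eq) (rule subgroup.subgroup_is_group[OF thompson_F_subgroup group_thompson_T])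

lemma inv_thompson_F:
  assumes "g \<in> carrier thompson_F"
  shows "m_inv thompson_F g = m_inv thompson_T g"
proof -
  have "m_inv thompson_F g = m_inv (thompson_T\<lparr>carrier := carrier thompson_F\<rparr>) g"
    by (rule arg_cong[OF thompson_F_eq])
  also have "\<dots> = m_inv thompson_T g"
    by (rule group.m_inv_consistent[OF group_thompson_T thompson_F_subgroup assms])
  finally show ?thesis .
qed

section \<open>Transport of diagrams\<close>

text \<open>The half-open arc from \<open>p\<close> to \<open>q\<close> in positive direction. Unlike the comparison of real numbers in
the definition of \<open>linked\<close>, this makes sense for both orders of \<open>p\<close> and \<open>q\<close> and is preserved by
cyclically monotone maps.\<close>

definition in_arc :: "real \<Rightarrow> real \<Rightarrow> real \<Rightarrow> bool" where
  "in_arc p q a \<longleftrightarrow> a = p \<or> cyc p a q"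

lemma linked_iff_arc:
  assumes "\<And>p q. {p, q} \<in> x \<Longrightarrow> p \<noteq> q"
  shows "linked x a b \<longleftrightarrow> (\<forall>p q. {p, q} \<in> x \<longrightarrow> (in_arc p q a \<longleftrightarrow> in_arc p q b))"
proof -
  have le: "in_arc p q t \<longleftrightarrow> p \<le> t \<and> t < q" if "p < q" for p q t
    using that by (auto simp: in_arc_def cyc_def)
  have ge: "in_arc p q t \<longleftrightarrow> \<not> (q \<le> t \<and> t < p)" if "q < p" for p q t
    using that by (auto simp: in_arc_def cyc_def)
  show ?thesis
  proof
    assume L: "linked x a b"
    show "\<forall>p q. {p, q} \<in> x \<longrightarrow> (in_arc p q a \<longleftrightarrow> in_arc p q b)"
    proof (intro allI impI)
      fix p q assume pq: "{p, q} \<in> x"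
      then consider "p < q" | "q < p" using assms by force
      then show "in_arc p q a \<longleftrightarrow> in_arc p q b"
      proof cases
        case 1
        then show ?thesis using L pq le[OF 1] unfolding linked_def by simp
      next
        case 2
        have "{q, p} \<in> x" using pq by (simp add: insert_commute)
        then have "(q \<le> a \<and> a < p) = (q \<le> b \<and> b < p)" using L 2 unfolding linked_def by blast
        then show ?thesis by (simp only: ge[OF 2])
      qed
    qed
  next
    assume "\<forall>p q. {p, q} \<in> x \<longrightarrow> (in_arc p q a \<longleftrightarrow> in_arc p q b)"
    then show "linked x a b" unfolding linked_def using le by blast
  qed
qed

context
  fixes g I
  assumes bij: "g \<in> Bij circle" and cm: "cyclic_mono g" and gd: "good_for g I"
begin

private lemma source: "I \<in> dyadic_partitions" and target: "image g ` I \<in> dyadic_partitions"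
  using gd by (auto simp: good_for_def)

lemma Inf_image: "Inf ` image g ` I = g ` Inf ` I"
  using good_for_points(1)[OF gd] by (auto simp: image_iff)

lemma bdry_points_image: "bdry_points (image g ` I) = g ` bdry_points I"
  unfolding bdry_points_eq[OF source] bdry_points_eq[OF target] image_UN
  using good_for_points(1,2)[OF gd] by simp

private lemma bdry_circle: "p \<in> bdry_points I \<Longrightarrow> p \<in> circle"
  using bdry_points_subset[OF source] by blast

private lemma g_inj: "inj_on g (bdry_points I)"
  using BijD(1)[OF bij] bdry_points_subset[OF source] by (rule inj_on_subset)

private lemma pair_preimage:
  assumes x: "x \<in> pairings I" and yz: "{y, z} \<in> image g ` x" "y \<noteq> z"
  obtains p q where "p \<in> bdry_points I" "q \<in> bdry_points I" "{p, q} \<in> x" "y = g p" "z = g q" "p \<noteq> q"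
proof -
  obtain s where s: "s \<in> x" "{y, z} = g ` s" using yz(1) by blast
  obtain p q where pq: "s = {p, q}" "p < q" "p \<in> bdry_points I" "q \<in> bdry_points I" using pairing_set[OF x s(1)] .
  have "{y, z} = {g p, g q}" using s(2) unfolding pq(1) by simp
  then have "y = g p \<and> z = g q \<or> y = g q \<and> z = g p" by (auto simp: doubleton_eq_iff)
  moreover have "{q, p} \<in> x" using s(1) pq(1) by (simp add: insert_commute)
  ultimately show thesis using that[of p q] that[of q p] pq s(1) by auto
qed

text \<open>A crossing in the image would be a crossing of the preimages, because the cyclic order determines
whether two strings cross; which of the four points comes first in \<open>{0..<1}\<close> may change.\<close>

lemma pairing_image:
  assumes x: "x \<in> pairings I"
  shows "image g ` x \<in> pairings (image g ` I)"
proof -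
  have part: "partition_on (bdry_points I) x" using x by (simp add: pairings_def)
  have "partition_on (g ` bdry_points I) (image g ` x - {{}})"
    by (rule partition_on_inj_image[OF part g_inj])
  moreover have "{} \<notin> image g ` x" using partition_onD3[OF part] by auto
  ultimately have "partition_on (bdry_points (image g ` I)) (image g ` x)" by (simp add: bdry_points_image)
  moreover have "\<forall>s\<in>image g ` x. card s = 2"
  proof
    fix s assume "s \<in> image g ` x"
    then obtain t where t: "t \<in> x" "s = g ` t" by auto
    then have "t \<subseteq> bdry_points I" using partition_onD1[OF part] by auto
    then have "card s = card t" unfolding t(2) by (intro card_image inj_on_subset[OF g_inj])
    then show "card s = 2" using x t(1) by (simp add: pairings_def)
  qed
  moreover have "\<not> (\<exists>p r q s. p < r \<and> r < q \<and> q < s \<and> {p, q} \<in> image g ` x \<and> {r, s} \<in> image g ` x)"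
  proof
    assume "\<exists>p r q s. p < r \<and> r < q \<and> q < s \<and> {p, q} \<in> image g ` x \<and> {r, s} \<in> image g ` x"
    then obtain p r q s where ord: "p < r" "r < q" "q < s" and im: "{p, q} \<in> image g ` x" "{r, s} \<in> image g ` x" by blast
    have ne: "p \<noteq> q" "r \<noteq> s" using ord by auto
    obtain p' q' where pq: "p' \<in> bdry_points I" "q' \<in> bdry_points I" "{p', q'} \<in> x" "p = g p'" "q = g q'"
      by (rule pair_preimage[OF x im(1) ne(1)])
    obtain r' s' where rs: "r' \<in> bdry_points I" "s' \<in> bdry_points I" "{r', s'} \<in> x" "r = g r'" "s = g s'"
      by (rule pair_preimage[OF x im(2) ne(2)])
    have nc: "{a, b} \<in> x \<Longrightarrow> {c, d} \<in> x \<Longrightarrow> a < c \<Longrightarrow> c < b \<Longrightarrow> b < d \<Longrightarrow> False" for a b c d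
      using x unfolding pairings_def by blast
    have "cyc p r q" "cyc q s p" using ord by (auto simp: cyc_def)
    then have "cyc p' r' q'" "cyc q' s' p'"
      using cyc_iff[OF cm] bdry_circle pq rs by auto
    moreover have "{q', p'} \<in> x" "{s', r'} \<in> x" using pq(3) rs(3) by (simp_all add: insert_commute)
    \<comment> \<open>The four cases correspond to the preimage that comes first in \<open>{0..<1}\<close>.\<close>
    ultimately show False
      using nc[OF pq(3) rs(3)] nc[OF rs(3) \<open>{q', p'} \<in> x\<close>] nc[OF \<open>{q', p'} \<in> x\<close> \<open>{s', r'} \<in> x\<close>]
        nc[OF \<open>{s', r'} \<in> x\<close> pq(3)]
      unfolding cyc_def by (smt (verit))
  qed
  ultimately show ?thesis unfolding pairings_def mem_Collect_eq by (intro conjI)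
qed

lemma linked_image:
  assumes x: "x \<in> pairings I" and ab: "a \<in> circle" "b \<in> circle"
  shows "linked (image g ` x) (g a) (g b) \<longleftrightarrow> linked x a b"
proof -
  have arc: "in_arc (g p) (g q) (g t) \<longleftrightarrow> in_arc p q t" if "p \<in> circle" "q \<in> circle" "t \<in> circle" for p q t
    using cyc_iff[OF cm that(1,3,2)] BijD(1)[OF bij] that by (auto simp: in_arc_def inj_on_eq_iff)
  have "(\<forall>y z. {y, z} \<in> image g ` x \<longrightarrow> (in_arc y z (g a) \<longleftrightarrow> in_arc y z (g b))) \<longleftrightarrow>
      (\<forall>p q. {p, q} \<in> x \<longrightarrow> (in_arc p q a \<longleftrightarrow> in_arc p q b))" (is "?L \<longleftrightarrow> ?R")
  proof
    assume L: ?L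
    show ?R
    proof (intro allI impI)
      fix p q assume pq: "{p, q} \<in> x"
      then have "{g p, g q} \<in> image g ` x" by (metis image_eqI image_empty image_insert)
      then have "in_arc (g p) (g q) (g a) \<longleftrightarrow> in_arc (g p) (g q) (g b)" using L by blast
      moreover have "p \<in> circle" "q \<in> circle" using pairing_pair[OF x pq] bdry_circle by auto
      ultimately show "in_arc p q a \<longleftrightarrow> in_arc p q b" using arc ab by simp
    qed
  next
    assume R: ?R
    show ?L
    proof (intro allI impI)
      fix y z assume yz: "{y, z} \<in> image g ` x"
      then have "y \<noteq> z" using pairing_pair[OF pairing_image[OF x]] by blast
      then obtain p q where pq: "p \<in> bdry_points I" "q \<in> bdry_points I" "{p, q} \<in> x" "y = g p" "z = g q"
        using pair_preimage[OF x yz] by metis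
      then have "p \<in> circle" "q \<in> circle" using bdry_circle by auto
      then show "in_arc y z (g a) \<longleftrightarrow> in_arc y z (g b)" using R pq arc ab by simp
    qed
  qed
  then show ?thesis
    using linked_iff_arc[of x a b] linked_iff_arc[of "image g ` x" "g a" "g b"]
      pairing_pair(3)[OF x] pairing_pair(3)[OF pairing_image[OF x]] by auto
qed

lemma spin_compat_image:
  assumes x: "x \<in> pairings I"
  shows "spin_compat (Inf ` image g ` I) (image g ` x) s \<longleftrightarrow> spin_compat (Inf ` I) x (s \<circ> g)"
proof -
  have "a \<in> circle" if "a \<in> Inf ` I" for a using that bdry_mem(1)[OF source] bdry_circle by auto
  then show ?thesis unfolding Inf_image spin_compat_def using linked_image[OF x] by simp
qed

lemma move_by_in_tl_space: "move_by g I v \<in> tl_space (image g ` I)"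
  unfolding move_by_def using pairing_image tl_basis_in_tl_space by (intro tl_extend_in_tl_space) blast

lemma spin_coeff_move_by: "spin_coeff (image g ` I) (move_by g I v) s = spin_coeff I v (s \<circ> g)"
proof -
  have "spin_coeff (image g ` I) (tl_basis (image g ` x)) s = of_bool (spin_compat (Inf ` I) x (s \<circ> g))"
    if x: "x \<in> pairings I" for x
    using spin_coeff_basis[OF finite_pairings[OF target] pairing_image[OF x]] spin_compat_image[OF x] by simp
  then show ?thesis unfolding move_by_def spin_coeff_extend by (simp add: spin_coeff_def)
qed

lemma split_image:
  assumes J: "J \<in> I" and x: "x \<in> pairings I"
  shows "image g ` split_left J x = split_left (g ` J) (image g ` x)"
    "image g ` split_right J x = split_right (g ` J) (image g ` x)"
proof -
  have gh: "good_for g (halve I J)" using halve_image(2)[OF bij gd J] .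
  have mem: "lower_half J \<in> halve I J" "upper_half J \<in> halve I J" by (auto simp: halve_def)
  have pts: "g (middle J) = middle (g ` J)" "g (middle (lower_half J)) = middle (lower_half (g ` J))"
    "g (middle (upper_half J)) = middle (upper_half (g ` J))"
    using good_for_points(2-4)[OF gd J] good_for_points(2)[OF gh mem(1)] good_for_points(2)[OF gh mem(2)] by simp_all
  have mv: "image g ` move_end (middle J) d x = move_end (g (middle J)) (g d) (image g ` x)" for d
  proof -
    have "g ` id(middle J := d) ` s = id(g (middle J) := g d) ` g ` s" if s: "s \<in> x" for s
    proof -
      have sub: "s \<subseteq> bdry_points I" using x s by (auto simp: pairings_def dest: partition_onD1)
      have "g ((id(middle J := d)) p) = (id(g (middle J) := g d)) (g p)" if "p \<in> s" for p
        using inj_onD[OF g_inj, of p "middle J"] sub that bdry_mem(2)[OF source J] by auto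
      then show ?thesis unfolding image_image by (intro image_cong refl)
    qed
    then show ?thesis
      unfolding move_end_def image_image[of "image g"] image_image[of "image (id(g (middle J) := g d))"]
      by (rule image_cong[OF refl])
  qed
  show "image g ` split_left J x = split_left (g ` J) (image g ` x)"
    "image g ` split_right J x = split_right (g ` J) (image g ` x)"
    unfolding split_left_def split_right_def image_insert mv pts by simp_all
qed

text \<open>Moving points commutes with connecting maps, since the midpoints of halves are carried to the midpoints of
halves.\<close>

lemma move_by_halve:
  assumes J: "J \<in> I"
  shows "move_by g (halve I J) (halve_map Q I J v) = halve_map Q (image g ` I) (g ` J) (move_by g I v)"
proof -
  define k where "k = complex_of_real (1 / sqrt (Q - 1))"
  note fin = finite_pairings[OF halve_in_dyadic_partitions[OF source J]]
  have "tl_extend (halve I J) (\<lambda>x. tl_basis (image g ` x)) (\<lambda>y. k * (tl_basis (split_left J x) y - tl_basis (split_right J x) y)) =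
      tl_extend (image g ` I) (\<lambda>x y. k * (tl_basis (split_left (g ` J) x) y - tl_basis (split_right (g ` J) x) y)) (tl_basis (image g ` x))"
    if x: "x \<in> pairings I" for x
  proof -
    have "(\<lambda>y. k * (tl_basis (split_left J x) y - tl_basis (split_right J x) y)) =
        (\<lambda>y. k * (tl_basis (split_left J x) y + - 1 * tl_basis (split_right J x) y))" by simp
    then show ?thesis
      by (simp only: tl_extend_scale tl_extend_add tl_extend_basis[OF fin split_left_in_pairings[OF source J x]]
          tl_extend_basis[OF fin split_right_in_pairings[OF source J x]]
          tl_extend_basis[OF finite_pairings[OF target] pairing_image[OF x]] split_image[OF J x]) simp
  qed
  then show ?thesis
    unfolding halve_map_eq move_by_def tl_extend_extend k_def[symmetric] by (rule tl_extend_cong)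
qed

end

section \<open>Parity of binary digits and regular configurations\<close>

text \<open>The parity of the number of digits 1 in the binary expansion, the Thue--Morse sequence.\<close>

fun thue :: "nat \<Rightarrow> bool" where
  "thue n = (if n = 0 then False else thue (n div 2) \<noteq> odd n)"

declare thue.simps [simp del]

lemma thue_double: "thue (2 * n) = thue n" "thue (Suc (2 * n)) = (\<not> thue n)"
  by (subst thue.simps; simp add: thue.simps[of 0])+

lemma thue_0 [simp]: "thue 0 = False"
  by (simp add: thue.simps)

lemma thue_1: "thue 1 = True"
  using thue_double(2)[of 0] by simp

lemma thue_concat: "j < 2 ^ m \<Longrightarrow> thue (p * 2 ^ m + j) \<longleftrightarrow> thue p \<noteq> thue j"
proof (induction m arbitrary: j)
  case (Suc m)
  have "j div 2 < 2 ^ m" using Suc.prems by auto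
  then have IH: "thue (p * 2 ^ m + j div 2) \<longleftrightarrow> thue p \<noteq> thue (j div 2)" by (rule Suc.IH)
  show ?case
  proof (cases "even j")
    case True
    then obtain i where i: "j = 2 * i" by blast
    have "p * 2 ^ Suc m + j = 2 * (p * 2 ^ m + i)" unfolding i by simp
    then have "thue (p * 2 ^ Suc m + j) = thue (p * 2 ^ m + i)" by (simp only: thue_double(1))
    moreover have "thue j = thue i" "j div 2 = i" unfolding i thue_double(1) by simp_all
    ultimately show ?thesis using IH by simp
  next
    case False
    then obtain i where i: "j = Suc (2 * i)" by (metis oddE Suc_eq_plus1)
    have "p * 2 ^ Suc m + j = Suc (2 * (p * 2 ^ m + i))" unfolding i by simp
    then have "thue (p * 2 ^ Suc m + j) = (\<not> thue (p * 2 ^ m + i))" by (simp only: thue_double(2))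
    moreover have "thue j = (\<not> thue i)" "j div 2 = i" unfolding i thue_double(2) by simp_all
    ultimately show ?thesis using IH by auto
  qed
qed simp

definition binary_parity :: "real \<Rightarrow> bool" where
  "binary_parity d = thue (nat \<lfloor>d * 2 ^ (LEAST n. d * 2 ^ n \<in> \<int>)\<rfloor>)"

lemma binary_parity_eq: "binary_parity (real p / 2 ^ n) = thue p"
proof -
  let ?d = "real p / 2 ^ n"
  define l where "l = (LEAST n. ?d * 2 ^ n \<in> \<int>)"
  have n: "?d * 2 ^ n \<in> \<int>" by simp
  have l: "?d * 2 ^ l \<in> \<int>" unfolding l_def by (rule LeastI[of _ n]) (rule n)
  have ln: "l \<le> n" unfolding l_def by (rule Least_le) (rule n)
  have "0 \<le> ?d * 2 ^ l" by simp
  then obtain q :: nat where q: "?d * 2 ^ l = real q" using l by (metis Ints_cases of_int_0_le_iff of_int_of_nat_eq nonneg_int_cases)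
  have "(2 :: real) ^ n = 2 ^ l * 2 ^ (n - l)" using ln by (metis le_add_diff_inverse power_add)
  then have "real p = real q * 2 ^ (n - l)" using q by (simp add: field_simps)
  then have p: "p = q * 2 ^ (n - l)" by (metis of_nat_eq_iff of_nat_mult of_nat_numeral of_nat_power)
  have "binary_parity ?d = thue q" unfolding binary_parity_def l_def[symmetric] q by simp
  then show ?thesis using thue_concat[of 0 "n - l" q] by (simp add: p)
qed

lemma binary_parity_0 [simp]: "\<not> binary_parity 0"
  using binary_parity_eq[of 0 0] by simp

lemma binary_parity_half [simp]: "binary_parity (1 / 2)"
  using binary_parity_eq[of 1 1] thue_1 by simp

definition rel_pos :: "real set \<Rightarrow> real \<Rightarrow> real" where
  "rel_pos J d = (d - Inf J) / (Sup J - Inf J)"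

text \<open>The binary digits of a point in a standard dyadic interval are those of the left endpoint followed
by those of its relative position.\<close>

lemma binary_parity_rel_pos:
  assumes J: "standard_dyadic J" and d: "d \<in> J" "d \<in> dyadic"
  shows "binary_parity d \<longleftrightarrow> binary_parity (Inf J) \<noteq> binary_parity (rel_pos J d)"
proof -
  obtain n p where np: "p < 2 ^ n" "J = dyadic_interval n p" using J by (auto simp: standard_dyadic_iff)
  obtain l where "d * 2 ^ l \<in> \<int>" using d(2) by (auto simp: dyadic_iff)
  then have "d * 2 ^ (n + l) \<in> \<int>" by (rule dyadic_scaled_Ints) simp
  then obtain i :: int where i: "d * 2 ^ (n + l) = of_int i" by (rule Ints_cases)
  have dp: "real p / 2 ^ n \<le> d" "d < (real p + 1) / 2 ^ n" using d(1) by (auto simp: np(2) dyadic_interval_def)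
  have "0 \<le> d" using dp(1) by (rule order_trans[rotated]) simp
  then have "(0 :: real) \<le> of_int i" unfolding i[symmetric] by simp
  then obtain q :: nat where "i = int q" using nonneg_int_cases by auto
  then have q: "d * 2 ^ (n + l) = real q" using i by simp
  have dq: "d = real q / 2 ^ (n + l)" using q by (simp add: field_simps)
  have "real p * 2 ^ l \<le> real q" "real q < (real p + 1) * 2 ^ l"
    using dp unfolding dq by (simp_all add: power_add field_simps)
  then have "real (p * 2 ^ l) \<le> real q" "real q < real ((p + 1) * 2 ^ l)" by (simp_all add: algebra_simps)
  then have le: "p * 2 ^ l \<le> q" "q < (p + 1) * 2 ^ l" by (simp_all only: of_nat_le_iff of_nat_less_iff)
  define j where "j = q - p * 2 ^ l"
  have j: "j < 2 ^ l" "q = p * 2 ^ l + j" using le by (auto simp: j_def)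
  have "rel_pos J d = real j / 2 ^ l"
    unfolding rel_pos_def np(2) dq j(2) by (simp add: field_simps power_add)
  then show ?thesis
    using thue_concat[OF j(1), of p] binary_parity_eq[of q "n + l"] binary_parity_eq[of p n] binary_parity_eq[of j l]
    by (simp add: dq j(2) np(2))
qed

text \<open>The configurations that arise below \<open>I\<close> by repeated halving: the spin of a point differs from that of
the left endpoint of its interval by the parity of its relative position.\<close>

definition regular :: "real set set \<Rightarrow> (real \<Rightarrow> bool) \<Rightarrow> bool" where
  "regular I w \<longleftrightarrow> (\<forall>J\<in>I. \<forall>d\<in>J \<inter> dyadic. w d \<longleftrightarrow> w (Inf J) \<noteq> binary_parity (rel_pos J d))"

lemma standard_middle_dyadic: "standard_dyadic J \<Longrightarrow> middle J \<in> dyadic"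
  using standard_dyadic_Inf_dyadic[OF standard_dyadic_half(2)[of J]] half_simps(3)[of J] by simp

lemma rel_pos_range:
  assumes "standard_dyadic J" "d \<in> J"
  shows "0 \<le> rel_pos J d" "rel_pos J d < 1"
  using assms standard_dyadicD(3)[OF assms(1)] standard_dyadic_mem[OF assms(1)] by (auto simp: rel_pos_def)

lemma rel_pos_dyadic:
  assumes "standard_dyadic J" "d \<in> dyadic"
  shows "rel_pos J d \<in> dyadic"
proof -
  obtain n :: nat where n: "Sup J - Inf J = 2 powi - int n" using standard_dyadic_length[OF assms(1)] .
  have "rel_pos J d = 2 powi int n * (d - Inf J)"
    unfolding rel_pos_def n by (simp add: power_int_minus divide_inverse)
  then show ?thesis using assms standard_dyadic_Inf_dyadic by (simp only:) (intro dyadic_power_int dyadic_diff)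
qed

lemma binary_parity_lower: "0 \<le> r \<Longrightarrow> r < 1 / 2 \<Longrightarrow> r \<in> dyadic \<Longrightarrow> binary_parity r = binary_parity (2 * r)"
proof -
  assume r: "0 \<le> r" "r < 1 / 2" "r \<in> dyadic"
  have "standard_dyadic (dyadic_interval 1 0)"
    unfolding standard_dyadic_iff by (intro exI[of _ 1] exI[of _ 0] conjI refl) simp
  from binary_parity_rel_pos[OF this, of r] show ?thesis using r
    by (simp add: rel_pos_def) (simp add: dyadic_interval_def mult.commute)
qed

lemma binary_parity_upper: "1 / 2 \<le> r \<Longrightarrow> r < 1 \<Longrightarrow> r \<in> dyadic \<Longrightarrow> binary_parity r = (\<not> binary_parity (2 * r - 1))"
proof -
  assume r: "1 / 2 \<le> r" "r < 1" "r \<in> dyadic"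
  have sd: "standard_dyadic (dyadic_interval 1 1)" unfolding standard_dyadic_iff by (intro exI[of _ 1] conjI refl) simp
  have "r \<in> dyadic_interval 1 1" using r by (simp add: dyadic_interval_def)
  moreover have "rel_pos (dyadic_interval 1 1) r = 2 * r - 1" by (simp add: rel_pos_def field_simps)
  ultimately show ?thesis using binary_parity_rel_pos[OF sd, of r] r(3) by simp
qed

lemma rel_pos_halves:
  assumes J: "standard_dyadic J"
  shows "rel_pos (lower_half J) d = 2 * rel_pos J d" "rel_pos (upper_half J) d = 2 * rel_pos J d - 1"
    "d \<in> lower_half J \<Longrightarrow> rel_pos J d < 1 / 2" "d \<in> upper_half J \<Longrightarrow> 1 / 2 \<le> rel_pos J d"
proof -
  have pos: "0 < Sup J - Inf J" using standard_dyadicD(3)[OF J] by simp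
  show "rel_pos (lower_half J) d = 2 * rel_pos J d" "rel_pos (upper_half J) d = 2 * rel_pos J d - 1"
    using pos by (simp_all add: rel_pos_def half_simps[OF J] middle_def field_simps)
  show "d \<in> lower_half J \<Longrightarrow> rel_pos J d < 1 / 2" "d \<in> upper_half J \<Longrightarrow> 1 / 2 \<le> rel_pos J d"
    using pos by (simp_all add: rel_pos_def lower_half_def upper_half_def middle_def field_simps)
qed

lemma rel_pos_Inf [simp]: "rel_pos J (Inf J) = 0"
  by (simp add: rel_pos_def)

lemma rel_pos_middle: "standard_dyadic J \<Longrightarrow> rel_pos J (middle J) = 1 / 2"
  using standard_dyadicD(3)[of J] by (simp add: rel_pos_def middle_def field_simps)

text \<open>This is the rule by which connecting maps extend configurations: the lower half keeps its spin and
the upper half receives the opposite one.\<close>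

lemma regular_halve_iff:
  assumes I: "I \<in> dyadic_partitions" and J: "J \<in> I"
  shows "regular I w \<longleftrightarrow> regular (halve I J) w \<and> w (middle J) = (\<not> w (Inf J))"
proof -
  note sd = dyadic_partitionsD(3)[OF I J]
  let ?ok = "\<lambda>K d. w d \<longleftrightarrow> w (Inf K) \<noteq> binary_parity (rel_pos K d)"
  have r: "0 \<le> rel_pos J d" "rel_pos J d < 1" "rel_pos J d \<in> dyadic" if "d \<in> J \<inter> dyadic" for d
    using rel_pos_range[OF sd] rel_pos_dyadic[OF sd] that by auto
  have sub: "lower_half J \<subseteq> J" "upper_half J \<subseteq> J" using halves(1)[OF sd] by auto
  have low: "?ok J d \<longleftrightarrow> ?ok (lower_half J) d" if "d \<in> lower_half J \<inter> dyadic" for d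
  proof -
    have d: "d \<in> J \<inter> dyadic" using that sub by auto
    have "binary_parity (rel_pos J d) = binary_parity (rel_pos (lower_half J) d)"
      using binary_parity_lower[of "rel_pos J d"] r[OF d] rel_pos_halves(1,3)[OF sd, of d] that by auto
    then show ?thesis using half_simps(1)[OF sd] by simp
  qed
  have up: "?ok J d \<longleftrightarrow> ?ok (upper_half J) d" if "d \<in> upper_half J \<inter> dyadic" "w (middle J) = (\<not> w (Inf J))" for d
  proof -
    have d: "d \<in> J \<inter> dyadic" using that(1) sub by auto
    have "binary_parity (rel_pos J d) = (\<not> binary_parity (rel_pos (upper_half J) d))"
      using binary_parity_upper[of "rel_pos J d"] r[OF d] rel_pos_halves(2,4)[OF sd, of d] that(1) by auto
    then show ?thesis using half_simps(3)[OF sd] that(2) by auto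
  qed
  have mid: "middle J \<in> J \<inter> dyadic"
    using middle_between[OF sd] standard_dyadic_mem[OF sd] standard_middle_dyadic[OF sd] by simp
  have "regular I w \<longleftrightarrow> (\<forall>K\<in>I - {J}. \<forall>d\<in>K \<inter> dyadic. ?ok K d) \<and> (\<forall>d\<in>J \<inter> dyadic. ?ok J d)"
    unfolding regular_def using J by blast
  also have "(\<forall>d\<in>J \<inter> dyadic. ?ok J d) \<longleftrightarrow> (\<forall>d\<in>lower_half J \<inter> dyadic. ?ok (lower_half J) d) \<and>
      (\<forall>d\<in>upper_half J \<inter> dyadic. ?ok (upper_half J) d) \<and> w (middle J) = (\<not> w (Inf J))" (is "?L \<longleftrightarrow> ?R")
  proof
    assume L: ?L
    then have "?ok J (middle J)" using mid by blast
    then have m: "w (middle J) = (\<not> w (Inf J))" using rel_pos_middle[OF sd] by simp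
    show ?R
      using L low up m sub by (intro conjI ballI) (blast, blast, simp)
  next
    assume R: ?R
    show ?L
    proof
      fix d assume d: "d \<in> J \<inter> dyadic"
      then consider "d \<in> lower_half J \<inter> dyadic" | "d \<in> upper_half J \<inter> dyadic" using halves(1)[OF sd] by blast
      then show "?ok J d"
      proof cases
        case 1
        then show ?thesis using R low[OF 1] by blast
      next
        case 2
        then show ?thesis using R up[OF 2] by blast
      qed
    qed
  qed
  also have "(\<forall>K\<in>I - {J}. \<forall>d\<in>K \<inter> dyadic. ?ok K d) \<and> \<dots> \<longleftrightarrow>
      regular (halve I J) w \<and> w (middle J) = (\<not> w (Inf J))"
    by (simp only: regular_def halve_def ball_Un ball_simps(5,7)) blast
  finally show ?thesis .
qed

abbreviation dyadic_circle :: "real set" where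
  "dyadic_circle \<equiv> dyadic \<inter> circle"

text \<open>The normalisation at 0 selects one configuration of each pair that differ by a global flip. Points
outside the dyadic circle receive a default value, so that configurations are determined by their
values at dyadic points.\<close>

definition spins :: "(real \<Rightarrow> bool) set" where
  "spins = {w. w 0 \<and> (\<forall>d. d \<notin> dyadic_circle \<longrightarrow> \<not> w d) \<and> (\<exists>I\<in>dyadic_partitions. regular I w)}"

lemma Inf_dyadic_circle:
  assumes "I \<in> dyadic_partitions" "J \<in> I"
  shows "Inf J \<in> dyadic_circle"
  using standard_dyadic_Inf_dyadic dyadic_partitionsD(3)[OF assms] bdry_mem(1)[OF assms] bdry_points_subset[OF assms(1)] by auto

lemma regular_agree:
  assumes I: "I \<in> dyadic_partitions" and w: "regular I w" "regular I w'" "w \<in> spins" "w' \<in> spins"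
    and eq: "\<And>a. a \<in> Inf ` I \<Longrightarrow> w a = w' a"
  shows "w = w'"
proof
  fix d
  show "w d = w' d"
  proof (cases "d \<in> dyadic_circle")
    case True
    then obtain J where J: "J \<in> I" "d \<in> J" using partition_onD1[OF dyadic_partitionsD(2)[OF I]] by blast
    then have "w d \<longleftrightarrow> w (Inf J) \<noteq> binary_parity (rel_pos J d)" "w' d \<longleftrightarrow> w' (Inf J) \<noteq> binary_parity (rel_pos J d)"
      using w(1,2) True unfolding regular_def by blast+
    then show ?thesis using eq J(1) by blast
  next
    case False
    then show ?thesis using w(3,4) by (simp add: spins_def)
  qed
qed

text \<open>A configuration on the intervals of a partition has exactly one regular extension; uniqueness is
\<open>regular_agree\<close>.\<close>

lemma regular_extension:
  assumes I: "I \<in> dyadic_partitions" and s: "s 0"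
  obtains w where "w \<in> spins" "regular I w" "\<And>a. a \<in> Inf ` I \<Longrightarrow> w a = s a"
proof -
  define w where "w d \<longleftrightarrow> d \<in> dyadic_circle \<and> (\<exists>J\<in>I. d \<in> J \<and> s (Inf J) \<noteq> binary_parity (rel_pos J d))" for d
  have w: "w d \<longleftrightarrow> s (Inf J) \<noteq> binary_parity (rel_pos J d)" if J: "J \<in> I" "d \<in> J" "d \<in> dyadic" for J d
  proof -
    have "K = J" if "K \<in> I" "d \<in> K" for K
      using disjointD[OF partition_onD2[OF dyadic_partitionsD(2)[OF I]] that(1) J(1)] that(2) J(2) by blast
    moreover have "d \<in> circle" using interval_subset_circle[OF I J(1)] J(2) by blast
    ultimately show ?thesis unfolding w_def using J by blast
  qed
  have Inf: "w (Inf J) = s (Inf J)" if J: "J \<in> I" for J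
  proof -
    note sd = dyadic_partitionsD(3)[OF I J]
    have "Inf J \<in> J" using standard_dyadicD(3)[OF sd] standard_dyadic_mem[OF sd] by simp
    then show ?thesis using w[OF J] standard_dyadic_Inf_dyadic[OF sd] by simp
  qed
  have reg: "regular I w" unfolding regular_def using w Inf by blast
  moreover have "w \<in> spins"
  proof -
    obtain J where "J \<in> I" "Inf J = 0" using zero_left_end[OF I] .
    then have "w 0" using Inf[of J] s by simp
    then show ?thesis using reg I by (auto simp: spins_def w_def)
  qed
  ultimately show thesis using that Inf by blast
qed

section \<open>Coordinates\<close>

lemma spin_coeff_cong:
  assumes "\<And>a. a \<in> Inf ` I \<Longrightarrow> s a = s' a"
  shows "spin_coeff I v s = spin_coeff I v s'"
proof -
  have "spin_compat (Inf ` I) x s = spin_compat (Inf ` I) x s'" for x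
    unfolding spin_compat_def using assms by simp
  then show ?thesis by (simp add: spin_coeff_def)
qed

lemma spin_coeff_flip: "spin_coeff I v (\<lambda>a. \<not> s a) = spin_coeff I v s"
  by (simp add: spin_coeff_def spin_compat_def)

text \<open>The factor \<open>sqrt 2\<close> accounts for the two configurations that are represented by one element of
\<open>spins\<close>.\<close>

definition spin_coord :: "real set set \<times> tl_vector \<Rightarrow> (real \<Rightarrow> bool) \<Rightarrow> complex" where
  "spin_coord a w = (if w \<in> spins \<and> regular (fst a) w then sqrt 2 * spin_coeff (fst a) (snd a) w else 0)"

text \<open>If \<open>w\<close> is regular for the halved partition but not for the original one, then its spins at the two
halves agree and both sides vanish.\<close>

lemma spin_coord_halve_step:
  assumes "(a, b) \<in> halve_step 2"
  shows "spin_coord b = spin_coord a"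
proof
  fix w
  obtain I v where a: "a = (I, v)" by (cases a)
  obtain J where J: "I \<in> dyadic_partitions" "J \<in> I" "b = (halve I J, halve_map 2 I J v)"
    using assms unfolding a by (rule halve_stepE)
  show "spin_coord b w = spin_coord a w"
    using regular_halve_iff[OF J(1,2), of w] spin_coeff_halve[OF J(1,2), of v w]
    by (auto simp: spin_coord_def a J(3))
qed

lemma spin_coord_path: "(a, b) \<in> (halve_step 2)\<^sup>* \<Longrightarrow> spin_coord b = spin_coord a"
  by (induction rule: rtrancl_induct) (auto dest: spin_coord_halve_step)

lemma spin_coeff_add: "spin_coeff I (\<lambda>x. v x + w x) s = spin_coeff I v s + spin_coeff I w s"
  by (simp add: spin_coeff_def distrib_right sum.distrib)

lemma spin_coeff_scale: "spin_coeff I (\<lambda>x. c * v x) s = c * spin_coeff I v s"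
  by (simp add: spin_coeff_def sum_distrib_left mult.assoc)

lemma spin_coord_add: "spin_coord (I, \<lambda>x. v x + w x) s = spin_coord (I, v) s + spin_coord (I, w) s"
  by (simp add: spin_coord_def spin_coeff_add distrib_left)

lemma spin_coord_scale: "spin_coord (I, \<lambda>x. c * v x) s = c * spin_coord (I, v) s"
  by (simp add: spin_coord_def spin_coeff_scale)

lemma bij_regular_spins:
  assumes I: "I \<in> dyadic_partitions"
  shows "bij_betw (\<lambda>w. restrict w (Inf ` I)) {w \<in> spins. regular I w} {s \<in> Inf ` I \<rightarrow>\<^sub>E UNIV. s 0}"
proof (rule bij_betw_imageI)
  obtain J where "J \<in> I" "Inf J = 0" using zero_left_end[OF I] .
  then have z: "0 \<in> Inf ` I" by (metis imageI)
  show "inj_on (\<lambda>w. restrict w (Inf ` I)) {w \<in> spins. regular I w}"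
  proof (rule inj_onI)
    fix w w' assume *: "w \<in> {w \<in> spins. regular I w}" "w' \<in> {w \<in> spins. regular I w}"
      "restrict w (Inf ` I) = restrict w' (Inf ` I)"
    have "w a = w' a" if "a \<in> Inf ` I" for a using fun_cong[OF *(3), of a] that by simp
    then show "w = w'" using regular_agree[OF I] * by blast
  qed
  show "(\<lambda>w. restrict w (Inf ` I)) ` {w \<in> spins. regular I w} = {s \<in> Inf ` I \<rightarrow>\<^sub>E UNIV. s 0}"
  proof (intro equalityI subsetI)
    fix s assume "s \<in> (\<lambda>w. restrict w (Inf ` I)) ` {w \<in> spins. regular I w}"
    then obtain w where w: "w \<in> spins" "s = restrict w (Inf ` I)" by auto
    have "w 0" using w(1) by (simp add: spins_def)
    then have "s 0" unfolding w(2) using z by simp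
    then show "s \<in> {s \<in> Inf ` I \<rightarrow>\<^sub>E UNIV. s 0}" unfolding w(2) by simp
  next
    fix s assume s: "s \<in> {s \<in> Inf ` I \<rightarrow>\<^sub>E (UNIV :: bool set). s 0}"
    then have "s 0" by simp
    then obtain w where w: "w \<in> spins" "regular I w" "\<And>a. a \<in> Inf ` I \<Longrightarrow> w a = s a"
      using regular_extension[OF I, of s] by metis
    have "s \<in> extensional (Inf ` I)" using s by (simp add: PiE_def)
    then have "restrict w (Inf ` I) = s" using w(3) by (intro extensionalityI[of _ "Inf ` I"]) auto
    then show "s \<in> (\<lambda>w. restrict w (Inf ` I)) ` {w \<in> spins. regular I w}" using w(1,2) by blast
  qed
qed

lemma finite_regular_spins: "I \<in> dyadic_partitions \<Longrightarrow> finite {w \<in> spins. regular I w}"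
proof -
  assume I: "I \<in> dyadic_partitions"
  have "finite (Inf ` I \<rightarrow>\<^sub>E (UNIV :: bool set))" using dyadic_partitionsD(1)[OF I] by (intro finite_PiE) auto
  then have "finite {s \<in> Inf ` I \<rightarrow>\<^sub>E (UNIV :: bool set). s 0}" by (rule rev_finite_subset) auto
  then show ?thesis using bij_betw_finite[OF bij_regular_spins[OF I]] by blast
qed

lemma spin_coord_in_ell2:
  assumes I: "I \<in> dyadic_partitions"
  shows "spin_coord (I, v) \<in> ell2_vecs spins"
proof -
  have "(\<lambda>w. (cmod (spin_coord (I, v) w))\<^sup>2) summable_on {w \<in> spins. regular I w}"
    using finite_regular_spins[OF I] by (rule summable_on_finite)
  then have "(\<lambda>w. (cmod (spin_coord (I, v) w))\<^sup>2) summable_on spins"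
    by (rule summable_on_cong_neutral[THEN iffD1, rotated -1]) (auto simp: spin_coord_def)
  then show ?thesis by (simp add: ell2_vecs_iff spin_coord_def)
qed

lemma chrom_form_eq_inner:
  assumes I: "I \<in> dyadic_partitions"
  shows "chrom_form 2 I v w = vinner (ell2 spins) (spin_coord (I, v)) (spin_coord (I, w))"
proof -
  let ?E = "Inf ` I \<rightarrow>\<^sub>E (UNIV :: bool set)" and ?R = "{w \<in> spins. regular I w}"
  let ?f = "\<lambda>s. spin_coeff I v s * cnj (spin_coeff I w s)"
  obtain J where "J \<in> I" "Inf J = 0" using zero_left_end[OF I] .
  then have z: "0 \<in> Inf ` I" by (metis imageI)
  have finE: "finite ?E" using dyadic_partitionsD(1)[OF I] by (intro finite_PiE) auto
  \<comment> \<open>Flipping all spins exchanges the configurations normalised at 0 with the others.\<close>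
  have flip: "(\<Sum>s\<in>{s \<in> ?E. \<not> s 0}. ?f s) = (\<Sum>s\<in>{s \<in> ?E. s 0}. ?f s)"
  proof (rule sum.reindex_bij_witness[where i = "\<lambda>s. \<lambda>a\<in>Inf ` I. \<not> s a" and j = "\<lambda>s. \<lambda>a\<in>Inf ` I. \<not> s a"])
    fix s assume s: "s \<in> {s \<in> ?E. \<not> s 0}"
    then have e: "s \<in> extensional (Inf ` I)" by (simp add: PiE_def)
    show "(\<lambda>a\<in>Inf ` I. \<not> (\<lambda>a\<in>Inf ` I. \<not> s a) a) = s"
      by (rule extensionalityI[OF _ e]) auto
    show "(\<lambda>a\<in>Inf ` I. \<not> s a) \<in> {s \<in> ?E. s 0}" using s z by simp
    have "spin_coeff I u (\<lambda>a\<in>Inf ` I. \<not> s a) = spin_coeff I u s" for u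
    proof -
      have "spin_coeff I u (\<lambda>a\<in>Inf ` I. \<not> s a) = spin_coeff I u (\<lambda>a. \<not> s a)" by (rule spin_coeff_cong) simp
      then show ?thesis by (simp only: spin_coeff_flip)
    qed
    then show "?f (\<lambda>a\<in>Inf ` I. \<not> s a) = ?f s" by simp
  next
    fix s assume s: "s \<in> {s \<in> ?E. s 0}"
    then have e: "s \<in> extensional (Inf ` I)" by (simp add: PiE_def)
    show "(\<lambda>a\<in>Inf ` I. \<not> (\<lambda>a\<in>Inf ` I. \<not> s a) a) = s"
      by (rule extensionalityI[OF _ e]) auto
    show "(\<lambda>a\<in>Inf ` I. \<not> s a) \<in> {s \<in> ?E. \<not> s 0}" using s z by simp
  qed
  have "chrom_form 2 I v w = (\<Sum>s\<in>?E. ?f s)" by (rule chrom_form_eq_spin_sum[OF I])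
  also have "?E = {s \<in> ?E. s 0} \<union> {s \<in> ?E. \<not> s 0}" by blast
  also have "(\<Sum>s\<in>\<dots>. ?f s) = (\<Sum>s\<in>{s \<in> ?E. s 0}. ?f s) + (\<Sum>s\<in>{s \<in> ?E. \<not> s 0}. ?f s)"
    using finE by (intro sum.union_disjoint) auto
  also have "\<dots> = 2 * (\<Sum>s\<in>{s \<in> ?E. s 0}. ?f s)" unfolding flip by simp
  also have "(\<Sum>s\<in>{s \<in> ?E. s 0}. ?f s) = (\<Sum>s\<in>?R. ?f (restrict s (Inf ` I)))"
    by (rule sum.reindex_bij_betw[OF bij_regular_spins[OF I], symmetric])
  also have "\<dots> = (\<Sum>s\<in>?R. ?f s)"
  proof (rule sum.cong[OF refl])
    fix s
    have "spin_coeff I u (restrict s (Inf ` I)) = spin_coeff I u s" for u by (rule spin_coeff_cong) simp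
    then show "?f (restrict s (Inf ` I)) = ?f s" by simp
  qed
  also have "2 * (\<Sum>s\<in>?R. ?f s) = (\<Sum>s\<in>?R. spin_coord (I, v) s * cnj (spin_coord (I, w) s))"
  proof -
    have "complex_of_real (sqrt 2) * complex_of_real (sqrt 2) = 2"
      by (simp flip: of_real_mult)
    then have "spin_coord (I, v) s * cnj (spin_coord (I, w) s) = 2 * ?f s" if "s \<in> ?R" for s
      using that by (simp add: spin_coord_def mult.assoc mult.left_commute)
    then show ?thesis by (simp add: sum_distrib_left)
  qed
  also have "\<dots> = (\<Sum>\<^sub>\<infinity>s\<in>?R. spin_coord (I, v) s * cnj (spin_coord (I, w) s))"
    using finite_regular_spins[OF I] by simp
  also have "\<dots> = (\<Sum>\<^sub>\<infinity>s\<in>spins. spin_coord (I, v) s * cnj (spin_coord (I, w) s))"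
    by (rule infsum_cong_neutral) (auto simp: spin_coord_def)
  finally show ?thesis by (simp add: ell2_def)
qed

section \<open>The action on spins\<close>

text \<open>The configuration is transported along \<open>g\<close> and then normalised at 0 again.\<close>

definition act :: "(real \<Rightarrow> real) \<Rightarrow> (real \<Rightarrow> bool) \<Rightarrow> real \<Rightarrow> bool" where
  "act g w d \<longleftrightarrow> d \<in> dyadic_circle \<and> w (inv_into circle g d) = w (inv_into circle g 0)"

lemma image_dyadic_circle:
  assumes g: "g \<in> carrier thompson_T"
  shows "g ` dyadic_circle = dyadic_circle"
proof -
  have sub: "h ` dyadic_circle \<subseteq> dyadic_circle" if h: "h \<in> carrier thompson_T" for h
  proof -
    obtain G where G: "thompson_lift G" "\<And>t. t \<in> circle \<Longrightarrow> h t = frac (G t)" and hB: "h \<in> Bij circle"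
      using h by (auto simp: thompson_T_def)
    have "h d \<in> dyadic" if "d \<in> dyadic_circle" for d
      using G(1) that dyadic_frac unfolding thompson_lift_def by (simp add: G(2) image_subset_iff)
    then show ?thesis using BijD(2)[OF hB] by blast
  qed
  have "dyadic_circle \<subseteq> g ` dyadic_circle"
  proof
    fix d assume d: "d \<in> dyadic_circle"
    let ?h = "restrict (inv_into circle g) circle"
    have "?h d \<in> dyadic_circle" using sub[OF inverse_in_thompson_T[OF g]] d by blast
    moreover have "g (?h d) = d" using restrict_inv_into(2)[OF carrier_T_Bij[OF g]] d by blast
    ultimately show "d \<in> g ` dyadic_circle" by (metis imageI)
  qed
  then show ?thesis using sub[OF g] by blast
qed

lemma act_apply:
  assumes g: "g \<in> carrier thompson_T" and d: "d \<in> dyadic_circle"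
  shows "act g w (g d) \<longleftrightarrow> w d = w (inv_into circle g 0)"
proof -
  have "g d \<in> dyadic_circle" using image_dyadic_circle[OF g] d by blast
  moreover have "inv_into circle g (g d) = d" using BijD(1)[OF carrier_T_Bij[OF g]] d by simp
  ultimately show ?thesis by (simp add: act_def)
qed

lemma regular_act:
  assumes g: "g \<in> carrier thompson_T" and gd: "good_for g I" and w: "regular I w"
  shows "regular (image g ` I) (act g w)"
  unfolding regular_def
proof (intro ballI; elim imageE)
  fix K d J assume d: "d \<in> K \<inter> dyadic" and K: "K = g ` J" and J: "J \<in> I"
  have I: "I \<in> dyadic_partitions" and gI: "image g ` I \<in> dyadic_partitions" using gd by (auto simp: good_for_def)
  obtain k where k: "0 < k" "\<And>t. t \<in> J \<Longrightarrow> g t = Inf (g ` J) + (t - Inf J) * k"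
    "Sup (g ` J) - Inf (g ` J) = (Sup J - Inf J) * k"
    using good_for_interval[OF gd J] by metis
  obtain e where e: "e \<in> J" "d = g e" using d K by blast
  have JC: "J \<subseteq> circle" by (rule interval_subset_circle[OF I J])
  have "d \<in> circle" using e JC BijD(2)[OF carrier_T_Bij[OF g]] by blast
  then obtain e' where e': "e' \<in> dyadic_circle" "d = g e'" using image_dyadic_circle[OF g] d by blast
  then have "e' = e" using BijD(1)[OF carrier_T_Bij[OF g]] e JC by (metis IntD2 inj_onD subsetD)
  then have ed: "e \<in> dyadic_circle" using e' by simp
  have rp: "rel_pos K d = rel_pos J e"
    unfolding rel_pos_def K k(3) e(2) k(2)[OF e(1)] using k(1) by simp
  have "act g w d \<longleftrightarrow> w e = w (inv_into circle g 0)" unfolding e(2) by (rule act_apply[OF g ed])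
  moreover have "act g w (Inf K) \<longleftrightarrow> w (Inf J) = w (inv_into circle g 0)"
    unfolding K good_for_points(1)[OF gd J, symmetric] by (rule act_apply[OF g Inf_dyadic_circle[OF I J]])
  moreover have "w e \<longleftrightarrow> w (Inf J) \<noteq> binary_parity (rel_pos J e)" using w J e(1) ed unfolding regular_def by blast
  ultimately show "act g w d \<longleftrightarrow> act g w (Inf K) \<noteq> binary_parity (rel_pos K d)" unfolding rp by blast
qed

lemma inv_into_circle:
  assumes g: "g \<in> carrier thompson_T" and d: "d \<in> circle"
  shows "inv_into circle g (g d) = d" "g (inv_into circle g d) = d" "inv_into circle g d \<in> circle"
proof -
  note gB = carrier_T_Bij[OF g]
  show "inv_into circle g (g d) = d" using BijD(1)[OF gB] d by simp
  show "g (inv_into circle g d) = d" "inv_into circle g d \<in> circle"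
    using restrict_inv_into(2,3)[OF gB d] d by simp_all
qed

lemma inv_into_dyadic_circle:
  assumes g: "g \<in> carrier thompson_T" and d: "d \<in> dyadic_circle"
  shows "inv_into circle g d \<in> dyadic_circle"
proof -
  obtain e where "e \<in> dyadic_circle" "d = g e" using image_dyadic_circle[OF g] d by blast
  then show ?thesis using inv_into_circle(1)[OF g] by simp
qed

lemma zero_dyadic_circle: "0 \<in> dyadic_circle"
  by (auto intro: dyadic_Ints)

lemma act_compose:
  assumes f: "f \<in> carrier thompson_T" and g: "g \<in> carrier thompson_T"
  shows "act (mult thompson_T g f) w = act g (act f w)"
proof
  fix d
  note fB = carrier_T_Bij[OF f] and gB = carrier_T_Bij[OF g]
  have gf: "mult thompson_T g f = compose circle g f" using mult_thompson_T fB gB by simp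
  have gfT: "compose circle g f \<in> carrier thompson_T" using compose_in_thompson_T[OF f g] .
  have inv: "inv_into circle (compose circle g f) t = inv_into circle f (inv_into circle g t)" if t: "t \<in> circle" for t
  proof -
    let ?s = "inv_into circle f (inv_into circle g t)"
    have "?s \<in> circle" using inv_into_circle(3) f g t by blast
    moreover have "compose circle g f ?s = t"
      using inv_into_circle(2)[OF f inv_into_circle(3)[OF g t]] inv_into_circle(2)[OF g t] calculation
      by (simp add: compose_def)
    ultimately show ?thesis using inv_into_circle(1)[OF gfT] by metis
  qed
  show "act (mult thompson_T g f) w d = act g (act f w) d"
  proof (cases "d \<in> dyadic_circle")
    case True
    then have "d \<in> circle" by simp
    then show ?thesis
      using inv_into_dyadic_circle[OF g True] inv_into_dyadic_circle[OF g zero_dyadic_circle]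
        inv[of d] inv[of 0] True
      unfolding gf act_def by auto
  next
    case False
    then show ?thesis unfolding act_def by blast
  qed
qed

lemma act_one:
  assumes "w \<in> spins"
  shows "act (one thompson_T) w = w"
proof
  fix d
  have "inv_into circle (\<lambda>t\<in>circle. t) d = d" if "d \<in> circle" for d
    using inv_into_circle(1)[OF id_in_thompson_T that] that by simp
  then show "act (one thompson_T) w d = w d"
    using assms unfolding act_def one_thompson_T spins_def by (cases "d \<in> dyadic_circle") auto
qed

lemma regular_path:
  assumes "((I, v), (K, u)) \<in> (halve_step 2)\<^sup>*" "regular I w"
  shows "regular K w"
  using assms
proof (induction "(K, u)" arbitrary: K u rule: rtrancl_induct)
  case (step y)
  obtain L z where y: "y = (L, z)" by (cases y)
  obtain J where J: "L \<in> dyadic_partitions" "J \<in> L" "K = halve L J" using step(2) unfolding y by (auto elim: halve_stepE)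
  then show ?case using step(3)[OF y step(4)] regular_halve_iff[OF J(1,2)] by simp
qed simp

lemma zero_in_tl_space: "(\<lambda>_. 0) \<in> tl_space I"
  by (simp add: tl_space_def)

lemma regular_uniform:
  assumes "I \<in> dyadic_partitions" "regular I w"
  obtains N where "\<And>M. M \<ge> N \<Longrightarrow> regular (uniform M) w"
proof -
  obtain N where N: "\<And>M. M \<ge> N \<Longrightarrow> level_le M I" using level_le_exists[OF assms(1)] by blast
  have "regular (uniform M) w" if "M \<ge> N" for M
    using path_to_uniform[OF N[OF that] zero_in_tl_space] regular_path assms(2) by blast
  then show thesis using that by blast
qed

lemma act_in_spins:
  assumes g: "g \<in> carrier thompson_T" and w: "w \<in> spins"
  shows "act g w \<in> spins"
proof -
  obtain I where I: "I \<in> dyadic_partitions" "regular I w" using w by (auto simp: spins_def)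
  obtain N1 where N1: "\<And>M. M \<ge> N1 \<Longrightarrow> regular (uniform M) w" using regular_uniform[OF I] by blast
  obtain N2 where N2: "\<And>M. M \<ge> N2 \<Longrightarrow> good_for g (uniform M)" using thompson_T_good_uniform[OF g] by blast
  let ?N = "max N1 N2"
  have "regular (image g ` uniform ?N) (act g w)" by (rule regular_act[OF g N2 N1]) simp_all
  moreover have "image g ` uniform ?N \<in> dyadic_partitions" using N2[of ?N] by (simp add: good_for_def)
  ultimately show ?thesis using zero_dyadic_circle by (auto simp: spins_def act_def)
qed

lemma act_inv:
  assumes g: "g \<in> carrier thompson_T" and w: "w \<in> spins"
  shows "act (m_inv thompson_T g) (act g w) = w" "act g (act (m_inv thompson_T g) w) = w"
proof -
  interpret group thompson_T by (rule group_thompson_T)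
  show "act (m_inv thompson_T g) (act g w) = w"
    using act_compose[OF g inv_closed[OF g]] l_inv[OF g] act_one[OF w] by metis
  show "act g (act (m_inv thompson_T g) w) = w"
    using act_compose[OF inv_closed[OF g] g] r_inv[OF g] act_one[OF w] by metis
qed

lemma regular_act_iff:
  assumes g: "g \<in> carrier thompson_T" and gd: "good_for g I" and w: "w \<in> spins"
  shows "regular (image g ` I) (act g w) \<longleftrightarrow> regular I w"
proof
  interpret group thompson_T by (rule group_thompson_T)
  let ?h = "m_inv thompson_T g"
  assume reg: "regular (image g ` I) (act g w)"
  have "good_for ?h (image g ` I)" "image ?h ` image g ` I = I"
    using good_for_inverse[OF carrier_T_Bij[OF g] gd] by (simp_all only: inv_thompson_T[OF g])
  then show "regular I w" using regular_act[OF inv_closed[OF g] _ reg] act_inv(1)[OF g w] by metis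
qed (rule regular_act[OF g gd])

text \<open>The possible flip caused by the normalisation is harmless, since coefficients are invariant
under a global flip.\<close>

lemma spin_coord_move_by:
  assumes g: "g \<in> carrier thompson_T" and gd: "good_for g I" and w: "w \<in> spins"
  shows "spin_coord (image g ` I, move_by g I v) (act g w) = spin_coord (I, v) w"
proof -
  have I: "I \<in> dyadic_partitions" using gd by (simp add: good_for_def)
  have gT: "g \<in> Bij circle" "cyclic_mono g" using g thompson_T_iff by auto
  let ?b = "w (inv_into circle g 0)"
  have eq: "(act g w \<circ> g) a = (w a = ?b)" if "a \<in> Inf ` I" for a
    using act_apply[OF g, of a w] Inf_dyadic_circle[OF I] that by auto
  have "spin_coeff (image g ` I) (move_by g I v) (act g w) = spin_coeff I v (act g w \<circ> g)"
    by (rule spin_coeff_move_by[OF gT gd])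
  also have "\<dots> = spin_coeff I v (\<lambda>a. w a = ?b)" by (rule spin_coeff_cong) (rule eq)
  also have "\<dots> = spin_coeff I v w" using spin_coeff_flip[of I v w] by (cases ?b) simp_all
  finally show ?thesis
    using regular_act_iff[OF g gd w] act_in_spins[OF g w] w by (simp add: spin_coord_def)
qed

section \<open>The direct limit\<close>

abbreviation vectors :: "(real set set \<times> tl_vector) set" where
  "vectors \<equiv> Sigma dyadic_partitions tl_space"

text \<open>Equivalent vectors are identified in all sufficiently fine uniform partitions.\<close>

lemma common_uniform:
  assumes "(a, b) \<in> limit_rel Q"
  shows "\<exists>N0. \<forall>N\<ge>N0. \<exists>w. (a, (uniform N, w)) \<in> (halve_step Q)\<^sup>* \<and> (b, (uniform N, w)) \<in> (halve_step Q)\<^sup>*"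
proof -
  obtain d where d: "(a, d) \<in> (halve_step Q)\<^sup>*" "(b, d) \<in> (halve_step Q)\<^sup>*" and a: "a \<in> vectors"
    using assms by (auto simp: limit_rel_def)
  have "d \<in> vectors" using halve_step_closed[OF d(1) a] .
  then obtain K z where K: "d = (K, z)" "K \<in> dyadic_partitions" "z \<in> tl_space K" by auto
  obtain N0 where N0: "\<And>M. M \<ge> N0 \<Longrightarrow> level_le M K" using level_le_exists[OF K(2)] by blast
  have "\<exists>w. (a, (uniform N, w)) \<in> (halve_step Q)\<^sup>* \<and> (b, (uniform N, w)) \<in> (halve_step Q)\<^sup>*" if "N \<ge> N0" for N
    using path_to_uniform[OF N0[OF that] K(3)] d unfolding K(1) by (meson rtrancl_trans)
  then show ?thesis by blast
qed

lemma limit_relI: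
  "a \<in> vectors \<Longrightarrow> b \<in> vectors \<Longrightarrow> (a, d) \<in> (halve_step Q)\<^sup>* \<Longrightarrow> (b, d) \<in> (halve_step Q)\<^sup>* \<Longrightarrow> (a, b) \<in> limit_rel Q"
  unfolding limit_rel_def by blast

lemma equiv_limit_rel: "equiv vectors (limit_rel Q)"
proof (rule equivI)
  show "limit_rel Q \<subseteq> vectors \<times> vectors" by (auto simp: limit_rel_def)
  show "refl_on vectors (limit_rel Q)" by (auto simp: limit_rel_def refl_on_def)
  show "sym (limit_rel Q)" by (auto simp: limit_rel_def sym_def)
  show "trans (limit_rel Q)"
  proof (rule transI)
    fix a b c assume ab: "(a, b) \<in> limit_rel Q" and bc: "(b, c) \<in> limit_rel Q"
    obtain N1 where N1: "\<forall>N\<ge>N1. \<exists>w. (a, (uniform N, w)) \<in> (halve_step Q)\<^sup>* \<and> (b, (uniform N, w)) \<in> (halve_step Q)\<^sup>*"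
      using common_uniform[OF ab] by blast
    obtain N2 where N2: "\<forall>N\<ge>N2. \<exists>w. (b, (uniform N, w)) \<in> (halve_step Q)\<^sup>* \<and> (c, (uniform N, w)) \<in> (halve_step Q)\<^sup>*"
      using common_uniform[OF bc] by blast
    let ?N = "max N1 N2"
    obtain w where w: "(a, (uniform ?N, w)) \<in> (halve_step Q)\<^sup>*" "(b, (uniform ?N, w)) \<in> (halve_step Q)\<^sup>*"
      using N1 by (meson max.cobounded1)
    obtain w' where w': "(b, (uniform ?N, w')) \<in> (halve_step Q)\<^sup>*" "(c, (uniform ?N, w')) \<in> (halve_step Q)\<^sup>*"
      using N2 by (meson max.cobounded2)
    have mem: "a \<in> vectors" "b \<in> vectors" "c \<in> vectors" using ab bc by (auto simp: limit_rel_def)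
    obtain I v where b: "b = (I, v)" "I \<in> dyadic_partitions" "v \<in> tl_space I" using mem(2) by auto
    have "w = w'" using path_unique[of I v "uniform ?N" w Q w'] w(2) w'(1) b by blast
    then show "(a, c) \<in> limit_rel Q" using limit_relI[OF mem(1,3) w(1)] w'(2) by blast
  qed
qed

text \<open>The operations of the limit space are given by the image of a set of representatives; it is a single
class because the representatives are equivalent.\<close>

lemma limit_class_image:
  assumes "S \<noteq> {}" "\<And>a b. a \<in> S \<Longrightarrow> b \<in> S \<Longrightarrow> (a, b) \<in> limit_rel Q"
  shows "a \<in> S \<Longrightarrow> limit_rel Q `` S = limit_rel Q `` {a}"
  using assms(2) equiv_limit_rel[of Q] unfolding equiv_def sym_def trans_def by blast

lemma class_member_path:
  assumes A: "A \<in> vectors // limit_rel Q" and a: "a \<in> A" "b \<in> A"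
  shows "(a, b) \<in> limit_rel Q" "a \<in> vectors"
  using quotient_eq_iff[OF equiv_limit_rel A A a] in_quotient_imp_subset[OF equiv_limit_rel A] a by auto

lemma class_path_closed:
  assumes A: "A \<in> vectors // limit_rel Q" and a: "a \<in> A" and "(a, b) \<in> (halve_step Q)\<^sup>*"
  shows "b \<in> A"
proof -
  have av: "a \<in> vectors" using class_member_path(2)[OF A a a] .
  then have "(a, b) \<in> limit_rel Q"
    using assms(3) halve_step_closed[OF assms(3)] by (intro limit_relI) auto
  then show ?thesis using in_quotient_imp_closed[OF equiv_limit_rel A a] by blast
qed

lemma class_uniform:
  assumes A: "A \<in> vectors // limit_rel Q"
  obtains N0 where "\<And>N. N \<ge> N0 \<Longrightarrow> \<exists>v. (uniform N, v) \<in> A"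
proof -
  obtain a where a: "a \<in> A" using in_quotient_imp_non_empty[OF equiv_limit_rel A] by blast
  obtain N0 where "\<forall>N\<ge>N0. \<exists>w. (a, (uniform N, w)) \<in> (halve_step Q)\<^sup>*"
    using common_uniform[OF class_member_path(1)[OF A a a]] by blast
  then show thesis using that class_path_closed[OF A a] by blast
qed

lemma class_sum_equiv:
  assumes "A \<in> vectors // limit_rel Q" "B \<in> vectors // limit_rel Q"
    and v: "(I, v) \<in> A" "(I', v') \<in> A" and w: "(I, w) \<in> B" "(I', w') \<in> B"
  shows "((I, \<lambda>x. v x + w x), (I', \<lambda>x. v' x + w' x)) \<in> limit_rel Q"
proof -
  have mem: "(I, v) \<in> vectors" "(I', v') \<in> vectors" "(I, w) \<in> vectors" "(I', w') \<in> vectors"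
    using class_member_path(2)[OF assms(1)] class_member_path(2)[OF assms(2)] v w by blast+
  obtain N1 where N1: "\<forall>N\<ge>N1. \<exists>u. ((I, v), (uniform N, u)) \<in> (halve_step Q)\<^sup>* \<and> ((I', v'), (uniform N, u)) \<in> (halve_step Q)\<^sup>*"
    using common_uniform[OF class_member_path(1)[OF assms(1) v]] by blast
  obtain N2 where N2: "\<forall>N\<ge>N2. \<exists>u. ((I, w), (uniform N, u)) \<in> (halve_step Q)\<^sup>* \<and> ((I', w'), (uniform N, u)) \<in> (halve_step Q)\<^sup>*"
    using common_uniform[OF class_member_path(1)[OF assms(2) w]] by blast
  let ?N = "max N1 N2"
  obtain u where u: "((I, v), (uniform ?N, u)) \<in> (halve_step Q)\<^sup>*" "((I', v'), (uniform ?N, u)) \<in> (halve_step Q)\<^sup>*"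
    using N1 by (meson max.cobounded1)
  obtain z where z: "((I, w), (uniform ?N, z)) \<in> (halve_step Q)\<^sup>*" "((I', w'), (uniform ?N, z)) \<in> (halve_step Q)\<^sup>*"
    using N2 by (meson max.cobounded2)
  have sum: "((K, \<lambda>x. a x + b x), (uniform ?N, \<lambda>x. u x + z x)) \<in> (halve_step Q)\<^sup>*"
    if K: "(K, a) \<in> vectors" "(K, b) \<in> vectors" "((K, a), (uniform ?N, u)) \<in> (halve_step Q)\<^sup>*"
      "((K, b), (uniform ?N, z)) \<in> (halve_step Q)\<^sup>*" for K a b
  proof -
    have m: "K \<in> dyadic_partitions" "a \<in> tl_space K" "b \<in> tl_space K" using K(1,2) by auto
    obtain b' where b': "((K, b), (uniform ?N, b')) \<in> (halve_step Q)\<^sup>*"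
      "((K, \<lambda>x. a x + b x), (uniform ?N, \<lambda>x. u x + b' x)) \<in> (halve_step Q)\<^sup>*"
      using path_linear[OF K(3) m] by blast
    have "b' = z" using path_unique[OF b'(1) K(4)] m by blast
    then show ?thesis using b'(2) by simp
  qed
  have "(I, \<lambda>x. v x + w x) \<in> vectors" "(I', \<lambda>x. v' x + w' x) \<in> vectors"
    using mem tl_space_add by auto
  then show ?thesis using sum[OF mem(1,3) u(1) z(1)] sum[OF mem(2,4) u(2) z(2)] by (rule limit_relI)
qed

lemma class_scale_equiv:
  assumes "A \<in> vectors // limit_rel Q" and v: "(I, v) \<in> A" "(I', v') \<in> A"
  shows "((I, \<lambda>x. c * v x), (I', \<lambda>x. c * v' x)) \<in> limit_rel Q"
proof -
  have mem: "(I, v) \<in> vectors" "(I', v') \<in> vectors" using class_member_path(2)[OF assms(1)] v by blast+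
  obtain N u where u: "((I, v), (uniform N, u)) \<in> (halve_step Q)\<^sup>*" "((I', v'), (uniform N, u)) \<in> (halve_step Q)\<^sup>*"
    using common_uniform[OF class_member_path(1)[OF assms(1) v]] by blast
  have "((I, \<lambda>x. c * v x), (uniform N, \<lambda>x. c * u x)) \<in> (halve_step Q)\<^sup>*"
    using path_linear[OF u(1), of v c] mem by auto
  moreover have "((I', \<lambda>x. c * v' x), (uniform N, \<lambda>x. c * u x)) \<in> (halve_step Q)\<^sup>*"
    using path_linear[OF u(2), of v' c] mem by auto
  ultimately show ?thesis using mem tl_space_scale by (intro limit_relI) auto
qed

lemma move_by_path:
  assumes g: "g \<in> carrier thompson_T" and "((I, v), (K, w)) \<in> (halve_step Q)\<^sup>*" "good_for g I"
  shows "((image g ` I, move_by g I v), (image g ` K, move_by g K w)) \<in> (halve_step Q)\<^sup>*"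
  using assms(2,3)
proof (induction "(I, v)" arbitrary: I v rule: converse_rtrancl_induct)
  case (step z)
  have gT: "g \<in> Bij circle" "cyclic_mono g" using g thompson_T_iff by auto
  obtain J where J: "J \<in> I" "z = (halve I J, halve_map Q I J v)" using step(1) by (auto elim: halve_stepE)
  have gI: "image g ` I \<in> dyadic_partitions" using step(4) by (simp add: good_for_def)
  have "((image g ` I, move_by g I v), (halve (image g ` I) (g ` J), halve_map Q (image g ` I) (g ` J) (move_by g I v))) \<in> halve_step Q"
    using J(1) by (intro halve_stepI gI move_by_in_tl_space[OF gT step(4)]) auto
  then have "((image g ` I, move_by g I v), (image g ` halve I J, move_by g (halve I J) (halve_map Q I J v))) \<in> halve_step Q"
    by (simp only: halve_image(1)[OF gT(1) step(4) J(1)] move_by_halve[OF gT step(4) J(1)])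
  moreover have "((image g ` halve I J, move_by g (halve I J) (halve_map Q I J v)), (image g ` K, move_by g K w)) \<in> (halve_step Q)\<^sup>*"
    by (rule step(3)[OF J(2) halve_image(2)[OF gT(1) step(4) J(1)]])
  ultimately show ?case by (rule converse_rtrancl_into_rtrancl)
qed simp

lemma class_move_equiv:
  assumes g: "g \<in> carrier thompson_T" and A: "A \<in> vectors // limit_rel Q"
    and v: "(I, v) \<in> A" "good_for g I" "(I', v') \<in> A" "good_for g I'"
  shows "((image g ` I, move_by g I v), (image g ` I', move_by g I' v')) \<in> limit_rel Q"
proof -
  have gT: "g \<in> Bij circle" "cyclic_mono g" using g thompson_T_iff by auto
  obtain N u where u: "((I, v), (uniform N, u)) \<in> (halve_step Q)\<^sup>*" "((I', v'), (uniform N, u)) \<in> (halve_step Q)\<^sup>*"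
    using common_uniform[OF class_member_path(1)[OF A v(1,3)]] by blast
  have "(image g ` I, move_by g I v) \<in> vectors" "(image g ` I', move_by g I' v') \<in> vectors"
    using move_by_in_tl_space[OF gT v(2)] move_by_in_tl_space[OF gT v(4)] v(2,4) by (auto simp: good_for_def)
  then show ?thesis using move_by_path[OF g u(1) v(2)] move_by_path[OF g u(2) v(4)] by (rule limit_relI)
qed

definition class_coord :: "(real set set \<times> tl_vector) set \<Rightarrow> (real \<Rightarrow> bool) \<Rightarrow> complex" where
  "class_coord A = spin_coord (SOME a. a \<in> A)"

lemma class_coord_eq:
  assumes A: "A \<in> vectors // limit_rel 2" and a: "a \<in> A"
  shows "class_coord A = spin_coord a"
proof -
  have "(SOME a. a \<in> A) \<in> A" using a by (rule someI)
  then have "((SOME a. a \<in> A), a) \<in> limit_rel 2" using class_member_path(1)[OF A] a by blast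
  then obtain d where "((SOME a. a \<in> A), d) \<in> (halve_step 2)\<^sup>*" "(a, d) \<in> (halve_step 2)\<^sup>*" by (auto simp: limit_rel_def)
  then show ?thesis unfolding class_coord_def using spin_coord_path by metis
qed

lemma limit_space_vecs: "vecs (limit_space Q) = vectors // limit_rel Q"
  by (simp add: limit_space_def)

lemma class_self: "a \<in> vectors \<Longrightarrow> a \<in> limit_rel Q `` {a}"
  by (rule equiv_class_self[OF equiv_limit_rel])

lemma class_in_quotient: "a \<in> vectors \<Longrightarrow> limit_rel Q `` {a} \<in> vectors // limit_rel Q"
  by (rule quotientI)

lemma common_uniform_members:
  assumes A: "A \<in> vectors // limit_rel Q" and B: "B \<in> vectors // limit_rel Q"
  obtains N v w where "(uniform N, v) \<in> A" "(uniform N, w) \<in> B"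
proof -
  obtain N1 where "\<And>N. N \<ge> N1 \<Longrightarrow> \<exists>v. (uniform N, v) \<in> A" using class_uniform[OF A] by blast
  moreover obtain N2 where "\<And>N. N \<ge> N2 \<Longrightarrow> \<exists>v. (uniform N, v) \<in> B" using class_uniform[OF B] by blast
  ultimately show thesis using that by (meson max.cobounded1 max.cobounded2)
qed

lemma limit_space_add:
  assumes A: "A \<in> vectors // limit_rel Q" and B: "B \<in> vectors // limit_rel Q"
    and vw: "(I, v) \<in> A" "(I, w) \<in> B"
  shows "vadd (limit_space Q) A B = limit_rel Q `` {(I, \<lambda>x. v x + w x)}" "(I, \<lambda>x. v x + w x) \<in> vectors"
proof -
  let ?S = "{(I, \<lambda>x. v x + w x) | I v w. (I, v) \<in> A \<and> (I, w) \<in> B}"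
  have mem: "(I, \<lambda>x. v x + w x) \<in> ?S" using vw by blast
  have "limit_rel Q `` ?S = limit_rel Q `` {(I, \<lambda>x. v x + w x)}"
    using mem by (intro limit_class_image) (use class_sum_equiv[OF A B] in blast)+
  then show "vadd (limit_space Q) A B = limit_rel Q `` {(I, \<lambda>x. v x + w x)}" by (simp add: limit_space_def)
  show "(I, \<lambda>x. v x + w x) \<in> vectors"
    using class_member_path(2)[OF A vw(1) vw(1)] class_member_path(2)[OF B vw(2) vw(2)] tl_space_add by auto
qed

lemma limit_space_scale:
  assumes A: "A \<in> vectors // limit_rel Q" and v: "(I, v) \<in> A"
  shows "vscale (limit_space Q) c A = limit_rel Q `` {(I, \<lambda>x. c * v x)}" "(I, \<lambda>x. c * v x) \<in> vectors"
proof -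
  let ?S = "{(I, \<lambda>x. c * v x) | I v. (I, v) \<in> A}"
  have mem: "(I, \<lambda>x. c * v x) \<in> ?S" using v by blast
  have "limit_rel Q `` ?S = limit_rel Q `` {(I, \<lambda>x. c * v x)}"
    using mem by (intro limit_class_image) (use class_scale_equiv[OF A] in blast)+
  then show "vscale (limit_space Q) c A = limit_rel Q `` {(I, \<lambda>x. c * v x)}" by (simp add: limit_space_def)
  show "(I, \<lambda>x. c * v x) \<in> vectors" using class_member_path(2)[OF A v v] tl_space_scale by auto
qed

lemma limit_space_inner:
  assumes A: "A \<in> vectors // limit_rel 2" and B: "B \<in> vectors // limit_rel 2"
  shows "vinner (limit_space 2) A B = vinner (ell2 spins) (class_coord A) (class_coord B)"
proof -
  have form: "chrom_form 2 I v w = vinner (ell2 spins) (class_coord A) (class_coord B)"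
    if vw: "(I, v) \<in> A" "(I, w) \<in> B" for I v w
  proof -
    have "I \<in> dyadic_partitions" using class_member_path(2)[OF A vw(1) vw(1)] by auto
    then show ?thesis using chrom_form_eq_inner class_coord_eq[OF A vw(1)] class_coord_eq[OF B vw(2)] by simp
  qed
  obtain N v w where mem: "(uniform N, v) \<in> A" "(uniform N, w) \<in> B" using common_uniform_members[OF A B] .
  have "{chrom_form 2 I v w | I v w. (I, v) \<in> A \<and> (I, w) \<in> B} =
      {vinner (ell2 spins) (class_coord A) (class_coord B)}" (is "?L = {?c}")
  proof (rule equalityI)
    show "?L \<subseteq> {?c}" using form by blast
    show "{?c} \<subseteq> ?L" using form[OF mem] mem by (metis (mono_tags, lifting) empty_subsetI insert_subset mem_Collect_eq)
  qed
  then show ?thesis by (simp add: limit_space_def)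
qed

text \<open>The class has representatives on all fine uniform partitions, and these partitions are good for \<open>g\<close>.\<close>

lemma class_coord_limit_rep:
  assumes g: "g \<in> carrier thompson_T" and A: "A \<in> vectors // limit_rel 2"
  shows "limit_rep 2 g A \<in> vectors // limit_rel 2"
    "w \<in> spins \<Longrightarrow> class_coord (limit_rep 2 g A) (act g w) = class_coord A w"
proof -
  have gT: "g \<in> Bij circle" "cyclic_mono g" using g thompson_T_iff by auto
  obtain N1 where N1: "\<And>N. N \<ge> N1 \<Longrightarrow> \<exists>v. (uniform N, v) \<in> A" using class_uniform[OF A] by blast
  obtain N2 where N2: "\<And>N. N \<ge> N2 \<Longrightarrow> good_for g (uniform N)" using thompson_T_good_uniform[OF g] by blast
  let ?I = "uniform (max N1 N2)"
  obtain v where v: "(?I, v) \<in> A" using N1 by (meson max.cobounded1)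
  have gd: "good_for g ?I" using N2 by simp
  let ?S = "{(image g ` J, move_by g J v) | J v. (J, v) \<in> A \<and> good_for g J}"
  have mem: "(image g ` ?I, move_by g ?I v) \<in> ?S" using v gd by blast
  have eq: "limit_rep 2 g A = limit_rel 2 `` {(image g ` ?I, move_by g ?I v)}"
    unfolding limit_rep_def
  proof (rule limit_class_image[OF _ _ mem])
    show "?S \<noteq> {}" using mem by blast
    fix a b assume "a \<in> ?S" "b \<in> ?S"
    then obtain I v J w where "a = (image g ` I, move_by g I v)" "(I, v) \<in> A" "good_for g I"
      "b = (image g ` J, move_by g J w)" "(J, w) \<in> A" "good_for g J" by blast
    then show "(a, b) \<in> limit_rel 2" using class_move_equiv[OF g A] by simp
  qed
  have vec: "(image g ` ?I, move_by g ?I v) \<in> vectors"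
    using move_by_in_tl_space[OF gT gd] gd by (auto simp: good_for_def)
  show cls: "limit_rep 2 g A \<in> vectors // limit_rel 2" unfolding eq by (rule class_in_quotient[OF vec])
  assume w: "w \<in> spins"
  have "(image g ` ?I, move_by g ?I v) \<in> limit_rep 2 g A" unfolding eq by (rule class_self[OF vec])
  then show "class_coord (limit_rep 2 g A) (act g w) = class_coord A w"
    using class_coord_eq[OF cls] class_coord_eq[OF A v] spin_coord_move_by[OF g gd w] by metis
qed

section \<open>The vacuum\<close>

lemma circle_partition: "{circle} \<in> dyadic_partitions" "uniform 0 = {circle}"
proof -
  show "uniform 0 = {circle}" by (auto simp: uniform_def dyadic_interval_def)
  then show "{circle} \<in> dyadic_partitions" using uniform_in_dyadic_partitions[of 0] by simp
qed

definition vacuum_spin :: "real \<Rightarrow> bool" where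
  "vacuum_spin d \<longleftrightarrow> d \<in> dyadic_circle \<and> \<not> binary_parity d"

lemma Inf_Sup_circle [simp]: "Inf circle = 0" "Sup circle = 1" "middle circle = 1 / 2"
  by (simp_all add: middle_def)

text \<open>On the undivided circle only the spin at 0 can be chosen, and it is normalised.\<close>

lemma regular_circle_iff:
  assumes "w \<in> spins"
  shows "regular {circle} w \<longleftrightarrow> w = vacuum_spin"
proof -
  have "regular {circle} w \<longleftrightarrow> (\<forall>d\<in>dyadic_circle. w d = (\<not> binary_parity d))"
    using assms by (auto simp: regular_def rel_pos_def spins_def)
  also have "\<dots> \<longleftrightarrow> w = vacuum_spin"
  proof
    assume eq: "\<forall>d\<in>dyadic_circle. w d = (\<not> binary_parity d)"
    show "w = vacuum_spin"
    proof
      fix d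
      show "w d = vacuum_spin d"
        using eq assms unfolding vacuum_spin_def spins_def by (cases "d \<in> dyadic_circle") blast+
    qed
  next
    assume "w = vacuum_spin"
    then show "\<forall>d\<in>dyadic_circle. w d = (\<not> binary_parity d)" unfolding vacuum_spin_def by blast
  qed
  finally show ?thesis .
qed

lemma vacuum_spin_in_spins: "vacuum_spin \<in> spins"
proof -
  have "regular {circle} vacuum_spin"
    using zero_dyadic_circle by (auto simp: regular_def rel_pos_def vacuum_spin_def)
  then show ?thesis using circle_partition(1) zero_dyadic_circle by (auto simp: spins_def vacuum_spin_def)
qed

lemma vacuum_pairing: "pairings {circle} = {{{0, 1 / 2}}}"
proof -
  have b: "bdry_points {circle} = {0, 1 / 2}" by (simp add: bdry_points_eq[OF circle_partition(1)])
  show ?thesis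
  proof (intro equalityI subsetI)
    fix x assume x: "x \<in> pairings {circle}"
    have "s = {0, 1 / 2}" if s: "s \<in> x" for s
    proof -
      obtain p q :: real where "s = {p, q}" "p < q" "p \<in> {0, 1 / 2}" "q \<in> {0, 1 / 2}"
        using pairing_set[OF x s] unfolding b by metis
      then show ?thesis by auto
    qed
    moreover have "x \<noteq> {}" using x b by (auto simp: pairings_def dest: partition_onD1)
    ultimately show "x \<in> {{{0, 1 / 2}}}" by blast
  next
    fix x :: "real set set" assume "x \<in> {{{0, 1 / 2}}}"
    then have x: "x = {{0, 1 / 2}}" by simp
    have "partition_on (bdry_points {circle}) x" unfolding b x by (rule partition_onI) auto
    moreover have "\<forall>s\<in>x. card s = 2" unfolding x by simp
    moreover have "\<not> (\<exists>p r q s. p < r \<and> r < q \<and> q < s \<and> {p, q} \<in> x \<and> {r, s} \<in> x)"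
      unfolding x by (auto simp: doubleton_eq_iff)
    ultimately show "x \<in> pairings {circle}" unfolding pairings_def by blast
  qed
qed

definition vacuum_class :: "(real set set \<times> tl_vector) set" where
  "vacuum_class = limit_rel 2 `` {({circle}, tl_basis {{0, 1 / 2}})}"

lemma vacuum_class_coord:
  "vacuum_class \<in> vectors // limit_rel 2"
  "class_coord vacuum_class = (\<lambda>w. sqrt 2 * of_bool (w = vacuum_spin))"
proof -
  let ?a = "({circle}, tl_basis {{0, 1 / 2}})"
  have vec: "?a \<in> vectors"
    using circle_partition(1) tl_basis_in_tl_space[of "{{0, 1 / 2}}" "{circle}"] vacuum_pairing by auto
  show cls: "vacuum_class \<in> vectors // limit_rel 2" unfolding vacuum_class_def by (rule class_in_quotient[OF vec])
  have "class_coord vacuum_class = spin_coord ?a"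
    unfolding vacuum_class_def by (rule class_coord_eq[OF class_in_quotient[OF vec] class_self[OF vec]])
  also have "\<dots> = (\<lambda>w. sqrt 2 * of_bool (w = vacuum_spin))"
  proof
    fix w
    have "spin_coeff {circle} (tl_basis {{0, 1 / 2}}) w = 1"
      using spin_coeff_basis[of "{circle}" "{{0, 1 / 2}}" w] vacuum_pairing by (simp add: spin_compat_def)
    then show "spin_coord ?a w = sqrt 2 * of_bool (w = vacuum_spin)"
      using regular_circle_iff[of w] vacuum_spin_in_spins by (auto simp: spin_coord_def)
  qed
  finally show "class_coord vacuum_class = (\<lambda>w. sqrt 2 * of_bool (w = vacuum_spin))" .
qed

section \<open>Transitivity\<close>

definition subdivision :: "nat \<Rightarrow> (nat \<Rightarrow> real) \<Rightarrow> bool" where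
  "subdivision n h \<longleftrightarrow> h 0 = 0 \<and> h n = 1 \<and> (\<forall>i<n. h i < h (Suc i) \<and> standard_dyadic {h i..<h (Suc i)})"

definition pieces :: "nat \<Rightarrow> (nat \<Rightarrow> real) \<Rightarrow> real set set" where
  "pieces n h = (\<lambda>i. {h i..<h (Suc i)}) ` {..<n}"

lemma subdivision_less:
  assumes "subdivision n h" "i < j" "j \<le> n"
  shows "h i < h j"
  using assms(2,3)
proof (induction j)
  case (Suc j)
  have "h j < h (Suc j)" using assms(1) Suc.prems(2) by (simp add: subdivision_def)
  then show ?case using Suc by (cases "i = j") (auto simp: less_Suc_eq)
qed simp

lemma subdivision_index:
  assumes h: "subdivision n h" and t: "t \<in> circle"
  obtains i where "i < n" "h i \<le> t" "t < h (Suc i)"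
proof -
  have n: "t < h n" using h t by (simp add: subdivision_def)
  define m where "m = (LEAST m. t < h m)"
  have m: "t < h m" unfolding m_def by (rule LeastI[of _ n]) (rule n)
  have "m \<le> n" unfolding m_def by (rule Least_le) (rule n)
  moreover have "m \<noteq> 0" using m h t by (auto simp: subdivision_def intro: ccontr)
  then obtain i where i: "m = Suc i" using not0_implies_Suc by blast
  moreover have "\<not> t < h i" using not_less_Least[of i "\<lambda>m. t < h m"] i unfolding m_def[symmetric] by simp
  ultimately have "i < n" "h i \<le> t" "t < h (Suc i)" using m by auto
  then show thesis by (rule that)
qed

lemma in_piecesI: "i < n \<Longrightarrow> K = {h i..<h (Suc i)} \<Longrightarrow> K \<in> pieces n h"
  by (auto simp: pieces_def)

lemma pieces_in_dyadic_partitions: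
  assumes h: "subdivision n h"
  shows "pieces n h \<in> dyadic_partitions" "Inf ` pieces n h = h ` {..<n}"
proof -
  have lt: "h i < h (Suc i)" if "i < n" for i using h that by (simp add: subdivision_def)
  have "partition_on circle (pieces n h)"
  proof (rule partition_onI)
    show "\<Union>(pieces n h) = circle"
    proof (intro equalityI subsetI)
      fix t assume "t \<in> \<Union>(pieces n h)"
      then obtain i where i: "i < n" "t \<in> {h i..<h (Suc i)}" by (auto simp: pieces_def)
      have "standard_dyadic {h i..<h (Suc i)}" using h i(1) by (simp add: subdivision_def)
      then show "t \<in> circle" using standard_dyadicD(2,4)[of "{h i..<h (Suc i)}"] i lt[OF i(1)] by auto
    next
      fix t assume "t \<in> circle"
      then obtain i where "i < n" "h i \<le> t" "t < h (Suc i)" using subdivision_index[OF h] by blast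
      then show "t \<in> \<Union>(pieces n h)" by (auto simp: pieces_def)
    qed
    show "{} \<notin> pieces n h" using lt by (auto simp: pieces_def not_le)
    fix A B assume "A \<in> pieces n h" "B \<in> pieces n h" "A \<noteq> B"
    then obtain i j where ij: "i < n" "j < n" "A = {h i..<h (Suc i)}" "B = {h j..<h (Suc j)}" "i \<noteq> j"
      by (auto simp: pieces_def)
    have le: "h (Suc i) \<le> h j" if "i < j" "j < n" for i j
      using subdivision_less[OF h, of "Suc i" j] that by (cases "Suc i = j") auto
    consider "i < j" | "j < i" using ij(5) by linarith
    then show "disjnt A B" unfolding ij(3,4) disjnt_def
    proof cases
      case 1
      then show "{h i..<h (Suc i)} \<inter> {h j..<h (Suc j)} = {}" using le[OF 1 ij(2)] by auto
    next
      case 2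
      then show "{h i..<h (Suc i)} \<inter> {h j..<h (Suc j)} = {}" using le[OF 2 ij(1)] by auto
    qed
  qed
  moreover have "standard_dyadic J" if "J \<in> pieces n h" for J
    using that h by (auto simp: pieces_def subdivision_def)
  ultimately show "pieces n h \<in> dyadic_partitions" by (auto simp: dyadic_partitions_def pieces_def)
  show "Inf ` pieces n h = h ` {..<n}"
    unfolding pieces_def image_image using lt by (intro image_cong refl) (simp add: cInf_atLeastLessThan)
qed

lemma subdivision_exists:
  assumes I: "I \<in> dyadic_partitions"
  obtains n h where "subdivision n h" "pieces n h = I"
proof -
  define n where "n = card (Inf ` I)"
  have fin: "finite (Inf ` I)" using dyadic_partitionsD(1)[OF I] by simp
  define e where "e = (!) (sorted_list_of_set (Inf ` I))"
  have len: "length (sorted_list_of_set (Inf ` I)) = n" by (simp add: n_def)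
  have e: "bij_betw e {..<n} (Inf ` I)"
    unfolding e_def using fin len by (intro bij_betw_nth) simp_all
  define h where "h i = (if i < n then e i else 1)" for i
  have im: "Inf ` I = e ` {..<n}" using e by (simp add: bij_betw_def)
  have einI: "e i \<in> Inf ` I" if "i < n" for i unfolding im using that by blast
  have e_lt: "e i < e j" if "i < j" "j < n" for i j
    unfolding e_def using sorted_wrt_nth_less[OF strict_sorted_list_of_set] that len by metis
  obtain J0 where "J0 \<in> I" "Inf J0 = 0" using zero_left_end[OF I] .
  then have "0 \<in> Inf ` I" by (metis imageI)
  then obtain i0 where i0: "i0 < n" "e i0 = 0" unfolding im by (metis imageE lessThan_iff)
  have e0: "e 0 = 0"
  proof -
    have "0 < n" using i0 by simp
    then have "0 \<le> e 0" using einI Inf_dyadic_circle[OF I] by fastforce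
    moreover have "i0 = 0" using e_lt[of 0 i0] i0 calculation by (cases "i0 = 0") auto
    ultimately show ?thesis using i0 by simp
  qed
  have piece: "{h i..<h (Suc i)} \<in> I \<and> h i < h (Suc i)" if i: "i < n" for i
  proof -
    obtain J where J: "J \<in> I" "Inf J = e i" using einI[OF i] by (auto simp: image_iff)
    note sd = dyadic_partitionsD(3)[OF I J(1)]
    have "Sup J = h (Suc i)"
    proof (cases "Suc i < n")
      case True
      have "e (Suc i) \<in> Inf ` I" using einI True by blast
      then obtain K where K: "K \<in> I" "Inf K = e (Suc i)" by (auto simp: image_iff)
      have lt: "Inf J < Inf K" using e_lt[of i "Suc i"] True J K by simp
      then have "J \<noteq> K" by auto
      then have le: "Sup J \<le> Inf K"
        using intervals_apart[OF I J(1) K(1)] lt standard_dyadicD(3)[OF dyadic_partitionsD(3)[OF I K(1)]] by force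
      have "Inf K < 1" using Inf_dyadic_circle[OF I K(1)] by simp
      then have "Sup J \<noteq> 1" using le by simp
      then obtain L where L: "L \<in> I" "Sup J = Inf L" using Sup_end[OF I J(1)] by auto
      have "Inf L \<in> e ` {..<n}" unfolding im[symmetric] using L(1) by (rule imageI)
      then obtain j where j: "j < n" "Inf L = e j" by auto
      have "e i < e j" using standard_dyadicD(3)[OF sd] J L j by simp
      then have "i < j" using e_lt[of j i] i by (metis less_irrefl not_less_iff_gr_or_eq order.asym)
      then have "j = Suc i" using e_lt[of "Suc i" j] j le L K by (cases "j = Suc i") auto
      then show ?thesis using L j True by (simp add: h_def)
    next
      case False
      have "Sup J = 1"
      proof (rule ccontr)
        assume "Sup J \<noteq> 1"
        then obtain L where L: "L \<in> I" "Sup J = Inf L" using Sup_end[OF I J(1)] by auto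
        have "Inf L \<in> e ` {..<n}" unfolding im[symmetric] using L(1) by (rule imageI)
        then obtain j where j: "j < n" "Inf L = e j" by auto
        have "e i < e j" using standard_dyadicD(3)[OF sd] J L j by simp
        moreover have "j \<le> i" using j False by simp
        ultimately show False using e_lt[of j i] i by (cases "j = i") auto
      qed
      then show ?thesis using False by (simp add: h_def)
    qed
    then have "J = {h i..<h (Suc i)}" using standard_dyadicD(1)[OF sd] J(2) i by (simp add: h_def)
    then show ?thesis using J(1) standard_dyadicD(3)[OF sd] \<open>Sup J = h (Suc i)\<close> J(2) i by (simp add: h_def)
  qed
  have "0 < n" using i0 by simp
  then have sub: "subdivision n h"
    using piece dyadic_partitionsD(3)[OF I] e0 by (simp add: subdivision_def h_def[of 0] h_def[of n])
  have "pieces n h = I"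
  proof
    show "pieces n h \<subseteq> I" using piece by (auto simp: pieces_def)
    show "I \<subseteq> pieces n h"
    proof
      fix J assume J: "J \<in> I"
      then have "Inf J \<in> e ` {..<n}" unfolding im[symmetric] by (rule imageI)
      then obtain i where i: "i < n" "Inf J = e i" by auto
      have "Inf {h i..<h (Suc i)} = e i" using piece[OF i(1)] i(1) by (simp add: h_def[of i])
      then have "J = {h i..<h (Suc i)}" using inj_onD[OF Inf_inj_on[OF I], of J "{h i..<h (Suc i)}"] piece[OF i(1)] i J by simp
      then show "J \<in> pieces n h" using i by (auto simp: pieces_def)
    qed
  qed
  then show thesis using that sub by blast
qed

lemma strict_mono_cyclic_mono:
  assumes "\<And>s t. s \<in> circle \<Longrightarrow> t \<in> circle \<Longrightarrow> s < t \<Longrightarrow> g s < g t"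
  shows "cyclic_mono g"
  unfolding cyclic_mono_def cyc_def
proof (intro ballI impI; elim disjE conjE)
  fix a b c assume c: "a \<in> circle" "b \<in> circle" "c \<in> circle"
  show "g a < g b \<and> g b < g c \<or> g b < g c \<and> g c < g a \<or> g c < g a \<and> g a < g b" if "a < b" "b < c"
    using assms[OF c(1,2) that(1)] assms[OF c(2,3) that(2)] by blast
  show "g a < g b \<and> g b < g c \<or> g b < g c \<and> g c < g a \<or> g c < g a \<and> g a < g b" if "b < c" "c < a"
    using assms[OF c(2,3) that(1)] assms[OF c(3,1) that(2)] by blast
  show "g a < g b \<and> g b < g c \<or> g b < g c \<and> g c < g a \<or> g c < g a \<and> g a < g b" if "c < a" "a < b"
    using assms[OF c(3,1) that(1)] assms[OF c(1,2) that(2)] by blast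
qed

text \<open>Configurations with the same word of spins lie in one orbit of \<open>F\<close>: the piecewise linear map that
matches the intervals in order carries one to the other.\<close>

lemma piecewise_linear_match:
  assumes h: "subdivision n h" and k: "subdivision n k"
    and w: "w \<in> spins" "regular (pieces n h) w" and w': "w' \<in> spins" "regular (pieces n k) w'"
    and eq: "\<And>i. i < n \<Longrightarrow> w (h i) = w' (k i)"
  shows "\<exists>g\<in>carrier thompson_F. act g w = w'"
proof -
  note hP = pieces_in_dyadic_partitions[OF h] and kP = pieces_in_dyadic_partitions[OF k]
  define sl where "sl i = (k (Suc i) - k i) / (h (Suc i) - h i)" for i
  define g where "g = (\<lambda>t\<in>circle. let i = (LEAST i. t < h (Suc i)) in k i + (t - h i) * sl i)"
  have lt: "h i < h (Suc i)" "k i < k (Suc i)" if "i < n" for i using h k that by (auto simp: subdivision_def)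
  have sl: "0 < sl i" if "i < n" for i using lt[OF that] by (simp add: sl_def)
  have hC: "t \<in> circle" if "i < n" "t \<in> {h i..<h (Suc i)}" for i t
    using interval_subset_circle[OF hP(1), of "{h i..<h (Suc i)}"] that by (auto simp: pieces_def)
  have gi: "g t = k i + (t - h i) * sl i" if i: "i < n" "t \<in> {h i..<h (Suc i)}" for i t
  proof -
    have "(LEAST i. t < h (Suc i)) = i"
    proof (rule Least_equality)
      show "t < h (Suc i)" using i by simp
      fix j assume j: "t < h (Suc j)"
      show "i \<le> j"
      proof (rule ccontr)
        assume "\<not> i \<le> j"
        then have "h (Suc j) \<le> h i" using subdivision_less[OF h, of "Suc j" i] i by (cases "Suc j = i") auto
        then show False using j i by simp
      qed
    qed
    then show ?thesis using hC[OF i] by (simp add: g_def)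
  qed
  have im: "g ` {h i..<h (Suc i)} = {k i..<k (Suc i)}" if i: "i < n" for i
  proof -
    have "g ` {h i..<h (Suc i)} = (\<lambda>t. k i + (t - h i) * sl i) ` {h i..<h (Suc i)}"
      using gi[OF i] by (intro image_cong refl)
    also have "\<dots> = {k i + (h i - h i) * sl i..<k i + (h (Suc i) - h i) * sl i}"
      by (rule affine_interval_image[OF sl[OF i]])
    also have "\<dots> = {k i..<k (Suc i)}" using lt[OF i] by (simp add: sl_def)
    finally show ?thesis .
  qed
  have imP: "image g ` pieces n h = pieces n k"
    unfolding pieces_def image_image using im by (intro image_cong refl) simp
  have mono: "g s < g t" if st: "s \<in> circle" "t \<in> circle" "s < t" for s t
  proof -
    obtain i where i: "i < n" "h i \<le> s" "s < h (Suc i)" using subdivision_index[OF h st(1)] .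
    obtain j where j: "j < n" "h j \<le> t" "t < h (Suc j)" using subdivision_index[OF h st(2)] .
    show ?thesis
    proof (cases "i = j")
      case True
      then show ?thesis using gi[OF i(1), of s] gi[OF j(1), of t] i j st(3) sl[OF i(1)] by simp
    next
      case False
      have "\<not> j < i" using subdivision_less[OF h, of "Suc j" i] i j st(3) by (cases "Suc j = i") auto
      then have "i < j" using False by simp
      then have "k (Suc i) \<le> k j" using subdivision_less[OF k, of "Suc i" j] j(1) by (cases "Suc i = j") auto
      moreover have "g s \<in> {k i..<k (Suc i)}" "g t \<in> {k j..<k (Suc j)}"
        using im[OF i(1)] im[OF j(1)] i j by (metis atLeastLessThan_iff imageI)+
      ultimately show ?thesis by simp
    qed
  qed
  have onto: "g ` circle = circle"
  proof -
    have "circle = \<Union>(pieces n h)" "circle = \<Union>(pieces n k)"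
      using partition_onD1[OF dyadic_partitionsD(2)[OF hP(1)]] partition_onD1[OF dyadic_partitionsD(2)[OF kP(1)]] by auto
    then show ?thesis using imP by (metis image_Union)
  qed
  have "inj_on g circle"
  proof (rule inj_onI)
    fix s t assume "s \<in> circle" "t \<in> circle" "g s = g t"
    then show "s = t" using mono[of s t] mono[of t s] by (metis less_irrefl linorder_neqE_linordered_idom)
  qed
  then have gB: "g \<in> Bij circle" using onto by (simp add: Bij_def bij_betw_def g_def)
  have gd: "good_for g (pieces n h)"
  proof (rule good_forI[OF gB hP(1)])
    fix J assume "J \<in> pieces n h"
    then obtain i where i: "i < n" "J = {h i..<h (Suc i)}" by (auto simp: pieces_def)
    have "\<forall>t\<in>J. g t = sl i * t + (k i - h i * sl i)" using gi[OF i(1)] unfolding i(2) by (simp add: algebra_simps)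
    then show "\<exists>\<alpha> \<beta>. \<forall>t\<in>J. g t = \<alpha> * t + \<beta>" by blast
    show "standard_dyadic (g ` J)" unfolding i(2) im[OF i(1)] using k i(1) by (simp add: subdivision_def)
  qed
  have gT: "g \<in> carrier thompson_T" 
    unfolding thompson_T_iff using gB strict_mono_cyclic_mono[of g, OF mono] gd by (intro conjI exI)
  have n: "0 < n" using h by (cases n) (auto simp: subdivision_def)
  have g0: "g 0 = 0" using gi[OF n, of 0] h k lt[OF n] by (simp add: subdivision_def)
  then have gF: "g \<in> carrier thompson_F" using gT by (simp add: thompson_F_def)
  have "inv_into circle g 0 = 0" using inv_into_circle(1)[OF gT, of 0] g0 by simp
  then have gd_eq: "act g w (g d) = w d" if "d \<in> dyadic_circle" for d
    using act_apply[OF gT that, of w] w(1) by (simp add: spins_def)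
  have "act g w (k i) = w' (k i)" if i: "i < n" for i
  proof -
    have "h i \<in> Inf ` pieces n h" unfolding hP(2) using i by blast
    then obtain J where "J \<in> pieces n h" "h i = Inf J" by (elim imageE)
    then have "h i \<in> dyadic_circle" using Inf_dyadic_circle[OF hP(1)] by (simp only:)
    then have "act g w (g (h i)) = w (h i)" by (rule gd_eq)
    moreover have "g (h i) = k i" using gi[OF i, of "h i"] lt[OF i] by simp
    ultimately show ?thesis using eq[OF i] by simp
  qed
  then have agree: "act g w a = w' a" if "a \<in> Inf ` pieces n k" for a
    using that unfolding kP(2) by auto
  have "regular (pieces n k) (act g w)" using regular_act[OF gT gd w(2)] unfolding imP .
  then have "act g w = w'" using w' act_in_spins[OF gT w(1)] agree by (intro regular_agree[OF kP(1)])
  then show ?thesis using gF by blast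
qed

definition split_at :: "(nat \<Rightarrow> real) \<Rightarrow> nat \<Rightarrow> nat \<Rightarrow> real" where
  "split_at h i j = (if j \<le> i then h j else if j = Suc i then (h i + h (Suc i)) / 2 else h (j - 1))"

lemma split_at:
  assumes h: "subdivision n h" and i: "i < n"
  shows "subdivision (Suc n) (split_at h i)"
    "regular (pieces n h) w \<Longrightarrow> regular (pieces (Suc n) (split_at h i)) w \<and> w (split_at h i (Suc i)) = (\<not> w (h i))"
proof -
  let ?J = "{h i..<h (Suc i)}" and ?m = "(h i + h (Suc i)) / 2"
  have lt: "h j < h (Suc j)" "standard_dyadic {h j..<h (Suc j)}" if "j < n" for j
    using h that by (auto simp: subdivision_def)
  note sd = lt(2)[OF i]
  have JI: "Inf ?J = h i" "Sup ?J = h (Suc i)" using lt(1)[OF i] by (simp_all add: cInf_atLeastLessThan cSup_atLeastLessThan)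
  have mid: "middle ?J = ?m" by (simp add: middle_def JI)
  have half: "lower_half ?J = {h i..<?m}" "upper_half ?J = {?m..<h (Suc i)}"
    by (simp_all add: lower_half_def upper_half_def mid JI)
  have left: "{split_at h i j..<split_at h i (Suc j)} = {h j..<h (Suc j)}" if "j < i" for j
    using that by (simp add: split_at_def)
  have right: "{split_at h i (Suc j)..<split_at h i (Suc (Suc j))} = {h j..<h (Suc j)}" if "i < j" for j
    using that by (simp add: split_at_def)
  have at: "{split_at h i i..<split_at h i (Suc i)} = lower_half ?J"
    "{split_at h i (Suc i)..<split_at h i (Suc (Suc i))} = upper_half ?J"
    unfolding half by (simp_all add: split_at_def)
  have ltm: "h i < ?m" "?m < h (Suc i)" using lt(1)[OF i] by simp_all
  show "subdivision (Suc n) (split_at h i)"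
    unfolding subdivision_def
  proof (intro conjI allI impI)
    show "split_at h i 0 = 0" "split_at h i (Suc n) = 1" using h i by (auto simp: split_at_def subdivision_def)
    fix j assume j: "j < Suc n"
    consider "j < i" | "j = i" | "j = Suc i" | j' where "j = Suc j'" "i < j'" "j' < n"
      using j i by (cases j) (auto simp: linorder_neq_iff, linarith)
    then show "split_at h i j < split_at h i (Suc j)" "standard_dyadic {split_at h i j..<split_at h i (Suc j)}"
      using left right at lt standard_dyadic_half[OF sd] i ltm
      by (cases; simp add: split_at_def; fail)+
  qed
  have "pieces (Suc n) (split_at h i) = halve (pieces n h) ?J"
  proof (intro equalityI subsetI)
    have inj: "{h j..<h (Suc j)} \<noteq> ?J" if "j < n" "j \<noteq> i" for j
    proof -
      have "h j \<noteq> h i" using subdivision_less[OF h, of i j] subdivision_less[OF h, of j i] that i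
        by (cases "i < j") auto
      then have "Inf {h j..<h (Suc j)} \<noteq> Inf ?J" using lt(1)[OF that(1)] JI by (simp add: cInf_atLeastLessThan)
      then show ?thesis by metis
    qed
    fix K
    show "K \<in> halve (pieces n h) ?J" if K: "K \<in> pieces (Suc n) (split_at h i)"
    proof -
      obtain j where j: "j < Suc n" "K = {split_at h i j..<split_at h i (Suc j)}" using K by (auto simp: pieces_def)
      consider "j < i" | "j = i" | "j = Suc i" | j' where "j = Suc j'" "i < j'" "j' < n"
        using j(1) i by (cases j) (auto simp: linorder_neq_iff, linarith)
      then show ?thesis
      proof cases
        case 1
        then have "K = {h j..<h (Suc j)}" "j < n" using j(2) left i by auto
        then show ?thesis using inj[of j] 1 unfolding halve_def pieces_def by blast
      next
        case 4
        then have "K = {h j'..<h (Suc j')}" using j(2) right by simp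
        then show ?thesis using inj[of j'] 4 unfolding halve_def pieces_def by blast
      qed (use j(2) at in \<open>simp_all add: halve_def\<close>)
    qed
    show "K \<in> pieces (Suc n) (split_at h i)" if K: "K \<in> halve (pieces n h) ?J"
    proof -
      consider "K = lower_half ?J" | "K = upper_half ?J" | j where "j < n" "j \<noteq> i" "K = {h j..<h (Suc j)}"
        using K unfolding halve_def pieces_def by blast
      then show ?thesis
      proof cases
        case 1
        then show ?thesis using in_piecesI[of i "Suc n" K "split_at h i"] at(1) i by (metis less_SucI)
      next
        case 2
        then show ?thesis using in_piecesI[of "Suc i" "Suc n" K "split_at h i"] at(2) i by (metis Suc_less_eq)
      next
        case (3 j)
        show ?thesis
        proof (cases "j < i")
          case True
          then show ?thesis using in_piecesI[of j "Suc n" K "split_at h i"] left 3 by (metis less_SucI)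
        next
          case False
          then have "i < j" using 3(2) by simp
          then show ?thesis using in_piecesI[of "Suc j" "Suc n" K "split_at h i"] right 3 by (metis Suc_less_eq)
        qed
      qed
    qed
  qed
  moreover have "?J \<in> pieces n h" using i by (auto simp: pieces_def)
  moreover assume "regular (pieces n h) w"
  ultimately show "regular (pieces (Suc n) (split_at h i)) w \<and> w (split_at h i (Suc i)) = (\<not> w (h i))"
    using regular_halve_iff[OF pieces_in_dyadic_partitions(1)[OF h], of ?J w] mid JI by (simp add: split_at_def)
qed

lemma subdivision_of_size: "\<exists>h. subdivision (Suc n) h"
proof (induction n)
  case 0
  have "circle = dyadic_interval 0 0" by (simp add: dyadic_interval_def)
  then have "standard_dyadic circle" unfolding standard_dyadic_iff by (intro exI[of _ 0] conjI) simp_all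
  then show ?case by (intro exI[of _ real]) (simp add: subdivision_def)
next
  case (Suc n)
  then show ?case using split_at(1)[of "Suc n" _ 0] by blast
qed

text \<open>By induction on the number of intervals. Let \<open>u\<close> be the configuration whose word is that of \<open>w\<close>
without the second letter. If the first two letters of \<open>w\<close> differ, they result from halving the first
interval of \<open>u\<close>. Otherwise halving the first interval of \<open>w\<close> gives a word whose first three letters
alternate, and it results from halving the first interval of \<open>u\<close> and then its upper half.\<close>

theorem spins_transitive:
  assumes "w \<in> spins"
  shows "\<exists>g\<in>carrier thompson_F. act g vacuum_spin = w"
proof -
  have step: "\<exists>g\<in>carrier thompson_F. act g vacuum_spin = w'"
    if f: "\<exists>f\<in>carrier thompson_F. act f vacuum_spin = w" and g: "\<exists>g\<in>carrier thompson_F. act g w = w'" for w w'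
  proof -
    obtain f g where fg: "f \<in> carrier thompson_F" "act f vacuum_spin = w" "g \<in> carrier thompson_F" "act g w = w'"
      using f g by blast
    have "f \<in> carrier thompson_T" "g \<in> carrier thompson_T" using fg by (auto simp: thompson_F_def)
    then have "act (mult thompson_T g f) vacuum_spin = w'" using act_compose fg by simp
    moreover have "mult thompson_T g f \<in> carrier thompson_F"
      using subgroup.m_closed[OF thompson_F_subgroup fg(3,1)] .
    ultimately show ?thesis by blast
  qed
  have main: "\<exists>g\<in>carrier thompson_F. act g vacuum_spin = w"
    if "w \<in> spins" "subdivision (Suc n) h" "regular (pieces (Suc n) h) w" for n h w
    using that
  proof (induction n arbitrary: h w)
    case 0
    have "pieces 1 h = {circle}" using 0(2) by (simp add: pieces_def subdivision_def lessThan_Suc)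
    then have "w = vacuum_spin" using regular_circle_iff[OF 0(1)] 0(3) by simp
    then have "act (one thompson_T) vacuum_spin = w" using act_one[OF vacuum_spin_in_spins] by simp
    then show ?case using subgroup.one_closed[OF thompson_F_subgroup] by blast
  next
    case (Suc n)
    note h = Suc.prems(2)
    obtain k where k: "subdivision (Suc n) k" using subdivision_of_size by blast
    \<comment> \<open>The word of \<open>w\<close> without its second letter, on the intervals of \<open>k\<close>.\<close>
    define s where "s x \<longleftrightarrow> x = 0 \<or> (\<exists>i. 0 < i \<and> i < Suc n \<and> x = k i \<and> w (h (Suc i)))" for x
    obtain u where u: "u \<in> spins" "regular (pieces (Suc n) k) u" "\<And>a. a \<in> Inf ` pieces (Suc n) k \<Longrightarrow> u a = s a"
      using regular_extension[OF pieces_in_dyadic_partitions(1)[OF k], of s] by (auto simp: s_def)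
    have uk: "u (k i) = w (h (Suc i))" if i: "0 < i" "i < Suc n" for i
    proof -
      have "k i \<noteq> 0" using subdivision_less[OF k i(1)] i(2) k by (simp add: subdivision_def)
      moreover have "k i \<noteq> k j" if "j < Suc n" "j \<noteq> i" for j
        using subdivision_less[OF k, of i j] subdivision_less[OF k, of j i] that i(2) by (cases "i < j") auto
      ultimately have "s (k i) = w (h (Suc i))" unfolding s_def using i by metis
      moreover have "k i \<in> Inf ` pieces (Suc n) k" using pieces_in_dyadic_partitions(2)[OF k] i(2) by blast
      ultimately show ?thesis using u(3) by simp
    qed
    have z: "h 0 = 0" "k 0 = 0" using h k by (simp_all add: subdivision_def)
    have wu0: "w 0" "u 0" using Suc.prems(1) u(1) by (simp_all add: spins_def)
    have IH: "\<exists>g\<in>carrier thompson_F. act g vacuum_spin = u" by (rule Suc.IH[OF u(1) k u(2)])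
    have k1s: "subdivision (Suc (Suc n)) (split_at k 0)" and k1r: "regular (pieces (Suc (Suc n)) (split_at k 0)) u"
      "u (split_at k 0 1) = (\<not> u (k 0))"
      using split_at(1)[OF k, of 0] split_at(2)[OF k _ u(2), of 0] by simp_all
    have "\<exists>g\<in>carrier thompson_F. act g u = w"
    proof (cases "w (h 1)")
      case False
      show ?thesis
      proof (rule piecewise_linear_match[OF k1s h u(1) k1r(1) Suc.prems(1,3)])
        fix i assume i: "i < Suc (Suc n)"
        consider "i = 0" | "i = 1" | j where "i = Suc j" "0 < j" "j < Suc n" using i by (cases i) auto
        then show "u (split_at k 0 i) = w (h i)"
        proof cases
          case 1
          then show ?thesis using z wu0 by (simp add: split_at_def)
        next
          case 2
          then show ?thesis using k1r(2) z wu0 False by simp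
        next
          case 3
          then show ?thesis using uk[OF 3(2,3)] by (simp add: split_at_def)
        qed
      qed
    next
      case True
      let ?k = "split_at (split_at k 0) 1" and ?h = "split_at h 0"
      have k2: "subdivision (Suc (Suc (Suc n))) ?k" "regular (pieces (Suc (Suc (Suc n))) ?k) u"
        "u (?k 2) = (\<not> u (split_at k 0 1))"
        using split_at(1)[OF k1s, of 1] split_at(2)[OF k1s _ k1r(1), of 1] by (simp_all add: numeral_2_eq_2)
      have h2: "subdivision (Suc (Suc (Suc n))) ?h" "regular (pieces (Suc (Suc (Suc n))) ?h) w"
        "w (?h 1) = (\<not> w (h 0))"
        using split_at(1)[OF h, of 0] split_at(2)[OF h _ Suc.prems(3), of 0] by simp_all
      show ?thesis
      proof (rule piecewise_linear_match[OF k2(1) h2(1) u(1) k2(2) Suc.prems(1) h2(2)])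
        fix i assume i: "i < Suc (Suc (Suc n))"
        consider "i = 0" | "i = 1" | "i = 2" | j where "i = Suc (Suc j)" "0 < j" "j < Suc n"
          using i by (cases i; cases "i - 1") auto
        then show "u (?k i) = w (?h i)"
        proof cases
          case 1
          then show ?thesis using z wu0 by (simp add: split_at_def)
        next
          case 2
          have "?k 1 = split_at k 0 1" by (simp add: split_at_def)
          then show ?thesis using 2 k1r(2) h2(3) z wu0 by simp
        next
          case 3
          have "?h 2 = h 1" by (simp add: split_at_def)
          then show ?thesis using 3 k2(3) k1r(2) z wu0 True by simp
        next
          case (4 j)
          have "?k i = k j" "?h i = h (Suc j)" using 4 by (simp_all add: split_at_def)
          then show ?thesis using uk[OF 4(2,3)] by simp
        qed
      qed
    qed
    then show ?case using step[OF IH] by blast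
  qed
  obtain I where I: "I \<in> dyadic_partitions" "regular I w" using assms by (auto simp: spins_def)
  obtain n h where h: "subdivision n h" "pieces n h = I" using subdivision_exists[OF I(1)] .
  have "n \<noteq> 0" using h(1) by (auto simp: subdivision_def intro: ccontr)
  then obtain m where "n = Suc m" using not0_implies_Suc by blast
  then show ?thesis using main[OF assms, of m h] h I by simp
qed

section \<open>Coordinates on the completed limit\<close>

lemma class_coord_in_ell2:
  assumes "A \<in> vectors // limit_rel 2"
  shows "class_coord A \<in> ell2_vecs spins"
proof -
  obtain a where a: "a \<in> A" using in_quotient_imp_non_empty[OF equiv_limit_rel assms] by blast
  then obtain I v where "a = (I, v)" "I \<in> dyadic_partitions" using class_member_path(2)[OF assms a a] by auto
  then show ?thesis using class_coord_eq[OF assms a] spin_coord_in_ell2 by simp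
qed

definition spin_rep :: "(real \<Rightarrow> real) \<Rightarrow> ((real \<Rightarrow> bool) \<Rightarrow> complex) \<Rightarrow> (real \<Rightarrow> bool) \<Rightarrow> complex" where
  "spin_rep g f = (\<lambda>w. if w \<in> spins then f (act (m_inv thompson_T g) w) else 0)"

lemma class_coord_spin_rep:
  assumes g: "g \<in> carrier thompson_T" and A: "A \<in> vectors // limit_rel 2"
  shows "class_coord (limit_rep 2 g A) = spin_rep g (class_coord A)"
proof
  fix w
  interpret group thompson_T by (rule group_thompson_T)
  show "class_coord (limit_rep 2 g A) w = spin_rep g (class_coord A) w"
  proof (cases "w \<in> spins")
    case True
    have "class_coord (limit_rep 2 g A) (act g (act (m_inv thompson_T g) w)) = class_coord A (act (m_inv thompson_T g) w)"
      by (rule class_coord_limit_rep(2)[OF g A act_in_spins[OF inv_closed[OF g] True]])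
    then show ?thesis using True act_inv(2)[OF g True] by (simp add: spin_rep_def)
  next
    case False
    then show ?thesis
      using class_coord_in_ell2[OF class_coord_limit_rep(1)[OF g A]] by (simp add: spin_rep_def ell2_vecs_iff)
  qed
qed

text \<open>Point masses are attained because the vectors in the orbit of the vacuum are multiples of them and
the orbit is everything.\<close>

lemma ell2_model_limit_space: "ell2_model (limit_space 2) spins class_coord"
proof
  fix A B assume "A \<in> vecs (limit_space 2)" "B \<in> vecs (limit_space 2)"
  then have A: "A \<in> vectors // limit_rel 2" and B: "B \<in> vectors // limit_rel 2" by (simp_all add: limit_space_vecs)
  show "class_coord A \<in> ell2_vecs spins" by (rule class_coord_in_ell2[OF A])
  obtain N v w where vw: "(uniform N, v) \<in> A" "(uniform N, w) \<in> B" using common_uniform_members[OF A B] .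
  note add = limit_space_add[OF A B vw]
  have "vadd (limit_space 2) A B \<in> vectors // limit_rel 2" unfolding add(1) by (rule class_in_quotient[OF add(2)])
  then show "vadd (limit_space 2) A B \<in> vecs (limit_space 2)" by (simp add: limit_space_vecs)
  show "class_coord (vadd (limit_space 2) A B) = (\<lambda>x. class_coord A x + class_coord B x)"
    unfolding add(1) class_coord_eq[OF class_in_quotient[OF add(2)] class_self[OF add(2)]]
      class_coord_eq[OF A vw(1)] class_coord_eq[OF B vw(2)]
    by (rule ext) (rule spin_coord_add)
  show "vinner (limit_space 2) A B = vinner (ell2 spins) (class_coord A) (class_coord B)"
    by (rule limit_space_inner[OF A B])
  fix c
  note scale = limit_space_scale[OF A vw(1), of c]
  have "vscale (limit_space 2) c A \<in> vectors // limit_rel 2" unfolding scale(1) by (rule class_in_quotient[OF scale(2)])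
  then show "vscale (limit_space 2) c A \<in> vecs (limit_space 2)" by (simp add: limit_space_vecs)
  show "class_coord (vscale (limit_space 2) c A) = (\<lambda>x. c * class_coord A x)"
    unfolding scale(1) class_coord_eq[OF class_in_quotient[OF scale(2)] class_self[OF scale(2)]]
      class_coord_eq[OF A vw(1)]
    by (rule ext) (rule spin_coord_scale)
next
  fix w assume w: "w \<in> spins"
  obtain g where g: "g \<in> carrier thompson_F" "act g vacuum_spin = w" using spins_transitive[OF w] by blast
  have gT: "g \<in> carrier thompson_T" using g(1) by (simp add: thompson_F_def)
  interpret group thompson_T by (rule group_thompson_T)
  let ?A = "limit_rep 2 g vacuum_class"
  note A = class_coord_limit_rep(1)[OF gT vacuum_class_coord(1)]
  obtain N v v' where v: "(uniform N, v) \<in> ?A" "(uniform N, v') \<in> ?A" using common_uniform_members[OF A A] .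
  note scale = limit_space_scale[OF A v(1), of "1 / sqrt 2"]
  let ?B = "vscale (limit_space 2) (1 / sqrt 2) ?A"
  have B: "?B \<in> vectors // limit_rel 2" unfolding scale(1) by (rule class_in_quotient[OF scale(2)])
  have "class_coord ?B = (\<lambda>y. 1 / sqrt 2 * class_coord ?A y)"
    unfolding scale(1) class_coord_eq[OF class_in_quotient[OF scale(2)] class_self[OF scale(2)]]
      class_coord_eq[OF A v(1)]
    by (rule ext) (rule spin_coord_scale)
  also have "\<dots> = (\<lambda>y. of_bool (y = w))"
  proof
    fix y
    have "act (m_inv thompson_T g) y = vacuum_spin \<longleftrightarrow> y = w" if "y \<in> spins"
      using act_inv[OF gT that] act_inv[OF gT vacuum_spin_in_spins] g(2) by metis
    then show "1 / sqrt 2 * class_coord ?A y = of_bool (y = w)"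
      unfolding class_coord_spin_rep[OF gT vacuum_class_coord(1)] spin_rep_def vacuum_class_coord(2)
      using w by (auto simp flip: of_real_mult)
  qed
  finally show "\<exists>u\<in>vecs (limit_space 2). class_coord u = (\<lambda>y. of_bool (y = w))"
    using B by (auto simp: limit_space_vecs)
next
  show "vecs (limit_space 2) \<noteq> {}" using vacuum_class_coord(1) by (auto simp: limit_space_vecs)
qed

interpretation limit: ell2_model "limit_space 2" spins class_coord
  by (rule ell2_model_limit_space)

text \<open>The inverse appears because functions are moved by composition with the inverse motion of points.\<close>

lemma bij_act:
  assumes g: "g \<in> carrier thompson_T"
  shows "bij_betw (act (m_inv thompson_T g)) spins spins"
proof -
  interpret group thompson_T by (rule group_thompson_T)
  show ?thesis
    using act_in_spins[OF g] act_in_spins[OF inv_closed[OF g]] act_inv[OF g]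
    by (intro bij_betw_byWitness[where f' = "act g"]) auto
qed

lemma ell2_reindex:
  assumes b: "bij_betw k X Y" and f: "f \<in> ell2_vecs Y"
  shows "(\<lambda>x. if x \<in> X then f (k x) else 0) \<in> ell2_vecs X"
proof -
  have "(\<lambda>y. (cmod (f y))\<^sup>2) summable_on Y" using f by (simp add: ell2_vecs_iff)
  then have "(\<lambda>x. (cmod (f (k x)))\<^sup>2) summable_on X"
    using summable_on_reindex_bij_betw[OF b, of "\<lambda>y. (cmod (f y))\<^sup>2"] by simp
  then have "(\<lambda>x. (cmod (if x \<in> X then f (k x) else 0))\<^sup>2) summable_on X"
    by (rule summable_on_cong[THEN iffD1, rotated]) simp
  then show ?thesis by (simp add: ell2_vecs_iff)
qed

lemma ell2_inner_reindex:
  assumes b: "bij_betw k X Y"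
  shows "vinner (ell2 X) (\<lambda>x. if x \<in> X then f (k x) else 0) (\<lambda>x. if x \<in> X then h (k x) else 0) = vinner (ell2 Y) f h"
proof -
  have "(\<Sum>\<^sub>\<infinity>x\<in>X. (if x \<in> X then f (k x) else 0) * cnj (if x \<in> X then h (k x) else 0)) =
      (\<Sum>\<^sub>\<infinity>x\<in>X. f (k x) * cnj (h (k x)))" by (intro infsum_cong) simp
  also have "\<dots> = (\<Sum>\<^sub>\<infinity>y\<in>Y. f y * cnj (h y))" by (rule infsum_reindex_bij_betw[OF b])
  finally show ?thesis by (simp add: ell2_def)
qed

lemma ell2_norm_reindex:
  assumes b: "bij_betw k X Y"
  shows "ell2_norm X (\<lambda>x. (if x \<in> X then f (k x) else 0) - (if x \<in> X then h (k x) else 0)) = ell2_norm Y (\<lambda>y. f y - h y)"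
proof -
  have "(\<Sum>\<^sub>\<infinity>x\<in>X. (cmod ((if x \<in> X then f (k x) else 0) - (if x \<in> X then h (k x) else 0)))\<^sup>2) =
      (\<Sum>\<^sub>\<infinity>x\<in>X. (cmod (f (k x) - h (k x)))\<^sup>2)" by (intro infsum_cong) simp
  also have "\<dots> = (\<Sum>\<^sub>\<infinity>y\<in>Y. (cmod (f y - h y))\<^sup>2)"
    using infsum_reindex_bij_betw[OF b, of "\<lambda>y. (cmod (f y - h y))\<^sup>2"] .
  finally show ?thesis by (simp add: ell2_norm_def)
qed

lemma spin_rep_in_ell2: "g \<in> carrier thompson_T \<Longrightarrow> f \<in> ell2_vecs spins \<Longrightarrow> spin_rep g f \<in> ell2_vecs spins"
  unfolding spin_rep_def by (rule ell2_reindex[OF bij_act])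

lemma chrom_rep_limit_class:
  assumes g: "g \<in> carrier thompson_T" and f: "f \<in> ell2_vecs spins"
  shows "chrom_rep 2 g (limit.limit_class f) = limit.limit_class (spin_rep g f)"
  unfolding chrom_rep_def
proof (rule limit.completion_map_eq[OF _ _ _ _ f])
  fix A assume "A \<in> vecs (limit_space 2)"
  then have A: "A \<in> vectors // limit_rel 2" by (simp add: limit_space_vecs)
  show "limit_rep 2 g A \<in> vecs (limit_space 2)" using class_coord_limit_rep(1)[OF g A] by (simp add: limit_space_vecs)
  show "class_coord (limit_rep 2 g A) = spin_rep g (class_coord A)" by (rule class_coord_spin_rep[OF g A])
next
  fix f h assume "f \<in> ell2_vecs spins" "h \<in> ell2_vecs spins"
  then show "spin_rep g f \<in> ell2_vecs spins" using spin_rep_in_ell2[OF g] by blast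
  show "ell2_norm spins (\<lambda>x. spin_rep g f x - spin_rep g h x) \<le> ell2_norm spins (\<lambda>x. f x - h x)"
    unfolding spin_rep_def ell2_norm_reindex[OF bij_act[OF g]] by simp
qed

lemma unitarily_equivalent_spin_rep:
  assumes sub: "carrier G \<subseteq> carrier thompson_T"
  shows "unitarily_equivalent G (chrom_space 2) (chrom_rep 2) (ell2 spins) spin_rep"
proof -
  have V: "vecs (chrom_space 2) = limit.limit_class ` ell2_vecs spins"
    unfolding chrom_space_def by (rule limit.vecs_completion)
  show ?thesis
    unfolding unitarily_equivalent_def
  proof (intro conjI ballI exI[of _ limit.coords] allI)
    show "bij_betw limit.coords (vecs (chrom_space 2)) (ell2_vecs spins)"
      unfolding chrom_space_def by (rule limit.bij_coords)
  next
    fix g assume "g \<in> carrier G"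
    then have g: "g \<in> carrier thompson_T" using sub by blast
    show "chrom_rep 2 g \<in> vecs (chrom_space 2) \<rightarrow> vecs (chrom_space 2)"
      unfolding V using chrom_rep_limit_class[OF g] spin_rep_in_ell2[OF g] by auto
    show "spin_rep g \<in> ell2_vecs spins \<rightarrow> ell2_vecs spins" using spin_rep_in_ell2[OF g] by blast
    fix u assume "u \<in> vecs (chrom_space 2)"
    then obtain f where f: "f \<in> ell2_vecs spins" "u = limit.limit_class f" unfolding V by blast
    show "limit.coords (chrom_rep 2 g u) = spin_rep g (limit.coords u)"
      unfolding f(2) chrom_rep_limit_class[OF g f(1)] limit.coords_limit_class[OF f(1)]
      by (rule limit.coords_limit_class[OF spin_rep_in_ell2[OF g f(1)]])
  next
    fix u v assume "u \<in> vecs (chrom_space 2)" "v \<in> vecs (chrom_space 2)"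
    then obtain f h where f: "f \<in> ell2_vecs spins" "u = limit.limit_class f"
      and h: "h \<in> ell2_vecs spins" "v = limit.limit_class h" unfolding V by blast
    have add: "vadd (chrom_space 2) u v = limit.limit_class (\<lambda>x. f x + h x)"
      unfolding chrom_space_def f(2) h(2) by (rule limit.completion_add[OF f(1) h(1)])
    show "vadd (chrom_space 2) u v \<in> vecs (chrom_space 2)" unfolding add V using ell2_add[OF f(1) h(1)] by blast
    show "limit.coords (vadd (chrom_space 2) u v) = vadd (ell2 spins) (limit.coords u) (limit.coords v)"
      unfolding add limit.coords_limit_class[OF ell2_add[OF f(1) h(1)]]
      unfolding f(2) h(2) limit.coords_limit_class[OF f(1)] limit.coords_limit_class[OF h(1)]
      by (simp add: ell2_def)
    show "vinner (ell2 spins) (limit.coords u) (limit.coords v) = vinner (chrom_space 2) u v"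
      unfolding chrom_space_def f(2) h(2) limit.completion_inner[OF f(1) h(1)]
        limit.coords_limit_class[OF f(1)] limit.coords_limit_class[OF h(1)] by (rule refl)
  next
    fix c u assume "u \<in> vecs (chrom_space 2)"
    then obtain f where f: "f \<in> ell2_vecs spins" "u = limit.limit_class f" unfolding V by blast
    have scale: "vscale (chrom_space 2) c u = limit.limit_class (\<lambda>x. c * f x)"
      unfolding chrom_space_def f(2) by (rule limit.completion_scale[OF f(1)])
    show "vscale (chrom_space 2) c u \<in> vecs (chrom_space 2)" unfolding scale V using ell2_scale[OF f(1)] by blast
    show "limit.coords (vscale (chrom_space 2) c u) = vscale (ell2 spins) c (limit.coords u)"
      unfolding scale limit.coords_limit_class[OF ell2_scale[OF f(1)]]
      unfolding f(2) limit.coords_limit_class[OF f(1)] by (simp add: ell2_def)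
  qed
qed

lemma unitarily_equivalent_trans:
  assumes VW: "unitarily_equivalent G V \<pi> W \<rho>" and WZ: "unitarily_equivalent G W \<rho> Z \<sigma>"
  shows "unitarily_equivalent G V \<pi> Z \<sigma>"
proof -
  obtain U where U: "bij_betw U (vecs V) (vecs W)"
    "\<And>u v. u \<in> vecs V \<Longrightarrow> v \<in> vecs V \<Longrightarrow> vadd V u v \<in> vecs V \<and> U (vadd V u v) = vadd W (U u) (U v)"
    "\<And>c u. u \<in> vecs V \<Longrightarrow> vscale V c u \<in> vecs V \<and> U (vscale V c u) = vscale W c (U u)"
    "\<And>u v. u \<in> vecs V \<Longrightarrow> v \<in> vecs V \<Longrightarrow> vinner W (U u) (U v) = vinner V u v"
    "\<And>g u. g \<in> carrier G \<Longrightarrow> u \<in> vecs V \<Longrightarrow> U (\<pi> g u) = \<rho> g (U u)"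
    using VW unfolding unitarily_equivalent_def by metis
  obtain T where T: "bij_betw T (vecs W) (vecs Z)"
    "\<And>u v. u \<in> vecs W \<Longrightarrow> v \<in> vecs W \<Longrightarrow> vadd W u v \<in> vecs W \<and> T (vadd W u v) = vadd Z (T u) (T v)"
    "\<And>c u. u \<in> vecs W \<Longrightarrow> vscale W c u \<in> vecs W \<and> T (vscale W c u) = vscale Z c (T u)"
    "\<And>u v. u \<in> vecs W \<Longrightarrow> v \<in> vecs W \<Longrightarrow> vinner Z (T u) (T v) = vinner W u v"
    "\<And>g u. g \<in> carrier G \<Longrightarrow> u \<in> vecs W \<Longrightarrow> T (\<rho> g u) = \<sigma> g (T u)"
    using WZ unfolding unitarily_equivalent_def by metis
  have mem: "U u \<in> vecs W" if "u \<in> vecs V" for u using U(1) that by (auto simp: bij_betw_def)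
  have maps: "\<forall>g\<in>carrier G. \<pi> g \<in> vecs V \<rightarrow> vecs V \<and> \<rho> g \<in> vecs W \<rightarrow> vecs W"
    using VW unfolding unitarily_equivalent_def by (rule conjunct1)
  have maps': "\<forall>g\<in>carrier G. \<rho> g \<in> vecs W \<rightarrow> vecs W \<and> \<sigma> g \<in> vecs Z \<rightarrow> vecs Z"
    using WZ unfolding unitarily_equivalent_def by (rule conjunct1)
  show ?thesis
    unfolding unitarily_equivalent_def
  proof (intro conjI exI[of _ "T \<circ> U"] ballI allI)
    show "bij_betw (T \<circ> U) (vecs V) (vecs Z)" using U(1) T(1) by (rule bij_betw_trans)
  next
    fix g assume "g \<in> carrier G"
    then show "\<pi> g \<in> vecs V \<rightarrow> vecs V" "\<sigma> g \<in> vecs Z \<rightarrow> vecs Z"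
      using maps maps' by blast+
  qed (simp_all add: U(2-5) T(2-5) mem)
qed

lemma unitarily_equivalent_cong:
  assumes "unitarily_equivalent G V \<pi> W \<rho>"
    and "\<And>g w. g \<in> carrier G \<Longrightarrow> w \<in> vecs W \<Longrightarrow> \<rho> g w = \<rho>' g w"
  shows "unitarily_equivalent G V \<pi> W \<rho>'"
proof -
  obtain U where U: "bij_betw U (vecs V) (vecs W)"
    "\<forall>u\<in>vecs V. \<forall>v\<in>vecs V. vadd V u v \<in> vecs V \<and> U (vadd V u v) = vadd W (U u) (U v)"
    "\<forall>c. \<forall>u\<in>vecs V. vscale V c u \<in> vecs V \<and> U (vscale V c u) = vscale W c (U u)"
    "\<forall>u\<in>vecs V. \<forall>v\<in>vecs V. vinner W (U u) (U v) = vinner V u v"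
    "\<forall>g\<in>carrier G. \<forall>u\<in>vecs V. U (\<pi> g u) = \<rho> g (U u)"
    and maps: "\<forall>g\<in>carrier G. \<pi> g \<in> vecs V \<rightarrow> vecs V \<and> \<rho> g \<in> vecs W \<rightarrow> vecs W"
    using assms(1) unfolding unitarily_equivalent_def by (elim conjE exE) (rule that)
  have mem: "U u \<in> vecs W" if "u \<in> vecs V" for u using U(1) that by (auto simp: bij_betw_def)
  have "\<forall>g\<in>carrier G. \<forall>u\<in>vecs V. U (\<pi> g u) = \<rho>' g (U u)" using U(5) mem assms(2) by simp
  moreover have "\<forall>g\<in>carrier G. \<pi> g \<in> vecs V \<rightarrow> vecs V \<and> \<rho>' g \<in> vecs W \<rightarrow> vecs W"
  proof (intro ballI conjI)
    fix g assume g: "g \<in> carrier G"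
    show "\<pi> g \<in> vecs V \<rightarrow> vecs V" using maps g by blast
    show "\<rho>' g \<in> vecs W \<rightarrow> vecs W"
    proof
      fix w assume w: "w \<in> vecs W"
      then have "\<rho> g w \<in> vecs W" using maps g by blast
      then show "\<rho>' g w \<in> vecs W" using assms(2)[OF g w] by simp
    qed
  qed
  ultimately show ?thesis unfolding unitarily_equivalent_def using U(1-4) by blast
qed

section \<open>Orbits and cosets\<close>

text \<open>For a transitive action, the orbit map identifies the cosets of the stabilizer of \<open>x0\<close> with \<open>X\<close>,
equivariantly; this carries over to square-summable functions.\<close>

locale transitive_action = group G for G (structure) +
  fixes X :: "'x set" and a :: "'a \<Rightarrow> 'x \<Rightarrow> 'x" and x0 :: 'x
  assumes closed: "g \<in> carrier G \<Longrightarrow> x \<in> X \<Longrightarrow> a g x \<in> X"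
    and mult: "g \<in> carrier G \<Longrightarrow> h \<in> carrier G \<Longrightarrow> a (g \<otimes> h) x = a g (a h x)"
    and one: "x \<in> X \<Longrightarrow> a \<one> x = x"
    and x0: "x0 \<in> X"
    and transitive: "x \<in> X \<Longrightarrow> \<exists>g\<in>carrier G. a g x0 = x"
begin

definition stab :: "'a set" where
  "stab = {g \<in> carrier G. a g x0 = x0}"

lemma inv_cancel: "g \<in> carrier G \<Longrightarrow> x \<in> X \<Longrightarrow> a (inv g) (a g x) = x"
  "g \<in> carrier G \<Longrightarrow> x \<in> X \<Longrightarrow> a g (a (inv g) x) = x"
  using mult[of "inv g" g x] mult[of g "inv g" x] one[of x] by simp_all

lemma subgroup_stab: "subgroup stab G"
proof (rule subgroupI)
  show "stab \<subseteq> carrier G" by (auto simp: stab_def)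
  have "\<one> \<in> stab" using one[OF x0] by (simp add: stab_def)
  then show "stab \<noteq> {}" by blast
  show "inv g \<in> stab" if "g \<in> stab" for g
    using that inv_cancel(1)[of g x0] x0 by (auto simp: stab_def)
  show "g \<otimes> h \<in> stab" if "g \<in> stab" "h \<in> stab" for g h
    using that mult by (simp add: stab_def)
qed

definition orbit_point :: "'a set \<Rightarrow> 'x" where
  "orbit_point C = a (SOME g. g \<in> C) x0"

lemma l_coset_stab: "g \<in> carrier G \<Longrightarrow> h \<in> g <# stab \<longleftrightarrow> h \<in> carrier G \<and> a h x0 = a g x0"
proof
  assume g: "g \<in> carrier G"
  { assume "h \<in> g <# stab"
    then obtain k where "k \<in> carrier G" "a k x0 = x0" "h = g \<otimes> k" by (auto simp: l_coset_def stab_def)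
    then show "h \<in> carrier G \<and> a h x0 = a g x0" using g mult by simp }
  assume h: "h \<in> carrier G \<and> a h x0 = a g x0"
  have "a (inv g \<otimes> h) x0 = x0" using mult[of "inv g" h x0] inv_cancel(1)[OF g x0] g h by simp
  then have "inv g \<otimes> h \<in> stab" using g h by (simp add: stab_def)
  moreover have "h = g \<otimes> (inv g \<otimes> h)" using g h by (simp add: m_assoc[symmetric])
  ultimately show "h \<in> g <# stab" unfolding l_coset_def by blast
qed

lemma orbit_point_l_coset:
  assumes g: "g \<in> carrier G"
  shows "orbit_point (g <# stab) = a g x0"
proof -
  have "g \<in> g <# stab" using l_coset_stab[OF g] g by simp
  then have "(SOME h. h \<in> g <# stab) \<in> g <# stab" by (rule someI)
  then show ?thesis using l_coset_stab[OF g] by (simp add: orbit_point_def)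
qed

lemma in_lcosets: "C \<in> lcosets stab \<longleftrightarrow> (\<exists>g\<in>carrier G. C = g <# stab)"
  by (auto simp: LCOSETS_def)

lemma bij_orbit_point: "bij_betw orbit_point (lcosets stab) X"
proof (rule bij_betw_imageI)
  show "inj_on orbit_point (lcosets stab)"
  proof (rule inj_onI)
    fix C D assume "C \<in> lcosets stab" "D \<in> lcosets stab" and eq: "orbit_point C = orbit_point D"
    then obtain g h where gh: "g \<in> carrier G" "C = g <# stab" "h \<in> carrier G" "D = h <# stab" by (auto simp: in_lcosets)
    then have "a g x0 = a h x0" using eq orbit_point_l_coset by simp
    then show "C = D"
      unfolding gh(2,4) by (intro Set.set_eqI) (simp add: l_coset_stab[OF gh(1)] l_coset_stab[OF gh(3)])
  qed
  show "orbit_point ` (lcosets stab) = X"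
  proof (intro equalityI subsetI)
    fix x assume "x \<in> orbit_point ` (lcosets stab)"
    then obtain g where "g \<in> carrier G" "x = orbit_point (g <# stab)" by (auto simp: in_lcosets)
    then show "x \<in> X" using orbit_point_l_coset closed x0 by simp
  next
    fix x assume "x \<in> X"
    then obtain g where "g \<in> carrier G" "a g x0 = x" using transitive by blast
    then show "x \<in> orbit_point ` (lcosets stab)"
      using orbit_point_l_coset in_lcosets by (metis image_eqI)
  qed
qed

lemma orbit_point_translate:
  assumes g: "g \<in> carrier G" and C: "C \<in> lcosets stab"
  shows "g <# C \<in> lcosets stab" "orbit_point (g <# C) = a g (orbit_point C)"
proof -
  obtain h where h: "h \<in> carrier G" "C = h <# stab" using C by (auto simp: in_lcosets)
  have eq: "g <# C = (g \<otimes> h) <# stab"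
    unfolding h(2) using g h(1) subgroup.subset[OF subgroup_stab] by (intro lcos_m_assoc) auto
  show "g <# C \<in> lcosets stab" unfolding eq in_lcosets using g h(1) by blast
  show "orbit_point (g <# C) = a g (orbit_point C)"
    unfolding eq using orbit_point_l_coset[of "g \<otimes> h"] orbit_point_l_coset[OF h(1)] g h mult by simp
qed

lemma perm_rep_equivalent:
  "unitarily_equivalent G (ell2 X) (\<lambda>g f x. if x \<in> X then f (a (inv g) x) else 0)
     (ell2 (lcosets stab)) (perm_rep G stab)"
proof -
  let ?Y = "lcosets stab"
  define T :: "('x \<Rightarrow> complex) \<Rightarrow> 'a set \<Rightarrow> complex" where
    "T f = (\<lambda>C. if C \<in> ?Y then f (orbit_point C) else 0)" for f
  define S :: "('a set \<Rightarrow> complex) \<Rightarrow> 'x \<Rightarrow> complex" where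
    "S f = (\<lambda>x. if x \<in> X then f (the_inv_into ?Y orbit_point x) else 0)" for f
  note b = bij_orbit_point
  have b': "bij_betw (the_inv_into ?Y orbit_point) X ?Y" using bij_betw_the_inv_into[OF b] .
  have op: "orbit_point C \<in> X" if "C \<in> ?Y" for C using b that by (auto simp: bij_betw_def)
  have ST: "S (T f) = f" if "f \<in> ell2_vecs X" for f
  proof
    fix x
    show "S (T f) x = f x"
      using that b' f_the_inv_into_f_bij_betw[OF b, of x]
      by (cases "x \<in> X") (auto simp: S_def T_def bij_betw_def ell2_vecs_iff)
  qed
  have TS: "T (S f) = f" if "f \<in> ell2_vecs ?Y" for f
  proof
    fix C
    show "T (S f) C = f C"
      using that op the_inv_into_f_f[of orbit_point ?Y C] b
      by (cases "C \<in> ?Y") (auto simp: S_def T_def bij_betw_def ell2_vecs_iff)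
  qed
  have memT: "T f \<in> ell2_vecs ?Y" if "f \<in> ell2_vecs X" for f
    unfolding T_def by (rule ell2_reindex[OF b that])
  have memS: "S f \<in> ell2_vecs X" if "f \<in> ell2_vecs ?Y" for f
    unfolding S_def by (rule ell2_reindex[OF b' that])
  have bij_a: "bij_betw (a (inv g)) X X" if g: "g \<in> carrier G" for g
    using closed g inv_cancel by (intro bij_betw_byWitness[where f' = "a g"]) auto
  have bij_l: "bij_betw (\<lambda>C. inv g <# C) ?Y ?Y" if g: "g \<in> carrier G" for g
  proof (rule bij_betw_byWitness[where f' = "\<lambda>C. g <# C"])
    have sub: "C \<subseteq> carrier G" if "C \<in> ?Y" for C
      using that l_coset_subset_G[OF subgroup.subset[OF subgroup_stab]] by (auto simp: in_lcosets)
    show "\<forall>C\<in>?Y. g <# (inv g <# C) = C" "\<forall>C\<in>?Y. inv g <# (g <# C) = C"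
      using sub g lcos_m_assoc lcos_mult_one by simp_all
    show "(\<lambda>C. inv g <# C) ` ?Y \<subseteq> ?Y" "(\<lambda>C. g <# C) ` ?Y \<subseteq> ?Y" using orbit_point_translate(1) g by auto
  qed
  show ?thesis
    unfolding unitarily_equivalent_def
  proof (intro conjI ballI exI[of _ T] allI)
    fix g assume g: "g \<in> carrier G"
    show "(\<lambda>f x. if x \<in> X then f (a (inv g) x) else 0) \<in> ell2_vecs X \<rightarrow> ell2_vecs X"
      using ell2_reindex[OF bij_a[OF g]] by blast
    show "perm_rep G stab g \<in> ell2_vecs ?Y \<rightarrow> ell2_vecs ?Y"
      unfolding perm_rep_def using ell2_reindex[OF bij_l[OF g]] by blast
    fix f assume "f \<in> ell2_vecs X"
    show "T (\<lambda>x. if x \<in> X then f (a (inv g) x) else 0) = perm_rep G stab g (T f)"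
    proof
      fix C
      show "T (\<lambda>x. if x \<in> X then f (a (inv g) x) else 0) C = perm_rep G stab g (T f) C"
        using orbit_point_translate[OF inv_closed[OF g], of C] op[of C] by (simp add: T_def perm_rep_def)
    qed
  next
    show "bij_betw T (ell2_vecs X) (ell2_vecs ?Y)"
      using ST TS memT memS by (intro bij_betw_byWitness[where f' = S]) auto
  next
    fix f h assume f: "f \<in> ell2_vecs X" and h: "h \<in> ell2_vecs X"
    show "vadd (ell2 X) f h \<in> ell2_vecs X" using ell2_add[OF f h] by (simp add: ell2_def)
    show "T (vadd (ell2 X) f h) = vadd (ell2 ?Y) (T f) (T h)" by (auto simp: T_def ell2_def)
    show "vinner (ell2 ?Y) (T f) (T h) = vinner (ell2 X) f h" unfolding T_def by (rule ell2_inner_reindex[OF b])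
  next
    fix c f assume f: "f \<in> ell2_vecs X"
    show "vscale (ell2 X) c f \<in> ell2_vecs X" using ell2_scale[OF f] by (simp add: ell2_def)
    show "T (vscale (ell2 X) c f) = vscale (ell2 ?Y) c (T f)" by (auto simp: T_def ell2_def)
  qed
qed

end

lemma transitive_action_T: "transitive_action thompson_T spins act vacuum_spin"
proof (intro transitive_action.intro transitive_action_axioms.intro group_thompson_T)
  fix w assume "w \<in> spins"
  then show "\<exists>g\<in>carrier thompson_T. act g vacuum_spin = w"
    using spins_transitive subgroup.subset[OF thompson_F_subgroup] by blast
qed (simp_all add: act_in_spins act_compose act_one vacuum_spin_in_spins)

lemma transitive_action_F: "transitive_action thompson_F spins act vacuum_spin"
proof (intro transitive_action.intro transitive_action_axioms.intro group_thompson_F)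
  have sub: "g \<in> carrier thompson_F \<Longrightarrow> g \<in> carrier thompson_T" for g by (simp add: thompson_F_def)
  have m: "mult thompson_F = mult thompson_T" "one thompson_F = one thompson_T" by (simp_all add: thompson_F_def)
  show "act g w \<in> spins" if "g \<in> carrier thompson_F" "w \<in> spins" for g w using act_in_spins sub that by blast
  show "act (mult thompson_F g h) w = act g (act h w)" if "g \<in> carrier thompson_F" "h \<in> carrier thompson_F" for g h w
    unfolding m using act_compose sub that by blast
  show "act (one thompson_F) w = w" if "w \<in> spins" for w unfolding m using act_one that by blast
qed (simp_all add: spins_transitive vacuum_spin_in_spins)

section \<open>The stabilizer of the vacuum\<close>

lemma vacuum_eq: "vacuum 2 = limit.limit_class (\<lambda>w. sqrt 2 * of_bool (w = vacuum_spin))"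
proof -
  have "vacuum_class \<in> vecs (limit_space 2)" using vacuum_class_coord(1) by (simp add: limit_space_vecs)
  then have "completion_embed (limit_space 2) vacuum_class = limit.limit_class (class_coord vacuum_class)"
    by (rule limit.completion_embed_eq)
  then show ?thesis unfolding vacuum_class_coord(2) by (simp add: vacuum_def vacuum_class_def)
qed

text \<open>The vacuum is a multiple of a point mass, and so is its image, so they are orthogonal unless
equal.\<close>

lemma vacuum_coeff:
  assumes g: "g \<in> carrier thompson_T"
  shows "vinner (chrom_space 2) (chrom_rep 2 g (vacuum 2)) (vacuum 2) = 2 \<longleftrightarrow> act g vacuum_spin = vacuum_spin"
proof -
  let ?f = "\<lambda>w. complex_of_real (sqrt 2 * of_bool (w = vacuum_spin))"
  have f: "?f \<in> ell2_vecs spins"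
    using class_coord_in_ell2[OF vacuum_class_coord(1)] unfolding vacuum_class_coord(2) .
  have "vinner (chrom_space 2) (chrom_rep 2 g (vacuum 2)) (vacuum 2) = vinner (ell2 spins) (spin_rep g ?f) ?f"
    unfolding vacuum_eq chrom_rep_limit_class[OF g f] chrom_space_def
    by (rule limit.completion_inner[OF spin_rep_in_ell2[OF g f] f])
  also have "\<dots> = (\<Sum>\<^sub>\<infinity>w\<in>spins. spin_rep g ?f w * cnj (?f w))" by (simp add: ell2_def)
  also have "\<dots> = (\<Sum>\<^sub>\<infinity>w\<in>{vacuum_spin}. spin_rep g ?f w * cnj (?f w))"
    by (rule infsum_cong_neutral) (use vacuum_spin_in_spins in auto)
  also have "\<dots> = spin_rep g ?f vacuum_spin * cnj (?f vacuum_spin)" by simp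
  also have "\<dots> = 2 * of_bool (act (m_inv thompson_T g) vacuum_spin = vacuum_spin)"
    using vacuum_spin_in_spins by (simp add: spin_rep_def flip: of_real_mult)
  finally have "vinner (chrom_space 2) (chrom_rep 2 g (vacuum 2)) (vacuum 2) = 2 \<longleftrightarrow>
      act (m_inv thompson_T g) vacuum_spin = vacuum_spin" by simp
  also have "\<dots> \<longleftrightarrow> act g vacuum_spin = vacuum_spin" using act_inv[OF g vacuum_spin_in_spins] by metis
  finally show ?thesis .
qed

theorem proposition5p2p2:
  fixes Q :: real and arrow_F arrow_T :: "(real \<Rightarrow> real) set"
  assumes Q: "Q = 2"
    and arrow_F: "arrow_F =
      {g \<in> carrier thompson_F. vinner (chrom_space Q) (chrom_rep Q g (vacuum Q)) (vacuum Q) = 2}"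
    and arrow_T: "arrow_T =
      {g \<in> carrier thompson_T. vinner (chrom_space Q) (chrom_rep Q g (vacuum Q)) (vacuum Q) = 2}"
  shows "subgroup arrow_F thompson_F \<and> subgroup arrow_T thompson_T \<and>
    unitarily_equivalent thompson_F (chrom_space Q) (chrom_rep Q)
      (ell2 (lcosets\<^bsub>thompson_F\<^esub> arrow_F)) (perm_rep thompson_F arrow_F) \<and>
    unitarily_equivalent thompson_T (chrom_space Q) (chrom_rep Q)
      (ell2 (lcosets\<^bsub>thompson_T\<^esub> arrow_T)) (perm_rep thompson_T arrow_T)"
proof -
  interpret F: transitive_action thompson_F spins act vacuum_spin by (rule transitive_action_F)
  interpret T: transitive_action thompson_T spins act vacuum_spin by (rule transitive_action_T)
  have sub: "carrier thompson_F \<subseteq> carrier thompson_T" using subgroup.subset[OF thompson_F_subgroup] .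
  have F: "arrow_F = F.stab" unfolding arrow_F Q F.stab_def using vacuum_coeff sub by blast
  have T: "arrow_T = T.stab" unfolding arrow_T Q T.stab_def using vacuum_coeff by blast
  have "unitarily_equivalent thompson_T (chrom_space 2) (chrom_rep 2) (ell2 spins)
      (\<lambda>g f w. if w \<in> spins then f (act (m_inv thompson_T g) w) else 0)"
    by (rule unitarily_equivalent_cong[OF unitarily_equivalent_spin_rep]) (simp_all add: spin_rep_def)
  then have eqT: "unitarily_equivalent thompson_T (chrom_space 2) (chrom_rep 2)
      (ell2 (lcosets\<^bsub>thompson_T\<^esub> T.stab)) (perm_rep thompson_T T.stab)"
    using T.perm_rep_equivalent by (rule unitarily_equivalent_trans)
  have "unitarily_equivalent thompson_F (chrom_space 2) (chrom_rep 2) (ell2 spins)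
      (\<lambda>g f w. if w \<in> spins then f (act (m_inv thompson_F g) w) else 0)"
  proof (rule unitarily_equivalent_cong[OF unitarily_equivalent_spin_rep[OF sub]])
    fix g f assume "g \<in> carrier thompson_F"
    then show "spin_rep g f = (\<lambda>w. if w \<in> spins then f (act (m_inv thompson_F g) w) else 0)"
      by (simp only: spin_rep_def inv_thompson_F)
  qed
  then have eqF: "unitarily_equivalent thompson_F (chrom_space 2) (chrom_rep 2)
      (ell2 (lcosets\<^bsub>thompson_F\<^esub> F.stab)) (perm_rep thompson_F F.stab)"
    using F.perm_rep_equivalent by (rule unitarily_equivalent_trans)
  show ?thesis
    unfolding F T Q using F.subgroup_stab T.subgroup_stab eqT eqF by blast
qed

end
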